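(* Let $m,n\ge 4$ be integers. Then a general small deformation of the union $X=X'\cup X''$ of two general cones $X',X''\subset\mathbb{P}^3$ of degrees $m$ and $n$, respectively, is a (Kobayashi) hyperbolic surface of degree $m+n$ in $\mathbb{P}^3$. Explicitly: for a general pair $(X',X'')$ of cones in $\mathbb{P}^3$ of degrees $m$ and $n$, with $X'=\{g_1=0\}$ and $X''=\{g_2=0\}$, where $g_1,g_2\in\mathbb{C}[z_1,z_2,z_3,z_4]$ are homogeneous of degrees $m$ and $n$, and for a general homogeneous polynomial $f_\infty\in\mathbb{C}[z_1,z_2,z_3,z_4]$ of degree $m+n$, there exists $\varepsilon>0$ such that for every $t\in\mathbb{C}$ with $0<|t|<\varepsilon$ the degree $m+n$ surface $$X_t=\{(z_1:z_2:z_3:z_4)\in\mathbb{P}^3 : g_1(z)\,g_2(z)+t\,f_\infty(z)=0\}$$ is Kobayashi hyperbolic.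
   Context: $\mathbb{P}^3$ denotes complex projective 3-space with homogeneous coordinates $(z_1:z_2:z_3:z_4)$. Cones: given a plane $H\subset\mathbb{P}^3$, an algebraic curve $C\subset H$ and a point $p\in\mathbb{P}^3\setminus H$, let $\langle C,p\rangle$ denote the union of the projective lines through $p$ and the points of $C$. A cone in $\mathbb{P}^3$ is a surface of the form $\langle C,p\rangle$; its degree equals $\deg C$. Thus, after a linear change of coordinates taking the vertices of two cones with distinct vertices to $(0:0:0:1)$ and $(0:0:1:0)$, the cones are given by equations $f_1(z_1,z_2,z_3)=0$ and $f_2(z_1,z_2,z_4)=0$ with $f_1,f_2$ homogeneous. "General" means: outside some proper Zariski-closed subset of the relevant irreducible parameter space. For the pair of cones, the parameter space consists of pairs of cones of degrees $m$ and $n$ (each cone determined by its vertex and its base curve of the given degree). For $f_\infty$, it is the space of homogeneous polynomials of degree $m+n$ in four variables; here the excluded subset is allowed to depend on the chosen pair of cones. The bound $\varepsilon$ is allowed to depend on $g_1,g_2,f_\infty$. A compact complex space (here, a projective surface, possibly singular) is Kobayashi hyperbolic if its Kobayashi pseudodistance is a distance; by Brody's theorem this is equivalent to the non-existence of non-constant holomorphic maps from $\mathbb{C}$ to it. *)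

theory Defs
  imports "HOL-Complex_Analysis.Complex_Analysis" "HOL-Library.Poly_Mapping"
begin

subsection \<open>Polynomials over the complex numbers\<close>

type_synonym 'v monomial = "'v \<Rightarrow>\<^sub>0 nat"
type_synonym 'v mpoly = "'v monomial \<Rightarrow>\<^sub>0 complex"

definition mdegree :: "'v monomial \<Rightarrow> nat" where
  "mdegree u = (\<Sum>i\<in>Poly_Mapping.keys u. Poly_Mapping.lookup u i)"

definition meval :: "'v mpoly \<Rightarrow> ('v \<Rightarrow> complex) \<Rightarrow> complex" where
  "meval F x = (\<Sum>u\<in>Poly_Mapping.keys F. Poly_Mapping.lookup F u *
     (\<Prod>i\<in>Poly_Mapping.keys u. x i ^ Poly_Mapping.lookup u i))"

definition homogeneous :: "nat \<Rightarrow> 'v mpoly \<Rightarrow> bool" where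
  "homogeneous d F \<longleftrightarrow> (\<forall>u\<in>Poly_Mapping.keys F. mdegree u = d)"

definition mconst :: "complex \<Rightarrow> 'v mpoly" where
  "mconst c = Poly_Mapping.single 0 c"

subsection \<open>Generality\<close>

text \<open>The parameter space \<open>S\<close> carries coordinate functions \<open>coord x i\<close>; a subset is Zariski closed
  in \<open>S\<close> if it is cut out in \<open>S\<close> by polynomials in these coordinates.\<close>

definition zariski_closed_in :: "('a \<Rightarrow> 'v \<Rightarrow> complex) \<Rightarrow> 'a set \<Rightarrow> 'a set \<Rightarrow> bool" where
  "zariski_closed_in coord S Z \<longleftrightarrow>
     (\<exists>\<F> :: 'v mpoly set. Z = {x \<in> S. \<forall>F\<in>\<F>. meval F (coord x) = 0})"

definition for_general :: "('a \<Rightarrow> 'v \<Rightarrow> complex) \<Rightarrow> 'a set \<Rightarrow> ('a \<Rightarrow> bool) \<Rightarrow> bool" where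
  "for_general coord S Q \<longleftrightarrow>
     (\<exists>Z. zariski_closed_in coord S Z \<and> Z \<noteq> S \<and> (\<forall>x \<in> S - Z. Q x))"

subsection \<open>Complex projective 3-space\<close>

definition proportional :: "complex ^ 4 \<Rightarrow> complex ^ 4 \<Rightarrow> bool" where
  "proportional z w \<longleftrightarrow> z \<noteq> 0 \<and> w \<noteq> 0 \<and> (\<exists>c. c \<noteq> 0 \<and> w = c *s z)"

lemma part_equivp_proportional: "part_equivp proportional"
proof (rule part_equivpI)
  have "proportional (axis 1 1) (axis 1 1)"
    unfolding proportional_def by (auto intro!: exI[of _ 1] simp: axis_eq_0_iff)
  then show "\<exists>z. proportional z z" by blast
  show "symp proportional"
  proof (rule sympI)
    fix z w assume "proportional z w"
    then obtain c where c: "z \<noteq> 0" "w \<noteq> 0" "c \<noteq> 0" "w = c *s z"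
      unfolding proportional_def by blast
    then have "z = inverse c *s w" by (simp add: vector_smult_assoc)
    with c show "proportional w z"
      unfolding proportional_def by (metis inverse_nonzero_iff_nonzero)
  qed
  show "transp proportional"
  proof (rule transpI)
    fix x y z assume "proportional x y" "proportional y z"
    then show "proportional x z"
      unfolding proportional_def by (metis mult_eq_0_iff vector_smult_assoc)
  qed
qed

quotient_type proj3 = "complex ^ 4" / partial: proportional
  by (rule part_equivp_proportional)

text \<open>The point \<open>(z\<^sub>1 : z\<^sub>2 : z\<^sub>3 : z\<^sub>4)\<close>; meaningful only for \<open>z \<noteq> 0\<close>.\<close>

definition pt :: "complex ^ 4 \<Rightarrow> proj3" where
  "pt z = abs_proj3 z"

lemma pt_eq_iff:
  assumes "z \<noteq> 0" "w \<noteq> 0"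
  shows "pt z = pt w \<longleftrightarrow> (\<exists>c. c \<noteq> 0 \<and> w = c *s z)"
proof -
  have refl: "proportional x x" if "x \<noteq> 0" for x
    unfolding proportional_def using that by (auto intro!: exI[of _ 1])
  show ?thesis
    using Quotient3_rel[OF Quotient3_proj3, of z w] refl assms
    unfolding pt_def proportional_def[of z w] by auto
qed

lemma pt_surj: "\<exists>z. z \<noteq> 0 \<and> p = pt z"
proof -
  have "proportional (rep_proj3 p) (rep_proj3 p)" "abs_proj3 (rep_proj3 p) = p"
    using Quotient3_rep_reflp[OF Quotient3_proj3] Quotient3_abs_rep[OF Quotient3_proj3] by auto
  then show ?thesis unfolding pt_def proportional_def by metis
qed

definition hypersurface :: "4 mpoly \<Rightarrow> proj3 set" where
  "hypersurface F = {pt z | z. z \<noteq> 0 \<and> meval F (\<lambda>i. z $ i) = 0}"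

definition proj_line :: "proj3 \<Rightarrow> proj3 \<Rightarrow> proj3 set" where
  "proj_line p q = {pt (a *s z + b *s w) | a b z w.
     z \<noteq> 0 \<and> w \<noteq> 0 \<and> p = pt z \<and> q = pt w \<and> a *s z + b *s w \<noteq> 0}"

subsection \<open>Cones\<close>

definition plane :: "proj3 set \<Rightarrow> bool" where
  "plane H \<longleftrightarrow> (\<exists>h. homogeneous 1 h \<and> h \<noteq> 0 \<and> H = hypersurface h)"

definition plane_curve :: "nat \<Rightarrow> proj3 set \<Rightarrow> proj3 set \<Rightarrow> bool" where
  "plane_curve d H C \<longleftrightarrow>
     (\<exists>c. homogeneous d c \<and> \<not> H \<subseteq> hypersurface c \<and> C = H \<inter> hypersurface c)"

definition cone_over :: "proj3 set \<Rightarrow> proj3 \<Rightarrow> proj3 set" where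
  "cone_over C p = (\<Union>x\<in>C. proj_line p x)"

definition is_cone :: "nat \<Rightarrow> proj3 \<Rightarrow> proj3 set \<Rightarrow> bool" where
  "is_cone d p X \<longleftrightarrow>
     (\<exists>H C. plane H \<and> p \<notin> H \<and> plane_curve d H C \<and> X = cone_over C p)"

text \<open>A cone of degree \<open>d\<close> is parametrised by its vertex, given by homogeneous coordinates \<open>v\<close>, and an
  equation \<open>g\<close> of degree \<open>d\<close>, so that multiple components are recorded. As \<open>v\<close> and \<open>g\<close> are determined
  by the cone only up to scalars, this is the affine cone over the irreducible projective bundle (over
  the space of vertices) of base curves of degree \<open>d\<close>. For scaling-invariant properties, as here,
  generality on the one space is the same as on the other: a closed subset may be replaced by the
  intersection of its rescalings.\<close>

definition cone_space :: "nat \<Rightarrow> ((complex ^ 4) \<times> 4 mpoly) set" where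
  "cone_space d =
     {(v, g). v \<noteq> 0 \<and> g \<noteq> 0 \<and> homogeneous d g \<and> is_cone d (pt v) (hypersurface g)}"

datatype cone_index = Vertex 4 | Coeff "4 monomial"

fun cone_coord :: "(complex ^ 4) \<times> 4 mpoly \<Rightarrow> cone_index \<Rightarrow> complex" where
  "cone_coord (v, g) (Vertex i) = v $ i"
| "cone_coord (v, g) (Coeff u) = Poly_Mapping.lookup g u"

fun cone_pair_coord ::
  "((complex ^ 4) \<times> 4 mpoly) \<times> ((complex ^ 4) \<times> 4 mpoly) \<Rightarrow> cone_index + cone_index \<Rightarrow> complex" where
  "cone_pair_coord (x, y) = case_sum (cone_coord x) (cone_coord y)"

subsection \<open>Kobayashi hyperbolicity\<close>

definition proj_holomorphic_on :: "(complex \<Rightarrow> proj3) \<Rightarrow> complex set \<Rightarrow> bool" where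
  "proj_holomorphic_on f U \<longleftrightarrow>
     (\<forall>w\<^sub>0\<in>U. \<exists>V F. open V \<and> w\<^sub>0 \<in> V \<and> V \<subseteq> U \<and>
        (\<forall>i. (\<lambda>w. F w $ i) holomorphic_on V) \<and> (\<forall>w\<in>V. F w \<noteq> 0 \<and> f w = pt (F w)))"

text \<open>Since the disc is reduced, holomorphic maps to a subvariety \<open>X\<close> (also a singular one) are the
  holomorphic maps to projective space with image in \<open>X\<close>.\<close>

definition holomorphic_disc :: "proj3 set \<Rightarrow> (complex \<Rightarrow> proj3) \<Rightarrow> bool" where
  "holomorphic_disc X f \<longleftrightarrow> proj_holomorphic_on f (ball 0 1) \<and> f ` ball 0 1 \<subseteq> X"

definition poincare_dist :: "complex \<Rightarrow> complex \<Rightarrow> real" where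
  "poincare_dist a b = 2 * artanh (cmod (a - b) / cmod (1 - cnj a * b))"

inductive disc_chain :: "proj3 set \<Rightarrow> proj3 \<Rightarrow> proj3 \<Rightarrow> real \<Rightarrow> bool" for X where
  start: "p \<in> X \<Longrightarrow> disc_chain X p p 0"
| step: "\<lbrakk>disc_chain X p (f a) r; holomorphic_disc X f; a \<in> ball 0 1; b \<in> ball 0 1\<rbrakk>
         \<Longrightarrow> disc_chain X p (f b) (r + poincare_dist a b)"

text \<open>Infinite if no chain of discs joins the two points, which does not happen on a connected \<open>X\<close>.\<close>

definition kobayashi_pseudodist :: "proj3 set \<Rightarrow> proj3 \<Rightarrow> proj3 \<Rightarrow> ereal" where
  "kobayashi_pseudodist X p q = (INF r\<in>{r. disc_chain X p q r}. ereal r)"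

text \<open>Symmetry and the triangle inequality always hold, so only definiteness is at stake.\<close>

definition kobayashi_hyperbolic :: "proj3 set \<Rightarrow> bool" where
  "kobayashi_hyperbolic X \<longleftrightarrow>
     (\<forall>p\<in>X. \<forall>q\<in>X. kobayashi_pseudodist X p q = 0 \<longrightarrow> p = q)"

end

theory Submission
  imports Defs "HOL-Computational_Algebra.Fundamental_Theorem_Algebra"
begin

text \<open>If \<open>g\<^sub>1 g\<^sub>2 + t f = 0\<close> fails to be hyperbolic for some \<open>t = t\<^sub>k \<rightarrow> 0\<close>, Brody's rescaling yields discs of
  growing radius on these surfaces which converge to a nonconstant entire curve with bounded derivative on one of the
  two cones, say on \<open>g\<^sub>1 = 0\<close>. By Hurwitz' theorem the limit lies on the other cone as well or meets it only
  where \<open>f = 0\<close>. Its projection from the vertex is an entire curve in a smooth plane curve of degree at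
  least four. Such a curve is constant: after a further rescaling its derivative is bounded, so that holomorphic
  differentials pull back to constants by Liouville's theorem. Hence the limit lies on a generator of the cone.
  There it either takes values in the finite intersection with the second cone or omits the at least three
  intersection points off \<open>f = 0\<close>, which contradicts Picard's little theorem.

  The conditions on \<open>(g\<^sub>1, g\<^sub>2, f)\<close> used here all say that some family of forms has no common
  zero in a projective space. Such conditions are open by elimination theory, and explicit triples with vertices at
  coordinate points satisfy them one at a time; as the triples with fixed vertices form a linear space, one triple
  satisfies them all.\<close>

text \<open>Some conditions concern two points of one generator: two tangencies, or two
  intersections on \<open>f = 0\<close>. Distinctness is not a closed condition. Therefore a second
  coordinate, \<open>VN\<close>, is added and differences between both points are divided by the
  difference of the coordinates; when the points merge, the quotient becomes a derivative, and the
  condition is again the absence of a common zero in a projective space. The number three arises as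
  n - 1: a generator meets the other cone either in n points, at most one of them on
  \<open>f = 0\<close>, or with one simple tangency in n - 1 points, none of them on
  \<open>f = 0\<close>. The bound on the degree enters again through the differentials on a plane
  curve, which need forms of degree d - 3 \<ge> 1. Both notions of generality come from one
  polynomial \<Psi> that is nonzero at one triple (P0, f0): a pair P is general if \<Psi>(P, f0)
  \<noteq> 0, and then f is general if \<Psi>(P, f) \<noteq> 0. Cones are defined as point sets, so
  the invariance of an equation along the vertex has to be recovered from its zeros.\<close>

no_notation fps_nth (infixl \<open>$\<close> 75)

section \<open>Evaluation and degree of polynomials\<close>

definition mono_val :: "'v monomial \<Rightarrow> ('v \<Rightarrow> complex) \<Rightarrow> complex" where
  "mono_val u x = (\<Prod>i\<in>Poly_Mapping.keys u. x i ^ Poly_Mapping.lookup u i)"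

text \<open>The linear functional with prescribed values \<open>c\<close> on the monomials.
  Evaluation at a point is one instance; another, in \<open>generic_no_common_zero\<close>, is a
  functional that annihilates an ideal.\<close>

definition lin_ext :: "('k \<Rightarrow> complex) \<Rightarrow> ('k \<Rightarrow>\<^sub>0 complex) \<Rightarrow> complex" where
  "lin_ext c p = (\<Sum>u\<in>Poly_Mapping.keys p. Poly_Mapping.lookup p u * c u)"

lemma meval_eq_lin_ext: "meval p x = lin_ext (\<lambda>u. mono_val u x) p"
  by (simp add: meval_def lin_ext_def mono_val_def)

lemma lin_ext_superset:
  assumes "finite A" "Poly_Mapping.keys p \<subseteq> A"
  shows "lin_ext c p = (\<Sum>u\<in>A. Poly_Mapping.lookup p u * c u)"
  unfolding lin_ext_def
  by (rule sum.mono_neutral_left) (use assms in \<open>auto simp: in_keys_iff\<close>)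

lemma lin_ext_add: "lin_ext c (p + q) = lin_ext c p + lin_ext c q"
proof -
  let ?A = "Poly_Mapping.keys p \<union> Poly_Mapping.keys q"
  have "lin_ext c r = (\<Sum>u\<in>?A. Poly_Mapping.lookup r u * c u)"
    if "Poly_Mapping.keys r \<subseteq> ?A" for r
    using that by (intro lin_ext_superset) auto
  then show ?thesis
    using keys_add[of p q] by (simp add: lookup_add distrib_right sum.distrib)
qed

lemma lin_ext_zero [simp]: "lin_ext c 0 = 0"
  by (simp add: lin_ext_def)

lemma lin_ext_single [simp]: "lin_ext c (Poly_Mapping.single u a) = a * c u"
  by (simp add: lin_ext_def)

lemma sum_single_keys:
  fixes p :: "'k \<Rightarrow>\<^sub>0 complex"
  shows "p = (\<Sum>u\<in>Poly_Mapping.keys p. Poly_Mapping.single u (Poly_Mapping.lookup p u))"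
proof (rule poly_mapping_eqI)
  fix k
  show "Poly_Mapping.lookup p k = Poly_Mapping.lookup (\<Sum>u\<in>Poly_Mapping.keys p. Poly_Mapping.single u (Poly_Mapping.lookup p u)) k"
    by (simp add: lookup_sum lookup_single when_def sum.delta in_keys_iff)
qed

lemma poly_mapping_sum_induct [case_names zero single add]:
  fixes p :: "'k \<Rightarrow>\<^sub>0 complex"
  assumes "P 0" "\<And>u a. P (Poly_Mapping.single u a)" "\<And>p q. P p \<Longrightarrow> P q \<Longrightarrow> P (p + q)"
  shows "P p"
proof -
  have "P (\<Sum>u\<in>A. Poly_Mapping.single u (Poly_Mapping.lookup p u))" for A
    by (induction A rule: infinite_finite_induct) (auto intro: assms)
  then show ?thesis by (subst sum_single_keys)
qed

lemma mono_val_UNIV: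
  fixes u :: "'v::finite monomial"
  shows "mono_val u x = (\<Prod>i\<in>UNIV. x i ^ Poly_Mapping.lookup u i)"
  unfolding mono_val_def
  by (rule prod.mono_neutral_left) (auto simp: in_keys_iff)

lemma mono_val_add:
  fixes u v :: "'v monomial"
  shows "mono_val (u + v) x = mono_val u x * mono_val v x"
proof -
  let ?A = "Poly_Mapping.keys u \<union> Poly_Mapping.keys v"
  have "mono_val r x = (\<Prod>i\<in>?A. x i ^ Poly_Mapping.lookup r i)"
    if "Poly_Mapping.keys r \<subseteq> ?A" for r
    unfolding mono_val_def
    by (rule prod.mono_neutral_left) (use that in \<open>auto simp: in_keys_iff\<close>)
  then show ?thesis
    using keys_add[of u v] by (simp add: lookup_add power_add prod.distrib)
qed

lemma mono_val_zero [simp]: "mono_val 0 x = 1"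
  by (simp add: mono_val_def)

lemma mono_val_single [simp]: "mono_val (Poly_Mapping.single i k) x = x i ^ k"
  by (cases "k = 0") (auto simp: mono_val_def)

lemma mdegree_superset:
  assumes "finite A" "Poly_Mapping.keys u \<subseteq> A"
  shows "mdegree u = (\<Sum>i\<in>A. Poly_Mapping.lookup u i)"
  unfolding mdegree_def
  by (rule sum.mono_neutral_left) (use assms in \<open>auto simp: in_keys_iff\<close>)

lemma mdegree_add: "mdegree (u + v) = mdegree u + mdegree v"
proof -
  let ?A = "Poly_Mapping.keys u \<union> Poly_Mapping.keys v"
  have "mdegree r = (\<Sum>i\<in>?A. Poly_Mapping.lookup r i)"
    if "Poly_Mapping.keys r \<subseteq> ?A" for r
    using that by (intro mdegree_superset) auto
  then show ?thesis
    using keys_add[of u v] by (simp add: lookup_add sum.distrib)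
qed

lemma mdegree_zero [simp]: "mdegree 0 = 0"
  by (simp add: mdegree_def)

lemma mdegree_single [simp]: "mdegree (Poly_Mapping.single i k) = k"
  by (cases "k = 0") (auto simp: mdegree_def)

lemma meval_zero [simp]: "meval 0 x = 0"
  by (simp add: meval_eq_lin_ext)

lemma meval_add: "meval (p + q) x = meval p x + meval q x"
  by (simp add: meval_eq_lin_ext lin_ext_add)

lemma meval_single: "meval (Poly_Mapping.single u a) x = a * mono_val u x"
  by (simp add: meval_eq_lin_ext)

lemma meval_mconst [simp]: "meval (mconst a) x = a"
  by (simp add: mconst_def meval_single)

lemma meval_mult: "meval (p * q) x = meval p x * meval q x"
proof (induction p rule: poly_mapping_sum_induct)
  case (single u a)
  show ?case
    by (induction q rule: poly_mapping_sum_induct)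
      (auto simp: mult_single meval_single mono_val_add meval_add algebra_simps)
qed (auto simp: meval_add distrib_right)

lemma finite_monomials_of_degree: "finite {u :: 'v::finite monomial. mdegree u = N}"
proof (rule finite_imageD)
  let ?M = "{u :: 'v monomial. mdegree u = N}"
  have le: "Poly_Mapping.lookup u i \<le> N" if "mdegree u = N" for u :: "'v monomial" and i
  proof -
    have "Poly_Mapping.lookup u i \<le> (\<Sum>i\<in>UNIV. Poly_Mapping.lookup u i)"
      by (rule member_le_sum) simp_all
    also have "\<dots> = mdegree u" by (rule mdegree_superset[symmetric]) simp_all
    also have "\<dots> = N" by (rule that)
    finally show ?thesis .
  qed
  have "Poly_Mapping.lookup ` ?M \<subseteq> (UNIV \<rightarrow>\<^sub>E {..N})"
  proof (rule image_subsetI)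
    fix u :: "'v monomial" assume "u \<in> ?M"
    then have "mdegree u = N" by (rule CollectD)
    show "Poly_Mapping.lookup u \<in> UNIV \<rightarrow>\<^sub>E {..N}"
      by (rule PiE_I) (simp_all only: atMost_iff le[OF \<open>mdegree u = N\<close>] UNIV_I not_True_eq_False)
  qed
  then show "finite (Poly_Mapping.lookup ` ?M)"
    by (rule finite_subset) (rule finite_PiE, simp_all)
  show "inj_on Poly_Mapping.lookup ?M"
    by (rule inj_onI) (rule poly_mapping_eqI, rule fun_cong)
qed

subsection \<open>Polynomial functions on the parameter space\<close>

text \<open>Polynomials in the functions \<open>G\<close> of the parameter, kept as functions: the
  parameters have infinitely many coordinates and are read in several coordinate systems, and only
  \<open>palg_meval\<close> has to produce a formal polynomial.\<close>

inductive_set palg :: "('a \<Rightarrow> complex) set \<Rightarrow> ('a \<Rightarrow> complex) set" for G where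
  const: "(\<lambda>_. c) \<in> palg G"
| gen: "g \<in> G \<Longrightarrow> g \<in> palg G"
| add: "p \<in> palg G \<Longrightarrow> q \<in> palg G \<Longrightarrow> (\<lambda>x. p x + q x) \<in> palg G"
| mult: "p \<in> palg G \<Longrightarrow> q \<in> palg G \<Longrightarrow> (\<lambda>x. p x * q x) \<in> palg G"

lemma palg_prod: "(\<And>i. i \<in> A \<Longrightarrow> f i \<in> palg G) \<Longrightarrow> (\<lambda>x. \<Prod>i\<in>A. f i x) \<in> palg G"
  by (induction A rule: infinite_finite_induct) (auto intro!: palg.const palg.mult)

lemma palg_uminus: "f \<in> palg G \<Longrightarrow> (\<lambda>x. - f x) \<in> palg G"
  using palg.mult[OF palg.const[where c = "-1"], of f G] by (simp only: mult_minus1)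

lemma palg_diff: "f \<in> palg G \<Longrightarrow> g \<in> palg G \<Longrightarrow> (\<lambda>x. f x - g x) \<in> palg G"
  by (simp only: diff_conv_add_uminus palg.add palg_uminus)

lemma palg_compose:
  assumes "p \<in> palg G" "\<And>g. g \<in> G \<Longrightarrow> (\<lambda>y. g (h y)) \<in> palg G'"
  shows "(\<lambda>y. p (h y)) \<in> palg G'"
  using assms(1)
proof induction
  case (const c) show ?case by (rule palg.const)
next
  case (gen g) then show ?case by (rule assms(2))
next
  case (add p q) from palg.add[OF add.IH] show ?case .
next
  case (mult p q) from palg.mult[OF mult.IH] show ?case .
qed

text \<open>Supplies the formal polynomial that \<open>zariski_closed_in\<close> asks for.\<close>

lemma palg_meval:
  assumes "p \<in> palg (Set.range (\<lambda>i x. coord x i))"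
  shows "\<exists>F. \<forall>x. meval F (coord x) = p x"
  using assms
proof induction
  case (const c)
  show ?case by (intro exI[of _ "mconst c"]) auto
next
  case (gen g)
  then obtain i where "g = (\<lambda>x. coord x i)" by auto
  then show ?case
    by (intro exI[of _ "Poly_Mapping.single (Poly_Mapping.single i 1) 1"]) (auto simp: meval_single)
next
  case (add p q)
  then obtain F F' where "\<forall>x. meval F (coord x) = p x" "\<forall>x. meval F' (coord x) = q x" by blast
  then show ?case by (intro exI[of _ "F + F'"]) (simp add: meval_add)
next
  case (mult p q)
  then obtain F F' where "\<forall>x. meval F (coord x) = p x" "\<forall>x. meval F' (coord x) = q x" by blast
  then show ?case by (intro exI[of _ "F * F'"]) (simp add: meval_mult)
qed

subsection \<open>Openness of nondegeneracy\<close>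

text \<open>Gaussian elimination with denominators cleared, so that no determinants are needed.\<close>

lemma generic_nondegenerate:
  assumes "finite B"
    and "\<And>\<phi> b. \<phi> \<in> V \<Longrightarrow> b \<in> B \<Longrightarrow> (\<lambda>\<theta>. \<phi> \<theta> b) \<in> palg G"
    and "\<And>c :: 'b \<Rightarrow> complex. (\<forall>\<phi>\<in>V. (\<Sum>b\<in>B. c b * \<phi> \<theta>\<^sub>0 b) = 0) \<Longrightarrow> \<forall>b\<in>B. c b = 0"
  shows "\<exists>\<Phi>\<in>palg G. \<Phi> \<theta>\<^sub>0 \<noteq> 0 \<and> (\<forall>\<theta>. \<Phi> \<theta> \<noteq> 0 \<longrightarrow>
           (\<forall>c :: 'b \<Rightarrow> complex. (\<forall>\<phi>\<in>V. (\<Sum>b\<in>B. c b * \<phi> \<theta> b) = 0) \<longrightarrow> (\<forall>b\<in>B. c b = 0)))"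
  using assms
proof (induction B arbitrary: V rule: finite_induct)
  case empty
  show ?case by (intro bexI[of _ "\<lambda>_. 1"]) (auto intro: palg.const)
next
  case (insert a B)
  \<comment> \<open>A pivot for the coordinate \<open>a\<close>: otherwise the indicator of
    \<open>a\<close> would be a nonzero solution at \<open>\<theta>\<^sub>0\<close>.\<close>
  have "\<exists>\<phi>\<in>V. \<phi> \<theta>\<^sub>0 a \<noteq> 0"
  proof (rule ccontr)
    assume "\<not> ?thesis"
    moreover have "(\<Sum>b\<in>B. (if b = a then 1 else 0) * \<phi> \<theta>\<^sub>0 b) = 0" for \<phi> :: "_ \<Rightarrow> 'b \<Rightarrow> complex"
      by (rule sum.neutral) (use insert.hyps in auto)
    ultimately have "\<forall>b\<in>insert a B. (if b = a then 1 else 0 :: complex) = 0"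
      using insert.hyps by (intro insert.prems(2)) simp
    then show False by simp
  qed
  then obtain \<rho> where \<rho>: "\<rho> \<in> V" "\<rho> \<theta>\<^sub>0 a \<noteq> 0" by blast
  \<comment> \<open>The row minus a multiple of the pivot row, scaled by the pivot so that its
    entries stay polynomial; its entry at \<open>a\<close> would be zero.\<close>
  define red where "red \<phi> \<theta> b = \<rho> \<theta> a * \<phi> \<theta> b - \<phi> \<theta> a * \<rho> \<theta> b" for \<phi> \<theta> b
  have red_sum: "(\<Sum>b\<in>B. c b * red \<phi> \<theta> b)
      = \<rho> \<theta> a * (\<Sum>b\<in>B. c b * \<phi> \<theta> b) - \<phi> \<theta> a * (\<Sum>b\<in>B. c b * \<rho> \<theta> b)" for c \<phi> \<theta>
    by (simp add: red_def algebra_simps sum_subtractf sum_distrib_left)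
  have "\<exists>\<Phi>\<in>palg G. \<Phi> \<theta>\<^sub>0 \<noteq> 0 \<and> (\<forall>\<theta>. \<Phi> \<theta> \<noteq> 0 \<longrightarrow>
           (\<forall>c. (\<forall>\<phi>\<in>red ` V. (\<Sum>b\<in>B. c b * \<phi> \<theta> b) = 0) \<longrightarrow> (\<forall>b\<in>B. c b = 0)))"
  proof (rule insert.IH)
    show "(\<lambda>\<theta>. \<phi> \<theta> b) \<in> palg G" if "\<phi> \<in> red ` V" "b \<in> B" for \<phi> b
      using that insert.prems(1) \<rho> by (auto simp: red_def intro!: palg_diff palg.mult)
    show "\<forall>b\<in>B. c b = 0" if c: "\<forall>\<phi>\<in>red ` V. (\<Sum>b\<in>B. c b * \<phi> \<theta>\<^sub>0 b) = 0" for c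
    proof -
      \<comment> \<open>Back substitution: the pivot equation determines the value at
        \<open>a\<close>.\<close>
      define c' where "c' b = (if b = a then - (\<Sum>b\<in>B. c b * \<rho> \<theta>\<^sub>0 b) / \<rho> \<theta>\<^sub>0 a else c b)" for b
      have c'_sum: "(\<Sum>b\<in>B. c' b * \<phi> \<theta>\<^sub>0 b) = (\<Sum>b\<in>B. c b * \<phi> \<theta>\<^sub>0 b)" for \<phi> :: "_ \<Rightarrow> 'b \<Rightarrow> complex"
        by (rule sum.cong) (use insert.hyps in \<open>auto simp: c'_def\<close>)
      have "(\<Sum>b\<in>insert a B. c' b * \<phi> \<theta>\<^sub>0 b) = 0" if "\<phi> \<in> V" for \<phi>
      proof -
        have "\<rho> \<theta>\<^sub>0 a * (\<Sum>b\<in>B. c b * \<phi> \<theta>\<^sub>0 b) = \<phi> \<theta>\<^sub>0 a * (\<Sum>b\<in>B. c b * \<rho> \<theta>\<^sub>0 b)"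
          using c that red_sum[of c \<phi> \<theta>\<^sub>0] by auto
        then have "- (\<Sum>b\<in>B. c b * \<rho> \<theta>\<^sub>0 b) / \<rho> \<theta>\<^sub>0 a * \<phi> \<theta>\<^sub>0 a + (\<Sum>b\<in>B. c b * \<phi> \<theta>\<^sub>0 b) = 0"
          using \<rho>(2) by (simp add: divide_simps mult.commute)
        then show ?thesis
          using insert.hyps by (simp add: c'_sum) (simp add: c'_def)
      qed
      then have "\<forall>b\<in>insert a B. c' b = 0" by (intro insert.prems(2)) auto
      then show ?thesis using insert.hyps by (auto simp: c'_def split: if_splits)
    qed
  qed
  then obtain \<Phi> where \<Phi>: "\<Phi> \<in> palg G" "\<Phi> \<theta>\<^sub>0 \<noteq> 0"
    "\<And>\<theta> c. \<Phi> \<theta> \<noteq> 0 \<Longrightarrow> \<forall>\<phi>\<in>red ` V. (\<Sum>b\<in>B. c b * \<phi> \<theta> b) = 0 \<Longrightarrow> \<forall>b\<in>B. c b = 0"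
    by blast
  show ?case
  proof (intro bexI[of _ "\<lambda>\<theta>. \<Phi> \<theta> * \<rho> \<theta> a"] conjI allI impI)
    fix \<theta> c assume nz: "\<Phi> \<theta> * \<rho> \<theta> a \<noteq> 0" and c: "\<forall>\<phi>\<in>V. (\<Sum>b\<in>insert a B. c b * \<phi> \<theta> b) = 0"
    have "\<forall>\<phi>\<in>red ` V. (\<Sum>b\<in>B. c b * \<phi> \<theta> b) = 0"
    proof clarify
      fix \<phi> assume "\<phi> \<in> V"
      then have "(\<Sum>b\<in>B. c b * \<phi> \<theta> b) = - c a * \<phi> \<theta> a" "(\<Sum>b\<in>B. c b * \<rho> \<theta> b) = - c a * \<rho> \<theta> a"
        using c \<rho>(1) insert.hyps by (auto simp: add_eq_0_iff)
      then show "(\<Sum>b\<in>B. c b * red \<phi> \<theta> b) = 0" by (simp add: red_sum)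
    qed
    then have B: "\<forall>b\<in>B. c b = 0" by (intro \<Phi>(3)[of \<theta>]) (use nz in auto)
    have "(\<Sum>b\<in>insert a B. c b * \<rho> \<theta> b) = 0" using c \<rho>(1) by blast
    moreover have "(\<Sum>b\<in>B. c b * \<rho> \<theta> b) = 0" by (rule sum.neutral) (use B in simp)
    ultimately have "c a * \<rho> \<theta> a = 0" using insert.hyps by simp
    then show "\<forall>b\<in>insert a B. c b = 0" using B nz by simp
  qed (use \<Phi> \<rho> insert.prems(1) in \<open>auto intro!: palg.mult\<close>)
qed

section \<open>Elimination theory\<close>

subsection \<open>A projective Nullstellensatz\<close>

definition var :: "'v \<Rightarrow> 'v mpoly" where
  "var i = Poly_Mapping.single (Poly_Mapping.single i 1) 1"

definition is_ideal :: "'r::comm_ring_1 set \<Rightarrow> bool" where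
  "is_ideal J \<longleftrightarrow> 0 \<in> J \<and> (\<forall>p\<in>J. \<forall>q\<in>J. p + q \<in> J) \<and> (\<forall>r. \<forall>p\<in>J. r * p \<in> J)"

lemma is_idealD:
  assumes "is_ideal J"
  shows "0 \<in> J" "p \<in> J \<Longrightarrow> q \<in> J \<Longrightarrow> p + q \<in> J" "p \<in> J \<Longrightarrow> r * p \<in> J" "p \<in> J \<Longrightarrow> p * r \<in> J"
    "p \<in> J \<Longrightarrow> q \<in> J \<Longrightarrow> p - q \<in> J" "(\<And>i. i \<in> A \<Longrightarrow> f i \<in> J) \<Longrightarrow> sum f A \<in> J"
proof -
  have *: "0 \<in> J" "\<And>p q. p \<in> J \<Longrightarrow> q \<in> J \<Longrightarrow> p + q \<in> J" "\<And>r p. p \<in> J \<Longrightarrow> r * p \<in> J"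
    using assms unfolding is_ideal_def by auto
  show "0 \<in> J" "p \<in> J \<Longrightarrow> q \<in> J \<Longrightarrow> p + q \<in> J" "p \<in> J \<Longrightarrow> r * p \<in> J" using * by auto
  show "p \<in> J \<Longrightarrow> p * r \<in> J" using *(3)[of p r] by (simp add: mult.commute)
  show "p \<in> J \<Longrightarrow> q \<in> J \<Longrightarrow> p - q \<in> J" using *(2)[of p "-1 * q"] *(3)[of q "-1"] by simp
  show "(\<And>i. i \<in> A \<Longrightarrow> f i \<in> J) \<Longrightarrow> sum f A \<in> J"
    by (induction A rule: infinite_finite_induct) (simp_all add: *)
qed

text \<open>One unknown is eliminated per equation, so that one of them remains free. This provides
  the linear dependence used in \<open>linear_form_in_ideal\<close>.\<close>

lemma underdetermined_system:
  fixes \<phi> :: "'a \<Rightarrow> 'b \<Rightarrow> complex"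
  assumes "finite B" "finite A" "card A > card B"
  shows "\<exists>c. (\<exists>a\<in>A. c a \<noteq> 0) \<and> (\<forall>b\<in>B. (\<Sum>a\<in>A. c a * \<phi> a b) = 0)"
  using assms
proof (induction B arbitrary: A \<phi> rule: finite_induct)
  case empty
  then obtain a where "a \<in> A" by (cases "A = {}") auto
  then show ?case by (intro exI[of _ "\<lambda>_. 1"]) auto
next
  case (insert b B)
  show ?case
  proof (cases "\<forall>a\<in>A. \<phi> a b = 0")
    case True
    obtain c where "\<exists>a\<in>A. c a \<noteq> 0" "\<forall>b\<in>B. (\<Sum>a\<in>A. c a * \<phi> a b) = 0"
      using insert.IH[of A \<phi>] insert.prems insert.hyps by auto
    then show ?thesis using True by (intro exI[of _ c]) simp
  next
    case False
    then obtain a0 where a0: "a0 \<in> A" "\<phi> a0 b \<noteq> 0" by blast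
    have "card (A - {a0}) > card B" using insert.prems insert.hyps a0 by simp
    then obtain c where c: "\<exists>a\<in>A - {a0}. c a \<noteq> 0"
      "\<forall>b'\<in>B. (\<Sum>a\<in>A - {a0}. c a * (\<phi> a b' - \<phi> a b / \<phi> a0 b * \<phi> a0 b')) = 0"
      using insert.IH[of "A - {a0}" "\<lambda>a b'. \<phi> a b' - \<phi> a b / \<phi> a0 b * \<phi> a0 b'"] insert.prems(1) by auto
    define e where "e = - (\<Sum>a\<in>A - {a0}. c a * \<phi> a b) / \<phi> a0 b"
    define c' where "c' = c(a0 := e)"
    have s: "(\<Sum>a\<in>A. c' a * \<phi> a b') = e * \<phi> a0 b' + (\<Sum>a\<in>A - {a0}. c a * \<phi> a b')" for b'
      using insert.prems(1) a0(1) by (simp add: sum.remove[of A a0] c'_def)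
    have "(\<Sum>a\<in>A. c' a * \<phi> a b) = 0" unfolding s using a0(2) by (simp add: e_def)
    moreover have "(\<Sum>a\<in>A. c' a * \<phi> a b') = 0" if "b' \<in> B" for b'
    proof -
      have "(\<Sum>a\<in>A - {a0}. c a * (\<phi> a b' - \<phi> a b / \<phi> a0 b * \<phi> a0 b'))
        = (\<Sum>a\<in>A - {a0}. c a * \<phi> a b') - (\<Sum>a\<in>A - {a0}. c a * \<phi> a b) * (\<phi> a0 b' / \<phi> a0 b)"
        by (simp add: right_diff_distrib sum_subtractf sum_distrib_left sum_distrib_right sum_divide_distrib mult_ac)
      then show ?thesis unfolding s using c(2) that by (simp add: e_def)
    qed
    moreover have "\<exists>a\<in>A. c' a \<noteq> 0" using c(1) by (auto simp: c'_def)
    ultimately show ?thesis by (intro exI[of _ c']) simp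
  qed
qed

lemma var_power: "var i ^ k = Poly_Mapping.single (Poly_Mapping.single i k) 1"
proof (induction k)
  case (Suc k)
  have "Poly_Mapping.single i (Suc 0) + Poly_Mapping.single i k = Poly_Mapping.single i (Suc k)"
    by (simp flip: single_add)
  then show ?case
    unfolding power_Suc Suc by (simp add: var_def mult_single)
qed simp

lemma single_eq_prod_var:
  fixes u :: "'v::finite monomial"
  shows "Poly_Mapping.single u a = mconst a * (\<Prod>i\<in>UNIV. var i ^ Poly_Mapping.lookup u i)"
proof -
  have "(\<Prod>i\<in>A. var i ^ Poly_Mapping.lookup u i)
      = Poly_Mapping.single (\<Sum>i\<in>A. Poly_Mapping.single i (Poly_Mapping.lookup u i)) (1 :: complex)"
    if "finite A" for A
    using that by induction (simp_all add: var_power mult_single)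
  moreover have "(\<Sum>i\<in>UNIV. Poly_Mapping.single i (Poly_Mapping.lookup u i)) = u"
    by (rule poly_mapping_eqI) (simp add: lookup_sum lookup_single when_def)
  ultimately show ?thesis by (simp add: mconst_def mult_single)
qed

lemma mconst_mult: "mconst (a * b) = mconst a * mconst b"
  by (simp add: mconst_def mult_single)

lemma mconst_add: "mconst (a + b) = mconst a + mconst b"
  by (simp add: mconst_def single_add)

lemma mconst_diff: "mconst (a - b) = mconst a - mconst b"
  by (simp add: mconst_def single_diff)

lemma mconst_0 [simp]: "mconst 0 = 0" and mconst_1 [simp]: "mconst 1 = 1"
  by (simp_all add: mconst_def)

lemma mconst_power: "mconst (a ^ n) = mconst a ^ n"
  by (induction n) (simp_all add: mconst_mult)

lemma mconst_prod: "mconst (prod f A) = (\<Prod>i\<in>A. mconst (f i))"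
  by (induction A rule: infinite_finite_induct) (simp_all add: mconst_mult)

lemma mconst_sum: "mconst (sum f A) = (\<Sum>i\<in>A. mconst (f i))"
  by (induction A rule: infinite_finite_induct) (simp_all add: mconst_add)

text \<open>The binary form of degree \<open>n\<close> in \<open>x\<close>, \<open>y\<close> whose dehomogenisation at \<open>x = 1\<close> is \<open>p\<close>.\<close>

definition bform :: "'v mpoly \<Rightarrow> 'v mpoly \<Rightarrow> nat \<Rightarrow> complex poly \<Rightarrow> 'v mpoly" where
  "bform x y n p = (\<Sum>i\<le>n. mconst (poly.coeff p i) * y ^ i * x ^ (n - i))"

lemma bform_linear_mult:
  assumes "Polynomial.degree p \<le> n"
  shows "bform x y (Suc n) ([:- r, 1:] * p) = (y - mconst r * x) * bform x y n p"
proof -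
  have cf: "poly.coeff ([:- r, 1:] * p) i = (case i of 0 \<Rightarrow> 0 | Suc j \<Rightarrow> poly.coeff p j) - r * poly.coeff p i" for i
    by (cases i) (simp_all add: coeff_pCons)
  \<comment> \<open>The second sum below runs up to \<open>Suc n\<close>; the bound on the degree
    kills its last term.\<close>
  have z: "poly.coeff p (Suc n) = 0" using assms by (simp add: coeff_eq_0)
  have "bform x y (Suc n) ([:- r, 1:] * p) =
      (\<Sum>i\<le>Suc n. mconst (case i of 0 \<Rightarrow> 0 | Suc j \<Rightarrow> poly.coeff p j) * y ^ i * x ^ (Suc n - i))
    - (\<Sum>i\<le>Suc n. mconst r * mconst (poly.coeff p i) * y ^ i * x ^ (Suc n - i))"
    unfolding bform_def cf by (simp only: mconst_diff mconst_mult left_diff_distrib sum_subtractf)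
  also have "(\<Sum>i\<le>Suc n. mconst (case i of 0 \<Rightarrow> 0 | Suc j \<Rightarrow> poly.coeff p j) * y ^ i * x ^ (Suc n - i))
      = (\<Sum>i\<le>n. mconst (poly.coeff p i) * y ^ Suc i * x ^ (n - i))"
    by (simp only: sum.atMost_Suc_shift) simp
  also have "\<dots> = y * bform x y n p"
    unfolding bform_def sum_distrib_left by (intro sum.cong refl) (simp add: mult_ac)
  also have "(\<Sum>i\<le>Suc n. mconst r * mconst (poly.coeff p i) * y ^ i * x ^ (Suc n - i))
      = (\<Sum>i\<le>n. mconst r * mconst (poly.coeff p i) * y ^ i * x ^ (Suc n - i))"
    by (simp add: z)
  also have "\<dots> = mconst r * x * bform x y n p"
    unfolding bform_def sum_distrib_left by (intro sum.cong refl) (simp add: Suc_diff_le mult_ac)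
  finally show ?thesis by (simp add: left_diff_distrib)
qed

lemma bform_prod:
  assumes "finite A"
  shows "bform x y (card A) (\<Prod>c\<in>A. [:- c, 1:]) = (\<Prod>c\<in>A. y - mconst c * x)"
  using assms
proof induction
  case empty
  show ?case by (simp add: bform_def)
next
  case (insert c A)
  have "Polynomial.degree (\<Prod>c\<in>A. [:- c, 1:]) \<le> card A"
    using degree_prod_sum_le[OF insert(1), of "\<lambda>c. [:- c, 1:]"] by simp
  from bform_linear_mult[OF this, of x y c] show ?case
    by (simp only: prod.insert[OF insert(1,2)] card_insert_disjoint[OF insert(1,2)] insert(3))
qed

lemma bform_sum: "bform x y n (\<Sum>c\<in>A. Polynomial.smult (w c) (p c)) = (\<Sum>c\<in>A. mconst (w c) * bform x y n (p c))"
proof -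
  have c: "mconst (poly.coeff (\<Sum>c\<in>A. Polynomial.smult (w c) (p c)) i) * y ^ i * x ^ (n - i)
      = (\<Sum>c\<in>A. mconst (w c) * (mconst (poly.coeff (p c) i) * y ^ i * x ^ (n - i)))" for i
    by (simp add: coeff_sum mconst_sum mconst_mult sum_distrib_right mult.assoc)
  show ?thesis
    unfolding bform_def c sum_distrib_left by (rule sum.swap)
qed

text \<open>Over the complex numbers \<open>p\<close> splits, so the binary form is a product of a
  nonzero constant, factors \<open>y - mconst r * x\<close>, and powers of \<open>x\<close> if
  \<open>n\<close> exceeds the degree. A prime ideal contains one of the factors, and powers of
  \<open>x\<close> are excluded.\<close>

lemma bform_root_in_prime:
  assumes J: "is_ideal J" and prime: "\<And>p q. p * q \<in> J \<Longrightarrow> p \<in> J \<or> q \<in> J"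
    and x: "\<And>N. x ^ N \<notin> J"
    and "p \<noteq> 0" "Polynomial.degree p \<le> n" "bform x y n p \<in> J"
  shows "\<exists>r. y - mconst r * x \<in> J"
  using assms(4-6)
proof (induction n arbitrary: p)
  case (0 p)
  then obtain a where a: "p = [:a:]" using degree_eq_zeroE by blast
  then have "mconst (inverse a) * mconst a \<in> J" using 0 is_idealD(3)[OF J] by (simp add: bform_def)
  moreover have "mconst (inverse a) * mconst a = (x ^ 0 :: 'a mpoly)"
    using 0 a by (simp flip: mconst_mult)
  ultimately show ?case using x by metis
next
  case (Suc n p)
  show ?case
  proof (cases "Polynomial.degree p = 0")
    case True
    then obtain a where a: "p = [:a:]" using degree_eq_zeroE by blast
    have "bform x y (Suc n) p = mconst a * x ^ Suc n"
      unfolding bform_def sum.atMost_Suc_shift a by (simp add: coeff_pCons)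
    then have "mconst (inverse a) * (mconst a * x ^ Suc n) \<in> J"
      using Suc.prems is_idealD(3)[OF J] by simp
    moreover have "mconst (inverse a) * (mconst a * x ^ Suc n) = x ^ Suc n"
      using Suc.prems a by (simp flip: mconst_mult mult.assoc)
    ultimately show ?thesis using x by metis
  next
    case False
    then obtain r where "poly p r = 0"
      using alg_closed_imp_poly_has_root[of p] by auto
    then obtain q where q: "p = [:- r, 1:] * q" by (auto simp: poly_eq_0_iff_dvd elim: dvdE)
    have "q \<noteq> 0" using q Suc.prems by auto
    then have dq: "Polynomial.degree q \<le> n"
      using Suc.prems(2) unfolding q by (subst (asm) degree_mult_eq) auto
    have "(y - mconst r * x) * bform x y n q \<in> J"
      using Suc.prems(3) unfolding q bform_linear_mult[OF dq] .
    then consider "y - mconst r * x \<in> J" | "bform x y n q \<in> J" using prime by blast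
    then show ?thesis using Suc.IH[OF \<open>q \<noteq> 0\<close> dq] by cases blast+
  qed
qed

text \<open>Zorn's lemma for the ideals that contain \<open>I\<close> and no power of
  \<open>x\<close>. A maximal one is the trace of a maximal ideal of the ring localised at
  \<open>x\<close>. The last conclusion says without fractions that the localised quotient is a
  field: \<open>u\<close> inverts \<open>p\<close> up to a power of \<open>x\<close>.\<close>

lemma maximal_ideal_avoiding_powers:
  fixes x :: "'r::comm_ring_1"
  assumes I: "is_ideal I" and x: "\<And>N. x ^ N \<notin> I"
  obtains J where "is_ideal J" "I \<subseteq> J" "\<And>N. x ^ N \<notin> J"
    "\<And>p. p \<notin> J \<Longrightarrow> \<exists>u N. x ^ N - u * p \<in> J"
proof -
  define ok where "ok J \<longleftrightarrow> is_ideal J \<and> I \<subseteq> J \<and> (\<forall>N. x ^ N \<notin> J)" for J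
  have "\<exists>M\<in>Collect ok. \<forall>X\<in>Collect ok. M \<subseteq> X \<longrightarrow> X = M"
  proof (rule subset_Zorn_nonempty)
    have "ok I" using I x unfolding ok_def by simp
    then show "Collect ok \<noteq> {}" by blast
    show "\<Union>\<C> \<in> Collect ok" if ne: "\<C> \<noteq> {}" and ch: "subset.chain (Collect ok) \<C>" for \<C>
    proof -
      have okC: "ok J" if "J \<in> \<C>" for J
        using ch that unfolding subset.chain_def by blast
      then have C: "is_ideal J" "I \<subseteq> J" "x ^ N \<notin> J" if "J \<in> \<C>" for J N
        using that unfolding ok_def by simp_all
      obtain J0 where J0: "J0 \<in> \<C>" using ne by blast
      have "p + q \<in> \<Union>\<C>" if pq: "p \<in> \<Union>\<C>" "q \<in> \<Union>\<C>" for p q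
      proof -
        obtain J where J: "J \<in> \<C>" "p \<in> J" using pq(1) by (rule UnionE)
        obtain K where K: "K \<in> \<C>" "q \<in> K" using pq(2) by (rule UnionE)
        have "J \<subseteq> K \<or> K \<subseteq> J" using ch J(1) K(1) unfolding subset.chain_def by blast
        then show ?thesis
        proof
          assume "J \<subseteq> K"
          then have "p + q \<in> K" using J K by (intro is_idealD(2)[OF C(1)]) auto
          then show ?thesis using K(1) by (rule UnionI[rotated])
        next
          assume "K \<subseteq> J"
          then have "p + q \<in> J" using J K by (intro is_idealD(2)[OF C(1)]) auto
          then show ?thesis using J(1) by (rule UnionI[rotated])
        qed
      qed
      moreover have "0 \<in> \<Union>\<C>" using is_idealD(1)[OF C(1)[OF J0]] J0 by (rule UnionI[rotated])
      moreover have "r * p \<in> \<Union>\<C>" if p: "p \<in> \<Union>\<C>" for r p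
      proof -
        obtain J where J: "J \<in> \<C>" "p \<in> J" using p by (rule UnionE)
        show ?thesis using is_idealD(3)[OF C(1)[OF J(1)] J(2)] J(1) by (rule UnionI[rotated])
      qed
      ultimately have "is_ideal (\<Union>\<C>)" unfolding is_ideal_def by simp
      moreover have "I \<subseteq> \<Union>\<C>" using C(2)[OF J0] J0 by (rule order_trans[OF _ Union_upper])
      moreover have "x ^ N \<notin> \<Union>\<C>" for N using C(3) by (auto simp del: Union_iff elim!: UnionE)
      ultimately show ?thesis unfolding ok_def by simp
    qed
  qed
  then obtain J where okJ: "ok J" and max: "\<And>X. ok X \<Longrightarrow> J \<subseteq> X \<Longrightarrow> X = J"
    by (metis mem_Collect_eq)
  have J: "is_ideal J" "I \<subseteq> J" "\<And>N. x ^ N \<notin> J" using okJ unfolding ok_def by simp_all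
  have "\<exists>u N. x ^ N - u * p \<in> J" if p: "p \<notin> J" for p
  proof (rule ccontr)
    assume no: "\<not> ?thesis"
    \<comment> \<open>The ideal generated by \<open>J\<close> and \<open>p\<close>; by the
      assumption it still contains no power of \<open>x\<close>.\<close>
    define K where "K = {j. \<exists>u. j - u * p \<in> J}"
    have "is_ideal K"
      unfolding is_ideal_def
    proof (intro conjI ballI allI)
      show "0 \<in> K" using is_idealD(1)[OF J(1)] unfolding K_def by (intro CollectI exI[of _ 0]) simp
      fix a r assume "a \<in> K"
      then obtain u where a: "a - u * p \<in> J" unfolding K_def by blast
      have "r * a - (r * u) * p \<in> J" using is_idealD(3)[OF J(1) a, of r] by (simp add: algebra_simps)
      then show "r * a \<in> K" unfolding K_def by blast
      fix b assume "b \<in> K"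
      then obtain w where b: "b - w * p \<in> J" unfolding K_def by blast
      have "(a + b) - (u + w) * p \<in> J" using is_idealD(2)[OF J(1) a b] by (simp add: algebra_simps)
      then show "a + b \<in> K" unfolding K_def by blast
    qed
    moreover have JK: "J \<subseteq> K"
    proof
      fix j assume "j \<in> J"
      then show "j \<in> K" unfolding K_def by (intro CollectI exI[of _ 0]) simp
    qed
    moreover have "x ^ N \<notin> K" for N using no unfolding K_def by blast
    ultimately have "ok K" using J(2) unfolding ok_def by blast
    then have "K = J" using JK max by blast
    moreover have "p \<in> K"
      using is_idealD(1)[OF J(1)] unfolding K_def by (intro CollectI exI[of _ 1]) simp
    ultimately show False using p by blast
  qed
  then show thesis using that J by blast
qed

text \<open>The quotient of the polynomial ring has countable dimension while the field is uncountable, so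
  the inverses of \<open>y - c x\<close> in the localised quotient are linearly dependent; clearing denominators
  yields a binary form in \<open>x\<close>, \<open>y\<close> lying in the ideal, which splits into linear factors.\<close>

lemma linear_form_in_ideal:
  fixes x y :: "'v::finite mpoly"
  assumes J: "is_ideal J" and x: "\<And>N. x ^ N \<notin> J"
    and max: "\<And>p. p \<notin> J \<Longrightarrow> \<exists>u N. x ^ N - u * p \<in> J"
  shows "\<exists>r. y - mconst r * x \<in> J"
proof (rule ccontr)
  assume no: "\<not> ?thesis"
  \<comment> \<open>Elements outside \<open>J\<close> are invertible up to powers of
    \<open>x\<close>, hence so is their product.\<close>
  have prime: "p \<in> J \<or> q \<in> J" if "p * q \<in> J" for p q
  proof (rule ccontr)
    assume "\<not> ?thesis"
    then obtain u N w M where u: "x ^ N - u * p \<in> J" and w: "x ^ M - w * q \<in> J" using max by metis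
    have "(x ^ N - u * p) * x ^ M + (u * p) * (x ^ M - w * q) + (u * w) * (p * q) \<in> J"
      by (intro is_idealD(2)[OF J] is_idealD(4)[OF J u] is_idealD(3)[OF J w] is_idealD(3)[OF J that])
    moreover have "(x ^ N - u * p) * x ^ M + (u * p) * (x ^ M - w * q) + (u * w) * (p * q) = x ^ (N + M)"
      by (simp add: algebra_simps power_add)
    ultimately show False using x by metis
  qed
  have "\<forall>c. \<exists>u N. x ^ N - u * (y - mconst c * x) \<in> J" using max no by blast
  then obtain U E where UE: "\<And>c. x ^ E c - U c * (y - mconst c * x) \<in> J" by metis
  \<comment> \<open>A joint bound for the exponent of \<open>x\<close> and the degrees in
    \<open>U c\<close>, so that the second pigeonhole argument below runs over finitely many
    exponents.\<close>
  have "\<exists>k. E c \<le> k \<and> (\<forall>u\<in>Poly_Mapping.keys (U c). mdegree u \<le> k)" for c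
  proof (intro exI[of _ "E c + (\<Sum>u\<in>Poly_Mapping.keys (U c). mdegree u)"] conjI ballI)
    fix u assume "u \<in> Poly_Mapping.keys (U c)"
    then have "mdegree u \<le> (\<Sum>u\<in>Poly_Mapping.keys (U c). mdegree u)"
      by (intro member_le_sum) auto
    then show "mdegree u \<le> E c + (\<Sum>u\<in>Poly_Mapping.keys (U c). mdegree u)" by simp
  qed simp
  then obtain D where D: "\<And>c. E c \<le> D c" "\<And>c u. u \<in> Poly_Mapping.keys (U c) \<Longrightarrow> mdegree u \<le> D c" by metis
  \<comment> \<open>There are countably many bounds but uncountably many \<open>c\<close>.
    Infinitely many \<open>c\<close> share a bound, and their \<open>U c\<close> involve only
    finitely many monomials.\<close>
  have "\<exists>k. infinite {c. D c = k}"
  proof (rule ccontr)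
    assume "\<not> ?thesis"
    then have "countable (\<Union>k. {c. D c = k})" by (intro countable_UN) (auto intro: countable_finite)
    moreover have "(\<Union>k. {c. D c = k}) = UNIV" by auto
    ultimately show False using uncountable_UNIV_complex by simp
  qed
  then obtain k where k: "infinite {c. D c = k}" by blast
  define B where "B = (\<Union>c\<in>{c. D c = k}. Poly_Mapping.keys (U c))"
  have "finite B"
  proof (rule finite_subset)
    show "B \<subseteq> (\<Union>j\<le>k. {u. mdegree u = j})" unfolding B_def using D(2) by fastforce
    show "finite (\<Union>j\<le>k. {u :: 'v monomial. mdegree u = j})" by (simp add: finite_monomials_of_degree)
  qed
  have "\<exists>k'. infinite {c. D c = k \<and> E c = k'}"
  proof (rule ccontr)
    assume "\<not> ?thesis"
    then have "finite (\<Union>k'\<le>k. {c. D c = k \<and> E c = k'})" by simp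
    moreover have "{c. D c = k} \<subseteq> (\<Union>k'\<le>k. {c. D c = k \<and> E c = k'})" using D(1) by auto
    ultimately show False using k finite_subset by blast
  qed
  then obtain k' where k': "infinite {c. D c = k \<and> E c = k'}" by blast
  \<comment> \<open>One more scalar than there are monomials forces a linear relation between the
    \<open>U c\<close>.\<close>
  obtain A where A: "A \<subseteq> {c. D c = k \<and> E c = k'}" "finite A" "card A = Suc (card B)"
    using infinite_arbitrarily_large[OF k'] by metis
  obtain w where w: "\<exists>c\<in>A. w c \<noteq> 0" "\<forall>u\<in>B. (\<Sum>c\<in>A. w c * Poly_Mapping.lookup (U c) u) = 0"
    using underdetermined_system[OF \<open>finite B\<close> A(2), of "\<lambda>c. Poly_Mapping.lookup (U c)"] A(3) by auto
  have lmc: "Poly_Mapping.lookup (mconst a * p) u = a * Poly_Mapping.lookup p u" for a and p :: "'v mpoly" and u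
    unfolding mconst_def
    by (subst mult_map_scale_conv_mult[symmetric]) (simp add: Poly_Mapping.map.rep_eq when_def)
  have dep: "(\<Sum>c\<in>A. mconst (w c) * U c) = 0"
  proof (rule poly_mapping_eqI)
    fix u
    show "Poly_Mapping.lookup (\<Sum>c\<in>A. mconst (w c) * U c) u = Poly_Mapping.lookup 0 u"
    proof (cases "u \<in> B")
      case True
      then show ?thesis using w(2) by (simp add: lookup_sum lmc)
    next
      case False
      then have "Poly_Mapping.lookup (U c) u = 0" if "c \<in> A" for c
        using that A(1) unfolding B_def by (auto simp: in_keys_iff)
      then show ?thesis by (simp add: lookup_sum lmc)
    qed
  qed
  \<comment> \<open>Modulo \<open>J\<close>, each \<open>U c\<close> is \<open>x ^ k'\<close>
    divided by \<open>y - mconst c * x\<close>. Multiplying the linear relation by the product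
    \<open>P\<close> of all denominators puts \<open>x ^ k' * S\<close> into
    \<open>J\<close>.\<close>
  define P where "P = (\<Prod>c\<in>A. y - mconst c * x)"
  define Q where "Q c = (\<Prod>l\<in>A - {c}. y - mconst l * x)" for c
  define S where "S = (\<Sum>c\<in>A. mconst (w c) * Q c)"
  have PQ: "P = (y - mconst c * x) * Q c" if "c \<in> A" for c
    unfolding P_def Q_def using that A(2) by (rule prod.remove[rotated])
  have "(\<Sum>c\<in>A. (x ^ k' - U c * (y - mconst c * x)) * (mconst (w c) * Q c)) \<in> J"
  proof (intro is_idealD(6)[OF J] is_idealD(4)[OF J])
    show "x ^ k' - U c * (y - mconst c * x) \<in> J" if "c \<in> A" for c using UE[of c] A(1) that by auto
  qed
  also have "(\<Sum>c\<in>A. (x ^ k' - U c * (y - mconst c * x)) * (mconst (w c) * Q c))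
      = (\<Sum>c\<in>A. x ^ k' * (mconst (w c) * Q c) - mconst (w c) * U c * P)"
    by (intro sum.cong refl) (simp add: PQ algebra_simps)
  also have "\<dots> = x ^ k' * S - (\<Sum>c\<in>A. mconst (w c) * U c) * P"
    by (simp add: sum_subtractf S_def sum_distrib_left sum_distrib_right)
  also have "\<dots> = x ^ k' * S" by (simp add: dep)
  finally have SJ: "S \<in> J" using prime x by blast
  define p where "p = (\<Sum>c\<in>A. Polynomial.smult (w c) (\<Prod>l\<in>A - {c}. [:- l, 1:]))"
  have Q: "Q c = bform x y (card B) (\<Prod>l\<in>A - {c}. [:- l, 1:])" if "c \<in> A" for c
  proof -
    have "card (A - {c}) = card B" using A that by simp
    then show ?thesis using bform_prod[of "A - {c}" x y] A(2) unfolding Q_def by simp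
  qed
  have "bform x y (card B) p = S"
    unfolding p_def bform_sum S_def by (intro sum.cong refl) (simp add: Q)
  \<comment> \<open>As in Lagrange interpolation: at a node \<open>c0\<close> of nonzero weight all
    summands but one vanish.\<close>
  moreover have "p \<noteq> 0"
  proof -
    obtain c0 where c0: "c0 \<in> A" "w c0 \<noteq> 0" using w(1) by blast
    have z: "(\<Prod>l\<in>A - {c}. c0 - l) = 0" if "c \<in> A" "c \<noteq> c0" for c
      using that c0 A(2) by (intro prod_zero bexI[of _ c0]) auto
    have "poly p c0 = (\<Sum>c\<in>A. w c * (\<Prod>l\<in>A - {c}. c0 - l))"
      by (simp add: p_def poly_sum poly_prod)
    also have "\<dots> = w c0 * (\<Prod>l\<in>A - {c0}. c0 - l)"
    proof -
      have "(\<Sum>c\<in>A - {c0}. w c * (\<Prod>l\<in>A - {c}. c0 - l)) = 0"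
        by (rule sum.neutral) (use z in simp)
      then show ?thesis using c0 A(2) by (simp only: sum.remove[of A c0] add_0_right)
    qed
    also have "\<dots> \<noteq> 0" using c0 A(2) by auto
    finally show ?thesis by auto
  qed
  moreover have "Polynomial.degree p \<le> card B"
    unfolding p_def
  proof (intro degree_sum_le[OF A(2)] order_trans[OF degree_smult_le])
    fix c assume "c \<in> A"
    then have "card (A - {c}) = card B" using A by simp
    then show "Polynomial.degree (\<Prod>l\<in>A - {c}. [:- l, 1:]) \<le> card B"
      using degree_prod_sum_le[of "A - {c}" "\<lambda>c. [:- c, 1:]"] A(2) by simp
  qed
  ultimately show False
    using bform_root_in_prime[OF J prime x, of p "card B" y] SJ no by blast
qed

text \<open>Modulo the maximal \<open>J\<close> every variable is a multiple \<open>r i\<close> of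
  \<open>var v\<close>, so a form \<open>q\<close> of degree \<open>d\<close> becomes
  \<open>meval q r\<close> times \<open>var v ^ d\<close>. For \<open>q\<close> in \<open>J\<close>
  this factor must be zero, as \<open>J\<close> contains no power of \<open>var v\<close>. Thus
  \<open>r\<close> is a common zero in the chart where coordinate \<open>v\<close> is 1.\<close>

theorem projective_nullstellensatz:
  fixes I :: "'v::finite mpoly set"
  assumes I: "is_ideal I" and v: "\<And>N. var v ^ N \<notin> I"
  shows "\<exists>r. r v = 1 \<and> (\<forall>q\<in>I. \<forall>d. homogeneous d q \<longrightarrow> meval q r = 0)"
proof -
  obtain J where J: "is_ideal J" "I \<subseteq> J" and x: "\<And>N. var v ^ N \<notin> J"
    and max: "\<And>p. p \<notin> J \<Longrightarrow> \<exists>u N. var v ^ N - u * p \<in> J"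
    by (rule maximal_ideal_avoiding_powers[OF I v]) (rule that)
  have "\<forall>i. \<exists>r. var i - mconst r * var v \<in> J"
    using linear_form_in_ideal[OF J(1) x max] by blast
  then obtain r where r: "\<And>i. var i - mconst (r i) * var v \<in> J" by metis
  have scal: "a = 0" if "mconst a * var v ^ N \<in> J" for a N
  proof (rule ccontr)
    assume "a \<noteq> 0"
    have "mconst (inverse a) * (mconst a * var v ^ N) \<in> J" by (rule is_idealD(3)[OF J(1) that])
    moreover have "mconst (inverse a) * (mconst a * var v ^ N) = var v ^ N"
      using \<open>a \<noteq> 0\<close> by (simp flip: mconst_mult mult.assoc)
    ultimately show False using x by simp
  qed
  have cmult: "p * p' - q * q' \<in> J" if "p - q \<in> J" "p' - q' \<in> J" for p p' q q'
  proof -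
    have "(p - q) * p' + q * (p' - q') \<in> J"
      by (intro is_idealD(2)[OF J(1)] is_idealD(4)[OF J(1) that(1)] is_idealD(3)[OF J(1) that(2)])
    then show ?thesis by (simp add: algebra_simps)
  qed
  have cpow: "var i ^ k - (mconst (r i) * var v) ^ k \<in> J" for i k
  proof (induction k)
    case 0
    show ?case using is_idealD(1)[OF J(1)] by simp
  next
    case (Suc k)
    show ?case unfolding power_Suc by (rule cmult[OF r Suc])
  qed
  have cprod: "(\<Prod>i\<in>A. var i ^ f i) - (\<Prod>i\<in>A. (mconst (r i) * var v) ^ f i) \<in> J" for A and f :: "'v \<Rightarrow> nat"
  proof (induction A rule: infinite_finite_induct)
    case (insert i A)
    show ?case unfolding prod.insert[OF insert(1,2)] by (rule cmult[OF cpow insert(3)])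
  qed (use is_idealD(1)[OF J(1)] in simp_all)
  have mono: "Poly_Mapping.single u a - mconst (a * mono_val u r) * var v ^ mdegree u \<in> J" for u a
  proof -
    have "(\<Prod>i\<in>UNIV. (mconst (r i) * var v) ^ Poly_Mapping.lookup u i)
        = mconst (mono_val u r) * var v ^ mdegree u"
      by (simp add: mono_val_UNIV mdegree_superset[of UNIV] power_mult_distrib prod.distrib
          mconst_prod mconst_power power_sum)
    moreover have "mconst a * (\<Prod>i\<in>UNIV. var i ^ Poly_Mapping.lookup u i)
        - mconst a * (\<Prod>i\<in>UNIV. (mconst (r i) * var v) ^ Poly_Mapping.lookup u i) \<in> J"
      by (rule cmult[OF _ cprod]) (simp add: is_idealD(1)[OF J(1)])
    ultimately show ?thesis
      by (simp only: single_eq_prod_var[of u a] mconst_mult mult.assoc)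
  qed
  have "meval q r = 0" if "q \<in> I" "homogeneous d q" for q d
  proof -
    have "(\<Sum>u\<in>Poly_Mapping.keys q. Poly_Mapping.single u (Poly_Mapping.lookup q u)
        - mconst (Poly_Mapping.lookup q u * mono_val u r) * var v ^ mdegree u) \<in> J"
      by (intro is_idealD(6)[OF J(1)] mono)
    also have "(\<Sum>u\<in>Poly_Mapping.keys q. Poly_Mapping.single u (Poly_Mapping.lookup q u)
        - mconst (Poly_Mapping.lookup q u * mono_val u r) * var v ^ mdegree u)
        = q - (\<Sum>u\<in>Poly_Mapping.keys q. mconst (Poly_Mapping.lookup q u * mono_val u r) * var v ^ d)"
      unfolding sum_subtractf sum_single_keys[symmetric]
      using that(2) by (intro arg_cong2[of _ _ _ _ "(-)"] refl sum.cong) (simp add: homogeneous_def)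
    also have "(\<Sum>u\<in>Poly_Mapping.keys q. mconst (Poly_Mapping.lookup q u * mono_val u r) * var v ^ d)
        = mconst (meval q r) * var v ^ d"
      by (simp add: meval_def mono_val_def mconst_sum sum_distrib_right)
    finally have "q - mconst (meval q r) * var v ^ d \<in> J" .
    from is_idealD(5)[OF J(1) _ this, of q] have "mconst (meval q r) * var v ^ d \<in> J"
      using J(2) that(1) by auto
    then show ?thesis by (rule scal)
  qed
  moreover have "r v = 1"
  proof -
    have "mconst (1 - r v) * var v ^ 1 \<in> J" using r[of v] by (simp add: mconst_diff left_diff_distrib)
    then have "1 - r v = 0" by (rule scal)
    then show ?thesis by simp
  qed
  ultimately show ?thesis by blast
qed

subsection \<open>Families of homogeneous forms\<close>

text \<open>\<open>hp G d Q\<close>: \<open>Q \<theta> X\<close> is a form of degree \<open>d\<close> in \<open>X\<close> whose coefficients are polynomials in the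
  functions \<open>G\<close> of the parameter \<open>\<theta>\<close>.\<close>

inductive hp :: "('a \<Rightarrow> complex) set \<Rightarrow> nat \<Rightarrow> ('a \<Rightarrow> ('v \<Rightarrow> complex) \<Rightarrow> complex) \<Rightarrow> bool" for G where
  coeff: "c \<in> palg G \<Longrightarrow> hp G 0 (\<lambda>\<theta> X. c \<theta>)"
| var: "hp G 1 (\<lambda>\<theta> X. X v)"
| zero: "hp G d (\<lambda>\<theta> X. 0)"
| add: "hp G d P \<Longrightarrow> hp G d Q \<Longrightarrow> hp G d (\<lambda>\<theta> X. P \<theta> X + Q \<theta> X)"
| mult: "hp G d P \<Longrightarrow> hp G e Q \<Longrightarrow> hp G (d + e) (\<lambda>\<theta> X. P \<theta> X * Q \<theta> X)"

lemma hp_sum: "(\<And>i. i \<in> A \<Longrightarrow> hp G d (Q i)) \<Longrightarrow> hp G d (\<lambda>\<theta> X. \<Sum>i\<in>A. Q i \<theta> X)"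
proof (induction A rule: infinite_finite_induct)
  case (insert i A)
  then show ?case using hp.add[of G d "Q i" "\<lambda>\<theta> X. \<Sum>i\<in>A. Q i \<theta> X"] by simp
qed (simp_all add: hp.zero)

lemma hp_scale: "c \<in> palg G \<Longrightarrow> hp G d Q \<Longrightarrow> hp G d (\<lambda>\<theta> X. c \<theta> * Q \<theta> X)"
  using hp.mult[OF hp.coeff, of c G d Q] by simp

lemma hp_power: "hp G d Q \<Longrightarrow> hp G (k * d) (\<lambda>\<theta> X. Q \<theta> X ^ k)"
proof (induction k)
  case 0
  show ?case using hp.coeff[OF palg.const] by simp
next
  case (Suc k)
  then show ?case using hp.mult[of G d Q "k * d"] by simp
qed

lemma hp_prod:
  assumes "\<And>i. i \<in> A \<Longrightarrow> hp G (d i) (Q i)" "finite A"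
  shows "hp G (\<Sum>i\<in>A. d i) (\<lambda>\<theta> X. \<Prod>i\<in>A. Q i \<theta> X)"
  using assms(2,1)
proof induction
  case empty
  show ?case using hp.coeff[OF palg.const] by simp
next
  case (insert i A)
  then show ?case using hp.mult[of G "d i" "Q i" "\<Sum>i\<in>A. d i"] by simp
qed

lemma hp_rename: "hp G d Q \<Longrightarrow> hp G d (\<lambda>\<theta> X. Q \<theta> (\<lambda>v. X (s v)))"
proof (induction rule: hp.induct)
  case (coeff c)
  then show ?case by (rule hp.coeff)
next
  case (var v)
  show ?case by (rule hp.var)
next
  case (zero d)
  show ?case by (rule hp.zero)
next
  case (add d P Q)
  show ?case using add.IH by (rule hp.add)
next
  case (mult d P e Q)
  show ?case using mult.IH by (rule hp.mult)
qed

text \<open>These explicit coefficients enter the linear algebra of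
  \<open>generic_no_common_zero\<close>. A list may repeat a monomial, which makes sums and products
  immediate.\<close>

lemma hp_terms:
  assumes "hp G d Q"
  shows "\<exists>ts. (\<forall>(u, c)\<in>set ts. mdegree u = d \<and> c \<in> palg G) \<and>
    (\<forall>\<theta> X. Q \<theta> X = (\<Sum>(u, c)\<leftarrow>ts. c \<theta> * mono_val u X))"
  using assms
proof induction
  case (coeff c)
  then show ?case by (intro exI[of _ "[(0, c)]"]) simp
next
  case (var v)
  show ?case
    by (intro exI[of _ "[(Poly_Mapping.single v 1, \<lambda>_. 1)]"]) (simp add: palg.const)
next
  case (zero d)
  show ?case by (intro exI[of _ "[]"]) simp
next
  case (add d P Q)
  then obtain ts us where "\<forall>(u, c)\<in>set ts. mdegree u = d \<and> c \<in> palg G"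
    "\<forall>\<theta> X. P \<theta> X = (\<Sum>(u, c)\<leftarrow>ts. c \<theta> * mono_val u X)"
    "\<forall>(u, c)\<in>set us. mdegree u = d \<and> c \<in> palg G"
    "\<forall>\<theta> X. Q \<theta> X = (\<Sum>(u, c)\<leftarrow>us. c \<theta> * mono_val u X)" by blast
  then show ?case by (intro exI[of _ "ts @ us"]) auto
next
  case (mult d P e Q)
  then obtain ts us where t: "\<forall>(u, c)\<in>set ts. mdegree u = d \<and> c \<in> palg G"
    "\<forall>\<theta> X. P \<theta> X = (\<Sum>(u, c)\<leftarrow>ts. c \<theta> * mono_val u X)"
    "\<forall>(u, c)\<in>set us. mdegree u = e \<and> c \<in> palg G"
    "\<forall>\<theta> X. Q \<theta> X = (\<Sum>(u, c)\<leftarrow>us. c \<theta> * mono_val u X)" by blast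
  define ws where "ws = map (\<lambda>((u, c), (u', c')). (u + u', \<lambda>\<theta>. c \<theta> * c' \<theta>)) (List.product ts us)"
  have "(\<Sum>(u, c)\<leftarrow>map (\<lambda>((u, c), (u', c')). (u + u', \<lambda>\<theta>. c \<theta> * c' \<theta>)) (List.product ts us). c \<theta> * mono_val u X)
      = (\<Sum>(u, c)\<leftarrow>ts. c \<theta> * mono_val u X) * (\<Sum>(u, c)\<leftarrow>us. c \<theta> * mono_val u X)" for \<theta> X
  proof (induction ts)
    case (Cons a ts)
    obtain u c where a: "a = (u, c)" by (cases a)
    have "(\<Sum>(u, c)\<leftarrow>map (\<lambda>((u, c), (u', c')). (u + u', \<lambda>\<theta>. c \<theta> * c' \<theta>)) (map (Pair a) us). c \<theta> * mono_val u X)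
      = c \<theta> * mono_val u X * (\<Sum>(u, c)\<leftarrow>us. c \<theta> * mono_val u X)"
      by (induction us) (auto simp: a mono_val_add algebra_simps)
    then show ?case using Cons by (simp add: a distrib_right)
  qed simp
  moreover have "\<forall>(u, c)\<in>set ws. mdegree u = d + e \<and> c \<in> palg G"
    using t(1,3) unfolding ws_def by (fastforce simp: mdegree_add intro: palg.mult)
  ultimately show ?case using t(2,4) unfolding ws_def[symmetric] by (intro exI[of _ ws]) simp
qed

text \<open>One multiple of a generator is added at a time, so that a linear functional which kills
  all such multiples kills the ideal by induction.\<close>

inductive_set ideal_gen :: "'r::comm_ring_1 set \<Rightarrow> 'r set" for B where
  zero: "0 \<in> ideal_gen B"
| step: "p \<in> ideal_gen B \<Longrightarrow> b \<in> B \<Longrightarrow> p + r * b \<in> ideal_gen B"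

lemma is_ideal_ideal_gen: "is_ideal (ideal_gen B)"
  unfolding is_ideal_def
proof (intro conjI ballI allI)
  show "0 \<in> ideal_gen B" by (rule ideal_gen.zero)
  fix p r assume p: "p \<in> ideal_gen B"
  show "r * p \<in> ideal_gen B"
    using p
  proof induction
    case (step p b s)
    have "r * p + (r * s) * b \<in> ideal_gen B" by (rule ideal_gen.step[OF step(3,2)])
    then show ?case by (simp add: algebra_simps)
  qed (simp add: ideal_gen.zero)
  fix q assume "q \<in> ideal_gen B"
  then show "p + q \<in> ideal_gen B"
  proof induction
    case (step q b s)
    have "(p + q) + s * b \<in> ideal_gen B" by (rule ideal_gen.step[OF step(3,2)])
    then show ?case by (simp add: algebra_simps)
  qed (use p in simp)
qed

lemma ideal_gen_base: "b \<in> B \<Longrightarrow> b \<in> ideal_gen B"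
  using ideal_gen.step[OF ideal_gen.zero, of b B 1] by simp

text \<open>The main theorem of elimination theory: by the Nullstellensatz the forms generate all monomials
  of some degree at the good parameter, and this is an open condition on the coefficients.\<close>

theorem generic_no_common_zero:
  fixes Q :: "'i \<Rightarrow> 'a \<Rightarrow> ('v::finite \<Rightarrow> complex) \<Rightarrow> complex"
  assumes Q: "\<And>i. i \<in> I \<Longrightarrow> hp G (d i) (Q i)"
    and good: "\<And>X. (\<forall>i\<in>I. Q i \<theta>\<^sub>0 X = 0) \<Longrightarrow> X = (\<lambda>_. 0)"
  shows "\<exists>\<Phi>\<in>palg G. \<Phi> \<theta>\<^sub>0 \<noteq> 0 \<and>
    (\<forall>\<theta>. \<Phi> \<theta> \<noteq> 0 \<longrightarrow> (\<forall>X. (\<forall>i\<in>I. Q i \<theta> X = 0) \<longrightarrow> X = (\<lambda>_. 0)))"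
proof -
  have "\<exists>ts. \<forall>i\<in>I. (\<forall>(u, c)\<in>set (ts i). mdegree u = d i \<and> c \<in> palg G) \<and>
    (\<forall>\<theta> X. Q i \<theta> X = (\<Sum>(u, c)\<leftarrow>ts i. c \<theta> * mono_val u X))"
    by (intro bchoice ballI hp_terms Q)
  then obtain ts where ts: "\<And>i u c. i \<in> I \<Longrightarrow> (u, c) \<in> set (ts i) \<Longrightarrow> mdegree u = d i \<and> c \<in> palg G"
    and ts_Q: "\<And>i \<theta> X. i \<in> I \<Longrightarrow> Q i \<theta> X = (\<Sum>(u, c)\<leftarrow>ts i. c \<theta> * mono_val u X)" by fast
  define q where "q i = (\<Sum>(u, c)\<leftarrow>ts i. Poly_Mapping.single u (c \<theta>\<^sub>0))" for i
  have meval_q: "meval (\<Sum>(u, c)\<leftarrow>xs. Poly_Mapping.single u (c \<theta>\<^sub>0)) X = (\<Sum>(u, c)\<leftarrow>xs. c \<theta>\<^sub>0 * mono_val u X)"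
    for xs :: "('v monomial \<times> ('a \<Rightarrow> complex)) list" and X
    by (induction xs) (auto simp: meval_add meval_single)
  have keys_q: "Poly_Mapping.keys (\<Sum>(u, c)\<leftarrow>xs. Poly_Mapping.single u (c \<theta>\<^sub>0)) \<subseteq> fst ` set xs"
    for xs :: "('v monomial \<times> ('a \<Rightarrow> complex)) list"
  proof (induction xs)
    case (Cons a xs)
    then show ?case
      using keys_add[of "Poly_Mapping.single (fst a) (snd a \<theta>\<^sub>0)" "\<Sum>(u, c)\<leftarrow>xs. Poly_Mapping.single u (c \<theta>\<^sub>0)"]
      by (cases a) (auto split: if_splits)
  qed simp
  have hom_q: "homogeneous (d i) (q i)" if "i \<in> I" for i
    using keys_q[of "ts i"] ts[OF that] unfolding homogeneous_def q_def by fastforce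
  let ?I = "ideal_gen (q ` I)"
  \<comment> \<open>Otherwise the Nullstellensatz gives a common zero at
    \<open>\<theta>\<^sub>0\<close> whose coordinate \<open>v\<close> is 1.\<close>
  have "\<exists>N. var v ^ N \<in> ?I" for v
  proof (rule ccontr)
    assume "\<not> ?thesis"
    then obtain r where r: "r v = 1" "\<forall>p\<in>?I. \<forall>d. homogeneous d p \<longrightarrow> meval p r = 0"
      using projective_nullstellensatz[OF is_ideal_ideal_gen, of v "q ` I"] by auto
    have "Q i \<theta>\<^sub>0 r = 0" if "i \<in> I" for i
    proof -
      have "meval (q i) r = 0" using r(2) hom_q[OF that] ideal_gen_base[of "q i" "q ` I"] that by blast
      then show ?thesis using ts_Q[OF that] meval_q unfolding q_def by simp
    qed
    then have "r = (\<lambda>_. 0)" by (intro good) simp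
    then show False using r(1) by simp
  qed
  then obtain E where E: "\<And>v. var v ^ E v \<in> ?I" by metis
  \<comment> \<open>A monomial of degree \<open>N\<close> has an exponent of at least
    \<open>E v\<close> for some \<open>v\<close> and hence lies in the ideal.\<close>
  define N where "N = Suc (\<Sum>v\<in>UNIV. E v)"
  have mono_in: "Poly_Mapping.single b 1 \<in> ?I" if "mdegree b = N" for b :: "'v monomial"
  proof -
    have "\<exists>v. E v \<le> Poly_Mapping.lookup b v"
    proof (rule ccontr)
      assume "\<not> ?thesis"
      then have "(\<Sum>v\<in>UNIV. Poly_Mapping.lookup b v) \<le> (\<Sum>v\<in>UNIV. E v)"
        by (intro sum_mono) (simp add: not_le less_imp_le)
      then show False using that mdegree_superset[of UNIV b] by (simp add: N_def)
    qed
    then obtain v where v: "E v \<le> Poly_Mapping.lookup b v" by blast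
    have "b = (b - Poly_Mapping.single v (E v)) + Poly_Mapping.single v (E v)"
      by (rule poly_mapping_eqI) (use v in \<open>auto simp: lookup_add lookup_minus lookup_single when_def\<close>)
    then have "Poly_Mapping.single b (1::complex)
        = Poly_Mapping.single (b - Poly_Mapping.single v (E v)) 1 * var v ^ E v"
      unfolding var_power mult_single by simp
    also have "\<dots> \<in> ?I" by (rule is_idealD(3)[OF is_ideal_ideal_gen E])
    finally show ?thesis .
  qed
  let ?B = "{b :: 'v monomial. mdegree b = N}"
  \<comment> \<open>The coefficient of the monomial \<open>b\<close> in the product of the monomial
    \<open>a\<close> with the form \<open>Q i\<close>, that is, the Macaulay matrix in degree
    \<open>N\<close>. The forms generate all monomials of this degree when no nonzero vector is
    orthogonal to all rows.\<close>
  define \<phi> where "\<phi> i a \<theta> b = (\<Sum>(u, c)\<leftarrow>ts i. if b = a + u then c \<theta> else 0)" for i a \<theta> and b :: "'v monomial"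
  have phi_sum: "(\<Sum>b\<in>?B. c b * \<phi> i a \<theta> b) = (\<Sum>(u, k)\<leftarrow>ts i. k \<theta> * c (a + u))"
    if "i \<in> I" "mdegree a + d i = N" for i a c \<theta>
  proof -
    have "(\<Sum>b\<in>?B. c b * (\<Sum>(u, k)\<leftarrow>xs. if b = a + u then k \<theta> else 0)) = (\<Sum>(u, k)\<leftarrow>xs. k \<theta> * c (a + u))"
      if "\<And>u k. (u, k) \<in> set xs \<Longrightarrow> mdegree u = d i" for xs
      using that
    proof (induction xs)
      case (Cons x xs)
      obtain u k where x: "x = (u, k)" by (cases x)
      have "mdegree (a + u) = N"
        using Cons.prems[of u k] \<open>mdegree a + d i = N\<close> by (simp add: x mdegree_add)
      then have "(\<Sum>b\<in>?B. c b * (if b = a + u then k \<theta> else 0)) = k \<theta> * c (a + u)"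
        using finite_monomials_of_degree[of N, where 'v = 'v]
        by (simp add: if_distrib[of "\<lambda>y. _ * y"] sum.delta cong: if_cong)
      moreover have "(\<Sum>b\<in>?B. c b * (\<Sum>(u, k)\<leftarrow>xs. if b = a + u then k \<theta> else 0)) = (\<Sum>(u, k)\<leftarrow>xs. k \<theta> * c (a + u))"
        by (rule Cons.IH) (use Cons.prems in auto)
      ultimately show ?case by (simp add: x distrib_left sum.distrib)
    qed simp
    then show ?thesis using ts[OF \<open>i \<in> I\<close>] unfolding \<phi>_def by blast
  qed
  define V where "V = {\<phi> i a | i a. i \<in> I \<and> mdegree a + d i = N}"
  have "\<exists>\<Phi>\<in>palg G. \<Phi> \<theta>\<^sub>0 \<noteq> 0 \<and> (\<forall>\<theta>. \<Phi> \<theta> \<noteq> 0 \<longrightarrow>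
           (\<forall>c :: 'v monomial \<Rightarrow> complex. (\<forall>\<psi>\<in>V. (\<Sum>b\<in>?B. c b * \<psi> \<theta> b) = 0) \<longrightarrow> (\<forall>b\<in>?B. c b = 0)))"
  proof (rule generic_nondegenerate[OF finite_monomials_of_degree])
    fix \<psi> and b :: "'v monomial" assume "\<psi> \<in> V"
    then obtain i a where i: "\<psi> = \<phi> i a" "i \<in> I" unfolding V_def by blast
    have "(\<lambda>\<theta>. (\<Sum>(u, c)\<leftarrow>xs. if b = a + u then c \<theta> else 0)) \<in> palg G"
      if "\<And>u k. (u, k) \<in> set xs \<Longrightarrow> k \<in> palg G" for xs
      using that
    proof (induction xs)
      case Nil
      show ?case using palg.const by simp
    next
      case (Cons x xs)
      obtain u k where x: "x = (u, k)" by (cases x)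
      have "(\<lambda>\<theta>. if b = a + u then k \<theta> else 0) \<in> palg G"
        using Cons.prems[of u k] palg.const[where c = 0] by (cases "b = a + u") (auto simp: x)
      moreover have "(\<lambda>\<theta>. (\<Sum>(u, c)\<leftarrow>xs. if b = a + u then c \<theta> else 0)) \<in> palg G"
        by (rule Cons.IH) (use Cons.prems in auto)
      ultimately have "(\<lambda>\<theta>. (if b = a + u then k \<theta> else 0) + (\<Sum>(u, c)\<leftarrow>xs. if b = a + u then c \<theta> else 0)) \<in> palg G"
        by (rule palg.add)
      then show ?case by (simp only: x list.map sum_list.Cons prod.case)
    qed
    then show "(\<lambda>\<theta>. \<psi> \<theta> b) \<in> palg G" using ts[OF i(2)] unfolding i(1) \<phi>_def by blast
  next
    fix c :: "'v monomial \<Rightarrow> complex" assume c: "\<forall>\<psi>\<in>V. (\<Sum>b\<in>?B. c b * \<psi> \<theta>\<^sub>0 b) = 0"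
    \<comment> \<open>Extension by zero to all other degrees gives a functional on all polynomials,
      which vanishes on every multiple of a generator, whatever its degree.\<close>
    define c' where "c' b = (if mdegree b = N then c b else 0)" for b
    have le_q: "lin_ext c' (Poly_Mapping.single a k * q i) = 0" if "i \<in> I" for a k i
    proof -
      have eq: "lin_ext c' (Poly_Mapping.single a k * (\<Sum>(u, c)\<leftarrow>xs. Poly_Mapping.single u (c \<theta>\<^sub>0)))
          = k * (\<Sum>(u, l)\<leftarrow>xs. l \<theta>\<^sub>0 * c' (a + u))" for xs
        by (induction xs) (auto simp: distrib_left mult_single lin_ext_add)
      have "(\<Sum>(u, l)\<leftarrow>ts i. l \<theta>\<^sub>0 * c' (a + u)) = 0"
      proof (cases "mdegree a + d i = N")
        case True
        have "(\<Sum>(u, l)\<leftarrow>ts i. l \<theta>\<^sub>0 * c' (a + u)) = (\<Sum>b\<in>?B. c' b * \<phi> i a \<theta>\<^sub>0 b)"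
          by (rule phi_sum[OF that True, symmetric])
        also have "\<dots> = (\<Sum>b\<in>?B. c b * \<phi> i a \<theta>\<^sub>0 b)" by (rule sum.cong) (auto simp: c'_def)
        also have "\<dots> = 0" using c that True unfolding V_def by blast
        finally show ?thesis .
      next
        case False
        then have "l \<theta>\<^sub>0 * c' (a + u) = 0" if "(u, l) \<in> set (ts i)" for u l
          using ts[OF \<open>i \<in> I\<close> that] by (simp add: c'_def mdegree_add)
        then have "map (\<lambda>(u, l). l \<theta>\<^sub>0 * c' (a + u)) (ts i) = map (\<lambda>_. 0) (ts i)"
          by (intro map_cong refl) auto
        then show ?thesis by (simp only: sum_list_0)
      qed
      then show ?thesis unfolding q_def eq by simp
    qed
    have le_rq: "lin_ext c' (r * q i) = 0" if "i \<in> I" for r i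
      by (induction r rule: poly_mapping_sum_induct) (simp_all add: le_q that distrib_right lin_ext_add)
    have le_I: "lin_ext c' p = 0" if "p \<in> ?I" for p
      using that by induction (auto simp: lin_ext_add le_rq)
    show "\<forall>b\<in>?B. c b = 0"
    proof (rule ballI)
      fix b :: "'v monomial" assume "b \<in> ?B"
      then have b: "mdegree b = N" by simp
      then show "c b = 0" using le_I[OF mono_in[OF b]] by (simp add: c'_def)
    qed
  qed
  then obtain \<Phi> where \<Phi>: "\<Phi> \<in> palg G" "\<Phi> \<theta>\<^sub>0 \<noteq> 0" and
    nondeg: "\<And>\<theta> c. \<Phi> \<theta> \<noteq> 0 \<Longrightarrow> \<forall>\<psi>\<in>V. (\<Sum>b\<in>?B. c b * \<psi> \<theta> b) = 0 \<Longrightarrow> \<forall>b\<in>?B. c b = 0"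
    by blast
  have "X = (\<lambda>_. 0)" if "\<Phi> \<theta> \<noteq> 0" and X: "\<forall>i\<in>I. Q i \<theta> X = 0" for \<theta> X
  proof -
    \<comment> \<open>At a common zero \<open>X\<close> the vector of the values of all monomials is
      orthogonal to all rows. So the monomials of degree \<open>N\<close> vanish at
      \<open>X\<close>, among them the pure powers.\<close>
    have "\<forall>b\<in>?B. mono_val b X = 0"
    proof (rule nondeg[OF that(1)], rule ballI)
      fix \<psi> assume "\<psi> \<in> V"
      then obtain i a where i: "\<psi> = \<phi> i a" "i \<in> I" "mdegree a + d i = N" unfolding V_def by blast
      have "(\<Sum>(u, k)\<leftarrow>xs. k \<theta> * mono_val (a + u) X) = mono_val a X * (\<Sum>(u, k)\<leftarrow>xs. k \<theta> * mono_val u X)"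
        for xs :: "('v monomial \<times> ('a \<Rightarrow> complex)) list"
        by (induction xs) (auto simp: mono_val_add algebra_simps)
      then show "(\<Sum>b\<in>?B. mono_val b X * \<psi> \<theta> b) = 0"
        unfolding i(1) phi_sum[OF i(2,3)] using ts_Q[OF i(2), of \<theta> X] X i(2) by simp
    qed
    moreover have "Poly_Mapping.single v N \<in> ?B" for v by simp
    ultimately have "mono_val (Poly_Mapping.single v N) X = 0" for v by blast
    then have "X v = 0" for v by (metis mono_val_single power_not_zero)
    then show ?thesis by (intro ext)
  qed
  then show ?thesis using \<Phi> by blast
qed

text \<open>The clause on \<open>d = 0\<close> compensates for truncated subtraction: in the product
  rule, a factor of degree 0 must have derivative zero for the sum to have degree
  \<open>d + e - 1\<close>.\<close>

lemma hp_deriv_aux: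
  assumes "hp G d Q"
  shows "\<exists>R. hp G (d - 1) R \<and> (d = 0 \<longrightarrow> R = (\<lambda>_ _. 0)) \<and>
    (\<forall>\<theta> X. ((\<lambda>t. Q \<theta> (X(v := t))) has_field_derivative R \<theta> X) (at (X v)))"
  using assms
proof induction
  case (coeff c)
  show ?case by (intro exI[of _ "\<lambda>_ _. 0"]) (auto intro: hp.zero)
next
  case (var w)
  show ?case
  proof (cases "v = w")
    case True
    then show ?thesis
      by (intro exI[of _ "\<lambda>_ _. 1"]) (auto intro: hp.coeff[OF palg.const] DERIV_ident)
  next
    case False
    then show ?thesis
      by (intro exI[of _ "\<lambda>_ _. 0"]) (auto intro: hp.zero)
  qed
next
  case (zero d)
  show ?case by (intro exI[of _ "\<lambda>_ _. 0"]) (auto intro: hp.zero)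
next
  case (add d P Q)
  then obtain R S where R: "hp G (d - 1) R" "d = 0 \<longrightarrow> R = (\<lambda>_ _. 0)"
      "\<And>\<theta> X. ((\<lambda>t. P \<theta> (X(v := t))) has_field_derivative R \<theta> X) (at (X v))"
    and S: "hp G (d - 1) S" "d = 0 \<longrightarrow> S = (\<lambda>_ _. 0)"
      "\<And>\<theta> X. ((\<lambda>t. Q \<theta> (X(v := t))) has_field_derivative S \<theta> X) (at (X v))" by blast
  show ?case
    by (intro exI[of _ "\<lambda>\<theta> X. R \<theta> X + S \<theta> X"] conjI allI impI hp.add R S DERIV_add)
      (use R S in auto)
next
  case (mult d P e Q)
  then obtain R S where R: "hp G (d - 1) R" "d = 0 \<longrightarrow> R = (\<lambda>_ _. 0)"
      "\<And>\<theta> X. ((\<lambda>t. P \<theta> (X(v := t))) has_field_derivative R \<theta> X) (at (X v))"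
    and S: "hp G (e - 1) S" "e = 0 \<longrightarrow> S = (\<lambda>_ _. 0)"
      "\<And>\<theta> X. ((\<lambda>t. Q \<theta> (X(v := t))) has_field_derivative S \<theta> X) (at (X v))" by blast
  have 1: "hp G (d + e - 1) (\<lambda>\<theta> X. R \<theta> X * Q \<theta> X)"
    using hp.mult[OF R(1) mult.hyps(2)] R(2) by (cases d) (auto intro: hp.zero)
  have 2: "hp G (d + e - 1) (\<lambda>\<theta> X. S \<theta> X * P \<theta> X)"
    using hp.mult[OF S(1) mult.hyps(1)] S(2) by (cases e) (auto intro: hp.zero simp: add.commute)
  show ?case
  proof (intro exI[of _ "\<lambda>\<theta> X. R \<theta> X * Q \<theta> X + S \<theta> X * P \<theta> X"] conjI allI impI hp.add 1 2)
    show "((\<lambda>t. P \<theta> (X(v := t)) * Q \<theta> (X(v := t))) has_field_derivative R \<theta> X * Q \<theta> X + S \<theta> X * P \<theta> X) (at (X v))" for \<theta> X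
      using DERIV_mult[OF R(3)[of \<theta> X] S(3)[of \<theta> X]] by simp
  qed (use R S in auto)
qed

lemma hp_deriv:
  assumes "hp G d Q"
  obtains R where "hp G (d - 1) R"
    "\<And>\<theta> X t. ((\<lambda>t. Q \<theta> (X(v := t))) has_field_derivative R \<theta> (X(v := t))) (at t)"
proof -
  obtain R where R: "hp G (d - 1) R"
    "\<And>\<theta> X. ((\<lambda>t. Q \<theta> (X(v := t))) has_field_derivative R \<theta> X) (at (X v))"
    using hp_deriv_aux[OF assms, of v] by blast
  have "((\<lambda>t. Q \<theta> (X(v := t))) has_field_derivative R \<theta> (X(v := t))) (at t)" for \<theta> X t
    using R(2)[of \<theta> "X(v := t)"] by simp
  then show thesis using that R(1) by blast
qed

text \<open>\<open>R\<close> is the divided difference of \<open>Q\<close> between the values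
  \<open>X v\<close> and \<open>X w\<close>, obtained for products from P Q - P' Q' = (P - P') Q +
  P' (Q - Q'). Its zeros are the pairs of distinct points with equal values of \<open>Q\<close> and,
  on the diagonal, the critical points; so distinct and infinitely near pairs obey one closed
  condition.\<close>

lemma hp_divided_difference_aux:
  assumes "hp G d Q"
  shows "\<exists>R. hp G (d - 1) R \<and> (d = 0 \<longrightarrow> R = (\<lambda>_ _. 0)) \<and>
    (\<forall>\<theta> X. Q \<theta> X - Q \<theta> (X(v := X w)) = (X v - X w) * R \<theta> X) \<and>
    (\<forall>\<theta> X. X v = X w \<longrightarrow> ((\<lambda>t. Q \<theta> (X(v := t))) has_field_derivative R \<theta> X) (at (X v)))"
  using assms
proof induction
  case (coeff c)
  show ?case by (intro exI[of _ "\<lambda>_ _. 0"]) (auto intro: hp.zero)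
next
  case (var u)
  show ?case
  proof (cases "v = u")
    case True
    then show ?thesis
      by (intro exI[of _ "\<lambda>_ _. 1"]) (auto intro: hp.coeff[OF palg.const] DERIV_ident)
  next
    case False
    then show ?thesis
      by (intro exI[of _ "\<lambda>_ _. 0"]) (auto intro: hp.zero)
  qed
next
  case (zero d)
  show ?case by (intro exI[of _ "\<lambda>_ _. 0"]) (auto intro: hp.zero)
next
  case (add d P Q)
  then obtain R S where R: "hp G (d - 1) R" "d = 0 \<longrightarrow> R = (\<lambda>_ _. 0)"
      "\<And>\<theta> X. P \<theta> X - P \<theta> (X(v := X w)) = (X v - X w) * R \<theta> X"
      "\<And>\<theta> X. X v = X w \<Longrightarrow> ((\<lambda>t. P \<theta> (X(v := t))) has_field_derivative R \<theta> X) (at (X v))"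
    and S: "hp G (d - 1) S" "d = 0 \<longrightarrow> S = (\<lambda>_ _. 0)"
      "\<And>\<theta> X. Q \<theta> X - Q \<theta> (X(v := X w)) = (X v - X w) * S \<theta> X"
      "\<And>\<theta> X. X v = X w \<Longrightarrow> ((\<lambda>t. Q \<theta> (X(v := t))) has_field_derivative S \<theta> X) (at (X v))" by blast
  show ?case
  proof (intro exI[of _ "\<lambda>\<theta> X. R \<theta> X + S \<theta> X"] conjI allI impI hp.add R(1) S(1) DERIV_add R(4) S(4))
    show "P \<theta> X + Q \<theta> X - (P \<theta> (X(v := X w)) + Q \<theta> (X(v := X w))) = (X v - X w) * (R \<theta> X + S \<theta> X)" for \<theta> X
      using R(3)[of \<theta> X] S(3)[of \<theta> X] by (simp add: algebra_simps)
  qed (use R(2) S(2) in auto)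
next
  case (mult d P e Q)
  then obtain R S where R: "hp G (d - 1) R" "d = 0 \<longrightarrow> R = (\<lambda>_ _. 0)"
      "\<And>\<theta> X. P \<theta> X - P \<theta> (X(v := X w)) = (X v - X w) * R \<theta> X"
      "\<And>\<theta> X. X v = X w \<Longrightarrow> ((\<lambda>t. P \<theta> (X(v := t))) has_field_derivative R \<theta> X) (at (X v))"
    and S: "hp G (e - 1) S" "e = 0 \<longrightarrow> S = (\<lambda>_ _. 0)"
      "\<And>\<theta> X. Q \<theta> X - Q \<theta> (X(v := X w)) = (X v - X w) * S \<theta> X"
      "\<And>\<theta> X. X v = X w \<Longrightarrow> ((\<lambda>t. Q \<theta> (X(v := t))) has_field_derivative S \<theta> X) (at (X v))" by blast
  have eq: "(\<lambda>\<theta> X. P \<theta> (\<lambda>u. X (if u = v then w else u))) = (\<lambda>\<theta> X. P \<theta> (X(v := X w)))"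
    by (intro ext arg_cong[of _ _ "P _"]) auto
  have P': "hp G d (\<lambda>\<theta> X. P \<theta> (X(v := X w)))"
    using hp_rename[OF mult.hyps(1), of "\<lambda>u. if u = v then w else u"] unfolding eq .
  have 1: "hp G (d + e - 1) (\<lambda>\<theta> X. R \<theta> X * Q \<theta> X)"
    using hp.mult[OF R(1) mult.hyps(2)] R(2) by (cases d) (auto intro: hp.zero)
  have 2: "hp G (d + e - 1) (\<lambda>\<theta> X. S \<theta> X * P \<theta> (X(v := X w)))"
    using hp.mult[OF S(1) P'] S(2) by (cases e) (auto intro: hp.zero simp: add.commute)
  show ?case
  proof (intro exI[of _ "\<lambda>\<theta> X. R \<theta> X * Q \<theta> X + S \<theta> X * P \<theta> (X(v := X w))"] conjI allI impI hp.add 1 2)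
    show "P \<theta> X * Q \<theta> X - P \<theta> (X(v := X w)) * Q \<theta> (X(v := X w))
        = (X v - X w) * (R \<theta> X * Q \<theta> X + S \<theta> X * P \<theta> (X(v := X w)))" for \<theta> X
    proof -
      have "P \<theta> X * Q \<theta> X - P \<theta> (X(v := X w)) * Q \<theta> (X(v := X w))
        = (P \<theta> X - P \<theta> (X(v := X w))) * Q \<theta> X + P \<theta> (X(v := X w)) * (Q \<theta> X - Q \<theta> (X(v := X w)))"
        by (simp add: algebra_simps)
      then show ?thesis unfolding R(3) S(3) by (simp add: algebra_simps)
    qed
    show "((\<lambda>t. P \<theta> (X(v := t)) * Q \<theta> (X(v := t))) has_field_derivative
        R \<theta> X * Q \<theta> X + S \<theta> X * P \<theta> (X(v := X w))) (at (X v))" if "X v = X w" for \<theta> X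
    proof -
      have "X(v := X w) = X" using that by (metis fun_upd_triv)
      then show ?thesis using DERIV_mult[OF R(4)[of X \<theta>] S(4)[of X \<theta>]] that by simp
    qed
  qed (use R(2) S(2) in auto)
qed

lemma hp_divided_difference:
  assumes "hp G d Q"
  obtains R where "hp G (d - 1) R"
    "\<And>\<theta> X. Q \<theta> X - Q \<theta> (X(v := X w)) = (X v - X w) * R \<theta> X"
    "\<And>\<theta> X. X v = X w \<Longrightarrow> ((\<lambda>t. Q \<theta> (X(v := t))) has_field_derivative R \<theta> X) (at (X v))"
  using hp_divided_difference_aux[OF assms, of v w] by blast

lemma hp_homogeneous: "hp G d Q \<Longrightarrow> Q \<theta> (\<lambda>v. c * X v) = c ^ d * Q \<theta> X"
  by (induction rule: hp.induct) (auto simp: algebra_simps power_add)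

lemma hp_palg: "hp G d Q \<Longrightarrow> (\<lambda>\<theta>. Q \<theta> X) \<in> palg G"
proof (induction rule: hp.induct)
  case (coeff c) then show ?case .
next
  case (var v) show ?case by (rule palg.const)
next
  case (zero d) show ?case by (rule palg.const)
next
  case (add d P Q) show ?case using add.IH by (rule palg.add)
next
  case (mult d P e Q) show ?case using mult.IH by (rule palg.mult)
qed

lemma coeff_mult_top:
  fixes p q :: "'a::comm_semiring_0 poly"
  assumes "Polynomial.degree p \<le> d" "Polynomial.degree q \<le> e"
  shows "poly.coeff (p * q) (d + e) = poly.coeff p d * poly.coeff q e"
proof -
  have "poly.coeff p i * poly.coeff q (d + e - i) = 0" if "i \<noteq> d" for i
  proof (cases "i < d")
    case True
    then have "poly.coeff q (d + e - i) = 0" using assms(2) by (intro coeff_eq_0) simp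
    then show ?thesis by simp
  next
    case False
    then have "poly.coeff p i = 0" using assms(1) that by (intro coeff_eq_0) simp
    then show ?thesis by simp
  qed
  then have "(\<Sum>i\<le>d + e. poly.coeff p i * poly.coeff q (d + e - i))
      = (\<Sum>i\<le>d + e. if i = d then poly.coeff p d * poly.coeff q e else 0)"
    by (intro sum.cong) auto
  then show ?thesis by (simp add: coeff_mult)
qed

text \<open>The coefficient in degree \<open>d\<close> is the value at the coordinate point of
  \<open>v\<close>. If it is nonzero, the degree along every line in this direction is exactly
  \<open>d\<close>.\<close>

lemma hp_restrict_poly:
  assumes "hp G d Q"
  shows "\<exists>p. Polynomial.degree p \<le> d \<and> poly.coeff p d = Q \<theta> ((\<lambda>_. 0)(v := 1)) \<and>
    (\<forall>t. poly p t = Q \<theta> (X(v := t)))"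
  using assms
proof induction
  case (coeff c)
  show ?case by (intro exI[of _ "[:c \<theta>:]"]) simp
next
  case (var w)
  show ?case
    by (intro exI[of _ "if v = w then [:0, 1:] else [:X w:]"]) auto
next
  case (zero d)
  show ?case by (intro exI[of _ 0]) simp
next
  case (add d P Q)
  then obtain p q where "Polynomial.degree p \<le> d \<and> poly.coeff p d = P \<theta> ((\<lambda>_. 0)(v := 1)) \<and>
    (\<forall>t. poly p t = P \<theta> (X(v := t)))" "Polynomial.degree q \<le> d \<and> poly.coeff q d = Q \<theta> ((\<lambda>_. 0)(v := 1)) \<and>
    (\<forall>t. poly q t = Q \<theta> (X(v := t)))" by blast
  then show ?case
    by (intro exI[of _ "p + q"] conjI allI degree_add_le) (simp_all del: fun_upd_apply)
next
  case (mult d P e Q)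
  then obtain p q where "Polynomial.degree p \<le> d \<and> poly.coeff p d = P \<theta> ((\<lambda>_. 0)(v := 1)) \<and>
    (\<forall>t. poly p t = P \<theta> (X(v := t)))" "Polynomial.degree q \<le> e \<and> poly.coeff q e = Q \<theta> ((\<lambda>_. 0)(v := 1)) \<and>
    (\<forall>t. poly q t = Q \<theta> (X(v := t)))" by blast
  then show ?case
    using degree_mult_le[of p q]
    by (intro exI[of _ "p * q"] conjI allI) (simp_all add: coeff_mult_top del: fun_upd_apply)
qed

lemma generic_no_common_zero_set:
  assumes "\<And>d Q. (d, Q) \<in> S \<Longrightarrow> hp G d (Q :: 'a \<Rightarrow> ('v::finite \<Rightarrow> complex) \<Rightarrow> complex)"
    and "\<And>X. (\<forall>(d, Q)\<in>S. Q \<theta>\<^sub>0 X = 0) \<Longrightarrow> X = (\<lambda>_. 0)"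
  shows "\<exists>\<Phi>\<in>palg G. \<Phi> \<theta>\<^sub>0 \<noteq> 0 \<and>
    (\<forall>\<theta>. \<Phi> \<theta> \<noteq> 0 \<longrightarrow> (\<forall>X. (\<forall>(d, Q)\<in>S. Q \<theta> X = 0) \<longrightarrow> X = (\<lambda>_. 0)))"
  using generic_no_common_zero[of S G fst snd \<theta>\<^sub>0] assms by (simp add: case_prod_unfold)

subsection \<open>Counting roots\<close>

text \<open>At most one root is multiple, and its multiplicity is then two. Dividing by the square
  of its linear factor leaves a squarefree polynomial that does not vanish there, and a squarefree
  polynomial has as many roots as its degree.\<close>

lemma many_simple_roots:
  fixes p :: "complex poly"
  assumes p: "p \<noteq> 0"
    and one: "\<And>a b. poly p a = 0 \<Longrightarrow> poly (pderiv p) a = 0 \<Longrightarrow> poly p b = 0 \<Longrightarrow> poly (pderiv p) b = 0 \<Longrightarrow> a = b"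
    and no3: "\<And>a. poly p a = 0 \<Longrightarrow> poly (pderiv p) a = 0 \<Longrightarrow> poly (pderiv (pderiv p)) a \<noteq> 0"
  shows "card {a. poly p a = 0} \<ge> Polynomial.degree p - 1"
    and "(\<forall>a. poly p a = 0 \<longrightarrow> poly (pderiv p) a \<noteq> 0) \<Longrightarrow> card {a. poly p a = 0} = Polynomial.degree p"
proof -
  have sqf: "card {a. poly q a = 0} = Polynomial.degree q"
    if "q \<noteq> 0" "\<And>a. poly q a = 0 \<Longrightarrow> poly (pderiv q) a \<noteq> 0" for q :: "complex poly"
  proof -
    have "rsquarefree q" using that by (auto simp: rsquarefree_roots)
    then have "Polynomial.degree (Polynomial.smult (lead_coeff q) (\<Prod>z|poly q z = 0. [:- z, 1:])) = Polynomial.degree q"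
      by (subst complex_poly_decompose_rsquarefree) simp_all
    then show ?thesis using \<open>q \<noteq> 0\<close> by (simp add: degree_prod_sum_eq)
  qed
  show "card {a. poly p a = 0} = Polynomial.degree p" if "\<forall>a. poly p a = 0 \<longrightarrow> poly (pderiv p) a \<noteq> 0"
    using sqf[OF p] that by blast
  show "card {a. poly p a = 0} \<ge> Polynomial.degree p - 1"
  proof (cases "\<forall>a. poly p a = 0 \<longrightarrow> poly (pderiv p) a \<noteq> 0")
    case True
    then show ?thesis using sqf[OF p] by simp
  next
    case False
    then obtain a where a: "poly p a = 0" "poly (pderiv p) a = 0" by blast
    obtain r where r: "p = [:- a, 1:] * r" using a(1) by (auto simp: poly_eq_0_iff_dvd elim: dvdE)
    have pd: "pderiv ([:- a, 1:] * h) = h + [:- a, 1:] * pderiv h" for h :: "complex poly"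
      unfolding pderiv_mult by (simp add: pderiv_pCons)
    have "poly r a = 0" using a(2) unfolding r pd by simp
    then obtain q where q: "r = [:- a, 1:] * q" by (auto simp: poly_eq_0_iff_dvd elim: dvdE)
    have pq: "p = [:- a, 1:] * ([:- a, 1:] * q)" using r q by simp
    have q0: "q \<noteq> 0" using p pq by auto
    have qa: "poly q a \<noteq> 0"
      using no3[OF a] unfolding pq pd pderiv_add by simp
    have "poly (pderiv q) b \<noteq> 0" if b: "poly q b = 0" for b
    proof
      assume "poly (pderiv q) b = 0"
      then have "poly p b = 0" "poly (pderiv p) b = 0"
        unfolding pq pd using b by simp_all
      then have "a = b" using one[OF a] by blast
      then show False using qa b by simp
    qed
    then have "card {b. poly q b = 0} = Polynomial.degree q" using sqf[OF q0] by blast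
    moreover have "{b. poly p b = 0} = insert a {b. poly q b = 0}" unfolding pq by auto
    moreover have "finite {b. poly q b = 0}" using q0 by (rule poly_roots_finite)
    moreover have dl: "Polynomial.degree ([:- a, 1:] * h) = Suc (Polynomial.degree h)" "[:- a, 1:] * h \<noteq> 0"
      if "h \<noteq> 0" for h :: "complex poly"
      using that degree_mult_eq[of "[:- a, 1:]" h] by (auto simp del: mult_pCons_left)
    moreover have "Polynomial.degree p = Suc (Suc (Polynomial.degree q))"
      unfolding pq dl(1)[OF dl(2)[OF q0]] dl(1)[OF q0] ..
    ultimately show ?thesis using qa by simp
  qed
qed

section \<open>Genericity conditions on the two cones\<close>

text \<open>Coordinates adapted to a pair of cones with vertices \<open>v\<^sub>1\<close>, \<open>v\<^sub>2\<close>: the point with coordinates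
  \<open>VX, VY, VS, VM\<close> is \<open>x e\<^sub>1 + y e\<^sub>2 + s v\<^sub>2 + \<mu> v\<^sub>1\<close>. The variable \<open>VN\<close> holds a second value of \<open>\<mu>\<close>.\<close>

datatype cvar = VX | VY | VS | VM | VN

lemma UNIV_cvar: "UNIV = {VX, VY, VS, VM, VN}"
  using cvar.exhaust by blast

instance cvar :: finite
  by standard (simp add: UNIV_cvar)

type_synonym cone_pair = "((complex ^ 4) \<times> 4 mpoly) \<times> ((complex ^ 4) \<times> 4 mpoly)"

definition vert1 :: "cone_pair \<times> 4 mpoly \<Rightarrow> complex ^ 4" where "vert1 \<theta> = fst (fst (fst \<theta>))"
definition eqn1 :: "cone_pair \<times> 4 mpoly \<Rightarrow> 4 mpoly" where "eqn1 \<theta> = snd (fst (fst \<theta>))"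
definition vert2 :: "cone_pair \<times> 4 mpoly \<Rightarrow> complex ^ 4" where "vert2 \<theta> = fst (snd (fst \<theta>))"
definition eqn2 :: "cone_pair \<times> 4 mpoly \<Rightarrow> 4 mpoly" where "eqn2 \<theta> = snd (snd (fst \<theta>))"
definition defm :: "cone_pair \<times> 4 mpoly \<Rightarrow> 4 mpoly" where "defm \<theta> = snd \<theta>"

definition param_gens :: "(cone_pair \<times> 4 mpoly \<Rightarrow> complex) set" where
  "param_gens = Set.range (\<lambda>i \<theta>. vert1 \<theta> $ i) \<union> Set.range (\<lambda>i \<theta>. vert2 \<theta> $ i) \<union>
     Set.range (\<lambda>u \<theta>. Poly_Mapping.lookup (eqn1 \<theta>) u) \<union> Set.range (\<lambda>u \<theta>. Poly_Mapping.lookup (eqn2 \<theta>) u) \<union>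
     Set.range (\<lambda>u \<theta>. Poly_Mapping.lookup (defm \<theta>) u)"

definition pnt :: "cone_pair \<times> 4 mpoly \<Rightarrow> (cvar \<Rightarrow> complex) \<Rightarrow> 4 \<Rightarrow> complex" where
  "pnt \<theta> X i = (if i = 1 then X VX else 0) + (if i = 2 then X VY else 0)
     + vert2 \<theta> $ i * X VS + vert1 \<theta> $ i * X VM"

lemma param_gens_palg:
  "(\<lambda>\<theta>. vert1 \<theta> $ i) \<in> palg param_gens" "(\<lambda>\<theta>. vert2 \<theta> $ i) \<in> palg param_gens"
  "(\<lambda>\<theta>. Poly_Mapping.lookup (eqn1 \<theta>) u) \<in> palg param_gens"
  "(\<lambda>\<theta>. Poly_Mapping.lookup (eqn2 \<theta>) u) \<in> palg param_gens"
  "(\<lambda>\<theta>. Poly_Mapping.lookup (defm \<theta>) u) \<in> palg param_gens"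
  by (rule palg.gen, simp add: param_gens_def)+

lemma hp_pnt: "hp param_gens 1 (\<lambda>\<theta> X. pnt \<theta> X i)"
proof -
  have "hp param_gens 1 (\<lambda>\<theta> X. (if i = 1 then 1 else 0) * X VX)"
    "hp param_gens 1 (\<lambda>\<theta> X. (if i = 2 then 1 else 0) * X VY)"
    by (rule hp_scale[OF palg.const hp.var])+
  from hp.add[OF hp.add[OF hp.add[OF this]], OF hp_scale[OF param_gens_palg(2) hp.var] hp_scale[OF param_gens_palg(1) hp.var]]
  show ?thesis unfolding pnt_def by (simp add: if_distrib[of "\<lambda>y. y * _"] cong: if_cong)
qed

text \<open>The sum runs over all monomials of degree \<open>d\<close> instead of the keys of
  \<open>g \<theta>\<close>, which vary with the parameter; so the dependence on the coefficients is
  visibly polynomial.\<close>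

definition form_at :: "(cone_pair \<times> 4 mpoly \<Rightarrow> 4 mpoly) \<Rightarrow> nat \<Rightarrow> cone_pair \<times> 4 mpoly \<Rightarrow> (cvar \<Rightarrow> complex) \<Rightarrow> complex" where
  "form_at g d \<theta> X = (\<Sum>u\<in>{u. mdegree u = d}. Poly_Mapping.lookup (g \<theta>) u * mono_val u (pnt \<theta> X))"

lemma hp_form_at:
  assumes "\<And>u. (\<lambda>\<theta>. Poly_Mapping.lookup (g \<theta>) u) \<in> palg param_gens"
  shows "hp param_gens d (form_at g d)"
proof -
  have "hp param_gens d (\<lambda>\<theta> X. mono_val u (pnt \<theta> X))" if "mdegree u = d" for u
  proof -
    have "hp param_gens (\<Sum>i\<in>UNIV. Poly_Mapping.lookup u i * 1) (\<lambda>\<theta> X. \<Prod>i\<in>UNIV. pnt \<theta> X i ^ Poly_Mapping.lookup u i)"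
      by (intro hp_prod hp_power hp_pnt) simp
    moreover have "(\<Sum>i\<in>UNIV. Poly_Mapping.lookup u i * 1) = d" using that mdegree_superset[of UNIV u] by simp
    ultimately show ?thesis by (simp add: mono_val_UNIV)
  qed
  then have "hp param_gens d (\<lambda>\<theta> X. \<Sum>u\<in>{u. mdegree u = d}. Poly_Mapping.lookup (g \<theta>) u * mono_val u (pnt \<theta> X))"
    by (intro hp_sum hp_scale assms) simp
  then show ?thesis unfolding form_at_def .
qed

lemma form_at_eq_meval:
  assumes "homogeneous d (g \<theta>)"
  shows "form_at g d \<theta> X = meval (g \<theta>) (pnt \<theta> X)"
  unfolding form_at_def meval_eq_lin_ext using assms
  by (intro lin_ext_superset[symmetric] finite_monomials_of_degree) (auto simp: homogeneous_def)

text \<open>The condition that the first cone is smooth away from its vertex, and that each of its generators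
  meets the second cone in at least three points off the surface \<open>f = 0\<close>.\<close>

definition good_side :: "cone_pair \<times> 4 mpoly \<Rightarrow> bool" where
  "good_side \<theta> \<longleftrightarrow>
    (let A = (\<lambda>X. meval (eqn1 \<theta>) (pnt \<theta> X)); B = (\<lambda>X. meval (eqn2 \<theta>) (pnt \<theta> X)); F = (\<lambda>X. meval (defm \<theta>) (pnt \<theta> X)) in
     (\<forall>X. X VM = 0 \<and> X VN = 0 \<and> (\<forall>v\<in>{VX, VY, VS}. ((\<lambda>t. A (X(v := t))) has_field_derivative 0) (at (X v))) \<longrightarrow> X = (\<lambda>_. 0)) \<and>
     A ((\<lambda>_. 0)(VS := 1)) \<noteq> 0 \<and> B ((\<lambda>_. 0)(VM := 1)) \<noteq> 0 \<and>
     (\<forall>X. (X VX \<noteq> 0 \<or> X VY \<noteq> 0 \<or> X VS \<noteq> 0) \<and> A X = 0 \<longrightarrow>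
        card {\<mu>. B (X(VM := \<mu>)) = 0 \<and> F (X(VM := \<mu>)) \<noteq> 0} \<ge> 3))"

definition homog_param :: "nat \<Rightarrow> nat \<Rightarrow> cone_pair \<times> 4 mpoly \<Rightarrow> bool" where
  "homog_param m n \<theta> \<longleftrightarrow> homogeneous m (eqn1 \<theta>) \<and> homogeneous n (eqn2 \<theta>) \<and> homogeneous (m + n) (defm \<theta>)"

text \<open>The algebraic form of being a cone, derived from the geometric definition in
  \<open>cone_space_invariant\<close>.\<close>

definition cone_param :: "cone_pair \<times> 4 mpoly \<Rightarrow> bool" where
  "cone_param \<theta> \<longleftrightarrow> (\<forall>z c. meval (eqn1 \<theta>) (\<lambda>i. z i + c * vert1 \<theta> $ i) = meval (eqn1 \<theta>) z) \<and>
     (\<forall>z c. meval (eqn2 \<theta>) (\<lambda>i. z i + c * vert2 \<theta> $ i) = meval (eqn2 \<theta>) z)"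

definition axis_param :: "nat \<Rightarrow> nat \<Rightarrow> 4 \<Rightarrow> 4 \<Rightarrow> cone_pair \<times> 4 mpoly \<Rightarrow> bool" where
  "axis_param m n i k \<theta> \<longleftrightarrow> homog_param m n \<theta> \<and> vert1 \<theta> = axis i 1 \<and> vert2 \<theta> = axis k 1 \<and>
     (\<forall>u\<in>Poly_Mapping.keys (eqn1 \<theta>). Poly_Mapping.lookup u i = 0) \<and>
     (\<forall>u\<in>Poly_Mapping.keys (eqn2 \<theta>). Poly_Mapping.lookup u k = 0)"

definition mkparam :: "4 \<Rightarrow> 4 \<Rightarrow> 4 mpoly \<Rightarrow> 4 mpoly \<Rightarrow> 4 mpoly \<Rightarrow> cone_pair \<times> 4 mpoly" where
  "mkparam i k a b f = (((axis i 1, a), (axis k 1, b)), f)"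

lemma mkparam_simps [simp]:
  "vert1 (mkparam i k a b f) = axis i 1" "vert2 (mkparam i k a b f) = axis k 1"
  "eqn1 (mkparam i k a b f) = a" "eqn2 (mkparam i k a b f) = b" "defm (mkparam i k a b f) = f"
  by (simp_all add: mkparam_def vert1_def vert2_def eqn1_def eqn2_def defm_def)

definition term4 :: "4 \<Rightarrow> nat \<Rightarrow> 4 \<Rightarrow> nat \<Rightarrow> complex \<Rightarrow> 4 mpoly" where
  "term4 i a j b c = Poly_Mapping.single (Poly_Mapping.single i a + Poly_Mapping.single j b) c"

lemma meval_term4: "meval (term4 i a j b c) z = c * z i ^ a * z j ^ b"
  by (simp add: term4_def meval_single mono_val_add)

lemma keys_term4: "Poly_Mapping.keys (term4 i a j b c) \<subseteq> {Poly_Mapping.single i a + Poly_Mapping.single j b}"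
  by (simp add: term4_def)

lemma homogeneous_term4: "a + b = d \<Longrightarrow> homogeneous d (term4 i a j b c)"
  using keys_term4[of i a j b c] by (auto simp: homogeneous_def mdegree_add dest!: subsetD)

lemma homogeneous_add: "homogeneous d p \<Longrightarrow> homogeneous d q \<Longrightarrow> homogeneous d (p + q)"
  using keys_add[of p q] unfolding homogeneous_def by blast

definition avoids :: "4 \<Rightarrow> 4 mpoly \<Rightarrow> bool" where
  "avoids i g \<longleftrightarrow> (\<forall>u\<in>Poly_Mapping.keys g. Poly_Mapping.lookup u i = 0)"

lemma avoids_add: "avoids l p \<Longrightarrow> avoids l q \<Longrightarrow> avoids l (p + q)"
  using keys_add[of p q] unfolding avoids_def by blast

lemma avoids_term4: "l \<noteq> i \<Longrightarrow> l \<noteq> j \<Longrightarrow> avoids l (term4 i a j b c)"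
  using keys_term4[of i a j b c] by (auto simp: avoids_def lookup_add lookup_single when_def dest!: subsetD)

lemma axis_param_mkparam:
  assumes "homogeneous m a" "homogeneous n b" "homogeneous (m + n) f" "avoids i a" "avoids k b"
  shows "axis_param m n i k (mkparam i k a b f)"
  using assms by (simp add: axis_param_def homog_param_def avoids_def)

lemma pnt_mkparam:
  assumes "i \<noteq> k" "i \<noteq> 1" "i \<noteq> 2" "k \<noteq> 1" "k \<noteq> 2"
  shows "pnt (mkparam i k a b f) X 1 = X VX" "pnt (mkparam i k a b f) X 2 = X VY"
    "pnt (mkparam i k a b f) X k = X VS" "pnt (mkparam i k a b f) X i = X VM"
  using assms by (auto simp: pnt_def axis_def)

lemma hp_copy: "hp G d Q \<Longrightarrow> hp G d (\<lambda>\<theta> X. Q \<theta> (X(v := X w)))"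
proof -
  assume "hp G d Q"
  from hp_rename[OF this, of "\<lambda>u. if u = v then w else u"]
  have "hp G d (\<lambda>\<theta> X. Q \<theta> (\<lambda>u. X (if u = v then w else u)))" .
  moreover have "(\<lambda>\<theta> X. Q \<theta> (\<lambda>u. X (if u = v then w else u))) = (\<lambda>\<theta> X. Q \<theta> (X(v := X w)))"
    by (intro ext arg_cong[of _ _ "Q _"]) auto
  ultimately show ?thesis by simp
qed

lemma cvar_fun_zeroI:
  "X VX = 0 \<Longrightarrow> X VY = 0 \<Longrightarrow> X VS = 0 \<Longrightarrow> X VM = 0 \<Longrightarrow> X VN = 0 \<Longrightarrow> X = (\<lambda>_. 0)"
  by (rule ext) (metis cvar.exhaust)

section \<open>Explicit pairs of cones for the single genericity conditions\<close>

locale axis_pair =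
  fixes m n :: nat and i k :: 4
  assumes m4: "m \<ge> 4" and n4: "n \<ge> 4"
    and ik: "i \<noteq> k" "i \<noteq> 1" "i \<noteq> 2" "k \<noteq> 1" "k \<noteq> 2"
begin

abbreviation "A \<equiv> form_at eqn1 m"
abbreviation "B \<equiv> form_at eqn2 n"
abbreviation "F \<equiv> form_at defm (m + n)"

lemma hpA: "hp param_gens m A" and hpB: "hp param_gens n B" and hpF: "hp param_gens (m + n) F"
  by (rule hp_form_at, rule param_gens_palg)+

text \<open>A polynomial condition that is not identically zero on the axis parameters. Different
  conditions may have different witnesses, and \<open>common_nonzero\<close> finds a common
  one.\<close>

definition example :: "(cone_pair \<times> 4 mpoly \<Rightarrow> complex) \<Rightarrow> bool" where
  "example \<Phi> \<longleftrightarrow> \<Phi> \<in> palg param_gens \<and> (\<exists>\<theta>. axis_param m n i k \<theta> \<and> \<Phi> \<theta> \<noteq> 0)"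

lemma example_forms:
  assumes "axis_param m n i k (mkparam i k a b f)"
  shows "A (mkparam i k a b f) X = meval a (pnt (mkparam i k a b f) X)"
    "B (mkparam i k a b f) X = meval b (pnt (mkparam i k a b f) X)"
    "F (mkparam i k a b f) X = meval f (pnt (mkparam i k a b f) X)"
  using assms by (simp_all add: axis_param_def homog_param_def form_at_eq_meval)

lemmas pnt4 = pnt_mkparam[OF ik]

text \<open>Neither cone passes through the vertex of the other. Pure powers of the coordinates
  \<open>k\<close> and \<open>i\<close> are witnesses.\<close>

lemma example_nonzero: "\<exists>\<Phi>. example \<Phi> \<and> (\<forall>\<theta>. \<Phi> \<theta> = A \<theta> ((\<lambda>_. 0)(VS := 1)) * B \<theta> ((\<lambda>_. 0)(VM := 1)))"
proof -
  define \<theta>\<^sub>0 where "\<theta>\<^sub>0 = mkparam i k (term4 k m 1 0 1) (term4 i n 1 0 1) 0"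
  have ax: "axis_param m n i k \<theta>\<^sub>0"
    unfolding \<theta>\<^sub>0_def using ik
    by (intro axis_param_mkparam homogeneous_term4 avoids_term4) (auto simp: homogeneous_def)
  have "A \<theta>\<^sub>0 ((\<lambda>_. 0)(VS := 1)) \<noteq> 0" "B \<theta>\<^sub>0 ((\<lambda>_. 0)(VM := 1)) \<noteq> 0"
    unfolding \<theta>\<^sub>0_def example_forms[OF ax[unfolded \<theta>\<^sub>0_def]] meval_term4 pnt4 by simp_all
  moreover have "(\<lambda>\<theta>. A \<theta> ((\<lambda>_. 0)(VS := 1)) * B \<theta> ((\<lambda>_. 0)(VM := 1))) \<in> palg param_gens"
    by (intro palg.mult hp_palg[OF hpA] hp_palg[OF hpB])
  ultimately have "example (\<lambda>\<theta>. A \<theta> ((\<lambda>_. 0)(VS := 1)) * B \<theta> ((\<lambda>_. 0)(VM := 1)))"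
    using ax unfolding example_def by (intro conjI exI[of _ \<theta>\<^sub>0]) simp_all
  then show ?thesis by (intro exI conjI allI) (assumption, rule refl)
qed

lemma example_no_common_zero:
  assumes "axis_param m n i k \<theta>\<^sub>0"
    and "\<And>d Q. (d, Q) \<in> S \<Longrightarrow> hp param_gens d Q"
    and "\<And>X :: cvar \<Rightarrow> complex. (\<forall>(d, Q)\<in>S. Q \<theta>\<^sub>0 X = 0) \<Longrightarrow> X = (\<lambda>_. 0)"
  shows "\<exists>\<Phi>. example \<Phi> \<and> (\<forall>\<theta>. \<Phi> \<theta> \<noteq> 0 \<longrightarrow> (\<forall>X. (\<forall>(d, Q)\<in>S. Q \<theta> X = 0) \<longrightarrow> X = (\<lambda>_. 0)))"
  using generic_no_common_zero_set[of S param_gens \<theta>\<^sub>0] assms unfolding example_def by blast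

text \<open>The Fermat cone is a witness, as its partial derivatives are multiples of powers of
  single coordinates. Elimination takes place in all five variables; therefore \<open>VM\<close> and
  \<open>VN\<close> are set to zero by linear forms that belong to the family.\<close>

lemma example_smooth:
  "\<exists>\<Phi>. example \<Phi> \<and> (\<forall>\<theta>. \<Phi> \<theta> \<noteq> 0 \<longrightarrow> (\<forall>X. X VM = 0 \<and> X VN = 0 \<and>
     (\<forall>v\<in>{VX, VY, VS}. ((\<lambda>t. A \<theta> (X(v := t))) has_field_derivative 0) (at (X v))) \<longrightarrow> X = (\<lambda>_. 0)))"
proof -
  have "\<forall>v. \<exists>R. hp param_gens (m - 1) R \<and>
      (\<forall>\<theta> X t. ((\<lambda>t. A \<theta> (X(v := t))) has_field_derivative R \<theta> (X(v := t))) (at t))"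
    using hp_deriv[OF hpA] by metis
  then obtain R where R: "\<And>v. hp param_gens (m - 1) (R v)"
    "\<And>v \<theta> X t. ((\<lambda>t. A \<theta> (X(v := t))) has_field_derivative R v \<theta> (X(v := t))) (at t)" by metis
  have R': "((\<lambda>t. A \<theta> (X(v := t))) has_field_derivative R v \<theta> X) (at (X v))" for v \<theta> X
    using R(2)[of \<theta> X v "X v"] by simp
  define S where "S = {(m - 1, R VX), (m - 1, R VY), (m - 1, R VS),
    (1, \<lambda>\<theta> X. X VM), (1, \<lambda>\<theta> X. X VN)}"
  define \<theta>\<^sub>0 where "\<theta>\<^sub>0 = mkparam i k (term4 1 m 2 0 1 + term4 2 m 1 0 1 + term4 k m 1 0 1) 0 0"
  have ax: "axis_param m n i k \<theta>\<^sub>0"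
    unfolding \<theta>\<^sub>0_def using ik
    by (intro axis_param_mkparam homogeneous_add homogeneous_term4 avoids_add avoids_term4)
      (auto simp: homogeneous_def avoids_def)
  have A0: "A \<theta>\<^sub>0 X = X VX ^ m + X VY ^ m + X VS ^ m" for X
    unfolding \<theta>\<^sub>0_def example_forms[OF ax[unfolded \<theta>\<^sub>0_def]] meval_add meval_term4 pnt4 by simp
  have "\<exists>\<Phi>. example \<Phi> \<and> (\<forall>\<theta>. \<Phi> \<theta> \<noteq> 0 \<longrightarrow> (\<forall>X. (\<forall>(d, Q)\<in>S. Q \<theta> X = 0) \<longrightarrow> X = (\<lambda>_. 0)))"
  proof (rule example_no_common_zero[OF ax])
    show "hp param_gens d Q" if "(d, Q) \<in> S" for d Q
      using that R(1) hp.var unfolding S_def by auto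
    fix X assume "\<forall>(d, Q)\<in>S. Q \<theta>\<^sub>0 X = 0"
    then have z: "R VX \<theta>\<^sub>0 X = 0" "R VY \<theta>\<^sub>0 X = 0" "R VS \<theta>\<^sub>0 X = 0" "X VM = 0" "X VN = 0"
      unfolding S_def by auto
    have d: "((\<lambda>t. A \<theta>\<^sub>0 (X(v := t))) has_field_derivative of_nat m * X v ^ (m - 1)) (at (X v))"
      if "v \<in> {VX, VY, VS}" for v
      unfolding A0 using that by (auto intro!: derivative_eq_intros)
    have "X v = 0" if "v \<in> {VX, VY, VS}" "R v \<theta>\<^sub>0 X = 0" for v
    proof -
      have "of_nat m * X v ^ (m - 1) = 0" using DERIV_unique[OF d[OF that(1)] R'] that(2) by simp
      then show ?thesis using m4 by simp
    qed
    then show "X = (\<lambda>_. 0)" using z by (intro cvar_fun_zeroI) auto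
  qed
  then obtain \<Phi> where \<Phi>: "example \<Phi>" "\<And>\<theta> X. \<Phi> \<theta> \<noteq> 0 \<Longrightarrow> \<forall>(d, Q)\<in>S. Q \<theta> X = 0 \<Longrightarrow> X = (\<lambda>_. 0)" by blast
  have "X = (\<lambda>_. 0)" if "\<Phi> \<theta> \<noteq> 0" "X VM = 0" "X VN = 0"
    "\<forall>v\<in>{VX, VY, VS}. ((\<lambda>t. A \<theta> (X(v := t))) has_field_derivative 0) (at (X v))" for \<theta> X
  proof (rule \<Phi>(2)[OF that(1)])
    have "R v \<theta> X = 0" if "v \<in> {VX, VY, VS}" for v
      using DERIV_unique[OF R'] that that(1) \<open>\<forall>v\<in>{VX, VY, VS}. _\<close> by blast
    then show "\<forall>(d, Q)\<in>S. Q \<theta> X = 0" using that(2,3) unfolding S_def by auto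
  qed
  then show ?thesis using \<Phi>(1) by blast
qed

text \<open>No line through the first vertex is tangent to the second cone at two points or has
  contact of order three with it. Projected from the second vertex, such lines pass through one
  point, and a general point lies on no bitangent or inflectional tangent of the base curve. Given
  \<open>dB = 0\<close>, the equation \<open>D = 0\<close> says that the second point is critical
  too or, if both coincide, that the second derivative vanishes.\<close>

lemma example_tangency:
  assumes dB: "hp param_gens (n - 1) dB"
      "\<And>\<theta> X t. ((\<lambda>t. B \<theta> (X(VM := t))) has_field_derivative dB \<theta> (X(VM := t))) (at t)"
    and D: "hp param_gens (n - 1 - 1) D"
      "\<And>\<theta> X. dB \<theta> X - dB \<theta> (X(VM := X VN)) = (X VM - X VN) * D \<theta> X"
      "\<And>\<theta> X. X VM = X VN \<Longrightarrow> ((\<lambda>t. dB \<theta> (X(VM := t))) has_field_derivative D \<theta> X) (at (X VM))"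
  shows "\<exists>\<Phi>. example \<Phi> \<and> (\<forall>\<theta>. \<Phi> \<theta> \<noteq> 0 \<longrightarrow> (\<forall>X. X VS = 0 \<and> B \<theta> X = 0 \<and> dB \<theta> X = 0 \<and>
     B \<theta> (X(VM := X VN)) = 0 \<and> D \<theta> X = 0 \<longrightarrow> X = (\<lambda>_. 0)))"
proof -
  define S where "S = {(n, B), (n - 1, dB), (n, \<lambda>\<theta> X. B \<theta> (X(VM := X VN))), (n - 1 - 1, D), (1, \<lambda>\<theta> X. X VS)}"
  \<comment> \<open>Here B is \<open>\<mu>^n - n x^(n-1) \<mu> + (n-1) y^n\<close>. A critical point
    satisfies \<open>\<mu>^(n-1) = x^(n-1)\<close>, and a critical zero also
    \<open>\<mu>^n = y^n\<close>. Two of them, \<mu> and \<nu>, give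
    \<open>(\<mu> - \<nu>) x^(n-1) = 0\<close>.\<close>
  define \<theta>\<^sub>0 where "\<theta>\<^sub>0 = mkparam i k 0
    (term4 i n 1 0 1 + term4 1 (n - 1) i 1 (- of_nat n) + term4 2 n 1 0 (of_nat n - 1)) 0"
  have ax: "axis_param m n i k \<theta>\<^sub>0"
    unfolding \<theta>\<^sub>0_def using ik n4
    by (intro axis_param_mkparam homogeneous_add homogeneous_term4 avoids_add avoids_term4)
      (auto simp: homogeneous_def avoids_def)
  have B0: "B \<theta>\<^sub>0 X = X VM ^ n - of_nat n * X VX ^ (n - 1) * X VM + (of_nat n - 1) * X VY ^ n" for X
    unfolding \<theta>\<^sub>0_def example_forms[OF ax[unfolded \<theta>\<^sub>0_def]] meval_add meval_term4 pnt4 by simp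
  have dB0: "dB \<theta>\<^sub>0 X = of_nat n * (X VM ^ (n - 1) - X VX ^ (n - 1))" for X
  proof -
    have "((\<lambda>t. B \<theta>\<^sub>0 (X(VM := t))) has_field_derivative of_nat n * (X VM ^ (n - 1) - X VX ^ (n - 1))) (at (X VM))"
      unfolding B0 by (auto intro!: derivative_eq_intros simp: algebra_simps)
    from DERIV_unique[OF dB(2)[of \<theta>\<^sub>0 X "X VM"] this] show ?thesis by simp
  qed
  have D0: "D \<theta>\<^sub>0 X = of_nat n * (of_nat (n - 1) * X VM ^ (n - 1 - 1))" if "X VM = X VN" for X
  proof -
    have "((\<lambda>t. dB \<theta>\<^sub>0 (X(VM := t))) has_field_derivative of_nat n * (of_nat (n - 1) * X VM ^ (n - 1 - 1))) (at (X VM))"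
      unfolding dB0 using n4 by (auto intro!: derivative_eq_intros)
    from DERIV_unique[OF D(3)[OF that, of \<theta>\<^sub>0] this] show ?thesis by simp
  qed
  have "\<exists>\<Phi>. example \<Phi> \<and> (\<forall>\<theta>. \<Phi> \<theta> \<noteq> 0 \<longrightarrow> (\<forall>X. (\<forall>(d, Q)\<in>S. Q \<theta> X = 0) \<longrightarrow> X = (\<lambda>_. 0)))"
  proof (rule example_no_common_zero[OF ax])
    show "hp param_gens d Q" if "(d, Q) \<in> S" for d Q
      using that hpB hp_copy[OF hpB, of VM VN] dB(1) D(1) hp.var[of param_gens VS] unfolding S_def by blast
    fix X assume "\<forall>(d, Q)\<in>S. Q \<theta>\<^sub>0 X = 0"
    then have z: "B \<theta>\<^sub>0 X = 0" "dB \<theta>\<^sub>0 X = 0" "B \<theta>\<^sub>0 (X(VM := X VN)) = 0" "D \<theta>\<^sub>0 X = 0" "X VS = 0"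
      unfolding S_def by auto
    have n: "of_nat n \<noteq> (0::complex)" "of_nat n - 1 \<noteq> (0::complex)" "of_nat (n - 1) \<noteq> (0::complex)"
      using n4 by (auto simp: of_nat_eq_1_iff)
    have pw: "t ^ n = t * t ^ (n - 1)" for t :: complex using n4 by (cases n) auto
    have dbl: "t ^ n = X VY ^ n" if "t ^ (n - 1) = X VX ^ (n - 1)"
      "t ^ n - of_nat n * X VX ^ (n - 1) * t + (of_nat n - 1) * X VY ^ n = 0" for t
    proof -
      have "(of_nat n - 1) * (X VY ^ n - t ^ n) = 0"
        using that(2) unfolding that(1)[symmetric] by (simp add: pw[of t] algebra_simps)
      then show ?thesis using n by simp
    qed
    have M: "X VM ^ (n - 1) = X VX ^ (n - 1)" using z(2) n unfolding dB0 by simp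
    have MY: "X VM ^ n = X VY ^ n" using dbl[OF M] z(1) unfolding B0 by simp
    have "X VM = 0 \<and> X VN = 0"
    proof (cases "X VM = X VN")
      case True
      then have "X VM ^ (n - 1 - 1) = 0" using z(4) n unfolding D0[OF True] by simp
      then show ?thesis using True by simp
    next
      case False
      have "dB \<theta>\<^sub>0 (X(VM := X VN)) = 0" using D(2)[of \<theta>\<^sub>0 X] z(2,4) by simp
      then have N: "X VN ^ (n - 1) = X VX ^ (n - 1)" using n unfolding dB0 by simp
      have NY: "X VN ^ n = X VY ^ n" using dbl[OF N] z(3) unfolding B0 by simp
      have "(X VM - X VN) * X VX ^ (n - 1) = 0"
        using MY NY M N unfolding pw[of "X VM"] pw[of "X VN"] by (simp add: algebra_simps)
      then have "X VX ^ (n - 1) = 0" using False by simp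
      then show ?thesis using M N by (metis power_not_zero)
    qed
    then show "X = (\<lambda>_. 0)" using z(5) M MY n4 by (intro cvar_fun_zeroI) (auto simp: zero_power)
  qed
  then obtain \<Phi> where \<Phi>: "example \<Phi>" "\<And>\<theta> X. \<Phi> \<theta> \<noteq> 0 \<Longrightarrow> \<forall>(d, Q)\<in>S. Q \<theta> X = 0 \<Longrightarrow> X = (\<lambda>_. 0)" by blast
  then show ?thesis unfolding S_def by (intro exI[of _ \<Phi>]) auto
qed

text \<open>No generator meets the second cone in two points on \<open>f = 0\<close>;
  \<open>RB\<close> and \<open>RF\<close> stand for divided differences, so the second point may be
  infinitely near. In the example \<open>B\<close> is a power of \<mu>, which forces both points to
  \<mu> = 0, and there the derivative of \<open>F\<close> along \<mu> is a power of y.\<close>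

lemma example_secant:
  assumes RB: "hp param_gens (n - 1) RB"
      "\<And>\<theta> X. B \<theta> X - B \<theta> (X(VM := X VN)) = (X VM - X VN) * RB \<theta> X"
    and RF: "hp param_gens (m + n - 1) RF"
      "\<And>\<theta> X. X VM = X VN \<Longrightarrow> ((\<lambda>t. F \<theta> (X(VM := t))) has_field_derivative RF \<theta> X) (at (X VM))"
  shows "\<exists>\<Phi>. example \<Phi> \<and> (\<forall>\<theta>. \<Phi> \<theta> \<noteq> 0 \<longrightarrow> (\<forall>X. A \<theta> X = 0 \<and> B \<theta> X = 0 \<and> RB \<theta> X = 0 \<and>
     F \<theta> X = 0 \<and> RF \<theta> X = 0 \<longrightarrow> X = (\<lambda>_. 0)))"
proof -
  define S where "S = {(m, A), (n, B), (n - 1, RB), (m + n, F), (m + n - 1, RF)}"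
  define \<theta>\<^sub>0 where "\<theta>\<^sub>0 = mkparam i k (term4 k m 1 0 1 + term4 1 m 2 0 1) (term4 i n 1 0 1)
    (term4 k (m + n) 1 0 1 + term4 2 (m + n - 1) i 1 1)"
  have ax: "axis_param m n i k \<theta>\<^sub>0"
    unfolding \<theta>\<^sub>0_def using ik n4
    by (intro axis_param_mkparam homogeneous_add homogeneous_term4 avoids_add avoids_term4) auto
  have A0: "A \<theta>\<^sub>0 X = X VS ^ m + X VX ^ m" and B0: "B \<theta>\<^sub>0 X = X VM ^ n"
    and F0: "F \<theta>\<^sub>0 X = X VS ^ (m + n) + X VY ^ (m + n - 1) * X VM" for X
    unfolding \<theta>\<^sub>0_def example_forms[OF ax[unfolded \<theta>\<^sub>0_def]] meval_add meval_term4 pnt4 by simp_all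
  have "\<exists>\<Phi>. example \<Phi> \<and> (\<forall>\<theta>. \<Phi> \<theta> \<noteq> 0 \<longrightarrow> (\<forall>X. (\<forall>(d, Q)\<in>S. Q \<theta> X = 0) \<longrightarrow> X = (\<lambda>_. 0)))"
  proof (rule example_no_common_zero[OF ax])
    show "hp param_gens d Q" if "(d, Q) \<in> S" for d Q
      using that hpA hpB hpF RB(1) RF(1) unfolding S_def by blast
    fix X assume "\<forall>(d, Q)\<in>S. Q \<theta>\<^sub>0 X = 0"
    then have z: "A \<theta>\<^sub>0 X = 0" "B \<theta>\<^sub>0 X = 0" "RB \<theta>\<^sub>0 X = 0" "F \<theta>\<^sub>0 X = 0" "RF \<theta>\<^sub>0 X = 0"
      unfolding S_def by auto
    have M: "X VM = 0" using z(2) unfolding B0 by simp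
    have N: "X VN = 0" using RB(2)[of \<theta>\<^sub>0 X] z(2,3) unfolding B0 by simp
    have "((\<lambda>t. F \<theta>\<^sub>0 (X(VM := t))) has_field_derivative X VY ^ (m + n - 1)) (at (X VM))"
      unfolding F0 by (auto intro!: derivative_eq_intros)
    from DERIV_unique[OF RF(2)[of X \<theta>\<^sub>0] this] have "X VY ^ (m + n - 1) = 0" using z(5) M N by simp
    then have Y: "X VY = 0" by simp
    have S: "X VS = 0" using z(4) M unfolding F0 by simp
    have "X VX = 0" using z(1) S m4 unfolding A0 by (simp add: zero_power)
    then show "X = (\<lambda>_. 0)" using M N Y S by (intro cvar_fun_zeroI)
  qed
  then obtain \<Phi> where \<Phi>: "example \<Phi>" "\<And>\<theta> X. \<Phi> \<theta> \<noteq> 0 \<Longrightarrow> \<forall>(d, Q)\<in>S. Q \<theta> X = 0 \<Longrightarrow> X = (\<lambda>_. 0)" by blast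
  then show ?thesis unfolding S_def by (intro exI[of _ \<Phi>]) auto
qed

text \<open>A generator tangent to the second cone does not meet it on \<open>f = 0\<close>.
  \<open>VM\<close> is the point of tangency and \<open>VN\<close> the point on
  \<open>f = 0\<close>, possibly the same. In the example the equations force \<mu>, x, \<nu>, s, y
  to zero in this order.\<close>

lemma example_tangent_off:
  assumes dB: "hp param_gens (n - 1) dB"
      "\<And>\<theta> X t. ((\<lambda>t. B \<theta> (X(VM := t))) has_field_derivative dB \<theta> (X(VM := t))) (at t)"
  shows "\<exists>\<Phi>. example \<Phi> \<and> (\<forall>\<theta>. \<Phi> \<theta> \<noteq> 0 \<longrightarrow> (\<forall>X. A \<theta> X = 0 \<and> B \<theta> X = 0 \<and> dB \<theta> X = 0 \<and>
     B \<theta> (X(VM := X VN)) = 0 \<and> F \<theta> (X(VM := X VN)) = 0 \<longrightarrow> X = (\<lambda>_. 0)))"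
proof -
  define S where "S = {(m, A), (n, B), (n - 1, dB), (n, \<lambda>\<theta> X. B \<theta> (X(VM := X VN))), (m + n, \<lambda>\<theta> X. F \<theta> (X(VM := X VN)))}"
  define \<theta>\<^sub>0 where "\<theta>\<^sub>0 = mkparam i k (term4 k m 1 0 1 + term4 2 m 1 0 1) (term4 i n 1 0 1 + term4 1 n 2 0 1)
    (term4 k (m + n) 1 0 1)"
  have ax: "axis_param m n i k \<theta>\<^sub>0"
    unfolding \<theta>\<^sub>0_def using ik n4
    by (intro axis_param_mkparam homogeneous_add homogeneous_term4 avoids_add avoids_term4) auto
  have A0: "A \<theta>\<^sub>0 X = X VS ^ m + X VY ^ m" and B0: "B \<theta>\<^sub>0 X = X VM ^ n + X VX ^ n"
    and F0: "F \<theta>\<^sub>0 X = X VS ^ (m + n)" for X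
    unfolding \<theta>\<^sub>0_def example_forms[OF ax[unfolded \<theta>\<^sub>0_def]] meval_add meval_term4 pnt4 by simp_all
  have "\<exists>\<Phi>. example \<Phi> \<and> (\<forall>\<theta>. \<Phi> \<theta> \<noteq> 0 \<longrightarrow> (\<forall>X. (\<forall>(d, Q)\<in>S. Q \<theta> X = 0) \<longrightarrow> X = (\<lambda>_. 0)))"
  proof (rule example_no_common_zero[OF ax])
    show "hp param_gens d Q" if "(d, Q) \<in> S" for d Q
      using that hpA hpB hp_copy[OF hpB, of VM VN] hp_copy[OF hpF, of VM VN] dB(1) unfolding S_def by blast
    fix X assume "\<forall>(d, Q)\<in>S. Q \<theta>\<^sub>0 X = 0"
    then have z: "A \<theta>\<^sub>0 X = 0" "B \<theta>\<^sub>0 X = 0" "dB \<theta>\<^sub>0 X = 0" "B \<theta>\<^sub>0 (X(VM := X VN)) = 0" "F \<theta>\<^sub>0 (X(VM := X VN)) = 0"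
      unfolding S_def by auto
    have "((\<lambda>t. B \<theta>\<^sub>0 (X(VM := t))) has_field_derivative of_nat n * X VM ^ (n - 1)) (at (X VM))"
      unfolding B0 by (auto intro!: derivative_eq_intros)
    from DERIV_unique[OF dB(2)[of \<theta>\<^sub>0 X "X VM"] this] have "of_nat n * X VM ^ (n - 1) = 0" using z(3) by simp
    then have M: "X VM = 0" using n4 by simp
    then have x: "X VX = 0" using z(2) n4 unfolding B0 by (simp add: zero_power)
    have N: "X VN = 0" using z(4) x n4 unfolding B0 by (simp add: zero_power)
    have S: "X VS = 0" using z(5) unfolding F0 by simp
    have "X VY = 0" using z(1) S m4 unfolding A0 by (simp add: zero_power)
    then show "X = (\<lambda>_. 0)" using M N x S by (intro cvar_fun_zeroI)
  qed
  then obtain \<Phi> where \<Phi>: "example \<Phi>" "\<And>\<theta> X. \<Phi> \<theta> \<noteq> 0 \<Longrightarrow> \<forall>(d, Q)\<in>S. Q \<theta> X = 0 \<Longrightarrow> X = (\<lambda>_. 0)" by blast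
  then show ?thesis unfolding S_def by (intro exI[of _ \<Phi>]) auto
qed

end

lemma pnt_VN [simp]: "pnt \<theta> (X(VN := t)) = pnt \<theta> X"
  by (rule ext) (simp add: pnt_def)

lemma form_at_VN: "form_at g d \<theta> (X(VN := t)) = form_at g d \<theta> X"
  by (simp add: form_at_def)

context axis_pair
begin

lemma form_indep:
  assumes "homog_param m n \<theta>" "cone_param \<theta>"
  shows "A \<theta> (X(VM := t)) = A \<theta> X" "B \<theta> (X(VS := t)) = B \<theta> X"
proof -
  have 1: "pnt \<theta> (X(VM := t)) = (\<lambda>i. pnt \<theta> X i + (t - X VM) * vert1 \<theta> $ i)"
    and 2: "pnt \<theta> (X(VS := t)) = (\<lambda>i. pnt \<theta> X i + (t - X VS) * vert2 \<theta> $ i)"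
    by (auto simp: pnt_def algebra_simps)
  show "A \<theta> (X(VM := t)) = A \<theta> X" "B \<theta> (X(VS := t)) = B \<theta> X"
    using assms unfolding homog_param_def cone_param_def
    by (simp_all add: form_at_eq_meval 1 2)
qed

text \<open>Along a generator the second cone is given by a polynomial in \<mu>, of degree exactly n
  as the cone misses the first vertex. Either all n roots are simple and at most one lies on
  \<open>f = 0\<close>, or a single root is double and none lies on \<open>f = 0\<close>. In both
  cases at least n - 1 roots remain.\<close>

lemma good_side_generic:
  "\<exists>S. finite S \<and> (\<forall>\<Phi>\<in>S. example \<Phi>) \<and>
     (\<forall>\<theta>. homog_param m n \<theta> \<and> cone_param \<theta> \<and> (\<forall>\<Phi>\<in>S. \<Phi> \<theta> \<noteq> 0) \<longrightarrow> good_side \<theta>)"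
proof -
  obtain dB where dB: "hp param_gens (n - 1) dB"
      "\<And>\<theta> X t. ((\<lambda>t. B \<theta> (X(VM := t))) has_field_derivative dB \<theta> (X(VM := t))) (at t)"
    using hp_deriv[OF hpB] by metis
  obtain D where D: "hp param_gens (n - 1 - 1) D"
      "\<And>\<theta> X. dB \<theta> X - dB \<theta> (X(VM := X VN)) = (X VM - X VN) * D \<theta> X"
      "\<And>\<theta> X. X VM = X VN \<Longrightarrow> ((\<lambda>t. dB \<theta> (X(VM := t))) has_field_derivative D \<theta> X) (at (X VM))"
    using hp_divided_difference[OF dB(1), of VM VN] by metis
  obtain RB where RB: "hp param_gens (n - 1) RB"
      "\<And>\<theta> X. B \<theta> X - B \<theta> (X(VM := X VN)) = (X VM - X VN) * RB \<theta> X"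
    using hp_divided_difference[OF hpB, of VM VN] by metis
  obtain RF where RF: "hp param_gens (m + n - 1) RF"
      "\<And>\<theta> X. F \<theta> X - F \<theta> (X(VM := X VN)) = (X VM - X VN) * RF \<theta> X"
      "\<And>\<theta> X. X VM = X VN \<Longrightarrow> ((\<lambda>t. F \<theta> (X(VM := t))) has_field_derivative RF \<theta> X) (at (X VM))"
    using hp_divided_difference[OF hpF, of VM VN] by metis
  obtain \<Phi>0 where \<Phi>0: "example \<Phi>0" "\<And>\<theta>. \<Phi>0 \<theta> = A \<theta> ((\<lambda>_. 0)(VS := 1)) * B \<theta> ((\<lambda>_. 0)(VM := 1))"
    using example_nonzero by blast
  obtain \<Phi>1 where \<Phi>1: "example \<Phi>1" "\<And>\<theta> X. \<Phi>1 \<theta> \<noteq> 0 \<Longrightarrow> X VM = 0 \<Longrightarrow> X VN = 0 \<Longrightarrow>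
     \<forall>v\<in>{VX, VY, VS}. ((\<lambda>t. A \<theta> (X(v := t))) has_field_derivative 0) (at (X v)) \<Longrightarrow> X = (\<lambda>_. 0)"
    using example_smooth by blast
  obtain \<Phi>2 where \<Phi>2: "example \<Phi>2" "\<And>\<theta> X. \<Phi>2 \<theta> \<noteq> 0 \<Longrightarrow> X VS = 0 \<Longrightarrow> B \<theta> X = 0 \<Longrightarrow> dB \<theta> X = 0 \<Longrightarrow>
     B \<theta> (X(VM := X VN)) = 0 \<Longrightarrow> D \<theta> X = 0 \<Longrightarrow> X = (\<lambda>_. 0)"
    using example_tangency[OF dB D] by blast
  obtain \<Phi>3 where \<Phi>3: "example \<Phi>3" "\<And>\<theta> X. \<Phi>3 \<theta> \<noteq> 0 \<Longrightarrow> A \<theta> X = 0 \<Longrightarrow> B \<theta> X = 0 \<Longrightarrow> RB \<theta> X = 0 \<Longrightarrow>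
     F \<theta> X = 0 \<Longrightarrow> RF \<theta> X = 0 \<Longrightarrow> X = (\<lambda>_. 0)"
    using example_secant[OF RB RF(1,3)] by blast
  obtain \<Phi>4 where \<Phi>4: "example \<Phi>4" "\<And>\<theta> X. \<Phi>4 \<theta> \<noteq> 0 \<Longrightarrow> A \<theta> X = 0 \<Longrightarrow> B \<theta> X = 0 \<Longrightarrow> dB \<theta> X = 0 \<Longrightarrow>
     B \<theta> (X(VM := X VN)) = 0 \<Longrightarrow> F \<theta> (X(VM := X VN)) = 0 \<Longrightarrow> X = (\<lambda>_. 0)"
    using example_tangent_off[OF dB] by blast
  have "good_side \<theta>" if h: "homog_param m n \<theta>" and c: "cone_param \<theta>"
    and nz: "\<Phi>0 \<theta> \<noteq> 0" "\<Phi>1 \<theta> \<noteq> 0" "\<Phi>2 \<theta> \<noteq> 0" "\<Phi>3 \<theta> \<noteq> 0" "\<Phi>4 \<theta> \<noteq> 0" for \<theta>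
  proof -
    have ev: "meval (eqn1 \<theta>) (pnt \<theta> X) = A \<theta> X" "meval (eqn2 \<theta>) (pnt \<theta> X) = B \<theta> X"
      "meval (defm \<theta>) (pnt \<theta> X) = F \<theta> X" for X
      using h unfolding homog_param_def by (simp_all add: form_at_eq_meval)
    have A1: "A \<theta> ((\<lambda>_. 0)(VS := 1)) \<noteq> 0" and B1: "B \<theta> ((\<lambda>_. 0)(VM := 1)) \<noteq> 0"
      using nz(1) \<Phi>0(2) by auto
    have "card {\<mu>. B \<theta> (X(VM := \<mu>)) = 0 \<and> F \<theta> (X(VM := \<mu>)) \<noteq> 0} \<ge> 3"
      if X: "X VX \<noteq> 0 \<or> X VY \<noteq> 0 \<or> X VS \<noteq> 0" and AX: "A \<theta> X = 0" for X
    proof -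
      obtain p where p: "Polynomial.degree p \<le> n" "poly.coeff p n \<noteq> 0"
        "\<And>t. poly p t = B \<theta> (X(VM := t))"
        using hp_restrict_poly[OF hpB, of \<theta> VM X] B1 by auto
      have deg: "Polynomial.degree p = n" using p(1,2) le_degree by (metis le_antisym)
      have p0: "p \<noteq> 0" using p(2) by auto
      have derB: "dB \<theta> (X'(VM := t)) = poly (pderiv p) t" if "\<And>t. poly p t = B \<theta> (X'(VM := t))" for X' t
        by (rule DERIV_unique[OF dB(2)[of \<theta> X' t]]) (use poly_DERIV[of p t] in \<open>simp add: that\<close>)
      have pVN: "poly p t = B \<theta> (X(VN := r, VM := t))" for r t
      proof -
        have "B \<theta> (X(VN := r, VM := t)) = B \<theta> (X(VM := t, VN := r))" by (simp add: fun_upd_twist)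
        then show ?thesis by (simp add: form_at_VN p(3))
      qed
      \<comment> \<open>By invariance along the second vertex \<open>B\<close> does not depend on
        \<open>VS\<close>, which may thus be set to 0 as \<open>\<Phi>2\<close> requires.\<close>
      have pVS: "poly p t = B \<theta> (X(VS := 0, VN := r, VM := t))" for r t
      proof -
        have "B \<theta> (X(VS := 0, VN := r, VM := t)) = B \<theta> (X(VN := r, VM := t, VS := 0))" by (simp add: fun_upd_twist)
        then show ?thesis using pVN by (simp add: form_indep(2)[OF h c])
      qed
      have one: "a = b" if "poly p a = 0" "poly (pderiv p) a = 0" "poly p b = 0" "poly (pderiv p) b = 0" for a b
      proof (rule ccontr)
        assume "a \<noteq> b"
        define Y where "Y = X(VS := 0, VN := b, VM := a)"
        have Y: "Y(VM := Y VN) = X(VS := 0, VN := b, VM := b)" "Y VS = 0" "Y VM = a" "Y VN = b"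
          by (auto simp: Y_def)
        have "dB \<theta> Y = 0" "dB \<theta> (Y(VM := Y VN)) = 0"
          unfolding Y(1) unfolding Y_def derB[OF pVS] by (fact that)+
        then have "(a - b) * D \<theta> Y = 0" using D(2)[of \<theta> Y] Y by simp
        then have "D \<theta> Y = 0" using \<open>a \<noteq> b\<close> by simp
        moreover have "B \<theta> Y = 0" "B \<theta> (Y(VM := Y VN)) = 0"
          unfolding Y(1) unfolding Y_def pVS[symmetric] by (fact that)+
        ultimately have "Y = (\<lambda>_. 0)" using \<Phi>2(2)[OF nz(3)] Y(2) \<open>dB \<theta> Y = 0\<close> by blast
        then show False using Y(3,4) \<open>a \<noteq> b\<close> by simp
      qed
      have no3: "poly (pderiv (pderiv p)) a \<noteq> 0" if "poly p a = 0" "poly (pderiv p) a = 0" for a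
      proof
        assume pp: "poly (pderiv (pderiv p)) a = 0"
        define Y where "Y = X(VS := 0, VN := a, VM := a)"
        have Y: "Y(VM := Y VN) = Y" "Y VS = 0" "Y VM = Y VN"
          by (auto simp: Y_def)
        have "((\<lambda>t. dB \<theta> (Y(VM := t))) has_field_derivative D \<theta> Y) (at (Y VM))" by (rule D(3)[OF Y(3)])
        moreover have "((\<lambda>t. dB \<theta> (Y(VM := t))) has_field_derivative 0) (at (Y VM))"
          using poly_DERIV[of "pderiv p" a] pp by (simp add: Y_def derB[OF pVS])
        ultimately have "D \<theta> Y = 0" by (rule DERIV_unique)
        moreover have "B \<theta> Y = 0" "dB \<theta> Y = 0"
          unfolding Y_def pVS[symmetric] derB[OF pVS] by (fact that)+
        ultimately have "Y = (\<lambda>_. 0)" using \<Phi>2(2)[OF nz(3)] Y by metis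
        then have "Y VX = 0" "Y VY = 0" by simp_all
        then have xy: "X VX = 0" "X VY = 0" by (simp_all add: Y_def)
        \<comment> \<open>Since \<open>VS\<close> was reset, only x = y = 0 is known. The point is
          then a multiple of the second vertex, through which the first cone does not pass.\<close>
        have "X(VM := 0, VN := 0) = (\<lambda>v. X VS * ((\<lambda>_. 0)(VS := 1)) v)"
          using xy by (auto simp: fun_eq_iff) (metis cvar.exhaust)
        then have "A \<theta> (X(VM := 0, VN := 0)) = X VS ^ m * A \<theta> ((\<lambda>_. 0)(VS := 1))"
          using hp_homogeneous[OF hpA, of \<theta> "X VS" "(\<lambda>_. 0)(VS := 1)"] by simp
        moreover have "A \<theta> (X(VM := 0, VN := 0)) = 0"
          using AX by (simp add: form_at_VN form_indep(1)[OF h c])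
        ultimately have "X VS = 0" using A1 by simp
        then show False using X xy by simp
      qed
      let ?R = "{a. poly p a = 0}" and ?T = "{\<mu>. B \<theta> (X(VM := \<mu>)) = 0 \<and> F \<theta> (X(VM := \<mu>)) \<noteq> 0}"
      have fin: "finite ?R" using p0 by (rule poly_roots_finite)
      have T: "?T = {a \<in> ?R. F \<theta> (X(VM := a)) \<noteq> 0}" by (auto simp: p(3))
      have AY: "A \<theta> (X(VN := b, VM := a)) = 0" for a b
        using AX by (simp add: form_at_VN form_indep(1)[OF h c])
      have Ynz: "X(VN := b, VM := a) \<noteq> (\<lambda>_. 0)" for a b
      proof
        assume "X(VN := b, VM := a) = (\<lambda>_. 0)"
        from fun_cong[OF this, of VX] fun_cong[OF this, of VY] fun_cong[OF this, of VS] show False using X by simp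
      qed
      have FY: "F \<theta> (X(VN := b, VM := a)) = F \<theta> (X(VM := a))" for a b
      proof -
        have "X(VN := b, VM := a) = X(VM := a, VN := b)" by (simp add: fun_upd_twist)
        then show ?thesis by (simp add: form_at_VN)
      qed
      have upd: "(X(VN := b, VM := a))(VM := (X(VN := b, VM := a)) VN) = X(VN := b, VM := b)"
        "(X(VN := b, VM := a)) VM = a" "(X(VN := b, VM := a)) VN = b" for a b by auto
      show ?thesis
      proof (cases "\<forall>a. poly p a = 0 \<longrightarrow> poly (pderiv p) a \<noteq> 0")
        case True
        have "card ?R = Polynomial.degree p"
          by (rule many_simple_roots(2)[OF p0]) (fact one, fact no3, fact True)
        then have cR: "card ?R = n" unfolding deg .
        have "a = b" if ab: "a \<in> ?R" "b \<in> ?R" "F \<theta> (X(VM := a)) = 0" "F \<theta> (X(VM := b)) = 0" for a b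
        proof (rule ccontr)
          assume "a \<noteq> b"
          let ?Y = "X(VN := b, VM := a)"
          have "(a - b) * RB \<theta> ?Y = 0"
            using RB(2)[of \<theta> ?Y] ab(1,2) pVN[where r = b and t = a] pVN[where r = b and t = b]
            unfolding upd by simp
          moreover have "(a - b) * RF \<theta> ?Y = 0"
            using RF(2)[of \<theta> ?Y] ab(3,4) FY[of b a] FY[of b b] unfolding upd by simp
          moreover have "B \<theta> ?Y = 0" "F \<theta> ?Y = 0"
            using ab pVN[where r = b and t = a] FY[of b a] by simp_all
          ultimately have "?Y = (\<lambda>_. 0)" using \<open>a \<noteq> b\<close> by (intro \<Phi>3(2)[OF nz(4) AY]) auto
          then show False using Ynz by blast
        qed
        then have "card {a \<in> ?R. F \<theta> (X(VM := a)) = 0} \<le> 1"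
          using fin by (intro card_le_Suc0_iff_eq[THEN iffD2, simplified One_nat_def[symmetric]]) auto
        moreover have "card ?R = card ?T + card {a \<in> ?R. F \<theta> (X(VM := a)) = 0}"
          unfolding T using fin by (subst card_Un_disjoint[symmetric]) (auto intro!: arg_cong[of _ _ card])
        ultimately show ?thesis using cR n4 by linarith
      next
        case False
        then obtain a where a: "poly p a = 0" "poly (pderiv p) a = 0" by blast
        have "F \<theta> (X(VM := b)) \<noteq> 0" if b: "poly p b = 0" for b
        proof
          assume Fb: "F \<theta> (X(VM := b)) = 0"
          let ?Y = "X(VN := b, VM := a)"
          have Y: "?Y(VM := ?Y VN) = X(VN := b, VM := b)" by simp
          have "B \<theta> ?Y = 0" "dB \<theta> ?Y = 0" "B \<theta> (?Y(VM := ?Y VN)) = 0" "F \<theta> (?Y(VM := ?Y VN)) = 0"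
            unfolding Y using a b Fb pVN[where r = b and t = a] pVN[where r = b and t = b] FY[of b b]
              derB[OF pVN[where r = b], of a] by simp_all
          then have "?Y = (\<lambda>_. 0)" by (rule \<Phi>4(2)[OF nz(5) AY])
          then show False using Ynz by blast
        qed
        then have "?T = ?R" unfolding T by auto
        moreover have "card ?R \<ge> Polynomial.degree p - 1"
          by (rule many_simple_roots(1)[OF p0]) (fact one, fact no3)
        ultimately show ?thesis using n4 unfolding deg by simp
      qed
    qed
    then show ?thesis
      unfolding good_side_def Let_def ev using A1 B1 \<Phi>1(2)[OF nz(2)] by blast
  qed
  then show ?thesis
    using \<Phi>0(1) \<Phi>1(1) \<Phi>2(1) \<Phi>3(1) \<Phi>4(1)
    by (intro exI[of _ "{\<Phi>0, \<Phi>1, \<Phi>2, \<Phi>3, \<Phi>4}"]) auto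
qed

end

subsection \<open>A common good parameter\<close>

definition swap_param :: "cone_pair \<times> 4 mpoly \<Rightarrow> cone_pair \<times> 4 mpoly" where
  "swap_param \<theta> = ((snd (fst \<theta>), fst (fst \<theta>)), snd \<theta>)"

lemma swap_param_simps [simp]:
  "vert1 (swap_param \<theta>) = vert2 \<theta>" "vert2 (swap_param \<theta>) = vert1 \<theta>"
  "eqn1 (swap_param \<theta>) = eqn2 \<theta>" "eqn2 (swap_param \<theta>) = eqn1 \<theta>" "defm (swap_param \<theta>) = defm \<theta>"
  "swap_param (swap_param \<theta>) = \<theta>"
  by (simp_all add: swap_param_def vert1_def vert2_def eqn1_def eqn2_def defm_def)

lemma swap_param_iff:
  "homog_param n m (swap_param \<theta>) \<longleftrightarrow> homog_param m n \<theta>" "cone_param (swap_param \<theta>) \<longleftrightarrow> cone_param \<theta>"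
  "axis_param n m k i (swap_param \<theta>) \<longleftrightarrow> axis_param m n i k \<theta>"
  by (auto simp: homog_param_def cone_param_def axis_param_def add.commute)

lemma palg_swap: "\<Phi> \<in> palg param_gens \<Longrightarrow> (\<lambda>\<theta>. \<Phi> (swap_param \<theta>)) \<in> palg param_gens"
proof (erule palg_compose)
  fix g assume "g \<in> param_gens"
  then show "(\<lambda>\<theta>. g (swap_param \<theta>)) \<in> palg param_gens"
    unfolding param_gens_def by (auto intro!: param_gens_palg[unfolded param_gens_def])
qed

lemma lookup_mconst_mult [simp]: "Poly_Mapping.lookup (mconst a * p) u = a * Poly_Mapping.lookup p u"
  unfolding mconst_def
  by (subst mult_map_scale_conv_mult[symmetric]) (simp add: Poly_Mapping.map.rep_eq when_def)

definition mix_param :: "cone_pair \<times> 4 mpoly \<Rightarrow> cone_pair \<times> 4 mpoly \<Rightarrow> complex \<Rightarrow> cone_pair \<times> 4 mpoly" where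
  "mix_param \<theta> \<eta> t = (((vert1 \<theta>, mconst (1 - t) * eqn1 \<theta> + mconst t * eqn1 \<eta>),
      (vert2 \<theta>, mconst (1 - t) * eqn2 \<theta> + mconst t * eqn2 \<eta>)), mconst (1 - t) * defm \<theta> + mconst t * defm \<eta>)"

lemma mix_param_simps [simp]:
  "vert1 (mix_param \<theta> \<eta> t) = vert1 \<theta>" "vert2 (mix_param \<theta> \<eta> t) = vert2 \<theta>"
  "eqn1 (mix_param \<theta> \<eta> t) = mconst (1 - t) * eqn1 \<theta> + mconst t * eqn1 \<eta>"
  "eqn2 (mix_param \<theta> \<eta> t) = mconst (1 - t) * eqn2 \<theta> + mconst t * eqn2 \<eta>"
  "defm (mix_param \<theta> \<eta> t) = mconst (1 - t) * defm \<theta> + mconst t * defm \<eta>"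
  by (simp_all add: mix_param_def vert1_def vert2_def eqn1_def eqn2_def defm_def)

lemma param_eqI:
  "vert1 \<theta> = vert1 \<eta> \<Longrightarrow> vert2 \<theta> = vert2 \<eta> \<Longrightarrow> eqn1 \<theta> = eqn1 \<eta> \<Longrightarrow> eqn2 \<theta> = eqn2 \<eta> \<Longrightarrow> defm \<theta> = defm \<eta> \<Longrightarrow> \<theta> = \<eta>"
  by (auto simp: prod_eq_iff vert1_def vert2_def eqn1_def eqn2_def defm_def)

lemma mix_param_0: "mix_param \<theta> \<eta> 0 = \<theta>"
  by (rule param_eqI) simp_all

lemma mix_param_1: "vert1 \<theta> = vert1 \<eta> \<Longrightarrow> vert2 \<theta> = vert2 \<eta> \<Longrightarrow> mix_param \<theta> \<eta> 1 = \<eta>"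
  by (rule param_eqI) simp_all

lemma homogeneous_mconst_mult: "homogeneous d p \<Longrightarrow> homogeneous d (mconst a * p)"
  unfolding homogeneous_def by (auto simp: in_keys_iff)

lemma avoids_mconst_mult: "avoids i p \<Longrightarrow> avoids i (mconst a * p)"
  unfolding avoids_def by (auto simp: in_keys_iff)

lemma axis_param_mix:
  assumes "axis_param m n i k \<theta>" "axis_param m n i k \<eta>"
  shows "axis_param m n i k (mix_param \<theta> \<eta> t)"
  using assms unfolding axis_param_def homog_param_def avoids_def[symmetric]
  by (simp add: homogeneous_add homogeneous_mconst_mult avoids_add avoids_mconst_mult)

lemma palg_on_line:
  assumes "\<Phi> \<in> palg param_gens"
  shows "\<exists>p :: complex poly. \<forall>t. \<Phi> (mix_param \<theta> \<eta> t) = poly p t"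
  using assms
proof induction
  case (const c)
  show ?case by (intro exI[of _ "[:c:]"]) simp
next
  case (gen g)
  have l: "\<exists>p. \<forall>t. (1 - t) * a + t * b = poly p t" for a b :: complex
    by (intro exI[of _ "[:a, b - a:]"]) (simp add: algebra_simps)
  have c: "\<exists>p. \<forall>t :: complex. a = poly p t" for a :: complex
    by (intro exI[of _ "[:a:]"]) simp
  show ?case using gen unfolding param_gens_def by (auto simp: lookup_add l c)
next
  case (add p q)
  then obtain r s where "\<forall>t. p (mix_param \<theta> \<eta> t) = poly r t" "\<forall>t. q (mix_param \<theta> \<eta> t) = poly s t" by blast
  then show ?case by (intro exI[of _ "r + s"]) simp
next
  case (mult p q)
  then obtain r s where "\<forall>t. p (mix_param \<theta> \<eta> t) = poly r t" "\<forall>t. q (mix_param \<theta> \<eta> t) = poly s t" by blast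
  then show ?case by (intro exI[of _ "r * s"]) simp
qed

text \<open>On the line joining a parameter good for \<open>S\<close> to one good for
  \<open>\<Phi>\<close>, each condition is a polynomial in t that is nonzero at 0 or at 1, so it
  fails for finitely many t only.\<close>

lemma common_nonzero:
  assumes "finite S" "\<And>\<Phi>. \<Phi> \<in> S \<Longrightarrow> \<Phi> \<in> palg param_gens \<and> (\<exists>\<theta>. axis_param m n i k \<theta> \<and> \<Phi> \<theta> \<noteq> 0)"
    and "axis_param m n i k \<theta>\<^sub>0"
  shows "\<exists>\<theta>. axis_param m n i k \<theta> \<and> (\<forall>\<Phi>\<in>S. \<Phi> \<theta> \<noteq> 0)"
  using assms(1,2)
proof (induction S rule: finite_induct)
  case empty
  show ?case using assms(3) by (intro exI[of _ \<theta>\<^sub>0]) simp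
next
  case (insert \<Phi> S)
  obtain \<theta> where \<theta>: "axis_param m n i k \<theta>" "\<forall>\<Phi>\<in>S. \<Phi> \<theta> \<noteq> 0" using insert.IH insert.prems by blast
  obtain \<eta> where \<eta>: "axis_param m n i k \<eta>" "\<Phi> \<eta> \<noteq> 0" using insert.prems[of \<Phi>] by blast
  have v: "vert1 \<theta> = vert1 \<eta>" "vert2 \<theta> = vert2 \<eta>" using \<theta>(1) \<eta>(1) by (simp_all add: axis_param_def)
  have fin: "finite {t. \<Psi> (mix_param \<theta> \<eta> t) = 0}" if \<Psi>: "\<Psi> \<in> insert \<Phi> S" for \<Psi>
  proof -
    obtain p where p: "\<And>t. \<Psi> (mix_param \<theta> \<eta> t) = poly p t"
      using palg_on_line[of \<Psi> \<theta> \<eta>] insert.prems[OF \<Psi>] by blast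
    have "p \<noteq> 0"
    proof
      assume "p = 0"
      then have "\<Psi> \<theta> = 0" "\<Psi> \<eta> = 0" using p[of 0] p[of 1] by (simp_all add: mix_param_0 mix_param_1[OF v])
      then show False using \<Psi> \<theta>(2) \<eta>(2) by auto
    qed
    then show ?thesis unfolding p by (rule poly_roots_finite)
  qed
  have "finite (\<Union>\<Psi>\<in>insert \<Phi> S. {t. \<Psi> (mix_param \<theta> \<eta> t) = 0})"
    using insert.hyps(1) fin by blast
  from ex_new_if_finite[OF infinite_UNIV_char_0 this]
  obtain t where "t \<notin> (\<Union>\<Psi>\<in>insert \<Phi> S. {t. \<Psi> (mix_param \<theta> \<eta> t) = 0})" ..
  then show ?case using axis_param_mix[OF \<theta>(1) \<eta>(1), of t] by blast
qed

text \<open>The determinant of \<open>e\<^sub>1, e\<^sub>2, v\<^sub>2, v\<^sub>1\<close>. Where it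
  is nonzero, the adapted coordinates are defined.\<close>

definition vertex_det :: "cone_pair \<times> 4 mpoly \<Rightarrow> complex" where
  "vertex_det \<theta> = vert1 \<theta> $ 4 * vert2 \<theta> $ 3 - vert1 \<theta> $ 3 * vert2 \<theta> $ 4"

text \<open>The conditions on the second cone are those on the first with the roles exchanged,
  pulled back along \<open>swap_param\<close>; hence the second instance of \<open>axis_pair\<close>
  with degrees and axes interchanged. The product of all conditions is
  \<open>\<Psi>\<close>.\<close>

theorem generic_parameter:
  assumes m: "m \<ge> 4" and n: "n \<ge> 4"
  obtains \<Psi> \<theta>\<^sub>0 where "\<Psi> \<in> palg param_gens" "axis_param m n 4 3 \<theta>\<^sub>0" "\<Psi> \<theta>\<^sub>0 \<noteq> 0"
    "\<And>\<theta>. homog_param m n \<theta> \<Longrightarrow> cone_param \<theta> \<Longrightarrow> \<Psi> \<theta> \<noteq> 0 \<Longrightarrow>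
       good_side \<theta> \<and> good_side (swap_param \<theta>) \<and> vertex_det \<theta> \<noteq> 0"
proof -
  interpret side1: axis_pair m n 4 3 by standard (use m n in simp_all)
  interpret side2: axis_pair n m 3 4 by standard (use m n in simp_all)
  obtain S where S: "finite S" "\<And>\<Phi>. \<Phi> \<in> S \<Longrightarrow> side1.example \<Phi>"
    "\<And>\<theta>. homog_param m n \<theta> \<Longrightarrow> cone_param \<theta> \<Longrightarrow> \<forall>\<Phi>\<in>S. \<Phi> \<theta> \<noteq> 0 \<Longrightarrow> good_side \<theta>"
    using side1.good_side_generic by blast
  obtain S' where S': "finite S'" "\<And>\<Phi>. \<Phi> \<in> S' \<Longrightarrow> side2.example \<Phi>"
    "\<And>\<theta>. homog_param n m \<theta> \<Longrightarrow> cone_param \<theta> \<Longrightarrow> \<forall>\<Phi>\<in>S'. \<Phi> \<theta> \<noteq> 0 \<Longrightarrow> good_side \<theta>"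
    using side2.good_side_generic by blast
  define R where "R = insert vertex_det (S \<union> (\<lambda>\<Phi> \<theta>. \<Phi> (swap_param \<theta>)) ` S')"
  define \<theta>\<^sub>1 where "\<theta>\<^sub>1 = mkparam 4 3 0 0 0"
  have ax1: "axis_param m n 4 3 \<theta>\<^sub>1"
    unfolding \<theta>\<^sub>1_def by (rule axis_param_mkparam) (simp_all add: homogeneous_def avoids_def)
  have ex: "\<Phi> \<in> palg param_gens \<and> (\<exists>\<theta>. axis_param m n 4 3 \<theta> \<and> \<Phi> \<theta> \<noteq> 0)" if \<Phi>R: "\<Phi> \<in> R" for \<Phi>
  proof -
    consider "\<Phi> = vertex_det" | "\<Phi> \<in> S" | \<Phi>' where "\<Phi>' \<in> S'" "\<Phi> = (\<lambda>\<theta>. \<Phi>' (swap_param \<theta>))"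
      using \<Phi>R unfolding R_def by blast
    then show ?thesis
    proof cases
      case 1
      have "vertex_det \<in> palg param_gens"
        unfolding vertex_det_def[abs_def] by (intro palg_diff palg.mult param_gens_palg)
      moreover have "vertex_det \<theta>\<^sub>1 \<noteq> 0" by (simp add: vertex_det_def \<theta>\<^sub>1_def axis_def)
      ultimately show ?thesis using 1 ax1 by blast
    next
      case 2
      then show ?thesis using S(2) unfolding side1.example_def by blast
    next
      case 3
      then obtain \<theta> where "\<Phi>' \<in> palg param_gens" "axis_param n m 3 4 \<theta>" "\<Phi>' \<theta> \<noteq> 0"
        using S'(2) unfolding side2.example_def by blast
      then show ?thesis
        using palg_swap[of \<Phi>'] swap_param_iff(3)[of m n 4 3 \<theta>] unfolding 3(2)
        by (intro conjI exI[of _ "swap_param \<theta>"]) simp_all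
    qed
  qed
  have finR: "finite R" unfolding R_def using S(1) S'(1) by simp
  obtain \<theta>\<^sub>0 where \<theta>\<^sub>0: "axis_param m n 4 3 \<theta>\<^sub>0" "\<forall>\<Phi>\<in>R. \<Phi> \<theta>\<^sub>0 \<noteq> 0"
    using common_nonzero[OF finR ex ax1] by blast
  show thesis
  proof (rule that[of "\<lambda>\<theta>. \<Prod>\<Phi>\<in>R. \<Phi> \<theta>", OF _ \<theta>\<^sub>0(1)])
    show "(\<lambda>\<theta>. \<Prod>\<Phi>\<in>R. \<Phi> \<theta>) \<in> palg param_gens" using ex by (intro palg_prod) blast
    show "(\<Prod>\<Phi>\<in>R. \<Phi> \<theta>\<^sub>0) \<noteq> 0" using \<theta>\<^sub>0(2) finR by simp
    fix \<theta> assume h: "homog_param m n \<theta>" and c: "cone_param \<theta>" and "(\<Prod>\<Phi>\<in>R. \<Phi> \<theta>) \<noteq> 0"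
    then have nz: "\<forall>\<Phi>\<in>R. \<Phi> \<theta> \<noteq> 0" using finR by simp
    show "good_side \<theta> \<and> good_side (swap_param \<theta>) \<and> vertex_det \<theta> \<noteq> 0"
    proof (intro conjI)
      show "good_side \<theta>" using nz by (intro S(3)[OF h c]) (simp add: R_def)
      have "\<forall>\<Phi>\<in>S'. \<Phi> (swap_param \<theta>) \<noteq> 0"
      proof
        fix \<Phi> assume "\<Phi> \<in> S'"
        then have "(\<lambda>\<theta>. \<Phi> (swap_param \<theta>)) \<in> R" unfolding R_def by blast
        from bspec[OF nz this] show "\<Phi> (swap_param \<theta>) \<noteq> 0" .
      qed
      then show "good_side (swap_param \<theta>)" using h c by (intro S'(3)) (simp_all add: swap_param_iff)
      show "vertex_det \<theta> \<noteq> 0" using nz by (simp add: R_def)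
    qed
  qed
qed

section \<open>Cones\<close>

lemma meval_homogeneous:
  fixes g :: "'v mpoly"
  assumes "homogeneous d g"
  shows "meval g (\<lambda>i. c * z i) = c ^ d * meval g z"
proof -
  have "mono_val u (\<lambda>i. c * z i) = c ^ mdegree u * mono_val u z" for u :: "'v monomial"
    by (simp add: mono_val_def mdegree_def power_mult_distrib prod.distrib power_sum)
  then show ?thesis
    using assms by (simp add: meval_eq_lin_ext lin_ext_def homogeneous_def sum_distrib_left mult_ac)
qed

lemma meval_line_poly: "\<exists>p :: complex poly. \<forall>t. poly p t = meval g (\<lambda>i. z i + t * w i)"
proof (induction g rule: poly_mapping_sum_induct)
  case zero
  show ?case by (intro exI[of _ 0]) simp
next
  case (single u a)
  show ?case
    by (intro exI[of _ "Polynomial.smult a (\<Prod>i\<in>Poly_Mapping.keys u. [:z i, w i:] ^ Poly_Mapping.lookup u i)"])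
      (simp add: meval_single mono_val_def poly_prod)
next
  case (add p q)
  then obtain r s where "\<forall>t. poly r t = meval p (\<lambda>i. z i + t * w i)" "\<forall>t. poly s t = meval q (\<lambda>i. z i + t * w i)" by blast
  then show ?case by (intro exI[of _ "r + s"]) (simp add: meval_add)
qed

lemma poly_no_root_const:
  fixes p :: "complex poly"
  assumes "\<And>t. poly p t \<noteq> 0"
  shows "poly p s = poly p t"
proof -
  have "Polynomial.degree p = 0" using alg_closed_imp_poly_has_root[of p] assms by (cases "Polynomial.degree p = 0") auto
  then show ?thesis by (elim degree_eq_zeroE) simp
qed

lemma poly_eq_at_limit:
  fixes p q :: "complex poly"
  assumes "\<And>t. t \<noteq> 0 \<Longrightarrow> poly p t = poly q t"
  shows "poly p t = poly q t"
proof -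
  have "infinite (UNIV - {0 :: complex})" using infinite_UNIV_char_0 by simp
  then have "infinite {t. poly (p - q) t = 0}"
    by (rule infinite_super[rotated]) (use assms in auto)
  then have "p - q = 0" using poly_roots_finite by blast
  then show ?thesis by simp
qed

lemma vec_nth_scale_fun: "(($) (c *s z)) = (\<lambda>i. c * z $ i)" for z :: "complex ^ 'n"
  by (rule ext) simp

lemma proj_lineI:
  "z \<noteq> 0 \<Longrightarrow> w \<noteq> 0 \<Longrightarrow> a *s z + b *s w \<noteq> 0 \<Longrightarrow> pt (a *s z + b *s w) \<in> proj_line (pt z) (pt w)"
  unfolding proj_line_def by blast

lemma pt_mem_hypersurface:
  assumes "homogeneous d g" "z \<noteq> 0"
  shows "pt z \<in> hypersurface g \<longleftrightarrow> meval g (($) z) = 0"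
proof
  assume "pt z \<in> hypersurface g"
  then obtain w where w: "pt z = pt w" "w \<noteq> 0" "meval g (($) w) = 0" unfolding hypersurface_def by auto
  then obtain c where "c \<noteq> 0" "w = c *s z" using pt_eq_iff[OF assms(2) w(2)] by auto
  then show "meval g (($) z) = 0"
    using w(3) meval_homogeneous[OF assms(1), of c "($) z"] by (simp add: vec_nth_scale_fun)
qed (use assms in \<open>auto simp: hypersurface_def\<close>)

text \<open>A cone is given by its point set only. On a line parallel to \<open>v\<close> the
  equation therefore vanishes everywhere or nowhere, and a polynomial in one variable without zeros
  is constant; in both cases \<open>g\<close> is constant on the line. Multiples of \<open>v\<close>
  need a separate argument, as their line contains 0, which is no projective point.\<close>

lemma cone_space_invariant:
  fixes v :: "complex ^ 4"
  assumes "(v, g) \<in> cone_space d"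
  shows "meval g (\<lambda>i. z i + c * v $ i) = meval g z"
proof -
  have v: "v \<noteq> 0" and hom: "homogeneous d g" and cone: "is_cone d (pt v) (hypersurface g)"
    using assms unfolding cone_space_def by auto
  obtain C where C: "hypersurface g = cone_over C (pt v)" using cone unfolding is_cone_def by blast
  have ray: "meval g (($) (z + t *s v)) = 0"
    if z: "\<And>t. z \<noteq> t *s v" and z0: "meval g (($) (z + s *s v)) = 0" for z s t
  proof -
    have nz: "z + t *s v \<noteq> 0" for t
    proof
      assume "z + t *s v = 0"
      then have "z = (- t) *s v" by (simp add: add_eq_0_iff2 vector_smult_lneg)
      then show False using z by blast
    qed
    have "pt (z + s *s v) \<in> hypersurface g" using pt_mem_hypersurface[OF hom nz] z0 by blast
    then obtain x where x: "x \<in> C" "pt (z + s *s v) \<in> proj_line (pt v) x"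
      unfolding C cone_over_def by blast
    then obtain a b z' w' where l: "pt (z + s *s v) = pt (a *s z' + b *s w')" "z' \<noteq> 0" "w' \<noteq> 0"
      "pt v = pt z'" "x = pt w'" "a *s z' + b *s w' \<noteq> 0"
      unfolding proj_line_def by blast
    obtain e where e: "e \<noteq> 0" "z + s *s v = e *s (a *s z' + b *s w')"
      using pt_eq_iff[OF l(6) nz] l(1) by metis
    obtain k where k: "v = k *s z'" using pt_eq_iff[OF l(2) v] l(4) by metis
    have eq: "z + t *s v = (e * a + (t - s) * k) *s z' + (e * b) *s w'"
    proof -
      have "z + t *s v = (z + s *s v) + (t - s) *s v" by (simp add: vector_sub_rdistrib)
      also have "\<dots> = e *s (a *s z' + b *s w') + ((t - s) * k) *s z'"
        unfolding e(2) by (subst k) (simp add: vector_smult_assoc)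
      also have "\<dots> = (e * a + (t - s) * k) *s z' + (e * b) *s w'"
        by (simp add: vec_eq_iff algebra_simps)
      finally show ?thesis .
    qed
    have "pt (z + t *s v) \<in> proj_line (pt v) x"
      unfolding l(4,5) eq by (rule proj_lineI[OF l(2,3) nz[of t, unfolded eq]])
    then have "pt (z + t *s v) \<in> hypersurface g" using x(1) unfolding C cone_over_def by blast
    then show ?thesis using pt_mem_hypersurface[OF hom nz] by blast
  qed
  have off: "meval g (($) (z + t *s v)) = meval g (($) z)" if z: "\<And>t. z \<noteq> t *s v" for z t
  proof -
    obtain p where p: "\<And>t. poly p t = meval g (\<lambda>i. z $ i + t * v $ i)"
      using meval_line_poly[of g "($) z" "($) v"] by auto
    have f: "($) (z + t *s v) = (\<lambda>i. z $ i + t * v $ i)" for t by (rule ext) simp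
    have "poly p t = poly p 0"
    proof (cases "\<exists>s. poly p s = 0")
      case True
      then obtain s where "poly p s = 0" by blast
      then have "poly p t = 0" for t using ray[OF z, of s t] by (simp add: p f)
      then show ?thesis by simp
    next
      case False
      then show ?thesis by (intro poly_no_root_const) auto
    qed
    then show ?thesis unfolding f by (simp add: p)
  qed
  have "\<exists>u. \<forall>t. u \<noteq> t *s v"
  proof (rule ccontr)
    assume "\<not> ?thesis"
    then obtain s t where st: "axis 1 1 = s *s v" "axis 2 1 = t *s v" by metis
    have "s * v $ 1 = 1" "s * v $ 2 = 0" "t * v $ 2 = 1"
      using arg_cong[OF st(1), of "\<lambda>x. vec_nth x 1"] arg_cong[OF st(1), of "\<lambda>x. vec_nth x 2"]
        arg_cong[OF st(2), of "\<lambda>x. vec_nth x 2"] by (simp_all add: axis_def)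
    then show False by auto
  qed
  then obtain u where u: "\<And>t. u \<noteq> t *s v" by blast
  define y where "y = (\<chi> i. z i)"
  have zy: "z = ($) y" by (rule ext) (simp add: y_def)
  have "meval g (($) (y + c *s v)) = meval g (($) y)"
  proof (cases "\<exists>s. y = s *s v")
    case False
    then show ?thesis by (intro off) blast
  next
    case True
    then obtain s where s: "y = s *s v" by blast
    obtain p where p: "\<And>t. poly p t = meval g (\<lambda>i. y $ i + t * u $ i)"
      using meval_line_poly[of g "($) y" "($) u"] by auto
    obtain q where q: "\<And>t. poly q t = meval g (\<lambda>i. (y + c *s v) $ i + t * u $ i)"
      using meval_line_poly[of g "($) (y + c *s v)" "($) u"] by auto
    \<comment> \<open>For t \<noteq> 0 the vector \<open>y + t *s u\<close> is not a multiple of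
      \<open>v\<close>, so the previous case applies. Both sides are polynomials in t, and equality
      extends to t = 0.\<close>
    have "poly q t = poly p t" if "t \<noteq> 0" for t
    proof -
      have "y + t *s u \<noteq> r *s v" for r
      proof
        assume "y + t *s u = r *s v"
        then have "s * v $ i + t * u $ i = r * v $ i" for i unfolding s by (simp add: vec_eq_iff)
        then have "t * u $ i = (r - s) * v $ i" for i
          by (simp only: left_diff_distrib) (metis add_diff_cancel_left')
        then have "u = ((r - s) / t) *s v"
          using that by (simp add: vec_eq_iff field_simps)
        then show False using u by blast
      qed
      from off[OF this, of c] have "meval g (($) ((y + t *s u) + c *s v)) = meval g (($) (y + t *s u))" .
      moreover have "($) ((y + t *s u) + c *s v) = (\<lambda>i. (y + c *s v) $ i + t * u $ i)"
        "($) (y + t *s u) = (\<lambda>i. y $ i + t * u $ i)" by (auto simp: fun_eq_iff)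
      ultimately show ?thesis by (simp only: p q)
    qed
    then have "poly q 0 = poly p 0" by (rule poly_eq_at_limit)
    moreover have "($) (y + c *s v) = (\<lambda>i. (y + c *s v) $ i)" by (rule ext) simp
    ultimately show ?thesis unfolding p q by simp
  qed
  moreover have "($) (y + c *s v) = (\<lambda>i. z i + c * v $ i)" by (auto simp: fun_eq_iff zy)
  ultimately show ?thesis unfolding zy by simp
qed

lemma avoids_indep:
  fixes g :: "4 mpoly"
  assumes "avoids i g" "\<And>j. j \<noteq> i \<Longrightarrow> y j = z j"
  shows "meval g y = meval g z"
  unfolding meval_eq_lin_ext lin_ext_def
proof (intro sum.cong refl arg_cong[of _ _ "(*) _"])
  fix u assume u: "u \<in> Poly_Mapping.keys g"
  show "mono_val u y = mono_val u z"
    unfolding mono_val_def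
  proof (rule prod.cong[OF refl])
    fix j assume "j \<in> Poly_Mapping.keys u"
    then have "j \<noteq> i" using assms(1) u unfolding avoids_def by (auto simp: in_keys_iff)
    then show "y j ^ Poly_Mapping.lookup u j = z j ^ Poly_Mapping.lookup u j" using assms(2) by simp
  qed
qed

lemma meval_var [simp]: "meval (var i) z = z i"
  by (simp add: var_def meval_single)

text \<open>Without a root \<open>p\<close> is constant, and by homogeneity the reversed polynomial
  \<open>q\<close> is a constant times t^d. It vanishes at 0, in contrast to
  \<open>meval g w\<close>.\<close>

lemma binary_form_root:
  assumes g: "homogeneous d g" "d > 0" and w: "meval g w \<noteq> 0"
  shows "\<exists>t. meval g (\<lambda>i. z i + t * w i) = 0"
proof (rule ccontr)
  assume no: "\<not> ?thesis"
  obtain p where p: "\<And>t. poly p t = meval g (\<lambda>i. z i + t * w i)" using meval_line_poly by metis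
  obtain q where q: "\<And>t. poly q t = meval g (\<lambda>i. w i + t * z i)" using meval_line_poly by metis
  have const: "poly p t = poly p 0" for t by (rule poly_no_root_const) (use no p in auto)
  have "poly q t = poly (Polynomial.monom (poly p 0) d) t" if "t \<noteq> 0" for t
  proof -
    have "(\<lambda>i. w i + t * z i) = (\<lambda>i. t * (z i + inverse t * w i))"
      using that by (auto simp: fun_eq_iff field_simps)
    then have "poly q t = t ^ d * poly p (inverse t)"
      unfolding p q using meval_homogeneous[OF g(1), of t "\<lambda>i. z i + inverse t * w i"] by simp
    then show ?thesis by (simp add: const[of "inverse t"] poly_monom)
  qed
  from poly_eq_at_limit[OF this, of 0] have "poly q 0 = 0" using g(2) by (simp add: poly_monom)
  then show False using w by (simp add: q)
qed

text \<open>Shows that the good parameter belongs to the parameter space: an equation free of the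
  coordinate \<open>i\<close> defines a cone over its curve in the plane where this coordinate is
  zero. The coordinate point of \<open>k\<close> witnesses that this plane is not contained in the
  surface.\<close>

lemma axis_cone_space:
  assumes g: "homogeneous d g" "d > 0" "avoids i g" and k: "k \<noteq> i" "meval g (($) (axis k 1)) \<noteq> 0"
  shows "(axis i 1, g) \<in> cone_space d"
proof -
  have ax: "axis i (1::complex) \<noteq> 0" "axis k (1::complex) \<noteq> 0" by (simp_all add: axis_eq_0_iff)
  have var1: "homogeneous 1 (var i)" by (simp add: homogeneous_def var_def)
  have H: "pt z \<in> hypersurface (var i) \<longleftrightarrow> z $ i = 0" if "z \<noteq> 0" for z
    using pt_mem_hypersurface[OF var1 that] by simp
  have g0: "g \<noteq> 0" using k(2) by auto
  let ?H = "hypersurface (var i)" and ?C = "hypersurface (var i) \<inter> hypersurface g"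
  have indep: "meval g (($) y) = meval g (($) z)" if "\<And>j. j \<noteq> i \<Longrightarrow> y $ j = z $ j" for y z
    by (rule avoids_indep[OF g(3)]) (rule that)
  have "\<exists>j. j \<noteq> i \<and> j \<noteq> k"
  proof (rule ccontr)
    assume "\<not> ?thesis"
    then have "(UNIV :: 4 set) \<subseteq> {i, k}" by auto
    then have "card (UNIV :: 4 set) \<le> card {i, k}" by (intro card_mono) simp_all
    also have "card {i, k} \<le> 2" by (simp add: card_insert_if)
    finally show False by simp
  qed
  then obtain j where j: "j \<noteq> i" "j \<noteq> k" by blast
  \<comment> \<open>The vertex lies in \<open>cone_over\<close> only if the base curve has a point;
    one is found on the line through the coordinate points of \<open>j\<close> and
    \<open>k\<close>.\<close>
  obtain t where t: "meval g (\<lambda>l. axis j 1 $ l + t * axis k 1 $ l) = 0"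
    using binary_form_root[OF g(1,2) k(2), of "($) (axis j 1)"] by auto
  define c where "c = axis j 1 + t *s axis k (1::complex)"
  have c: "c \<noteq> 0" "c $ i = 0" "meval g (($) c) = 0"
  proof -
    have "c $ j = 1" using j by (simp add: c_def axis_def)
    then show "c \<noteq> 0" by auto
    show "c $ i = 0" using j k by (simp add: c_def axis_def)
    have "($) c = (\<lambda>l. axis j 1 $ l + t * axis k 1 $ l)" by (rule ext) (simp add: c_def)
    then show "meval g (($) c) = 0" using t by simp
  qed
  have "hypersurface g = cone_over ?C (pt (axis i 1))"
  proof (intro set_eqI iffI)
    fix x assume "x \<in> hypersurface g"
    then obtain z where z: "x = pt z" "z \<noteq> 0" "meval g (($) z) = 0" unfolding hypersurface_def by blast
    define y where "y = z - (z $ i) *s axis i 1"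
    have yi: "y $ i = 0" by (simp add: y_def axis_def)
    have gy: "meval g (($) y) = 0" using indep[of y z] z(3) by (simp add: y_def axis_def)
    show "x \<in> cone_over ?C (pt (axis i 1))"
    proof (cases "y = 0")
      case True
      then have zi: "z = (z $ i) *s axis i 1 + 0 *s c" by (simp add: y_def)
      have "pt c \<in> ?C" using H[OF c(1)] pt_mem_hypersurface[OF g(1) c(1)] c by simp
      moreover have "x \<in> proj_line (pt (axis i 1)) (pt c)"
        unfolding z(1) by (subst zi, rule proj_lineI[OF ax(1) c(1)]) (subst zi[symmetric], fact z(2))
      ultimately show ?thesis unfolding cone_over_def by blast
    next
      case False
      have zi: "z = (z $ i) *s axis i 1 + 1 *s y" by (simp add: y_def)
      have "pt y \<in> ?C" using H[OF False] pt_mem_hypersurface[OF g(1) False] yi gy by simp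
      moreover have "x \<in> proj_line (pt (axis i 1)) (pt y)"
        unfolding z(1) by (subst zi, rule proj_lineI[OF ax(1) False]) (subst zi[symmetric], fact z(2))
      ultimately show ?thesis unfolding cone_over_def by blast
    qed
  next
    fix x assume "x \<in> cone_over ?C (pt (axis i 1))"
    then obtain q where q: "q \<in> hypersurface g" "x \<in> proj_line (pt (axis i 1)) q" unfolding cone_over_def by blast
    then obtain a b z w where l: "x = pt (a *s z + b *s w)" "z \<noteq> 0" "w \<noteq> 0" "pt (axis i 1) = pt z" "q = pt w"
      "a *s z + b *s w \<noteq> 0" unfolding proj_line_def by blast
    have gw: "meval g (($) w) = 0" using q(1) l(5) pt_mem_hypersurface[OF g(1) l(3)] by simp
    obtain e where "z = e *s axis i 1" using pt_eq_iff[OF ax(1) l(2)] l(4) by blast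
    then have "meval g (($) (a *s z + b *s w)) = meval g (($) (b *s w))"
      by (intro indep) (simp add: axis_def)
    also have "\<dots> = 0" using gw meval_homogeneous[OF g(1), of b "($) w"] by (simp add: vec_nth_scale_fun)
    finally show "x \<in> hypersurface g" unfolding l(1) using pt_mem_hypersurface[OF g(1) l(6)] by simp
  qed
  moreover have "\<not> ?H \<subseteq> hypersurface g"
  proof
    assume "?H \<subseteq> hypersurface g"
    moreover have "pt (axis k 1) \<in> ?H" using H[OF ax(2)] k(1) by (simp add: axis_def)
    ultimately have "pt (axis k 1) \<in> hypersurface g" by (rule subsetD)
    then show False using pt_mem_hypersurface[OF g(1) ax(2)] k(2) by simp
  qed
  moreover have "pt (axis i 1) \<notin> ?H" using H[OF ax(1)] by (simp add: axis_def)
  moreover have "var i \<noteq> (0 :: 4 mpoly)"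
  proof
    assume "var i = (0 :: 4 mpoly)"
    then have "meval (var i) (\<lambda>_. 1) = meval (0 :: 4 mpoly) (\<lambda>_. 1)" by (rule arg_cong)
    then show False by simp
  qed
  then have "plane ?H" unfolding plane_def using var1 by (intro exI[of _ "var i"]) simp
  moreover have "plane_curve d ?H ?C"
    unfolding plane_curve_def using g(1) \<open>\<not> ?H \<subseteq> hypersurface g\<close> by (intro exI[of _ g]) simp
  ultimately have "is_cone d (pt (axis i 1)) (hypersurface g)"
    unfolding is_cone_def by (intro exI[of _ ?H] exI[of _ ?C]) simp
  then show ?thesis unfolding cone_space_def using ax(1) g0 g(1) by simp
qed

section \<open>From a nonvanishing polynomial to Zariski generality\<close>

lemma cone_pair_coord_simps:
  "cone_pair_coord P (Inl (Vertex i)) = fst (fst P) $ i" "cone_pair_coord P (Inl (Coeff u)) = Poly_Mapping.lookup (snd (fst P)) u"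
  "cone_pair_coord P (Inr (Vertex i)) = fst (snd P) $ i" "cone_pair_coord P (Inr (Coeff u)) = Poly_Mapping.lookup (snd (snd P)) u"
  by (cases P; cases "fst P"; cases "snd P"; simp)+

text \<open>With \<open>f\<close> frozen its coefficients become constants, and only the coordinates
  of the pair remain; \<open>palg_deform_coord\<close> is the complementary slice.\<close>

lemma palg_pair_coord:
  assumes "\<Psi> \<in> palg param_gens"
  shows "\<exists>F. \<forall>P. meval F (cone_pair_coord P) = \<Psi> (P, f)"
proof (rule palg_meval, rule palg_compose[OF assms])
  fix g assume "g \<in> param_gens"
  let ?R = "Set.range (\<lambda>i x. cone_pair_coord x i)"
  have "(\<lambda>P. cone_pair_coord P i) \<in> palg ?R" for i by (rule palg.gen) blast
  from this[of "Inl (Vertex i)" for i] this[of "Inl (Coeff u)" for u] this[of "Inr (Vertex i)" for i] this[of "Inr (Coeff u)" for u]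
  have "(\<lambda>P. vert1 (P, f) $ i) \<in> palg ?R" "(\<lambda>P. vert2 (P, f) $ i) \<in> palg ?R"
    "(\<lambda>P. Poly_Mapping.lookup (eqn1 (P, f)) u) \<in> palg ?R" "(\<lambda>P. Poly_Mapping.lookup (eqn2 (P, f)) u) \<in> palg ?R"
    for i u
    by (simp_all add: vert1_def vert2_def eqn1_def eqn2_def cone_pair_coord_simps)
  then show "(\<lambda>P. g (P, f)) \<in> palg ?R"
    using \<open>g \<in> param_gens\<close> unfolding param_gens_def by (auto simp: defm_def intro: palg.const)
qed

lemma palg_deform_coord:
  assumes "\<Psi> \<in> palg param_gens"
  shows "\<exists>F. \<forall>f. meval F (Poly_Mapping.lookup f) = \<Psi> (P, f)"
proof (rule palg_meval, rule palg_compose[OF assms])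
  fix g assume "g \<in> param_gens"
  have "(\<lambda>f. Poly_Mapping.lookup f u) \<in> palg (Set.range (\<lambda>i x. Poly_Mapping.lookup x i))" for u
    by (rule palg.gen) blast
  then show "(\<lambda>f. g (P, f)) \<in> palg (Set.range (\<lambda>i x. Poly_Mapping.lookup x i))"
    using \<open>g \<in> param_gens\<close> unfolding param_gens_def
    by (auto simp: defm_def vert1_def vert2_def eqn1_def eqn2_def intro: palg.const)
qed

text \<open>A pair \<open>P\<close> is excluded when \<open>\<Psi> (P, f\<^sub>0) = 0\<close>. For
  any other pair \<open>f\<^sub>0\<close> itself shows that \<open>\<Psi> (P, f)\<close> is not
  identically zero in \<open>f\<close>, so its zeros form a proper closed subset, which depends on
  \<open>P\<close>.\<close>

theorem for_general_cone_pairs: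
  assumes m: "m \<ge> 4" and n: "n \<ge> 4"
    and Q: "\<And>v\<^sub>1 g\<^sub>1 v\<^sub>2 g\<^sub>2 f. homog_param m n (((v\<^sub>1, g\<^sub>1), (v\<^sub>2, g\<^sub>2)), f) \<Longrightarrow> cone_param (((v\<^sub>1, g\<^sub>1), (v\<^sub>2, g\<^sub>2)), f) \<Longrightarrow>
      good_side (((v\<^sub>1, g\<^sub>1), (v\<^sub>2, g\<^sub>2)), f) \<Longrightarrow> good_side (swap_param (((v\<^sub>1, g\<^sub>1), (v\<^sub>2, g\<^sub>2)), f)) \<Longrightarrow>
      vertex_det (((v\<^sub>1, g\<^sub>1), (v\<^sub>2, g\<^sub>2)), f) \<noteq> 0 \<Longrightarrow> Q g\<^sub>1 g\<^sub>2 f"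
  shows "for_general cone_pair_coord (cone_space m \<times> cone_space n)
     (\<lambda>((v\<^sub>1, g\<^sub>1), (v\<^sub>2, g\<^sub>2)). for_general Poly_Mapping.lookup {f. homogeneous (m + n) f} (Q g\<^sub>1 g\<^sub>2))"
proof -
  obtain \<Psi> \<theta>\<^sub>0 where \<Psi>: "\<Psi> \<in> palg param_gens" "axis_param m n 4 3 \<theta>\<^sub>0" "\<Psi> \<theta>\<^sub>0 \<noteq> 0"
    and good: "\<And>\<theta>. homog_param m n \<theta> \<Longrightarrow> cone_param \<theta> \<Longrightarrow> \<Psi> \<theta> \<noteq> 0 \<Longrightarrow>
       good_side \<theta> \<and> good_side (swap_param \<theta>) \<and> vertex_det \<theta> \<noteq> 0"
    using generic_parameter[OF m n] by metis
  define P\<^sub>0 f\<^sub>0 where "P\<^sub>0 = fst \<theta>\<^sub>0" and "f\<^sub>0 = snd \<theta>\<^sub>0"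
  have th0: "\<theta>\<^sub>0 = (P\<^sub>0, f\<^sub>0)" by (simp add: P\<^sub>0_def f\<^sub>0_def)
  obtain g\<^sub>1 g\<^sub>2 where P0: "P\<^sub>0 = ((axis 4 1, g\<^sub>1), (axis 3 1, g\<^sub>2))"
    and g: "homogeneous m g\<^sub>1" "homogeneous n g\<^sub>2" "homogeneous (m + n) f\<^sub>0" "avoids 4 g\<^sub>1" "avoids 3 g\<^sub>2"
    using \<Psi>(2) unfolding axis_param_def homog_param_def avoids_def P\<^sub>0_def f\<^sub>0_def
    by (cases \<theta>\<^sub>0) (auto simp: vert1_def vert2_def eqn1_def eqn2_def defm_def)
  have "cone_param \<theta>\<^sub>0"
    unfolding cone_param_def th0 P0
    by (auto simp: vert1_def vert2_def eqn1_def eqn2_def axis_def intro!: avoids_indep[OF g(4)] avoids_indep[OF g(5)])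
  then have "good_side \<theta>\<^sub>0" using good[of \<theta>\<^sub>0] \<Psi>(2,3) unfolding axis_param_def by blast
  then have "meval g\<^sub>1 (pnt \<theta>\<^sub>0 ((\<lambda>_. 0)(VS := 1))) \<noteq> 0" "meval g\<^sub>2 (pnt \<theta>\<^sub>0 ((\<lambda>_. 0)(VM := 1))) \<noteq> 0"
    unfolding good_side_def Let_def by (simp_all add: th0 P0 eqn1_def eqn2_def)
  moreover have "pnt \<theta>\<^sub>0 ((\<lambda>_. 0)(VS := 1)) = ($) (axis 3 1)" "pnt \<theta>\<^sub>0 ((\<lambda>_. 0)(VM := 1)) = ($) (axis 4 1)"
    by (simp_all add: pnt_def fun_eq_iff th0 P0 vert1_def vert2_def)
  ultimately have "P\<^sub>0 \<in> cone_space m \<times> cone_space n"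
    unfolding P0 using axis_cone_space[of m g\<^sub>1 4 3] axis_cone_space[of n g\<^sub>2 3 4] g m n by simp
  obtain F where F: "\<And>P. meval F (cone_pair_coord P) = \<Psi> (P, f\<^sub>0)" using palg_pair_coord[OF \<Psi>(1)] by blast
  let ?Z = "{P \<in> cone_space m \<times> cone_space n. \<forall>G\<in>{F}. meval G (cone_pair_coord P) = 0}"
  show ?thesis
    unfolding for_general_def[of cone_pair_coord]
  proof (intro exI[of _ ?Z] conjI ballI)
    show "zariski_closed_in cone_pair_coord (cone_space m \<times> cone_space n) ?Z"
      unfolding zariski_closed_in_def by blast
    have "P\<^sub>0 \<notin> ?Z" using \<Psi>(3) by (simp add: F th0)
    then show "?Z \<noteq> cone_space m \<times> cone_space n" using \<open>P\<^sub>0 \<in> _\<close> by blast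
    fix P assume P: "P \<in> (cone_space m \<times> cone_space n) - ?Z"
    obtain v\<^sub>1 h\<^sub>1 v\<^sub>2 h\<^sub>2 where Peq: "P = ((v\<^sub>1, h\<^sub>1), (v\<^sub>2, h\<^sub>2))" by (metis surj_pair)
    have cs: "(v\<^sub>1, h\<^sub>1) \<in> cone_space m" "(v\<^sub>2, h\<^sub>2) \<in> cone_space n" and nz: "\<Psi> (P, f\<^sub>0) \<noteq> 0"
      using P by (auto simp: F Peq)
    have hom: "homogeneous m h\<^sub>1" "homogeneous n h\<^sub>2" using cs by (auto simp: cone_space_def)
    obtain E where E: "\<And>f. meval E (Poly_Mapping.lookup f) = \<Psi> (P, f)" using palg_deform_coord[OF \<Psi>(1)] by blast
    let ?Y = "{f \<in> {f. homogeneous (m + n) f}. \<forall>G\<in>{E}. meval G (Poly_Mapping.lookup f) = 0}"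
    have "for_general Poly_Mapping.lookup {f. homogeneous (m + n) f} (Q h\<^sub>1 h\<^sub>2)"
      unfolding for_general_def
    proof (intro exI[of _ ?Y] conjI ballI)
      show "zariski_closed_in Poly_Mapping.lookup {f. homogeneous (m + n) f} ?Y"
        unfolding zariski_closed_in_def by blast
      have "f\<^sub>0 \<notin> ?Y" using nz by (simp add: E)
      then show "?Y \<noteq> {f. homogeneous (m + n) f}" using g(3) by blast
      fix f assume f: "f \<in> {f. homogeneous (m + n) f} - ?Y"
      have h: "homog_param m n (P, f)"
        using hom f by (simp add: homog_param_def Peq eqn1_def eqn2_def defm_def)
      have c: "cone_param (P, f)"
        using cone_space_invariant[OF cs(1)] cone_space_invariant[OF cs(2)]
        by (simp add: cone_param_def Peq eqn1_def eqn2_def vert1_def vert2_def)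
      have "\<Psi> (P, f) \<noteq> 0" using f by (auto simp: E)
      then show "Q h\<^sub>1 h\<^sub>2 f" using good[OF h c] h c Q unfolding Peq by blast
    qed
    then show "(\<lambda>((v\<^sub>1, g\<^sub>1), (v\<^sub>2, g\<^sub>2)). for_general Poly_Mapping.lookup {f. homogeneous (m + n) f} (Q g\<^sub>1 g\<^sub>2)) P"
      unfolding Peq prod.case .
  qed
qed

section \<open>Curves in projective space\<close>

subsection \<open>Lifts and the Fubini--Study derivative\<close>

definition lift :: "(complex \<Rightarrow> proj3) \<Rightarrow> complex set \<Rightarrow> (complex \<Rightarrow> complex ^ 4) \<Rightarrow> bool" where
  "lift f V F \<longleftrightarrow> open V \<and> (\<forall>i. (\<lambda>w. F w $ i) holomorphic_on V) \<and> (\<forall>w\<in>V. F w \<noteq> 0 \<and> f w = pt (F w))"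

lemma proj_holomorphic_on_lift:
  "proj_holomorphic_on f U \<longleftrightarrow> (\<forall>w\<in>U. \<exists>V F. w \<in> V \<and> V \<subseteq> U \<and> lift f V F)"
  unfolding proj_holomorphic_on_def lift_def by (intro ball_cong refl) meson

lemma lift_subset: "lift f V F \<Longrightarrow> open W \<Longrightarrow> W \<subseteq> V \<Longrightarrow> lift f W F"
  unfolding lift_def by (meson holomorphic_on_subset subsetD)

lemma proj_holomorphic_on_subset:
  assumes "proj_holomorphic_on f U" "open W" "W \<subseteq> U"
  shows "proj_holomorphic_on f W"
  unfolding proj_holomorphic_on_lift
proof
  fix w assume "w \<in> W"
  then obtain V F where "w \<in> V" "lift f V F" using assms unfolding proj_holomorphic_on_lift by blast
  then have "lift f (V \<inter> W) F" "w \<in> V \<inter> W" using assms(2) \<open>w \<in> W\<close>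
    by (auto intro: lift_subset simp: lift_def open_Int)
  then show "\<exists>V F. w \<in> V \<and> V \<subseteq> W \<and> lift f V F" by blast
qed

lemma rep_proj3_nonzero: "rep_proj3 p \<noteq> 0" and pt_rep_proj3: "pt (rep_proj3 p) = p"
proof -
  have "proportional (rep_proj3 p) (rep_proj3 p)" "abs_proj3 (rep_proj3 p) = p"
    using Quotient3_rep_reflp[OF Quotient3_proj3] Quotient3_abs_rep[OF Quotient3_proj3] by auto
  then show "rep_proj3 p \<noteq> 0" "pt (rep_proj3 p) = p" unfolding pt_def proportional_def by auto
qed

definition sqn :: "complex ^ 4 \<Rightarrow> real" where
  "sqn z = (\<Sum>i\<in>UNIV. (cmod (z $ i))\<^sup>2)"

lemma sqn_nonneg: "sqn z \<ge> 0"
  by (simp add: sqn_def sum_nonneg)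

lemma sqn_pos: "z \<noteq> 0 \<Longrightarrow> sqn z > 0"
proof -
  assume "z \<noteq> 0"
  then obtain i where "z $ i \<noteq> 0" by (auto simp: vec_eq_iff)
  then show ?thesis unfolding sqn_def by (intro sum_pos2[of _ i]) auto
qed

lemma sqn_scale: "sqn (c *s z) = (cmod c)\<^sup>2 * sqn z"
  by (simp add: sqn_def norm_mult power_mult_distrib sum_distrib_left)

lemma sqn_complex: "complex_of_real (sqn z) = (\<Sum>i\<in>UNIV. z $ i * cnj (z $ i))"
  unfolding sqn_def of_real_sum by (intro sum.cong refl) (metis complex_norm_square of_real_power)

lemma cmod_mult_le_sqn: "cmod (z $ i) * cmod (z $ j) \<le> sqn z"
proof -
  have le: "(cmod (z $ i))\<^sup>2 \<le> sqn z" for i unfolding sqn_def by (rule member_le_sum) auto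
  have "cmod (z $ i) * cmod (z $ j) \<le> max (cmod (z $ i)) (cmod (z $ j)) * max (cmod (z $ i)) (cmod (z $ j))"
    by (intro mult_mono) (auto simp: le_max_iff_disj)
  also have "\<dots> \<le> sqn z" using le[of i] le[of j] by (auto simp: max_def power2_eq_square)
  finally show ?thesis .
qed

text \<open>An l1 norm of the bivector, each minor counted twice. It suffices because the metric
  matters only up to comparison.\<close>

definition wedge_norm :: "complex ^ 4 \<Rightarrow> complex ^ 4 \<Rightarrow> real" where
  "wedge_norm z w = (\<Sum>i\<in>UNIV. \<Sum>j\<in>UNIV. cmod (z $ i * w $ j - z $ j * w $ i))"

lemma wedge_norm_nonneg: "wedge_norm z w \<ge> 0"
  by (simp add: wedge_norm_def sum_nonneg)

lemma wedge_norm_row: "(\<Sum>j\<in>UNIV. cmod (z $ i * w $ j - z $ j * w $ i)) \<le> wedge_norm z w"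
  unfolding wedge_norm_def by (rule member_le_sum) (auto intro: sum_nonneg)

lemma wedge_norm_entry: "cmod (z $ i * w $ j - z $ j * w $ i) \<le> wedge_norm z w"
proof -
  have "cmod (z $ i * w $ j - z $ j * w $ i) \<le> (\<Sum>j\<in>UNIV. cmod (z $ i * w $ j - z $ j * w $ i))"
    by (rule member_le_sum) auto
  then show ?thesis using wedge_norm_row[of z i w] by linarith
qed

text \<open>This is the effect of a change of lift: the derivative of u F is u F' + u' F, and the
  second term drops out of the minors.\<close>

lemma wedge_norm_scale: "wedge_norm (c *s z) (c *s w + d *s z) = (cmod c)\<^sup>2 * wedge_norm z w"
proof -
  have "(c *s z) $ i * (c *s w + d *s z) $ j - (c *s z) $ j * (c *s w + d *s z) $ i
      = c\<^sup>2 * (z $ i * w $ j - z $ j * w $ i)" for i j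
    by (simp add: algebra_simps power2_eq_square)
  then show ?thesis unfolding wedge_norm_def by (simp add: norm_mult norm_power sum_distrib_left)
qed

lemma wedge_norm_smult_right: "wedge_norm z (c *s w) = cmod c * wedge_norm z w"
proof -
  have "z $ i * (c *s w) $ j - z $ j * (c *s w) $ i = c * (z $ i * w $ j - z $ j * w $ i)" for i j
    by (simp add: algebra_simps)
  then show ?thesis unfolding wedge_norm_def by (simp add: norm_mult sum_distrib_left)
qed

definition vderiv :: "(complex \<Rightarrow> complex ^ 4) \<Rightarrow> complex \<Rightarrow> complex ^ 4" where
  "vderiv F w = (\<chi> i. deriv (\<lambda>x. F x $ i) w)"

text \<open>The norm of the derivative in a metric comparable to the Fubini--Study metric: \<open>|F \<and> F'| / |F|\<^sup>2\<close>
  is independent of the lift \<open>F\<close>.\<close>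

definition fs_deriv :: "(complex \<Rightarrow> proj3) \<Rightarrow> complex \<Rightarrow> real" where
  "fs_deriv f w = (SOME c. \<exists>V F. lift f V F \<and> w \<in> V \<and> c = wedge_norm (F w) (vderiv F w) / sqn (F w))"

text \<open>Two lifts differ pointwise by a scalar. Where coordinate \<open>i\<close> is nonzero,
  the scalar is the quotient of the two \<open>i\<close>-th coordinates and hence
  holomorphic.\<close>

lemma lift_ratio:
  assumes "lift f V F" "lift f W G" "w \<in> V" "w \<in> W"
  obtains u U where "open U" "w \<in> U" "U \<subseteq> V \<inter> W" "u holomorphic_on U"
    "\<And>x. x \<in> U \<Longrightarrow> u x \<noteq> 0" "\<And>x. x \<in> U \<Longrightarrow> G x = u x *s F x"
proof -
  have F: "open V" "\<And>i. (\<lambda>w. F w $ i) holomorphic_on V" "\<And>w. w \<in> V \<Longrightarrow> F w \<noteq> 0 \<and> f w = pt (F w)"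
    and G: "open W" "\<And>i. (\<lambda>w. G w $ i) holomorphic_on W" "\<And>w. w \<in> W \<Longrightarrow> G w \<noteq> 0 \<and> f w = pt (G w)"
    using assms(1,2) unfolding lift_def by auto
  obtain i where i: "F w $ i \<noteq> 0" using F(3)[OF assms(3)] by (auto simp: vec_eq_iff)
  have "continuous_on V (\<lambda>w. F w $ i)" using F(2) by (rule holomorphic_on_imp_continuous_on)
  then have op: "open {x \<in> V. F x $ i \<noteq> 0}"
  proof -
    have "{x \<in> V. F x $ i \<noteq> 0} = V \<inter> (\<lambda>w. F w $ i) -` (- {0})" by blast
    then show ?thesis
      using continuous_open_preimage[OF \<open>continuous_on V (\<lambda>w. F w $ i)\<close> F(1) open_Compl[OF closed_singleton[of 0]]] by simp
  qed
  define U where "U = {x \<in> V. F x $ i \<noteq> 0} \<inter> W"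
  have GF: "G x = (G x $ i / F x $ i) *s F x \<and> G x $ i / F x $ i \<noteq> 0" if "x \<in> U" for x
  proof -
    have x: "x \<in> V" "x \<in> W" "F x $ i \<noteq> 0" using that unfolding U_def by auto
    have "pt (F x) = pt (G x)" using F(3)[OF x(1)] G(3)[OF x(2)] by simp
    then obtain c where c: "c \<noteq> 0" "G x = c *s F x"
      using pt_eq_iff[of "F x" "G x"] F(3)[OF x(1)] G(3)[OF x(2)] by blast
    then have "G x $ i / F x $ i = c" using x(3) by simp
    then show ?thesis using c by simp
  qed
  show thesis
  proof (rule that[of U "\<lambda>x. G x $ i / F x $ i"])
    show "open U" unfolding U_def using op G(1) by (rule open_Int)
    show "w \<in> U" unfolding U_def using i assms by simp
    show "U \<subseteq> V \<inter> W" unfolding U_def by blast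
    show "(\<lambda>x. G x $ i / F x $ i) holomorphic_on U"
    proof (rule holomorphic_on_divide)
      show "(\<lambda>x. G x $ i) holomorphic_on U" by (rule holomorphic_on_subset[OF G(2)]) (auto simp: U_def)
      show "(\<lambda>x. F x $ i) holomorphic_on U" by (rule holomorphic_on_subset[OF F(2)]) (auto simp: U_def)
    qed (simp add: U_def)
    show "G x $ i / F x $ i \<noteq> 0" "G x = (G x $ i / F x $ i) *s F x" if "x \<in> U" for x
      by (rule conjunct2[OF GF[OF that]], rule conjunct1[OF GF[OF that]])
  qed
qed

lemma vderiv_mult:
  fixes F G :: "complex \<Rightarrow> complex ^ 4"
  assumes "open U" "w \<in> U" "u holomorphic_on U" "\<And>i. (\<lambda>x. F x $ i) holomorphic_on U"
    and "\<And>x. x \<in> U \<Longrightarrow> G x = u x *s F x"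
  shows "vderiv G w = u w *s vderiv F w + deriv u w *s F w"
proof -
  have "deriv (\<lambda>x. G x $ i) w = u w * deriv (\<lambda>x. F x $ i) w + deriv u w * F w $ i" for i
  proof (rule DERIV_imp_deriv)
    have "(u has_field_derivative deriv u w) (at w)" "((\<lambda>x. F x $ i) has_field_derivative deriv (\<lambda>x. F x $ i) w) (at w)"
      using holomorphic_derivI[OF assms(3,1,2)] holomorphic_derivI[OF assms(4,1,2)] by auto
    from DERIV_mult[OF this]
    have "((\<lambda>x. u x * F x $ i) has_field_derivative u w * deriv (\<lambda>x. F x $ i) w + deriv u w * F w $ i) (at w)"
      by (simp add: algebra_simps)
    then show "((\<lambda>x. G x $ i) has_field_derivative u w * deriv (\<lambda>x. F x $ i) w + deriv u w * F w $ i) (at w)"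
      by (rule has_field_derivative_transform_within_open[OF _ assms(1,2)]) (simp add: assms(5))
  qed
  then show ?thesis by (simp add: vderiv_def vec_eq_iff)
qed

lemma fs_deriv_lift:
  assumes "lift f V F" "w \<in> V"
  shows "fs_deriv f w = wedge_norm (F w) (vderiv F w) / sqn (F w)"
  unfolding fs_deriv_def
proof (rule some_equality)
  show "\<exists>V' F'. lift f V' F' \<and> w \<in> V' \<and> wedge_norm (F w) (vderiv F w) / sqn (F w) = wedge_norm (F' w) (vderiv F' w) / sqn (F' w)"
    using assms by blast
  fix c assume "\<exists>V' F'. lift f V' F' \<and> w \<in> V' \<and> c = wedge_norm (F' w) (vderiv F' w) / sqn (F' w)"
  then obtain W G where G: "lift f W G" "w \<in> W" and c: "c = wedge_norm (G w) (vderiv G w) / sqn (G w)" by blast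
  from lift_ratio[OF assms(1) G(1) assms(2) G(2)] obtain u U where
    U: "open U" "w \<in> U" "U \<subseteq> V \<inter> W" "u holomorphic_on U"
    "\<And>x. x \<in> U \<Longrightarrow> u x \<noteq> 0" "\<And>x. x \<in> U \<Longrightarrow> G x = u x *s F x" by metis
  have hF: "(\<lambda>x. F x $ i) holomorphic_on U" for i
    using assms(1) U(3) unfolding lift_def by (meson holomorphic_on_subset le_inf_iff)
  have "vderiv G w = u w *s vderiv F w + deriv u w *s F w"
    by (rule vderiv_mult[OF U(1,2,4) hF U(6)])
  then show "c = wedge_norm (F w) (vderiv F w) / sqn (F w)"
    unfolding c U(6)[OF U(2)] using U(5)[OF U(2)] by (simp add: wedge_norm_scale sqn_scale)
qed

lemma fs_deriv_nonneg:
  assumes "proj_holomorphic_on f U" "w \<in> U"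
  shows "fs_deriv f w \<ge> 0"
proof -
  obtain V F where "w \<in> V" "lift f V F" using assms unfolding proj_holomorphic_on_lift by blast
  then show ?thesis by (simp add: fs_deriv_lift wedge_norm_nonneg sqn_nonneg)
qed

lemma lift_compose:
  assumes "lift f V F" "open W" "\<phi> holomorphic_on W" "\<phi> ` W \<subseteq> V"
  shows "lift (\<lambda>x. f (\<phi> x)) W (\<lambda>x. F (\<phi> x))"
proof -
  have "((\<lambda>w. F w $ i) \<circ> \<phi>) holomorphic_on W" for i
    using assms unfolding lift_def by (intro holomorphic_on_compose_gen[of _ W _ V]) auto
  then show ?thesis using assms unfolding lift_def by (auto simp: o_def)
qed

lemma proj_holomorphic_on_compose:
  assumes "proj_holomorphic_on f U" "open W" "\<phi> holomorphic_on W" "\<phi> ` W \<subseteq> U"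
  shows "proj_holomorphic_on (\<lambda>x. f (\<phi> x)) W"
  unfolding proj_holomorphic_on_lift
proof
  fix w assume w: "w \<in> W"
  then have "\<phi> w \<in> U" using assms(4) by blast
  then obtain V F where V: "\<phi> w \<in> V" "lift f V F" using assms(1) unfolding proj_holomorphic_on_lift by blast
  have "open V" using V(2) unfolding lift_def by simp
  have op: "open (W \<inter> \<phi> -` V)"
    by (rule continuous_open_preimage[OF holomorphic_on_imp_continuous_on[OF assms(3)] assms(2) \<open>open V\<close>])
  have "\<phi> holomorphic_on (W \<inter> \<phi> -` V)" by (rule holomorphic_on_subset[OF assms(3)]) simp
  from lift_compose[OF V(2) op this] have "lift (\<lambda>x. f (\<phi> x)) (W \<inter> \<phi> -` V) (\<lambda>x. F (\<phi> x))" by blast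
  then show "\<exists>V F. w \<in> V \<and> V \<subseteq> W \<and> lift (\<lambda>x. f (\<phi> x)) V F"
    using w V(1) by (intro exI[of _ "W \<inter> \<phi> -` V"] exI[of _ "\<lambda>x. F (\<phi> x)"]) simp
qed

lemma fs_deriv_compose:
  assumes "proj_holomorphic_on f U" "open W" "\<phi> holomorphic_on W" "\<phi> ` W \<subseteq> U" "w \<in> W"
  shows "fs_deriv (\<lambda>x. f (\<phi> x)) w = cmod (deriv \<phi> w) * fs_deriv f (\<phi> w)"
proof -
  have "\<phi> w \<in> U" using assms(4,5) by blast
  then obtain V F where V: "\<phi> w \<in> V" "lift f V F" using assms(1) unfolding proj_holomorphic_on_lift by blast
  define W' where "W' = W \<inter> \<phi> -` V"
  have "open V" using V(2) unfolding lift_def by simp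
  have W': "open W'" "w \<in> W'"
    unfolding W'_def
    using continuous_open_preimage[OF holomorphic_on_imp_continuous_on[OF assms(3)] assms(2) \<open>open V\<close>] assms(5) V(1)
    by simp_all
  have "\<phi> holomorphic_on W'" unfolding W'_def by (rule holomorphic_on_subset[OF assms(3)]) simp
  from lift_compose[OF V(2) W'(1) this]
  have l: "lift (\<lambda>x. f (\<phi> x)) W' (\<lambda>x. F (\<phi> x))" unfolding W'_def by blast
  have "deriv (\<lambda>x. F (\<phi> x) $ i) w = deriv \<phi> w * deriv (\<lambda>x. F x $ i) (\<phi> w)" for i
  proof (rule DERIV_imp_deriv)
    have "((\<lambda>x. F x $ i) has_field_derivative deriv (\<lambda>x. F x $ i) (\<phi> w)) (at (\<phi> w))"
      using V by (intro holomorphic_derivI[of _ V]) (auto simp: lift_def)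
    moreover have "(\<phi> has_field_derivative deriv \<phi> w) (at w)" by (rule holomorphic_derivI[OF assms(3,2,5)])
    ultimately show "((\<lambda>x. F (\<phi> x) $ i) has_field_derivative deriv \<phi> w * deriv (\<lambda>x. F x $ i) (\<phi> w)) (at w)"
      by (subst mult.commute) (rule DERIV_chain2)
  qed
  then have "vderiv (\<lambda>x. F (\<phi> x)) w = deriv \<phi> w *s vderiv F (\<phi> w)" by (simp add: vderiv_def vec_eq_iff)
  then show ?thesis
    by (simp add: fs_deriv_lift[OF l W'(2)] fs_deriv_lift[OF V(2,1)] wedge_norm_smult_right)
qed

lemma continuous_on_sqn:
  fixes F :: "complex \<Rightarrow> complex ^ 4"
  assumes "\<And>i. continuous_on S (\<lambda>x. F x $ i)"
  shows "continuous_on S (\<lambda>x. sqn (F x))"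
  unfolding sqn_def by (intro continuous_on_sum continuous_on_power continuous_on_norm assms)

lemma continuous_on_wedge_norm:
  fixes F G :: "complex \<Rightarrow> complex ^ 4"
  assumes "\<And>i. continuous_on S (\<lambda>x. F x $ i)" "\<And>i. continuous_on S (\<lambda>x. G x $ i)"
  shows "continuous_on S (\<lambda>x. wedge_norm (F x) (G x))"
  unfolding wedge_norm_def
  by (intro continuous_on_sum continuous_on_norm continuous_on_diff continuous_on_mult assms)

lemma continuous_on_fs_deriv:
  assumes "proj_holomorphic_on f U"
  shows "continuous_on U (fs_deriv f)"
proof (rule continuous_at_imp_continuous_on, rule ballI)
  fix w assume "w \<in> U"
  then obtain V F where V: "w \<in> V" "lift f V F" using assms unfolding proj_holomorphic_on_lift by blast
  have V': "open V" "\<And>i. (\<lambda>w. F w $ i) holomorphic_on V" "\<And>x. x \<in> V \<Longrightarrow> F x \<noteq> 0"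
    using V(2) unfolding lift_def by auto
  have "continuous_on V (\<lambda>x. wedge_norm (F x) (vderiv F x) / sqn (F x))"
  proof (intro continuous_on_divide continuous_on_sqn continuous_on_wedge_norm ballI
      holomorphic_on_imp_continuous_on[OF V'(2)])
    show "continuous_on V (\<lambda>x. vderiv F x $ i)" for i
      unfolding vderiv_def by (simp add: holomorphic_on_imp_continuous_on[OF holomorphic_deriv[OF V'(2,1)]])
    show "sqn (F x) \<noteq> 0" if "x \<in> V" for x using sqn_pos[OF V'(3)[OF that]] by simp
  qed
  then have "continuous_on V (fs_deriv f)"
    by (rule continuous_on_eq) (simp add: fs_deriv_lift[OF V(2)])
  then show "isCont (fs_deriv f) w" using V(1) V'(1) by (simp add: continuous_on_eq_continuous_at)
qed

subsection \<open>The embedding by orthogonal projections\<close>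

text \<open>The orthogonal projection onto the line of the point. The type \<open>proj3\<close> is a
  bare quotient without topology; distances, compactness and limits are taken among these
  matrices.\<close>

definition emb :: "proj3 \<Rightarrow> complex ^ 4 ^ 4" where
  "emb p = (\<chi> i j. rep_proj3 p $ i * cnj (rep_proj3 p $ j) / of_real (sqn (rep_proj3 p)))"

lemma emb_pt:
  assumes "z \<noteq> 0"
  shows "emb (pt z) $ i $ j = z $ i * cnj (z $ j) / of_real (sqn z)"
proof -
  obtain c where c: "c \<noteq> 0" "rep_proj3 (pt z) = c *s z"
    using pt_eq_iff[OF assms rep_proj3_nonzero[of "pt z"]] pt_rep_proj3[of "pt z"] by auto
  have "complex_of_real ((cmod c)\<^sup>2) = c * cnj c" by (metis complex_norm_square of_real_power)
  then show ?thesis using c(1) by (simp add: emb_def c(2) sqn_scale)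
qed

lemma emb_inj:
  assumes "emb p = emb q"
  shows "p = q"
proof -
  obtain z w where z: "z \<noteq> 0" "p = pt z" and w: "w \<noteq> 0" "q = pt w" using pt_surj by metis
  have e: "z $ i * cnj (z $ j) / of_real (sqn z) = w $ i * cnj (w $ j) / of_real (sqn w)" for i j
    using assms emb_pt[OF z(1), of i j] emb_pt[OF w(1), of i j] z(2) w(2) by simp
  have s: "complex_of_real (sqn z) \<noteq> 0" "complex_of_real (sqn w) \<noteq> 0" using sqn_pos[OF z(1)] sqn_pos[OF w(1)] by simp_all
  obtain j where j: "z $ j \<noteq> 0" using z(1) by (auto simp: vec_eq_iff)
  have "w $ j * cnj (w $ j) / of_real (sqn w) \<noteq> 0" using e[of j j] j s by auto
  then have wj: "w $ j \<noteq> 0" by auto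
  define k where "k = cnj (z $ j) * of_real (sqn w) / (of_real (sqn z) * cnj (w $ j))"
  have "w $ i = k * z $ i" for i
    using e[of i j] s wj unfolding k_def by (simp add: field_simps)
  then have "w = k *s z" by (simp add: vec_eq_iff)
  moreover have "k \<noteq> 0" unfolding k_def using j s wj by simp
  ultimately show ?thesis unfolding z(2) w(2) using pt_eq_iff[OF z(1) w(1)] by blast
qed

lemma cmod_emb_le: "cmod (emb p $ i $ j) \<le> 1"
proof -
  obtain z where z: "z \<noteq> 0" "p = pt z" using pt_surj by metis
  show ?thesis
    using cmod_mult_le_sqn[of z i j] sqn_pos[OF z(1)]
    by (simp add: z(2) emb_pt[OF z(1)] norm_mult norm_divide)
qed

lemma norm_matrix_le:
  fixes M :: "complex ^ 4 ^ 4"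
  assumes "\<And>i j. cmod (M $ i $ j) \<le> B"
  shows "norm M \<le> 16 * B"
proof -
  have "norm M \<le> (\<Sum>i\<in>UNIV. norm (M $ i))" unfolding norm_vec_def by (rule L2_set_le_sum) auto
  also have "\<dots> \<le> (\<Sum>i\<in>(UNIV::4 set). \<Sum>j\<in>(UNIV::4 set). cmod (M $ i $ j))"
    by (rule sum_mono, subst norm_vec_def, rule L2_set_le_sum) auto
  also have "\<dots> \<le> (\<Sum>i\<in>(UNIV::4 set). \<Sum>j\<in>(UNIV::4 set). B)" by (intro sum_mono assms)
  finally show ?thesis by simp
qed

lemma norm_emb_le: "norm (emb p) \<le> 16"
  using norm_matrix_le[of "emb p" 1] cmod_emb_le by simp

text \<open>The numerator of the differentiated quotient is a combination of the minors of
  \<open>z\<close> and its derivative with coefficients of size at most \<open>sqn z\<close>. Two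
  such sums of minors occur, hence the factor 2.\<close>

lemma emb_lift_derivative:
  assumes "lift f V F" "w \<in> V"
  obtains D where "((\<lambda>x. emb (f x) $ i $ j) has_derivative D) (at w)"
    "\<And>h. cmod (D h) \<le> 2 * fs_deriv f w * cmod h"
proof -
  have V: "open V" "\<And>i. (\<lambda>w. F w $ i) holomorphic_on V" "\<And>x. x \<in> V \<Longrightarrow> F x \<noteq> 0" "\<And>x. x \<in> V \<Longrightarrow> f x = pt (F x)"
    using assms(1) unfolding lift_def by auto
  define z where "z = F w"
  define \<zeta> where "\<zeta> h = h *s vderiv F w" for h
  define S where "S = (\<Sum>k\<in>UNIV. z $ k * cnj (z $ k))"
  have S1: "S = of_real (sqn z)" unfolding S_def by (rule sqn_complex[symmetric])
  have S: "S = of_real (sqn z)" "S \<noteq> 0"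
    using S1 sqn_pos[OF V(3)[OF assms(2)]] unfolding z_def by simp_all
  have dF: "((\<lambda>x. F x $ k) has_derivative (\<lambda>h. \<zeta> h $ k)) (at w)" for k
  proof -
    have "(\<lambda>h. \<zeta> h $ k) = (*) (deriv (\<lambda>x. F x $ k) w)"
      by (auto simp: fun_eq_iff \<zeta>_def vderiv_def)
    then show ?thesis
      using has_field_derivative_imp_has_derivative[OF holomorphic_derivI[OF V(2,1) assms(2)], of k] by simp
  qed
  have dc: "((\<lambda>x. cnj (F x $ k)) has_derivative (\<lambda>h. cnj (\<zeta> h $ k))) (at w)" for k
    using bounded_linear.has_derivative[OF bounded_linear_cnj dF] .
  define dN where "dN h = z $ i * cnj (\<zeta> h $ j) + \<zeta> h $ i * cnj (z $ j)" for h
  define dS where "dS h = (\<Sum>k\<in>UNIV. z $ k * cnj (\<zeta> h $ k) + \<zeta> h $ k * cnj (z $ k))" for h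
  have 1: "((\<lambda>x. F x $ i * cnj (F x $ j)) has_derivative dN) (at w)"
    using has_derivative_mult[OF dF dc, of i j] unfolding dN_def[abs_def] z_def .
  have 2: "((\<lambda>x. \<Sum>k\<in>UNIV. F x $ k * cnj (F x $ k)) has_derivative dS) (at w)"
    unfolding dS_def[abs_def] z_def by (intro has_derivative_sum has_derivative_mult dF dc)
  define D where "D h = (dN h * S - z $ i * cnj (z $ j) * dS h) / S\<^sup>2" for h
  have SF: "(\<Sum>k\<in>UNIV. F w $ k * cnj (F w $ k)) = S" unfolding S_def z_def ..
  have rhs: "- p * (inverse S * q * inverse S) + r / S = (r * S - p * q) / S\<^sup>2" for p q r
    using S(2) by (simp add: field_simps power2_eq_square)
  have "((\<lambda>x. F x $ i * cnj (F x $ j) / (\<Sum>k\<in>UNIV. F x $ k * cnj (F x $ k))) has_derivative D) (at w)"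
  proof -
    have nz: "(\<Sum>k\<in>UNIV. F w $ k * cnj (F w $ k)) \<noteq> 0" unfolding SF by (rule S(2))
    from has_derivative_divide[OF 1 2 nz] show ?thesis unfolding SF rhs D_def[abs_def] z_def .
  qed
  then have "((\<lambda>x. emb (f x) $ i $ j) has_derivative D) (at w)"
  proof (rule has_derivative_transform_within_open[OF _ V(1) assms(2)])
    fix x assume "x \<in> V"
    show "F x $ i * cnj (F x $ j) / (\<Sum>k\<in>UNIV. F x $ k * cnj (F x $ k)) = emb (f x) $ i $ j"
      unfolding V(4)[OF \<open>x \<in> V\<close>] emb_pt[OF V(3)[OF \<open>x \<in> V\<close>]] sqn_complex ..
  qed
  moreover have "cmod (D h) \<le> 2 * fs_deriv f w * cmod h" for h
  proof -
    have num: "dN h * S - z $ i * cnj (z $ j) * dS h = (\<Sum>k\<in>UNIV.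
        (z $ k * \<zeta> h $ i - z $ i * \<zeta> h $ k) * (cnj (z $ k) * cnj (z $ j))
        + z $ i * z $ k * cnj (z $ k * \<zeta> h $ j - z $ j * \<zeta> h $ k))"
      unfolding dN_def dS_def S_def sum_distrib_left sum_distrib_right sum_subtractf[symmetric]
      by (intro sum.cong refl) (simp add: algebra_simps)
    have "cmod (dN h * S - z $ i * cnj (z $ j) * dS h)
        \<le> (\<Sum>k\<in>UNIV. cmod (z $ i * \<zeta> h $ k - z $ k * \<zeta> h $ i) * sqn z
        + sqn z * cmod (z $ j * \<zeta> h $ k - z $ k * \<zeta> h $ j))"
      unfolding num
    proof (intro sum_norm_le order_trans[OF norm_triangle_ineq] add_mono)
      fix k
      show "cmod ((z $ k * \<zeta> h $ i - z $ i * \<zeta> h $ k) * (cnj (z $ k) * cnj (z $ j)))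
          \<le> cmod (z $ i * \<zeta> h $ k - z $ k * \<zeta> h $ i) * sqn z"
        using cmod_mult_le_sqn[of z k j]
        by (simp add: norm_mult norm_minus_commute[of "z $ k * _"] mult_left_mono)
      have "cmod (z $ i * z $ k * cnj (z $ k * \<zeta> h $ j - z $ j * \<zeta> h $ k))
          = (cmod (z $ i) * cmod (z $ k)) * cmod (z $ k * \<zeta> h $ j - z $ j * \<zeta> h $ k)"
        by (simp only: norm_mult complex_mod_cnj)
      then show "cmod (z $ i * z $ k * cnj (z $ k * \<zeta> h $ j - z $ j * \<zeta> h $ k))
          \<le> sqn z * cmod (z $ j * \<zeta> h $ k - z $ k * \<zeta> h $ j)"
        using cmod_mult_le_sqn[of z i k] by (simp add: norm_minus_commute[of "z $ k * _"] mult_right_mono)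
    qed
    also have "\<dots> = ((\<Sum>k\<in>UNIV. cmod (z $ i * \<zeta> h $ k - z $ k * \<zeta> h $ i))
        + (\<Sum>k\<in>UNIV. cmod (z $ j * \<zeta> h $ k - z $ k * \<zeta> h $ j))) * sqn z"
      by (simp only: sum.distrib distrib_right sum_distrib_right mult.commute[of "sqn z"])
    also have "\<dots> \<le> (wedge_norm z (\<zeta> h) + wedge_norm z (\<zeta> h)) * sqn z"
      by (intro mult_right_mono add_mono wedge_norm_row sqn_nonneg)
    finally have "cmod (dN h * S - z $ i * cnj (z $ j) * dS h) \<le> 2 * wedge_norm z (\<zeta> h) * sqn z" by simp
    then have "cmod (D h) \<le> 2 * wedge_norm z (\<zeta> h) * sqn z / (sqn z)\<^sup>2"
      unfolding D_def S(1) by (simp add: norm_divide norm_power divide_right_mono)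
    also have "\<dots> = 2 * (wedge_norm z (\<zeta> h) / sqn z)"
      by (simp add: power2_eq_square)
    also have "\<dots> = 2 * fs_deriv f w * cmod h"
      unfolding fs_deriv_lift[OF assms] \<zeta>_def wedge_norm_smult_right z_def by simp
    finally show ?thesis .
  qed
  ultimately show thesis by (rule that)
qed

text \<open>The constant 32 is the factor 2 of \<open>emb_lift_derivative\<close> times the 16
  matrix entries.\<close>

lemma emb_lipschitz:
  assumes f: "proj_holomorphic_on f U" and U: "convex U" and C: "\<And>w. w \<in> U \<Longrightarrow> fs_deriv f w \<le> C"
    and ab: "a \<in> U" "b \<in> U"
  shows "norm (emb (f a) - emb (f b)) \<le> 32 * C * cmod (a - b)"
proof -
  have "cmod ((emb (f a) - emb (f b)) $ i $ j) \<le> 2 * C * cmod (a - b)" for i j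
  proof -
    have "\<forall>w\<in>U. \<exists>D. ((\<lambda>x. emb (f x) $ i $ j) has_derivative D) (at w) \<and> (\<forall>h. cmod (D h) \<le> 2 * fs_deriv f w * cmod h)"
    proof
      fix w assume "w \<in> U"
      then obtain V F where "lift f V F" "w \<in> V" using f unfolding proj_holomorphic_on_lift by blast
      from emb_lift_derivative[OF this, of i j]
      show "\<exists>D. ((\<lambda>x. emb (f x) $ i $ j) has_derivative D) (at w) \<and> (\<forall>h. cmod (D h) \<le> 2 * fs_deriv f w * cmod h)" by metis
    qed
    then obtain D where D: "\<And>w. w \<in> U \<Longrightarrow> ((\<lambda>x. emb (f x) $ i $ j) has_derivative D w) (at w)"
      "\<And>w h. w \<in> U \<Longrightarrow> cmod (D w h) \<le> 2 * fs_deriv f w * cmod h" by metis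
    have "cmod (emb (f a) $ i $ j - emb (f b) $ i $ j) \<le> 2 * C * cmod (a - b)"
    proof (rule differentiable_bound[OF U _ _ ab])
      show "((\<lambda>x. emb (f x) $ i $ j) has_derivative D w) (at w within U)" if "w \<in> U" for w
        using D(1)[OF that] by (rule has_derivative_at_withinI)
      show "onorm (D w) \<le> 2 * C" if w: "w \<in> U" for w
      proof (rule onorm_le)
        fix h
        have "cmod (D w h) \<le> 2 * fs_deriv f w * cmod h" by (rule D(2)[OF w])
        also have "\<dots> \<le> 2 * C * cmod h" using C[OF w] by (intro mult_right_mono) auto
        finally show "cmod (D w h) \<le> 2 * C * cmod h" .
      qed
    qed
    then show ?thesis by simp
  qed
  from norm_matrix_le[OF this] show ?thesis by simp
qed

lemma fs_deriv_zero_imp_const: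
  assumes "proj_holomorphic_on f U" "convex U" "\<And>w. w \<in> U \<Longrightarrow> fs_deriv f w = 0" "a \<in> U" "b \<in> U"
  shows "f a = f b"
  using emb_lipschitz[OF assms(1,2) _ assms(4,5), of 0] assms(3) by (intro emb_inj) simp

subsection \<open>Hyperbolicity from a bound on discs\<close>

lemma artanh_ge_half:
  fixes x :: real
  assumes "0 \<le> x" "x < 1"
  shows "x \<le> 2 * artanh x"
proof -
  have "ln ((1 + x) / (1 - x)) = ln (1 + x) - ln (1 - x)" using assms by (intro ln_divide_pos) auto
  moreover have "ln (1 - x) \<le> - x" using ln_le_minus_one[of "1 - x"] assms by simp
  moreover have "ln (1 + x) \<ge> 0" using assms by simp
  ultimately show ?thesis by (simp add: artanh_def)
qed

lemma holomorphic_disc_compose: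
  assumes "holomorphic_disc X f" "\<phi> holomorphic_on ball 0 1" "\<phi> ` ball 0 1 \<subseteq> ball 0 1"
  shows "holomorphic_disc X (\<lambda>x. f (\<phi> x))"
  unfolding holomorphic_disc_def
proof
  have f: "proj_holomorphic_on f (ball 0 1)" "f ` ball 0 1 \<subseteq> X"
    using assms(1) unfolding holomorphic_disc_def by simp_all
  show "proj_holomorphic_on (\<lambda>x. f (\<phi> x)) (ball 0 1)"
    by (rule proj_holomorphic_on_compose[OF f(1) open_ball assms(2,3)])
  show "(\<lambda>x. f (\<phi> x)) ` ball 0 1 \<subseteq> X" using f(2) assms(3) by blast
qed

text \<open>A Moebius map moves one of two points to the centre of the disc. Near the centre the
  derivative bound makes the embedded disc Lipschitz, and far from it the embedding is bounded; so
  embedded distances are at most a constant times Poincare distances. Summation over chains shows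
  that points at pseudodistance zero coincide.\<close>

theorem kobayashi_hyperbolicI:
  assumes C: "\<And>f. holomorphic_disc X f \<Longrightarrow> fs_deriv f 0 \<le> C" "C \<ge> 0"
  shows "kobayashi_hyperbolic X"
proof -
  \<comment> \<open>\<open>64 * C\<close> is the factor 32 of \<open>emb_lipschitz\<close> times the
    bound \<open>2 * C\<close> on the half disc. The summand 64 covers
    \<open>cmod c \<ge> 1/2\<close>, where embedded points have distance at most 32.\<close>
  define K where "K = 64 * C + 64"
  have fs: "fs_deriv g w \<le> 2 * C" if g: "holomorphic_disc X g" and w: "w \<in> ball 0 (1/2)" for g w
  proof -
    \<comment> \<open>The disc of radius 1/2 about \<open>w\<close> lies in the unit disc; its
      reparametrisation by the unit disc halves the derivative.\<close>
    define \<phi> where "\<phi> \<zeta> = w + \<zeta> / 2" for \<zeta> :: complex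
    have hol: "\<phi> holomorphic_on ball 0 1" unfolding \<phi>_def[abs_def]
      by (intro holomorphic_on_add holomorphic_on_const holomorphic_on_divide holomorphic_on_ident) simp
    have im: "\<phi> ` ball 0 1 \<subseteq> ball 0 1"
    proof (rule image_subsetI)
      fix \<zeta> :: complex assume "\<zeta> \<in> ball 0 1"
      then have "cmod \<zeta> < 1" "cmod w < 1/2" using w by simp_all
      moreover have "cmod (w + \<zeta> / 2) \<le> cmod w + cmod (\<zeta> / 2)" by (rule norm_triangle_ineq)
      moreover have "cmod (\<zeta> / 2) = cmod \<zeta> / 2" by (simp add: norm_divide)
      ultimately have "cmod (w + \<zeta> / 2) < 1" by linarith
      then show "\<phi> \<zeta> \<in> ball 0 1" by (simp add: \<phi>_def)
    qed
    have "(\<phi> has_field_derivative 0 + 1 / 2) (at 0)"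
      unfolding \<phi>_def[abs_def] by (intro DERIV_add DERIV_const DERIV_cdivide DERIV_ident)
    then have d: "deriv \<phi> 0 = 1 / 2" by (simp only: add_0_left DERIV_imp_deriv)
    have "proj_holomorphic_on g (ball 0 1)" using g unfolding holomorphic_disc_def by simp
    from fs_deriv_compose[OF this open_ball hol im, of 0]
    have "fs_deriv (\<lambda>x. g (\<phi> x)) 0 = fs_deriv g w / 2" by (simp add: d) (simp add: \<phi>_def)
    moreover have "fs_deriv (\<lambda>x. g (\<phi> x)) 0 \<le> C" by (rule C(1)[OF holomorphic_disc_compose[OF g hol im]])
    ultimately show ?thesis by simp
  qed
  have dist: "norm (emb (f a) - emb (f b)) \<le> K * poincare_dist a b"
    if f: "holomorphic_disc X f" and a: "a \<in> ball 0 1" and b: "b \<in> ball 0 1" for f a b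
  proof -
    define \<phi> where "\<phi> = Moebius_function 0 (- a)"
    define c where "c = Moebius_function 0 a b"
    have na: "cmod (- a) < 1" "cmod a < 1" "cmod b < 1" using a b by auto
    have hol: "\<phi> holomorphic_on ball 0 1" unfolding \<phi>_def by (rule Moebius_function_holomorphic[OF na(1)])
    have im: "\<phi> ` ball 0 1 \<subseteq> ball 0 1"
    proof (rule image_subsetI)
      fix x :: complex assume "x \<in> ball 0 1"
      then show "\<phi> x \<in> ball 0 1" unfolding \<phi>_def using Moebius_function_norm_lt_1[OF na(1), of x 0] by simp
    qed
    have c: "\<phi> c = b" unfolding \<phi>_def c_def by (rule Moebius_function_compose) (use na in simp_all)
    have z: "\<phi> 0 = a" unfolding \<phi>_def by (simp add: Moebius_function_of_zero)
    have cm: "cmod c = cmod (a - b) / cmod (1 - cnj a * b)"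
      by (simp add: c_def Moebius_function_simple norm_divide norm_minus_commute)
    have c1: "cmod c < 1" unfolding c_def by (rule Moebius_function_norm_lt_1[OF na(2,3)])
    let ?g = "\<lambda>x. f (\<phi> x)"
    have g: "holomorphic_disc X ?g" by (rule holomorphic_disc_compose[OF f hol im])
    have "norm (emb (f a) - emb (f b)) \<le> K * cmod c"
    proof (cases "cmod c < 1/2")
      case True
      have "proj_holomorphic_on ?g (ball 0 1)" using g unfolding holomorphic_disc_def by simp
      then have g2: "proj_holomorphic_on ?g (ball 0 (1/2))"
        by (rule proj_holomorphic_on_subset[OF _ open_ball]) (simp add: subset_ball)
      have "norm (emb (?g 0) - emb (?g c)) \<le> 32 * (2 * C) * cmod (0 - c)"
      proof (rule emb_lipschitz[OF g2 convex_ball])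
        show "fs_deriv ?g w \<le> 2 * C" if "w \<in> ball 0 (1/2)" for w by (rule fs[OF g that])
      qed (use True in simp_all)
      then have "norm (emb (f a) - emb (f b)) \<le> 32 * (2 * C) * cmod c" by (simp add: z c)
      also have "\<dots> \<le> K * cmod c" by (intro mult_right_mono) (auto simp: K_def)
      finally show ?thesis .
    next
      case False
      have "norm (emb (f a) - emb (f b)) \<le> 32"
        using norm_triangle_ineq4[of "emb (f a)" "emb (f b)"] norm_emb_le[of "f a"] norm_emb_le[of "f b"] by linarith
      also have "\<dots> \<le> 64 * cmod c" using False by simp
      also have "\<dots> \<le> K * cmod c" using C(2) by (intro mult_right_mono) (auto simp: K_def)
      finally show ?thesis .
    qed
    also have "\<dots> \<le> K * poincare_dist a b"
      using artanh_ge_half[of "cmod c"] c1 C(2) unfolding poincare_dist_def cm[symmetric]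
      by (intro mult_left_mono) (auto simp: K_def)
    finally show ?thesis .
  qed
  have chain: "norm (emb p - emb q) \<le> K * r" if "disc_chain X p q r" for p q r
    using that
  proof induction
    case (step p f a r b)
    have "norm (emb p - emb (f b)) \<le> norm (emb p - emb (f a)) + norm (emb (f a) - emb (f b))"
      using norm_triangle_ineq[of "emb p - emb (f a)" "emb (f a) - emb (f b)"] by simp
    also have "\<dots> \<le> K * r + K * poincare_dist a b"
      by (intro add_mono step.IH dist step.hyps)
    finally show ?case by (simp add: distrib_left)
  qed simp
  have "p = q" if "kobayashi_pseudodist X p q = 0" for p q
  proof (rule emb_inj, rule ccontr)
    assume ne: "emb p \<noteq> emb q"
    define \<epsilon> where "\<epsilon> = norm (emb p - emb q) / K"
    have K: "K > 0" using C(2) by (simp add: K_def)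
    have "\<epsilon> > 0" using ne K by (simp add: \<epsilon>_def)
    then have "kobayashi_pseudodist X p q < ereal \<epsilon>" using that by simp
    then obtain r where r: "disc_chain X p q r" "r < \<epsilon>"
      unfolding kobayashi_pseudodist_def INF_less_iff by auto
    have "norm (emb p - emb q) < K * \<epsilon>"
      by (rule le_less_trans[OF chain[OF r(1)] mult_strict_left_mono[OF r(2) K]])
    then show False using K by (simp add: \<epsilon>_def)
  qed
  then show ?thesis unfolding kobayashi_hyperbolic_def by blast
qed

subsection \<open>Brody limits\<close>

text \<open>Zalcman's version of Brody reparametrisation: affine rescaling at a maximum of
  \<open>(1/2 - |w|) |f'(w)|\<close>.\<close>

lemma brody_rescaling:
  assumes f: "proj_holomorphic_on f (ball 0 1)" and M: "fs_deriv f 0 > 0"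
  obtains h where "proj_holomorphic_on h (ball 0 (fs_deriv f 0 / 4))"
    "h ` ball 0 (fs_deriv f 0 / 4) \<subseteq> f ` ball 0 1"
    "fs_deriv h 0 = 1" "\<And>\<zeta>. \<zeta> \<in> ball 0 (fs_deriv f 0 / 4) \<Longrightarrow> fs_deriv h \<zeta> \<le> 2"
proof -
  define \<Gamma> where "\<Gamma> w = (1/2 - cmod w) * fs_deriv f w" for w
  have "continuous_on (cball 0 (1/2)) (fs_deriv f)"
    by (rule continuous_on_subset[OF continuous_on_fs_deriv[OF f]]) auto
  then have "continuous_on (cball 0 (1/2)) \<Gamma>"
    unfolding \<Gamma>_def by (intro continuous_intros)
  moreover have "cball (0::complex) (1/2) \<noteq> {}" by simp
  ultimately obtain a where a: "a \<in> cball 0 (1/2)" "\<And>w. w \<in> cball 0 (1/2) \<Longrightarrow> \<Gamma> w \<le> \<Gamma> a"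
    using continuous_attains_sup[OF compact_cball] by blast
  define \<delta> L where "\<delta> = 1/2 - cmod a" and "L = \<Gamma> a"
  have L: "L \<ge> fs_deriv f 0 / 2" using a(2)[of 0] by (simp add: L_def \<Gamma>_def)
  then have Lpos: "L > 0" using M by simp
  have \<delta>: "\<delta> > 0"
  proof (rule ccontr)
    assume "\<not> \<delta> > 0"
    then have "1/2 - cmod a = 0" using a(1) by (simp add: \<delta>_def)
    then have "L = 0" unfolding L_def \<Gamma>_def by (simp only: mult_zero_left)
    then show False using Lpos by simp
  qed
  define s where "s = fs_deriv f a"
  have Ls: "L = \<delta> * s" by (simp add: L_def \<Gamma>_def \<delta>_def s_def)
  have s: "s > 0" using Ls Lpos \<delta> by (simp add: zero_less_mult_iff)
  define \<phi> where "\<phi> \<zeta> = a + \<zeta> / of_real s" for \<zeta> :: complex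
  let ?B = "ball (0::complex) (fs_deriv f 0 / 4)"
  \<comment> \<open>As |\<zeta>| \<le> L / 2 and L = \<delta> s, the map \<phi> moves
    \<open>a\<close> by at most \<delta> / 2. There the weight is at least half of that at the
    maximum, which gives the bound 2 for the derivative.\<close>
  have near: "1/2 - cmod (\<phi> \<zeta>) \<ge> \<delta> / 2" if "\<zeta> \<in> ?B" for \<zeta>
  proof -
    have "cmod \<zeta> \<le> L / 2" using that L by simp
    then have "cmod \<zeta> / s \<le> \<delta> / 2" using s by (simp add: Ls field_simps)
    moreover have "cmod (\<phi> \<zeta>) \<le> cmod a + cmod \<zeta> / s"
      unfolding \<phi>_def using norm_triangle_ineq[of a "\<zeta> / of_real s"] s by (simp add: norm_divide)
    ultimately show ?thesis by (simp add: \<delta>_def)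
  qed
  have hol: "\<phi> holomorphic_on ?B" unfolding \<phi>_def[abs_def] using s
    by (intro holomorphic_on_add holomorphic_on_const holomorphic_on_divide holomorphic_on_ident) simp
  have im: "\<phi> ` ?B \<subseteq> ball 0 1"
  proof (rule image_subsetI)
    fix \<zeta> assume "\<zeta> \<in> ?B"
    from near[OF this] \<delta> show "\<phi> \<zeta> \<in> ball 0 1" by simp
  qed
  have d: "deriv \<phi> \<zeta> = 1 / of_real s" for \<zeta>
  proof -
    have "(\<phi> has_field_derivative 0 + 1 / of_real s) (at \<zeta>)"
      unfolding \<phi>_def[abs_def] by (intro DERIV_add DERIV_const DERIV_cdivide DERIV_ident)
    then show ?thesis by (simp only: add_0_left DERIV_imp_deriv)
  qed
  have fs: "fs_deriv (\<lambda>x. f (\<phi> x)) \<zeta> = fs_deriv f (\<phi> \<zeta>) / s" if "\<zeta> \<in> ?B" for \<zeta>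
    using fs_deriv_compose[OF f open_ball hol im that] s by (simp add: d norm_divide)
  show thesis
  proof (rule that[of "\<lambda>x. f (\<phi> x)"])
    show "proj_holomorphic_on (\<lambda>x. f (\<phi> x)) ?B" by (rule proj_holomorphic_on_compose[OF f open_ball hol im])
    show "(\<lambda>x. f (\<phi> x)) ` ?B \<subseteq> f ` ball 0 1" using im by blast
    show "fs_deriv (\<lambda>x. f (\<phi> x)) 0 = 1" using fs[of 0] M s by (simp add: \<phi>_def s_def)
    show "fs_deriv (\<lambda>x. f (\<phi> x)) \<zeta> \<le> 2" if \<zeta>: "\<zeta> \<in> ?B" for \<zeta>
    proof -
      have n: "1/2 - cmod (\<phi> \<zeta>) \<ge> \<delta> / 2" by (rule near[OF \<zeta>])
      then have "\<phi> \<zeta> \<in> cball 0 (1/2)" using \<delta> by simp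
      then have "(1/2 - cmod (\<phi> \<zeta>)) * fs_deriv f (\<phi> \<zeta>) \<le> \<delta> * s" using a(2) unfolding Ls[symmetric] L_def \<Gamma>_def by blast
      moreover have "\<delta> / 2 * fs_deriv f (\<phi> \<zeta>) \<le> (1/2 - cmod (\<phi> \<zeta>)) * fs_deriv f (\<phi> \<zeta>)"
        by (intro mult_right_mono n fs_deriv_nonneg[OF f] subsetD[OF im imageI[OF \<zeta>]])
      ultimately have "\<delta> / 2 * fs_deriv f (\<phi> \<zeta>) \<le> \<delta> * s" by linarith
      then have "fs_deriv f (\<phi> \<zeta>) \<le> 2 * s" using \<delta> by simp
      then show ?thesis unfolding fs[OF \<zeta>] using s by (simp add: field_simps)
    qed
  qed
qed

text \<open>Locally uniform convergence of suitable lifts from some index on. It is stated for lifts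
  because the theorems of Weierstrass and Hurwitz will be applied to polynomials in their
  coordinates.\<close>

definition conv_curves :: "(nat \<Rightarrow> complex \<Rightarrow> proj3) \<Rightarrow> (complex \<Rightarrow> proj3) \<Rightarrow> bool" where
  "conv_curves h g \<longleftrightarrow> (\<forall>w\<^sub>0. \<exists>\<delta>>0. \<exists>N H G. (\<forall>k\<ge>N. lift (h k) (ball w\<^sub>0 \<delta>) (H k)) \<and> lift g (ball w\<^sub>0 \<delta>) G \<and>
     (\<forall>i. uniform_limit (ball w\<^sub>0 \<delta>) (\<lambda>k w. H k w $ i) (\<lambda>w. G w $ i) sequentially))"

lemma conv_curves_fs_deriv:
  assumes "conv_curves h g"
  shows "(\<lambda>k. fs_deriv (h k) w) \<longlonglongrightarrow> fs_deriv g w"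
proof -
  obtain \<delta> N H G where \<delta>: "\<delta> > 0" and H: "\<And>k. k \<ge> N \<Longrightarrow> lift (h k) (ball w \<delta>) (H k)"
    and G: "lift g (ball w \<delta>) G"
    and ul: "\<And>i. uniform_limit (ball w \<delta>) (\<lambda>k x. H k x $ i) (\<lambda>x. G x $ i) sequentially"
    using assms[unfolded conv_curves_def, rule_format, of w] by blast
  have wB: "w \<in> ball w \<delta>" using \<delta> by simp
  have holH: "(\<lambda>x. H k x $ i) holomorphic_on ball w \<delta>" if "k \<ge> N" for k i using H[OF that] unfolding lift_def by blast
  have tv: "(\<lambda>k. H k w $ i) \<longlonglongrightarrow> G w $ i" for i using tendsto_uniform_limitI[OF ul wB] .
  have td: "(\<lambda>k. deriv (\<lambda>x. H k x $ i) w) \<longlonglongrightarrow> deriv (\<lambda>x. G x $ i) w" for i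
  proof -
    have sub: "cball w (\<delta>/2) \<subseteq> ball w \<delta>" "ball w (\<delta>/2) \<subseteq> ball w \<delta>" using \<delta> by auto
    have ev: "\<forall>\<^sub>F k in sequentially. continuous_on (cball w (\<delta>/2)) (\<lambda>x. H k x $ i) \<and>
        (\<forall>x\<in>ball w (\<delta>/2). ((\<lambda>x. H k x $ i) has_field_derivative deriv (\<lambda>x. H k x $ i) x) (at x))"
    proof (rule eventually_sequentiallyI[of N], intro conjI ballI)
      fix k assume k: "k \<ge> N"
      show "continuous_on (cball w (\<delta>/2)) (\<lambda>x. H k x $ i)"
        using holomorphic_on_imp_continuous_on[OF holH[OF k]] sub(1) by (rule continuous_on_subset)
      fix x assume "x \<in> ball w (\<delta>/2)"
      then show "((\<lambda>x. H k x $ i) has_field_derivative deriv (\<lambda>x. H k x $ i) x) (at x)"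
        using sub(2) by (intro holomorphic_derivI[OF holH[OF k] open_ball]) blast
    qed
    have d2: "\<delta>/2 > 0" using \<delta> by simp
    obtain g' where g': "\<And>x. x \<in> ball w (\<delta>/2) \<Longrightarrow>
        ((\<lambda>x. G x $ i) has_field_derivative g' x) (at x) \<and> (\<lambda>k. deriv (\<lambda>x. H k x $ i) x) \<longlonglongrightarrow> g' x"
      by (rule has_complex_derivative_uniform_limit[OF ev uniform_limit_on_subset[OF ul sub(1)] sequentially_bot d2]) blast
    have "w \<in> ball w (\<delta>/2)" using \<delta> by simp
    note gw = g'[OF this]
    have "deriv (\<lambda>x. G x $ i) w = g' w" by (rule DERIV_imp_deriv[OF conjunct1[OF gw]])
    then show ?thesis using conjunct2[OF gw] by simp
  qed
  have "(\<lambda>k. wedge_norm (H k w) (vderiv (H k) w) / sqn (H k w)) \<longlonglongrightarrow> wedge_norm (G w) (vderiv G w) / sqn (G w)"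
  proof (rule tendsto_divide)
    show "(\<lambda>k. wedge_norm (H k w) (vderiv (H k) w)) \<longlonglongrightarrow> wedge_norm (G w) (vderiv G w)"
      unfolding wedge_norm_def vderiv_def vec_lambda_beta
      by (intro tendsto_sum tendsto_norm tendsto_diff tendsto_mult tv td)
    show "(\<lambda>k. sqn (H k w)) \<longlonglongrightarrow> sqn (G w)"
      unfolding sqn_def by (intro tendsto_sum tendsto_power tendsto_norm tv)
    have "G w \<noteq> 0" using G wB unfolding lift_def by blast
    then show "sqn (G w) \<noteq> 0" using sqn_pos by force
  qed
  moreover have "\<forall>\<^sub>F k in sequentially. wedge_norm (H k w) (vderiv (H k) w) / sqn (H k w) = fs_deriv (h k) w"
    by (rule eventually_sequentiallyI[of N]) (simp add: fs_deriv_lift[OF H wB])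
  ultimately show ?thesis unfolding fs_deriv_lift[OF G wB] by (rule Lim_transform_eventually)
qed

text \<open>The \<open>i\<close>-th column of the projection is a multiple of \<open>z\<close>;
  division by its diagonal entry normalises coordinate \<open>i\<close> to 1. This recovers a lift
  from the embedding.\<close>

lemma emb_column:
  assumes "z \<noteq> 0" "emb (pt z) $ i $ i \<noteq> 0"
  shows "z $ i \<noteq> 0" "(\<chi> j. emb (pt z) $ j $ i / emb (pt z) $ i $ i) = (1 / z $ i) *s z"
proof -
  show nz: "z $ i \<noteq> 0" using assms(2) by (auto simp: emb_pt[OF assms(1)])
  have "sqn z \<noteq> 0" using sqn_pos[OF assms(1)] by simp
  then show "(\<chi> j. emb (pt z) $ j $ i / emb (pt z) $ i $ i) = (1 / z $ i) *s z"
    using nz by (simp add: emb_pt[OF assms(1)] vec_eq_iff)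
qed

lemma emb_column_point:
  assumes "emb p $ i $ i \<noteq> 0"
  shows "(\<chi> j. emb p $ j $ i / emb p $ i $ i) \<noteq> 0" "pt (\<chi> j. emb p $ j $ i / emb p $ i $ i) = p"
proof -
  obtain z where z: "z \<noteq> 0" "p = pt z" using pt_surj by blast
  note c = emb_column[OF z(1) assms[unfolded z(2)]]
  show 1: "(\<chi> j. emb p $ j $ i / emb p $ i $ i) \<noteq> 0"
    unfolding z(2) c(2) using c(1) z(1) by (auto simp: vec_eq_iff)
  show "pt (\<chi> j. emb p $ j $ i / emb p $ i $ i) = p"
  proof -
    have "1 / z $ i \<noteq> 0" using c(1) by simp
    moreover have "(1 / z $ i) *s z \<noteq> 0" using 1 unfolding z(2) c(2) .
    ultimately have "pt z = pt ((1 / z $ i) *s z)" using pt_eq_iff[OF z(1)] by blast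
    then show ?thesis unfolding z(2) c(2) by simp
  qed
qed

lemma lift_chart:
  assumes f: "proj_holomorphic_on f V" "open V" and nz: "\<And>w. w \<in> V \<Longrightarrow> emb (f w) $ i $ i \<noteq> 0"
  shows "lift f V (\<lambda>w. \<chi> j. emb (f w) $ j $ i / emb (f w) $ i $ i)"
  unfolding lift_def
proof (intro conjI ballI allI assms(2))
  fix w assume w: "w \<in> V"
  show "(\<chi> j. emb (f w) $ j $ i / emb (f w) $ i $ i) \<noteq> 0" by (rule emb_column_point(1)[OF nz[OF w]])
  show "f w = pt (\<chi> j. emb (f w) $ j $ i / emb (f w) $ i $ i)" by (rule emb_column_point(2)[OF nz[OF w], symmetric])
next
  fix j
  have "(\<lambda>w. (\<chi> j. emb (f w) $ j $ i / emb (f w) $ i $ i) $ j) field_differentiable (at w)" if w: "w \<in> V" for w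
  proof -
    obtain W F where W: "w \<in> W" "W \<subseteq> V" "lift f W F" using f(1) w unfolding proj_holomorphic_on_lift by blast
    have F: "open W" "\<And>i. (\<lambda>w. F w $ i) holomorphic_on W" "\<And>x. x \<in> W \<Longrightarrow> F x \<noteq> 0" "\<And>x. x \<in> W \<Longrightarrow> f x = pt (F x)"
      using W(3) unfolding lift_def by auto
    have col: "F x $ i \<noteq> 0" "(\<chi> j. emb (f x) $ j $ i / emb (f x) $ i $ i) $ j = F x $ j / F x $ i" if x: "x \<in> W" for x
    proof -
      have "emb (pt (F x)) $ i $ i \<noteq> 0" using nz[of x] W(2) x F(4)[OF x] by auto
      from emb_column[OF F(3)[OF x] this]
      show "F x $ i \<noteq> 0" "(\<chi> j. emb (f x) $ j $ i / emb (f x) $ i $ i) $ j = F x $ j / F x $ i"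
        unfolding F(4)[OF x] by simp_all
    qed
    have "(\<lambda>x. F x $ j / F x $ i) holomorphic_on W"
      by (intro holomorphic_on_divide F(2) col(1))
    then have "(\<lambda>x. (\<chi> j. emb (f x) $ j $ i / emb (f x) $ i $ i) $ j) holomorphic_on W"
      by (rule holomorphic_transform) (simp only: col(2))
    then show ?thesis using F(1) W(1) by (rule holomorphic_on_imp_differentiable_at)
  qed
  then show "(\<lambda>w. (\<chi> j. emb (f w) $ j $ i / emb (f w) $ i $ i) $ j) holomorphic_on V"
    using assms(2) by (simp only: holomorphic_on_open field_differentiable_def) blast
qed

lemma compact_range_emb: "compact (Set.range emb)"
proof -
  define \<Phi> :: "complex ^ 4 \<Rightarrow> complex ^ 4 ^ 4" where "\<Phi> z = (\<chi> i j. z $ i * cnj (z $ j) / of_real (sqn z))" for z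
  have \<Phi>: "\<Phi> z = emb (pt z)" if "z \<noteq> 0" for z
    using emb_pt[OF that] by (simp add: \<Phi>_def vec_eq_iff)
  have "continuous_on (sphere 0 1) \<Phi>"
    unfolding \<Phi>_def
  proof (intro continuous_on_vec_lambda continuous_on_divide continuous_on_mult continuous_on_of_real continuous_on_cnj ballI)
    show "continuous_on (sphere (0::complex^4) 1) sqn" unfolding sqn_def[abs_def] by (intro continuous_intros)
    fix z :: "complex ^ 4" assume "z \<in> sphere 0 1"
    then have "z \<noteq> 0" by auto
    then show "complex_of_real (sqn z) \<noteq> 0" using sqn_pos by force
  qed (intro continuous_intros)+
  then have "compact (\<Phi> ` sphere 0 1)" by (rule compact_continuous_image) simp
  moreover have "\<Phi> ` sphere 0 1 = Set.range emb"
  proof (intro set_eqI iffI)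
    fix M assume "M \<in> \<Phi> ` sphere 0 1"
    then obtain z where "z \<in> sphere 0 1" "M = \<Phi> z" by blast
    moreover then have "z \<noteq> 0" by auto
    ultimately show "M \<in> Set.range emb" using \<Phi> by blast
  next
    fix M assume "M \<in> Set.range emb"
    then obtain p where "M = emb p" by blast
    moreover obtain z where z: "z \<noteq> 0" "p = pt z" using pt_surj by blast
    define y where "y = complex_of_real (1 / norm z) *s z"
    have yz: "y = (1 / norm z) *\<^sub>R z"
      unfolding y_def vec_eq_iff vector_smult_component vector_scaleR_component
      by (simp add: scaleR_conv_of_real)
    have y: "norm y = 1" using z(1) by (simp add: yz)
    then have y0: "y \<noteq> 0" by auto
    have "complex_of_real (1 / norm z) \<noteq> 0" using z(1) by simp
    then have "pt z = pt y" using pt_eq_iff[OF z(1) y0] unfolding y_def by blast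
    then have "emb p = \<Phi> y" unfolding z(2) using \<Phi>[OF y0] by simp
    ultimately show "M \<in> \<Phi> ` sphere 0 1" using y by auto
  qed
  ultimately show ?thesis by simp
qed

text \<open>The theorem of Arzela and Ascoli on each disc of integer radius, followed by a diagonal
  argument. The limits on the discs agree, being pointwise limits of one sequence.\<close>

lemma lipschitz_subsequence:
  fixes e :: "nat \<Rightarrow> complex \<Rightarrow> complex ^ 4 ^ 4"
  assumes bd: "\<And>k w. norm (e k w) \<le> B" and lip: "\<And>k v w. norm (e k v - e k w) \<le> K * cmod (v - w)"
  obtains r :: "nat \<Rightarrow> nat" and L where "strict_mono r"
    "\<And>i::nat. uniform_limit (cball 0 (real i)) (\<lambda>n. e (r n)) L sequentially"
proof -
  define P where "P i s \<longleftrightarrow> (\<exists>L. uniform_limit (cball 0 (real i)) (\<lambda>n. e (s n)) L sequentially)"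
    for i and s :: "nat \<Rightarrow> nat"
  have K: "K \<ge> 0"
  proof -
    have "0 \<le> norm (e 0 1 - e 0 0)" by simp
    also have "\<dots> \<le> K * cmod (1 - 0)" by (rule lip)
    finally show ?thesis by simp
  qed
  have sub: "\<exists>k. strict_mono (k :: nat \<Rightarrow> nat) \<and> P i (s \<circ> k)" for i and s :: "nat \<Rightarrow> nat"
  proof -
    obtain g k where gk: "strict_mono (k :: nat \<Rightarrow> nat)"
      "\<And>\<epsilon>. 0 < \<epsilon> \<Longrightarrow> \<exists>N. \<forall>n x. n \<ge> N \<and> x \<in> cball 0 (real i) \<longrightarrow> norm (e (s (k n)) x - g x) < \<epsilon>"
    proof (rule Arzela_Ascoli[of "cball (0::complex) (real i)" "\<lambda>n. e (s n)" B])
      show "compact (cball (0::complex) (real i))" by simp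
      show "norm (e (s n) x) \<le> B" for n x by (rule bd)
      show "\<exists>d>0. \<forall>n y. y \<in> cball 0 (real i) \<and> norm (x - y) < d \<longrightarrow> norm (e (s n) x - e (s n) y) < \<epsilon>"
        if "0 < \<epsilon>" for x \<epsilon>
      proof (intro exI[of _ "\<epsilon> / (K + 1)"] conjI allI impI)
        show "\<epsilon> / (K + 1) > 0" using that K by simp
        fix n y assume "y \<in> cball 0 (real i) \<and> norm (x - y) < \<epsilon> / (K + 1)"
        then have lt: "(K + 1) * norm (x - y) < \<epsilon>" using K by (simp add: field_simps)
        have "norm (e (s n) x - e (s n) y) \<le> K * norm (x - y)" by (rule lip)
        also have "\<dots> \<le> (K + 1) * norm (x - y)" by (intro mult_right_mono) auto
        finally show "norm (e (s n) x - e (s n) y) < \<epsilon>" using lt by linarith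
      qed
    qed blast
    have "uniform_limit (cball 0 (real i)) (\<lambda>n. e ((s \<circ> k) n)) g sequentially"
    proof (rule uniform_limitI)
      fix \<epsilon> :: real assume "\<epsilon> > 0"
      then obtain N where "\<forall>n x. n \<ge> N \<and> x \<in> cball 0 (real i) \<longrightarrow> norm (e (s (k n)) x - g x) < \<epsilon>"
        using gk(2) by blast
      then show "\<forall>\<^sub>F n in sequentially. \<forall>x\<in>cball 0 (real i). dist (e ((s \<circ> k) n) x) (g x) < \<epsilon>"
        by (intro eventually_sequentiallyI[of N]) (simp add: dist_norm)
    qed
    then show ?thesis unfolding P_def using gk(1) by blast
  qed
  have P_P: "P i (s \<circ> k2)" if P1: "P i (s \<circ> k1)" and k2: "\<And>j. N \<le> j \<Longrightarrow> \<exists>j'. j \<le> j' \<and> k2 j = k1 j'"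
    for i and s k1 k2 :: "nat \<Rightarrow> nat" and N
  proof -
    obtain L where L: "uniform_limit (cball 0 (real i)) (\<lambda>n. e ((s \<circ> k1) n)) L sequentially"
      using P1 unfolding P_def by blast
    have "uniform_limit (cball 0 (real i)) (\<lambda>n. e ((s \<circ> k2) n)) L sequentially"
    proof (rule uniform_limitI)
      fix \<epsilon> :: real assume "\<epsilon> > 0"
      from uniform_limitD[OF L this] obtain M where
        M: "\<And>n. n \<ge> M \<Longrightarrow> \<forall>x\<in>cball 0 (real i). dist (e ((s \<circ> k1) n) x) (L x) < \<epsilon>"
        unfolding eventually_sequentially by blast
      show "\<forall>\<^sub>F n in sequentially. \<forall>x\<in>cball 0 (real i). dist (e ((s \<circ> k2) n) x) (L x) < \<epsilon>"
      proof (rule eventually_sequentiallyI[of "max M N"])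
        fix n assume "n \<ge> max M N"
        then obtain j' where "n \<le> j'" "k2 n = k1 j'" using k2[of n] by auto
        then show "\<forall>x\<in>cball 0 (real i). dist (e ((s \<circ> k2) n) x) (L x) < \<epsilon>"
          using M[of j'] \<open>n \<ge> max M N\<close> by simp
      qed
    qed
    then show ?thesis unfolding P_def by blast
  qed
  obtain r where r: "strict_mono (r :: nat \<Rightarrow> nat)" "\<And>i. P i (id \<circ> r)"
  proof (rule subsequence_diagonalization_lemma[of P id])
    show "\<exists>k. strict_mono (k :: nat \<Rightarrow> nat) \<and> P i (s \<circ> k)" for i and s :: "nat \<Rightarrow> nat" by (rule sub)
    show "P i (s \<circ> k2)" if "P i (s \<circ> k1)" "\<And>j. N \<le> j \<Longrightarrow> \<exists>j'. j \<le> j' \<and> k2 j = k1 j'"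
      for i and s k1 k2 :: "nat \<Rightarrow> nat" and N
      by (rule P_P[of i s k1 N k2]) (use that in blast)+
  qed blast
  have "\<forall>i. \<exists>L. uniform_limit (cball 0 (real i)) (\<lambda>n. e (r n)) L sequentially"
    using r(2) unfolding P_def by simp
  then obtain L where L: "\<And>i. uniform_limit (cball 0 (real i)) (\<lambda>n. e (r n)) (L i) sequentially" by metis
  define L' where "L' w = lim (\<lambda>n. e (r n) w)" for w
  have "L' w = L i w" if "w \<in> cball 0 (real i)" for w i
    unfolding L'_def using tendsto_uniform_limitI[OF L that] by (rule limI)
  then have "uniform_limit (cball 0 (real i)) (\<lambda>n. e (r n)) L' sequentially" for i
    using L[of i] by (subst uniform_limit_cong'[where g = "\<lambda>n. e (r n)" and i = "L i"]) auto
  then show thesis using that r(1) by blast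
qed

text \<open>The projection has trace 1 and four diagonal entries. So at every point some affine
  chart is available with a uniform bound.\<close>

lemma emb_diag_large: "\<exists>i. cmod (emb p $ i $ i) \<ge> 1/4"
proof -
  obtain z where z: "z \<noteq> 0" "p = pt z" using pt_surj by blast
  have "(\<Sum>i\<in>UNIV. emb p $ i $ i) = (\<Sum>i\<in>UNIV. z $ i * cnj (z $ i)) / of_real (sqn z)"
    unfolding z(2) emb_pt[OF z(1)] sum_divide_distrib ..
  also have "\<dots> = 1" using sqn_pos[OF z(1)] unfolding sqn_complex[symmetric] by simp
  finally have s: "(\<Sum>i\<in>UNIV. emb p $ i $ i) = 1" .
  show ?thesis
  proof (rule ccontr)
    assume "\<not> ?thesis"
    then have "cmod (emb p $ i $ i) < 1/4" for i by (simp add: not_le)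
    then have "(\<Sum>i\<in>(UNIV :: 4 set). cmod (emb p $ i $ i)) < (\<Sum>i\<in>(UNIV :: 4 set). 1/4)"
      by (intro sum_strict_mono) auto
    moreover have "cmod (\<Sum>i\<in>UNIV. emb p $ i $ i) \<le> (\<Sum>i\<in>UNIV. cmod (emb p $ i $ i))" by (rule norm_sum)
    ultimately show False using s by simp
  qed
qed

lemma cmod_entry_le: "cmod (M $ i $ j) \<le> norm (M :: complex ^ 4 ^ 4)"
  using Finite_Cartesian_Product.norm_nth_le[of "M $ i" j] Finite_Cartesian_Product.norm_nth_le[of M i] by linarith

text \<open>Over the common denominator, which is at least 1/64, the numerator is at most
  \<open>2 * \<epsilon>\<close>.\<close>

lemma quotient_diff_le:
  fixes a b a' b' :: complex
  assumes "cmod (a - a') \<le> \<epsilon>" "cmod (b - b') \<le> \<epsilon>" "cmod a' \<le> 1" "cmod b \<ge> 1/8" "cmod b' \<ge> 1/8" "cmod b' \<le> 1"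
  shows "cmod (a / b - a' / b') \<le> 128 * \<epsilon>"
proof -
  have nz: "b \<noteq> 0" "b' \<noteq> 0" using assms by auto
  have e0: "\<epsilon> \<ge> 0" using assms(1) norm_ge_zero by (rule order_trans[rotated])
  have "a / b - a' / b' = ((a - a') * b' + a' * (b' - b)) / (b * b')"
    using nz by (simp add: field_simps)
  then have "cmod (a / b - a' / b') = cmod ((a - a') * b' + a' * (b' - b)) / (cmod b * cmod b')"
    by (simp add: norm_divide norm_mult)
  also have "\<dots> \<le> (\<epsilon> * 1 + 1 * \<epsilon>) / (1/8 * (1/8))"
  proof (intro frac_le mult_mono order_trans[OF norm_triangle_ineq] add_mono)
    show "cmod ((a - a') * b') \<le> \<epsilon> * 1" unfolding norm_mult using assms e0 by (intro mult_mono) auto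
    show "cmod (a' * (b' - b)) \<le> 1 * \<epsilon>"
      unfolding norm_mult using assms e0 by (intro mult_mono) (auto simp: norm_minus_commute)
  qed (use assms e0 in auto)
  finally show ?thesis by simp
qed

text \<open>The embedded curves are uniformly Lipschitz, so a subsequence converges locally
  uniformly, with limit in the compact image of \<open>emb\<close>. In the chart of a large diagonal
  entry the lifts converge too, which makes the limit holomorphic and lets the derivative 1 at the
  centre survive.\<close>

theorem brody_limit:
  assumes hol: "\<And>k::nat. proj_holomorphic_on (h k) (ball 0 (real k))"
    and bd: "\<And>k \<zeta>. \<zeta> \<in> ball 0 (real k) \<Longrightarrow> fs_deriv (h k) \<zeta> \<le> 2"
    and one: "\<And>k. k \<ge> 1 \<Longrightarrow> fs_deriv (h k) 0 = 1"
  obtains r :: "nat \<Rightarrow> nat" and g where "strict_mono r" "conv_curves (\<lambda>k. h (r k)) g" "proj_holomorphic_on g UNIV"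
    "\<And>w. fs_deriv g w \<le> 2" "fs_deriv g 0 = 1"
proof -
  \<comment> \<open>Composition with the nearest point of the closed disc of radius k / 2 extends
    the k-th curve to the whole plane without increasing the Lipschitz constant.\<close>
  define cl where "cl k = closest_point (cball (0::complex) (real k / 2))" for k :: nat
  define e where "e k w = emb (h k (cl k w))" for k w
  have cl_in: "cl k w \<in> cball 0 (real k / 2)" for k w
    unfolding cl_def by (rule closest_point_in_set) auto
  have lip: "norm (e k v - e k w) \<le> 64 * cmod (v - w)" for k v w
  proof (cases "k = 0")
    case True
    then have "cl k v = cl k w" using cl_in[of k v] cl_in[of k w] by simp
    then show ?thesis by (simp add: e_def)
  next
    case False
    have in_ball: "cl k v \<in> ball 0 (real k)" "cl k w \<in> ball 0 (real k)"
      using cl_in[of k v] cl_in[of k w] False by auto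
    have "norm (e k v - e k w) \<le> 32 * 2 * cmod (cl k v - cl k w)"
      unfolding e_def by (rule emb_lipschitz[OF hol convex_ball]) (use bd in_ball in auto)
    also have "\<dots> \<le> 64 * cmod (v - w)"
      using closest_point_lipschitz[of "cball (0::complex) (real k / 2)" v w]
      by (simp add: cl_def dist_norm)
    finally show ?thesis .
  qed
  have bdd: "norm (e k w) \<le> 16" for k w unfolding e_def by (rule norm_emb_le)
  obtain r :: "nat \<Rightarrow> nat" and L where r: "strict_mono r"
    and ul: "\<And>i::nat. uniform_limit (cball 0 (real i)) (\<lambda>n. e (r n)) L sequentially"
  proof (rule lipschitz_subsequence[of e 16 64])
    show "norm (e k w) \<le> 16" for k w by (rule bdd)
    show "norm (e k v - e k w) \<le> 64 * cmod (v - w)" for k v w by (rule lip)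
  qed (rule that)
  have pw: "(\<lambda>n. e (r n) w) \<longlonglongrightarrow> L w" for w
  proof -
    obtain i :: nat where "cmod w \<le> real i" using real_arch_simple by blast
    then have "w \<in> cball 0 (real i)" by simp
    then show ?thesis by (rule tendsto_uniform_limitI[OF ul])
  qed
  have L_lip: "norm (L v - L w) \<le> 64 * cmod (v - w)" for v w
    by (rule Lim_norm_ubound[OF sequentially_bot tendsto_diff[OF pw pw]]) (simp add: lip)
  have Lr: "L w \<in> Set.range emb" for w
    by (rule closed_sequentially[OF compact_imp_closed[OF compact_range_emb] _ pw[of w]]) (simp add: e_def)
  define g where "g w = (SOME p. L w = emb p)" for w
  have g: "emb (g w) = L w" for w
  proof -
    obtain p where "L w = emb p" using Lr[of w] by (rule rangeE)
    then show ?thesis unfolding g_def by (metis (mono_tags) someI)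
  qed
  have local: "\<exists>\<delta>>0. \<exists>N H G. (\<forall>k\<ge>N. lift (h (r k)) (ball w\<^sub>0 \<delta>) (H k)) \<and> lift g (ball w\<^sub>0 \<delta>) G \<and>
     (\<forall>i. uniform_limit (ball w\<^sub>0 \<delta>) (\<lambda>k w. H k w $ i) (\<lambda>w. G w $ i) sequentially)" for w\<^sub>0
  proof -
    \<comment> \<open>Chosen with \<open>64 * \<delta> = 1/16\<close>: on the ball the diagonal
      entry of the limit is at least 3/16 and that of late curves at least 1/8.\<close>
    define \<delta> where "\<delta> = (1 / 1024 :: real)"
    obtain i where i: "cmod (L w\<^sub>0 $ i $ i) \<ge> 1/4" using emb_diag_large[of "g w\<^sub>0"] g by metis
    obtain R :: nat where R: "cmod w\<^sub>0 + 1 \<le> real R" using real_arch_simple by blast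
    have sub: "ball w\<^sub>0 \<delta> \<subseteq> cball 0 (real R)"
    proof
      fix w assume "w \<in> ball w\<^sub>0 \<delta>"
      then have "cmod (w\<^sub>0 - w) < 1" by (simp add: dist_norm \<delta>_def)
      then show "w \<in> cball 0 (real R)" using R norm_triangle_ineq2[of w w\<^sub>0] by (simp add: norm_minus_commute)
    qed
    have Lii: "cmod (L w $ i $ i) \<ge> 3/16" if "w \<in> ball w\<^sub>0 \<delta>" for w
    proof -
      have "cmod ((L w\<^sub>0 - L w) $ i $ i) \<le> 64 * cmod (w\<^sub>0 - w)" using cmod_entry_le L_lip by (rule order_trans)
      also have "\<dots> \<le> 1/16" using that by (simp add: dist_norm \<delta>_def)
      finally show ?thesis using i norm_triangle_ineq2[of "L w\<^sub>0 $ i $ i" "L w $ i $ i"] by simp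
    qed
    have "\<forall>\<^sub>F n in sequentially. \<forall>w\<in>cball 0 (real R). dist (e (r n) w) (L w) < 1/16"
      by (rule uniform_limitD[OF ul]) simp
    then obtain N0 where N0: "\<And>n w. n \<ge> N0 \<Longrightarrow> w \<in> cball 0 (real R) \<Longrightarrow> dist (e (r n) w) (L w) < 1/16"
      unfolding eventually_sequentially by blast
    \<comment> \<open>The second bound places the ball in the disc where \<open>cl\<close> is the
      identity.\<close>
    define N where "N = max N0 (2 * R + 2)"
    have e_eq: "e (r k) w = emb (h (r k) w)" "w \<in> ball 0 (real (r k))" if k: "k \<ge> N" and w: "w \<in> ball w\<^sub>0 \<delta>" for k w
    proof -
      have "r k \<ge> k" by (rule seq_suble[OF r])
      then have rk: "real (r k) \<ge> 2 * real R + 2" using k unfolding N_def by linarith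
      have w': "cmod w \<le> real R" using sub w by auto
      then have "cl (r k) w = w" unfolding cl_def by (intro closest_point_self) (use rk in simp)
      then show "e (r k) w = emb (h (r k) w)" by (simp add: e_def)
      show "w \<in> ball 0 (real (r k))" using w' rk by simp
    qed
    have eii: "cmod (emb (h (r k) w) $ i $ i) \<ge> 1/8" if k: "k \<ge> N" and w: "w \<in> ball w\<^sub>0 \<delta>" for k w
    proof -
      have "dist (e (r k) w) (L w) < 1/16" using N0 k sub w unfolding N_def by auto
      then have "norm (L w - emb (h (r k) w)) < 1/16" using e_eq(1)[OF k w] by (simp add: dist_norm norm_minus_commute)
      then have "cmod ((L w - emb (h (r k) w)) $ i $ i) < 1/16" by (rule le_less_trans[OF cmod_entry_le])
      then show ?thesis using Lii[OF w] norm_triangle_ineq2[of "L w $ i $ i" "emb (h (r k) w) $ i $ i"] by simp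
    qed
    define H where "H k w = (\<chi> j. emb (h (r k) w) $ j $ i / emb (h (r k) w) $ i $ i)" for k w
    define G where "G w = (\<chi> j. emb (g w) $ j $ i / emb (g w) $ i $ i)" for w
    have lH: "lift (h (r k)) (ball w\<^sub>0 \<delta>) (H k)" if k: "k \<ge> N" for k
      unfolding H_def[abs_def]
    proof (rule lift_chart[OF _ open_ball])
      show "proj_holomorphic_on (h (r k)) (ball w\<^sub>0 \<delta>)"
        by (rule proj_holomorphic_on_subset[OF hol open_ball]) (use e_eq(2)[OF k] in blast)
      show "emb (h (r k) w) $ i $ i \<noteq> 0" if "w \<in> ball w\<^sub>0 \<delta>" for w using eii[OF k that] by auto
    qed
    have ulH: "uniform_limit (ball w\<^sub>0 \<delta>) (\<lambda>k w. H k w $ j) (\<lambda>w. G w $ j) sequentially" for j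
    proof (rule uniform_limitI)
      fix \<epsilon> :: real assume \<epsilon>: "\<epsilon> > 0"
      then have "\<forall>\<^sub>F n in sequentially. \<forall>w\<in>cball 0 (real R). dist (e (r n) w) (L w) < \<epsilon> / 256"
        by (intro uniform_limitD[OF ul]) simp
      then obtain M where M: "\<And>n w. n \<ge> M \<Longrightarrow> w \<in> cball 0 (real R) \<Longrightarrow> dist (e (r n) w) (L w) < \<epsilon> / 256"
        unfolding eventually_sequentially by blast
      show "\<forall>\<^sub>F k in sequentially. \<forall>w\<in>ball w\<^sub>0 \<delta>. dist (H k w $ j) (G w $ j) < \<epsilon>"
      proof (rule eventually_sequentiallyI[of "max M N"], rule ballI)
        fix k w assume "k \<ge> max M N" and w: "w \<in> ball w\<^sub>0 \<delta>"
        then have k: "k \<ge> M" "k \<ge> N" by auto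
        have "norm (emb (h (r k) w) - emb (g w)) < \<epsilon> / 256"
          using M[OF k(1) subsetD[OF sub w]] unfolding e_eq(1)[OF k(2) w] g dist_norm .
        then have le: "cmod ((emb (h (r k) w) - emb (g w)) $ a $ b) \<le> \<epsilon> / 256" for a b
          using cmod_entry_le[of "emb (h (r k) w) - emb (g w)" a b] by linarith
        have "cmod (emb (h (r k) w) $ j $ i / emb (h (r k) w) $ i $ i - emb (g w) $ j $ i / emb (g w) $ i $ i) \<le> 128 * (\<epsilon> / 256)"
          using le[of j i] le[of i i] eii[OF k(2) w] Lii[OF w] cmod_emb_le[of "g w"]
          by (intro quotient_diff_le) (auto simp: g)
        then show "dist (H k w $ j) (G w $ j) < \<epsilon>" using \<epsilon> by (simp add: H_def G_def dist_norm)
      qed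
    qed
    have lG: "lift g (ball w\<^sub>0 \<delta>) G"
      unfolding lift_def
    proof (intro conjI allI ballI open_ball)
      fix w assume "w \<in> ball w\<^sub>0 \<delta>"
      from Lii[OF this] have "emb (g w) $ i $ i \<noteq> 0" unfolding g by auto
      from emb_column_point[OF this] show "G w \<noteq> 0" "g w = pt (G w)" unfolding G_def by simp_all
    next
      fix j
      show "(\<lambda>w. G w $ j) holomorphic_on ball w\<^sub>0 \<delta>"
      proof (rule holomorphic_uniform_sequence[OF open_ball])
        show "(\<lambda>w. H (k + N) w $ j) holomorphic_on ball w\<^sub>0 \<delta>" for k using lH[of "k + N"] unfolding lift_def by simp
        fix w assume "w \<in> ball w\<^sub>0 \<delta>"
        then obtain d where d: "d > 0" "cball w d \<subseteq> ball w\<^sub>0 \<delta>" using open_contains_cball open_ball by blast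
        have "uniform_limit (ball w\<^sub>0 \<delta>) (\<lambda>k w. H (k + N) w $ j) (\<lambda>w. G w $ j) sequentially"
          using ulH[of j] by (rule filterlim_compose[OF _ filterlim_add_const_nat_at_top, unfolded o_def])
        then show "\<exists>d>0. cball w d \<subseteq> ball w\<^sub>0 \<delta> \<and> uniform_limit (cball w d) (\<lambda>k w. H (k + N) w $ j) (\<lambda>w. G w $ j) sequentially"
          using d uniform_limit_on_subset by blast
      qed
    qed
    have "\<delta> > 0" by (simp add: \<delta>_def)
    then show ?thesis using lH lG ulH by blast
  qed
  have conv: "conv_curves (\<lambda>k. h (r k)) g" unfolding conv_curves_def using local by blast
  have hg: "proj_holomorphic_on g UNIV"
    unfolding proj_holomorphic_on_lift
  proof
    fix w
    obtain \<delta> G where "\<delta> > 0" "lift g (ball w \<delta>) G" using local[of w] by blast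
    then show "\<exists>V F. w \<in> V \<and> V \<subseteq> UNIV \<and> lift g V F" by (intro exI[of _ "ball w \<delta>"] exI[of _ G]) simp
  qed
  show thesis
  proof (rule that[OF r conv hg])
    fix w
    obtain R :: nat where R: "cmod w < real R" using reals_Archimedean2 by blast
    have "\<forall>\<^sub>F k in sequentially. fs_deriv (h (r k)) w \<le> 2"
    proof (rule eventually_sequentiallyI[of R])
      fix k assume "k \<ge> R"
      then have "r k \<ge> R" using seq_suble[OF r, of k] by linarith
      then show "fs_deriv (h (r k)) w \<le> 2" by (intro bd) (use R in simp)
    qed
    then show "fs_deriv g w \<le> 2" by (rule tendsto_upperbound[OF conv_curves_fs_deriv[OF conv] _ sequentially_bot])
  next
    have "\<forall>\<^sub>F k in sequentially. fs_deriv (h (r k)) 0 = 1"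
    proof (rule eventually_sequentiallyI[of 1])
      fix k :: nat assume "k \<ge> 1"
      then have "r k \<ge> 1" using seq_suble[OF r, of k] by linarith
      then show "fs_deriv (h (r k)) 0 = 1" by (rule one)
    qed
    then have "(\<lambda>k. fs_deriv (h (r k)) 0) \<longlonglongrightarrow> 1" by (rule tendsto_eventually)
    then show "fs_deriv g 0 = 1" by (rule LIMSEQ_unique[OF conv_curves_fs_deriv[OF conv]])
  qed
qed

subsection \<open>Polynomial functions along curves\<close>

text \<open>Polynomial functions, unlike formal polynomials, admit a linear change of coordinates by
  mere composition.\<close>

inductive polyfun :: "(complex ^ 4 \<Rightarrow> complex) \<Rightarrow> bool" where
  const: "polyfun (\<lambda>z. c)"
| coord: "polyfun (\<lambda>z. z $ i)"
| add: "polyfun a \<Longrightarrow> polyfun b \<Longrightarrow> polyfun (\<lambda>z. a z + b z)"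
| mult: "polyfun a \<Longrightarrow> polyfun b \<Longrightarrow> polyfun (\<lambda>z. a z * b z)"

lemma polyfun_sum: "(\<And>i. i \<in> A \<Longrightarrow> polyfun (f i)) \<Longrightarrow> polyfun (\<lambda>z. \<Sum>i\<in>A. f i z)"
  by (induction A rule: infinite_finite_induct) (simp_all add: polyfun.const polyfun.add)

lemma polyfun_prod: "(\<And>i. i \<in> A \<Longrightarrow> polyfun (f i)) \<Longrightarrow> polyfun (\<lambda>z. \<Prod>i\<in>A. f i z)"
  by (induction A rule: infinite_finite_induct) (simp_all add: polyfun.const polyfun.mult)

lemma polyfun_power: "polyfun f \<Longrightarrow> polyfun (\<lambda>z. f z ^ n)"
  by (induction n) (simp_all add: polyfun.const polyfun.mult)

lemma polyfun_meval:
  assumes "\<And>i. polyfun (\<lambda>z. l z i)"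
  shows "polyfun (\<lambda>z. meval g (l z))"
  unfolding meval_def
  by (intro polyfun_sum polyfun.mult polyfun.const polyfun_prod polyfun_power assms)

lemma polyfun_continuous: "polyfun a \<Longrightarrow> continuous_on S a"
  by (induction rule: polyfun.induct) (auto intro!: continuous_intros)

lemma polyfun_derivative:
  assumes "polyfun a"
  shows "\<exists>D. (\<forall>j. polyfun (D j)) \<and>
    (\<forall>F w. (\<forall>i. (\<lambda>x. F x $ i) field_differentiable (at w)) \<longrightarrow>
       ((\<lambda>x. a (F x)) has_field_derivative (\<Sum>j\<in>UNIV. D j (F w) * deriv (\<lambda>x. F x $ j) w)) (at w))"
  using assms
proof induction
  case (const c)
  show ?case by (intro exI[of _ "\<lambda>j z. 0"]) (simp add: polyfun.const)
next
  case (coord i)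
  show ?case
  proof (intro exI[of _ "\<lambda>j z. if j = i then 1 else 0"] conjI allI impI)
    fix F :: "complex \<Rightarrow> complex ^ 4" and w assume "\<forall>i. (\<lambda>x. F x $ i) field_differentiable (at w)"
    then have "((\<lambda>x. F x $ i) has_field_derivative deriv (\<lambda>x. F x $ i) w) (at w)"
      by (simp add: field_differentiable_derivI)
    then show "((\<lambda>x. F x $ i) has_field_derivative (\<Sum>j\<in>UNIV. (if j = i then 1 else 0) * deriv (\<lambda>x. F x $ j) w)) (at w)"
      by (simp add: if_distrib[of "\<lambda>y. y * _"] cong: if_cong)
  qed (simp add: polyfun.const)
next
  case (add a b)
  then obtain D E where D: "\<And>j. polyfun (D j)" "\<And>F w. \<forall>i. (\<lambda>x. F x $ i) field_differentiable (at w) \<Longrightarrow>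
       ((\<lambda>x. a (F x)) has_field_derivative (\<Sum>j\<in>UNIV. D j (F w) * deriv (\<lambda>x. F x $ j) w)) (at w)"
    and E: "\<And>j. polyfun (E j)" "\<And>F w. \<forall>i. (\<lambda>x. F x $ i) field_differentiable (at w) \<Longrightarrow>
       ((\<lambda>x. b (F x)) has_field_derivative (\<Sum>j\<in>UNIV. E j (F w) * deriv (\<lambda>x. F x $ j) w)) (at w)"
    by blast
  show ?case
  proof (intro exI[of _ "\<lambda>j z. D j z + E j z"] conjI allI impI polyfun.add D(1) E(1))
    fix F :: "complex \<Rightarrow> complex ^ 4" and w assume "\<forall>i. (\<lambda>x. F x $ i) field_differentiable (at w)"
    from DERIV_add[OF D(2)[OF this] E(2)[OF this]]
    show "((\<lambda>x. a (F x) + b (F x)) has_field_derivative (\<Sum>j\<in>UNIV. (D j (F w) + E j (F w)) * deriv (\<lambda>x. F x $ j) w)) (at w)"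
      by (simp add: distrib_right sum.distrib)
  qed
next
  case (mult a b)
  then obtain D E where D: "\<And>j. polyfun (D j)" "\<And>F w. \<forall>i. (\<lambda>x. F x $ i) field_differentiable (at w) \<Longrightarrow>
       ((\<lambda>x. a (F x)) has_field_derivative (\<Sum>j\<in>UNIV. D j (F w) * deriv (\<lambda>x. F x $ j) w)) (at w)"
    and E: "\<And>j. polyfun (E j)" "\<And>F w. \<forall>i. (\<lambda>x. F x $ i) field_differentiable (at w) \<Longrightarrow>
       ((\<lambda>x. b (F x)) has_field_derivative (\<Sum>j\<in>UNIV. E j (F w) * deriv (\<lambda>x. F x $ j) w)) (at w)"
    by blast
  show ?case
  proof (intro exI[of _ "\<lambda>j z. D j z * b z + E j z * a z"] conjI allI impI polyfun.add polyfun.mult D(1) E(1) mult.hyps)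
    fix F :: "complex \<Rightarrow> complex ^ 4" and w assume "\<forall>i. (\<lambda>x. F x $ i) field_differentiable (at w)"
    note der = DERIV_mult[OF D(2)[OF this] E(2)[OF this]]
    have eq: "(\<Sum>j\<in>UNIV. D j (F w) * deriv (\<lambda>x. F x $ j) w) * b (F w) + (\<Sum>j\<in>UNIV. E j (F w) * deriv (\<lambda>x. F x $ j) w) * a (F w)
        = (\<Sum>j\<in>UNIV. (D j (F w) * b (F w) + E j (F w) * a (F w)) * deriv (\<lambda>x. F x $ j) w)"
      unfolding sum_distrib_right sum.distrib[symmetric] by (intro sum.cong refl) (simp add: algebra_simps)
    from der show "((\<lambda>x. a (F x) * b (F x)) has_field_derivative
        (\<Sum>j\<in>UNIV. (D j (F w) * b (F w) + E j (F w) * a (F w)) * deriv (\<lambda>x. F x $ j) w)) (at w)"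
      unfolding eq .
  qed
qed

lemma polyfun_holomorphic:
  assumes "polyfun a" "\<And>i. (\<lambda>x. F x $ i) holomorphic_on V"
  shows "(\<lambda>x. a (F x)) holomorphic_on V"
  using assms(1) by induction (auto intro: holomorphic_on_add holomorphic_on_mult assms(2))

definition hom_fun :: "nat \<Rightarrow> (complex ^ 4 \<Rightarrow> complex) \<Rightarrow> bool" where
  "hom_fun d a \<longleftrightarrow> (\<forall>c z. a (c *s z) = c ^ d * a z)"

lemma lift_rep:
  assumes "lift f V F" "w \<in> V"
  obtains c where "c \<noteq> 0" "rep_proj3 (f w) = c *s F w"
proof -
  have F: "F w \<noteq> 0" "f w = pt (F w)" using assms unfolding lift_def by auto
  have "pt (F w) = pt (rep_proj3 (f w))" using F(2) pt_rep_proj3 by simp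
  then show thesis using pt_eq_iff[OF F(1) rep_proj3_nonzero] that by blast
qed

lemma hom_fun_lift:
  assumes "hom_fun d a" "lift f V F" "w \<in> V"
  shows "a (rep_proj3 (f w)) = 0 \<longleftrightarrow> a (F w) = 0"
proof -
  obtain c where "c \<noteq> 0" "rep_proj3 (f w) = c *s F w" by (rule lift_rep[OF assms(2,3)])
  then show ?thesis using assms(1) unfolding hom_fun_def by simp
qed

lemma hom_fun_pt: "hom_fun d a \<Longrightarrow> z \<noteq> 0 \<Longrightarrow> a (rep_proj3 (pt z)) = 0 \<longleftrightarrow> a z = 0"
proof -
  assume a: "hom_fun d a" and z: "z \<noteq> 0"
  obtain c where "c \<noteq> 0" "rep_proj3 (pt z) = c *s z"
    using pt_eq_iff[OF z rep_proj3_nonzero[of "pt z"]] pt_rep_proj3 by auto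
  then show ?thesis using a unfolding hom_fun_def by simp
qed

text \<open>The representatives chosen by \<open>rep_proj3\<close> need not vary continuously. A
  quotient of forms of equal degree is independent of them and may be computed with local
  lifts.\<close>

lemma ratio_holomorphic:
  assumes g: "proj_holomorphic_on g U" and U: "open U" and pq: "polyfun p" "polyfun q" "hom_fun d p" "hom_fun d q"
    and nz: "\<And>w. w \<in> U \<Longrightarrow> q (rep_proj3 (g w)) \<noteq> 0"
  shows "(\<lambda>w. p (rep_proj3 (g w)) / q (rep_proj3 (g w))) holomorphic_on U"
proof -
  have "(\<lambda>w. p (rep_proj3 (g w)) / q (rep_proj3 (g w))) field_differentiable (at w)" if w: "w \<in> U" for w
  proof -
    obtain V F where V: "w \<in> V" "V \<subseteq> U" "lift g V F" using g w unfolding proj_holomorphic_on_lift by blast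
    have F: "open V" "\<And>i. (\<lambda>w. F w $ i) holomorphic_on V" using V(3) unfolding lift_def by auto
    have "(\<lambda>x. p (F x) / q (F x)) holomorphic_on V"
    proof (rule holomorphic_on_divide)
      show "(\<lambda>x. p (F x)) holomorphic_on V" by (rule polyfun_holomorphic[OF pq(1) F(2)])
      show "(\<lambda>x. q (F x)) holomorphic_on V" by (rule polyfun_holomorphic[OF pq(2) F(2)])
      fix x assume "x \<in> V"
      then show "q (F x) \<noteq> 0" using nz[of x] hom_fun_lift[OF pq(4) V(3)] V(2) by blast
    qed
    moreover have "p (F x) / q (F x) = p (rep_proj3 (g x)) / q (rep_proj3 (g x))" if x: "x \<in> V" for x
    proof -
      obtain c where "c \<noteq> 0" "rep_proj3 (g x) = c *s F x" by (rule lift_rep[OF V(3) x])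
      then show ?thesis using pq(3,4) unfolding hom_fun_def by simp
    qed
    ultimately have "(\<lambda>w. p (rep_proj3 (g w)) / q (rep_proj3 (g w))) holomorphic_on V"
      by (rule holomorphic_transform)
    then show ?thesis using F(1) V(1) by (rule holomorphic_on_imp_differentiable_at)
  qed
  then show ?thesis by (simp add: holomorphic_on_def field_differentiable_at_within)
qed

text \<open>The identity theorem is used ball by ball on local lifts, which shows that the interior
  of the zero set is open and closed.\<close>

lemma identity_principle:
  assumes g: "proj_holomorphic_on g UNIV" and a: "polyfun a" "hom_fun d a"
    and O: "open O'" "O' \<noteq> {}" "\<And>w. w \<in> O' \<Longrightarrow> a (rep_proj3 (g w)) = 0"
  shows "a (rep_proj3 (g w)) = 0"
proof -
  define Z where "Z = interior {w. a (rep_proj3 (g w)) = 0}"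
  have "closure Z \<subseteq> Z"
  proof
    fix w\<^sub>0 assume w0: "w\<^sub>0 \<in> closure Z"
    obtain V F where V: "w\<^sub>0 \<in> V" "lift g V F" using g unfolding proj_holomorphic_on_lift by blast
    then obtain \<delta> where \<delta>: "\<delta> > 0" "ball w\<^sub>0 \<delta> \<subseteq> V" using openE unfolding lift_def by blast
    have F: "lift g (ball w\<^sub>0 \<delta>) F" by (rule lift_subset[OF V(2) open_ball \<delta>(2)])
    have hol: "(\<lambda>x. a (F x)) holomorphic_on ball w\<^sub>0 \<delta>"
    proof (rule polyfun_holomorphic[OF a(1)])
      show "(\<lambda>x. F x $ i) holomorphic_on ball w\<^sub>0 \<delta>" for i using F unfolding lift_def by blast
    qed
    have "Z \<inter> ball w\<^sub>0 \<delta> \<noteq> {}"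
    proof -
      obtain y where "y \<in> Z" "dist y w\<^sub>0 < \<delta>" using w0 \<delta>(1) unfolding closure_approachable by blast
      then show ?thesis by (auto simp: dist_commute)
    qed
    moreover have "open (Z \<inter> ball w\<^sub>0 \<delta>)" unfolding Z_def by (intro open_Int open_interior open_ball)
    moreover have "a (F x) = 0" if "x \<in> Z \<inter> ball w\<^sub>0 \<delta>" for x
      using that interior_subset hom_fun_lift[OF a(2) F] unfolding Z_def by blast
    ultimately have zero: "a (F x) = 0" if x: "x \<in> ball w\<^sub>0 \<delta>" for x
      by (intro analytic_continuation_open[OF _ open_ball _ connected_ball _ hol holomorphic_on_const _ x,
            of "Z \<inter> ball w\<^sub>0 \<delta>" 0]) auto
    have "ball w\<^sub>0 \<delta> \<subseteq> {w. a (rep_proj3 (g w)) = 0}"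
      using hom_fun_lift[OF a(2) F] zero by blast
    then have "ball w\<^sub>0 \<delta> \<subseteq> Z" unfolding Z_def by (intro interior_maximal open_ball)
    then show "w\<^sub>0 \<in> Z" using \<delta>(1) by auto
  qed
  then have "closed Z" using closure_subset closure_eq by blast
  moreover have "open Z" unfolding Z_def by (rule open_interior)
  moreover have "Z \<noteq> {}"
  proof -
    have "O' \<subseteq> Z" unfolding Z_def using O by (intro interior_maximal) auto
    then show ?thesis using O(2) by blast
  qed
  ultimately have "Z = UNIV" using clopen by blast
  then show ?thesis using interior_subset unfolding Z_def by blast
qed

lemma conv_curves_closed:
  assumes c: "conv_curves h g" and a: "polyfun a" "hom_fun d a"
    and z: "\<And>w. \<forall>\<^sub>F k in sequentially. a (rep_proj3 (h k w)) = 0"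
  shows "a (rep_proj3 (g w)) = 0"
proof -
  from c[unfolded conv_curves_def, rule_format, of w] obtain \<delta> N H G where \<delta>: "\<delta> > 0"
    and H: "\<And>k. k \<ge> N \<Longrightarrow> lift (h k) (ball w \<delta>) (H k)" and G: "lift g (ball w \<delta>) G"
    and ul: "\<And>i. uniform_limit (ball w \<delta>) (\<lambda>k x. H k x $ i) (\<lambda>x. G x $ i) sequentially"
    by blast
  have wB: "w \<in> ball w \<delta>" using \<delta> by simp
  have "(\<lambda>k. H k w) \<longlonglongrightarrow> G w"
    by (rule vec_tendstoI) (rule tendsto_uniform_limitI[OF ul wB])
  moreover have "isCont a (G w)" using polyfun_continuous[OF a(1), of UNIV] by (simp add: continuous_on_eq_continuous_at)
  ultimately have "(\<lambda>k. a (H k w)) \<longlonglongrightarrow> a (G w)" by (rule isCont_tendsto_compose[rotated])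
  moreover have "\<forall>\<^sub>F k in sequentially. a (H k w) = 0"
    using z[of w] eventually_ge_at_top[of N]
  proof eventually_elim
    case (elim k)
    then show ?case using hom_fun_lift[OF a(2) H[OF elim(2)] wB] by simp
  qed
  ultimately have "a (G w) = 0" by (metis LIMSEQ_unique tendsto_eventually)
  then show ?thesis using hom_fun_lift[OF a(2) G wB] by simp
qed

subsection \<open>Smooth plane curves of degree at least four contain no Brody curves\<close>

text \<open>A change of lift replaces (z, \<zeta>) by (c z, c \<zeta> + d z). An expression in the
  lift and its derivative that is invariant under this descends to a function on the plane.\<close>

lemma lift_invariant_function:
  assumes g: "proj_holomorphic_on g UNIV"
    and inv: "\<And>c d z \<zeta>. c \<noteq> 0 \<Longrightarrow> \<Psi> (c *s z) (c *s \<zeta> + d *s z) = \<Psi> z \<zeta>"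
  obtains E where "\<And>V F w. lift g V F \<Longrightarrow> w \<in> V \<Longrightarrow> E w = \<Psi> (F w) (vderiv F w)"
proof -
  have "\<forall>w. \<exists>V F. w \<in> V \<and> lift g V F" using g unfolding proj_holomorphic_on_lift by blast
  then obtain V0 F0 where 0: "\<And>w. w \<in> V0 w" "\<And>w. lift g (V0 w) (F0 w)" by metis
  have "\<Psi> (F0 w w) (vderiv (F0 w) w) = \<Psi> (F w) (vderiv F w)" if F: "lift g V F" "w \<in> V" for V F w
  proof -
    obtain u U where U: "open U" "w \<in> U" "U \<subseteq> V \<inter> V0 w" "u holomorphic_on U"
      "\<And>x. x \<in> U \<Longrightarrow> u x \<noteq> 0" "\<And>x. x \<in> U \<Longrightarrow> F0 w x = u x *s F x"
      by (rule lift_ratio[OF F(1) 0(2) F(2) 0(1)]) blast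
    have "(\<lambda>x. F x $ i) holomorphic_on U" for i
      using F(1) U(3) unfolding lift_def by (meson holomorphic_on_subset le_inf_iff)
    then have "vderiv (F0 w) w = u w *s vderiv F w + deriv u w *s F w"
      using vderiv_mult[OF U(1,2,4) _ U(6)] by blast
    then show ?thesis unfolding U(6)[OF U(2)] using inv[OF U(5)[OF U(2)]] by simp
  qed
  then show thesis using that[of "\<lambda>w. \<Psi> (F0 w w) (vderiv (F0 w) w)"] by blast
qed

lemma sqn_eq_norm: "sqn z = (norm z)\<^sup>2"
  by (simp add: sqn_def norm_vec_def L2_set_def sum_nonneg)

text \<open>Both vectors are orthogonal to n, so their cross product is parallel to n.\<close>

lemma cross_product_parallel:
  fixes n1 n2 n3 z1 z2 z3 x1 x2 x3 :: complex
  assumes "n1 * z1 + n2 * z2 + n3 * z3 = 0" "n1 * x1 + n2 * x2 + n3 * x3 = 0"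
  shows "n1 * (z3 * x1 - z1 * x3) = n2 * (z2 * x3 - z3 * x2)"
    "n2 * (z1 * x2 - z2 * x1) = n3 * (z3 * x1 - z1 * x3)"
    "n3 * (z2 * x3 - z3 * x2) = n1 * (z1 * x2 - z2 * x1)"
  using assms by algebra+

lemma other_indices:
  fixes i :: 4
  obtains j1 j2 j3 where "UNIV = {i, j1, j2, j3}" "i \<noteq> j1" "i \<noteq> j2" "i \<noteq> j3" "j1 \<noteq> j2" "j1 \<noteq> j3" "j2 \<noteq> j3"
proof -
  have "card (UNIV - {i}) = 3" by (simp add: card_Diff_singleton)
  then obtain j1 j2 j3 where j: "UNIV - {i} = {j1, j2, j3}" "j1 \<noteq> j2" "j1 \<noteq> j3" "j2 \<noteq> j3"
    unfolding card_3_iff by blast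
  then show thesis by (intro that[of j1 j2 j3]) blast+
qed

text \<open>For a curve of degree \<open>d\<close> the form \<open>F \<times> F' = \<lambda> grad a\<close> multiplied by monomials of degree
  \<open>d - 3\<close> is a pulled back holomorphic differential, and it is bounded on a Brody curve. By Liouville
  these functions are constant, hence so are the ratios of the coordinates.\<close>

theorem no_brody_plane_curve:
  assumes g: "proj_holomorphic_on g UNIV" and a: "polyfun a" "hom_fun d a" and d: "d \<ge> 4"
    and gi: "\<And>w. rep_proj3 (g w) $ i = 0" and ga: "\<And>w. a (rep_proj3 (g w)) = 0"
    and smooth: "\<And>z. z \<noteq> 0 \<Longrightarrow> z $ i = 0 \<Longrightarrow>
      \<exists>j. j \<noteq> i \<and> \<not> ((\<lambda>t. a (z + t *s axis j 1)) has_field_derivative 0) (at 0)"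
    and bd: "\<And>w. fs_deriv g w \<le> 2"
  shows "fs_deriv g w = 0"
proof -
  obtain j1 j2 j3 where U: "UNIV = {i, j1, j2, j3}"
    and dist: "i \<noteq> j1" "i \<noteq> j2" "i \<noteq> j3" "j1 \<noteq> j2" "j1 \<noteq> j3" "j2 \<noteq> j3"
    by (rule other_indices)
  let ?J = "{j1, j2, j3}"
  have sum4: "(\<Sum>j\<in>UNIV. f j) = f i + f j1 + f j2 + f j3" for f :: "4 \<Rightarrow> complex"
    unfolding U using dist by (simp add: add.assoc)
  obtain D where D: "\<And>j. polyfun (D j)"
    "\<And>F w. \<forall>i. (\<lambda>x. F x $ i) field_differentiable (at w) \<Longrightarrow>
       ((\<lambda>x. a (F x)) has_field_derivative (\<Sum>j\<in>UNIV. D j (F w) * deriv (\<lambda>x. F x $ j) w)) (at w)"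
    using polyfun_derivative[OF a(1)] by blast
  have Dpart: "((\<lambda>t. a (z + t *s axis j 1)) has_field_derivative D j z) (at 0)" for z j
  proof -
    have der: "((\<lambda>t. (z + t *s axis j 1) $ k) has_field_derivative axis j 1 $ k) (at 0)" for k
    proof -
      have "((\<lambda>t. z $ k + t * axis j 1 $ k) has_field_derivative 0 + 1 * axis j 1 $ k) (at 0)"
        by (intro DERIV_add DERIV_const DERIV_cmult_right DERIV_ident)
      then show ?thesis by simp
    qed
    then have fd: "\<forall>k. (\<lambda>t. (z + t *s axis j 1) $ k) field_differentiable (at 0)"
      unfolding field_differentiable_def by blast
    from D(2)[OF fd] have "((\<lambda>t. a (z + t *s axis j 1)) has_field_derivative
        (\<Sum>k\<in>UNIV. D k (z + 0 *s axis j 1) * axis j 1 $ k)) (at 0)"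
      by (simp only: DERIV_imp_deriv[OF der])
    then show ?thesis by (simp add: axis_def if_distrib[of "\<lambda>y. _ * y"] cong: if_cong)
  qed
  have homD: "D j (c *s z) = c ^ (d - 1) * D j z" if c: "c \<noteq> 0" for j c z
  proof -
    have "((\<lambda>t. t / c) has_field_derivative 1 / c) (at 0)" by (intro DERIV_cdivide DERIV_ident)
    then have "((\<lambda>t. a (z + (t / c) *s axis j 1)) has_field_derivative D j z * (1 / c)) (at 0)"
      using Dpart[of z j] by (intro DERIV_chain2[of "\<lambda>t. a (z + t *s axis j 1)"]) simp_all
    then have "((\<lambda>t. c ^ d * a (z + (t / c) *s axis j 1)) has_field_derivative c ^ d * (D j z * (1 / c))) (at 0)"
      by (rule DERIV_cmult)
    moreover have "c ^ d * a (z + (t / c) *s axis j 1) = a (c *s z + t *s axis j 1)" for t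
    proof -
      have "c *s (z + (t / c) *s axis j 1) = c *s z + t *s axis j 1"
        using c by (simp add: vec_eq_iff distrib_left)
      then show ?thesis using a(2) unfolding hom_fun_def by metis
    qed
    ultimately have "D j (c *s z) = c ^ d * (D j z * (1 / c))"
      using DERIV_unique[OF Dpart[of "c *s z" j]] by simp
    moreover have "c ^ d = c * c ^ (d - 1)" using d by (cases d) simp_all
    ultimately show ?thesis using c by simp
  qed
  have euler: "(\<Sum>j\<in>UNIV. D j z * z $ j) = of_nat d * a z" for z
  proof -
    have der: "((\<lambda>t. (t *s z) $ k) has_field_derivative z $ k) (at 1)" for k
    proof -
      have "((\<lambda>t. t * z $ k) has_field_derivative 1 * z $ k) (at 1)" by (intro DERIV_cmult_right DERIV_ident)
      then show ?thesis by simp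
    qed
    then have fd: "\<forall>k. (\<lambda>t. (t *s z) $ k) field_differentiable (at 1)"
      unfolding field_differentiable_def by blast
    from D(2)[OF fd] have 1: "((\<lambda>t. a (t *s z)) has_field_derivative (\<Sum>k\<in>UNIV. D k (1 *s z) * z $ k)) (at 1)"
      by (simp only: DERIV_imp_deriv[OF der])
    have "((\<lambda>t. t ^ d) has_field_derivative of_nat d * 1 ^ (d - 1)) (at (1::complex))"
      by (rule DERIV_cong[OF DERIV_power[OF DERIV_ident]]) simp
    then have "((\<lambda>t. t ^ d * a z) has_field_derivative of_nat d * 1 ^ (d - 1) * a z) (at 1)"
      by (rule DERIV_cmult_right)
    moreover have "(\<lambda>t. t ^ d * a z) = (\<lambda>t. a (t *s z))" using a(2) unfolding hom_fun_def by auto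
    ultimately show ?thesis using DERIV_unique[OF 1] by simp
  qed
  define W where "W l z \<zeta> = (if l = j1 then z $ j2 * \<zeta> $ j3 - z $ j3 * \<zeta> $ j2
     else if l = j2 then z $ j3 * \<zeta> $ j1 - z $ j1 * \<zeta> $ j3 else z $ j1 * \<zeta> $ j2 - z $ j2 * \<zeta> $ j1)"
    for l and z \<zeta> :: "complex ^ 4"
  have Wj: "W j1 z \<zeta> = z $ j2 * \<zeta> $ j3 - z $ j3 * \<zeta> $ j2" "W j2 z \<zeta> = z $ j3 * \<zeta> $ j1 - z $ j1 * \<zeta> $ j3"
    "W j3 z \<zeta> = z $ j1 * \<zeta> $ j2 - z $ j2 * \<zeta> $ j1" for z \<zeta>
    using dist by (simp_all add: W_def)
  have W_le: "cmod (W l z \<zeta>) \<le> wedge_norm z \<zeta>" for l z \<zeta>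
    unfolding W_def using wedge_norm_entry by (simp add: wedge_norm_entry)
  define S where "S z = (cmod (D j1 z))\<^sup>2 + (cmod (D j2 z))\<^sup>2 + (cmod (D j3 z))\<^sup>2" for z
  define M where "M z \<zeta> = cnj (D j1 z) * W j1 z \<zeta> + cnj (D j2 z) * W j2 z \<zeta> + cnj (D j3 z) * W j3 z \<zeta>" for z \<zeta>
  \<comment> \<open>The factor in F \<times> F' = \<Lambda> grad a as a least-squares quotient,
    which avoids the choice of a nonvanishing partial derivative. On the curve it equals
    \<open>W l / D l\<close> wherever \<open>D l\<close> is nonzero, and this gives
    holomorphy.\<close>
  define \<Lambda> where "\<Lambda> z \<zeta> = M z \<zeta> / of_real (S z)" for z \<zeta>
  \<comment> \<open>When the lift is scaled, \<open>W\<close> has weight 2 and the gradient weight d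
    - 1. So \<Lambda> has weight 3 - d, and a monomial of degree d - 3 compensates it.\<close>
  define \<Psi> where "\<Psi> j k z \<zeta> = \<Lambda> z \<zeta> * (z $ j ^ (d - 4) * z $ k)" for j k z \<zeta>
  have S_pos: "S z > 0" if z: "z \<noteq> 0" "z $ i = 0" for z
  proof -
    obtain j where j: "j \<noteq> i" "\<not> ((\<lambda>t. a (z + t *s axis j 1)) has_field_derivative 0) (at 0)" using smooth[OF z] by blast
    then have "D j z \<noteq> 0" using Dpart[of z j] by metis
    moreover have "j \<in> ?J" using j(1) U by blast
    ultimately have "(cmod (D j1 z))\<^sup>2 > 0 \<or> (cmod (D j2 z))\<^sup>2 > 0 \<or> (cmod (D j3 z))\<^sup>2 > 0" by auto
    moreover have "(cmod (D l z))\<^sup>2 \<ge> 0" for l by simp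
    ultimately show ?thesis unfolding S_def by (metis add_nonneg_nonneg add_nonneg_pos add_pos_nonneg)
  qed
  have inv: "\<Psi> j k (c *s z) (c *s \<zeta> + e *s z) = \<Psi> j k z \<zeta>" if c: "c \<noteq> 0" for j k c e z \<zeta>
  proof -
    define q where "q = c ^ (d - 1)"
    have q0: "q \<noteq> 0" using c by (simp add: q_def)
    have Wc: "W l (c *s z) (c *s \<zeta> + e *s z) = c\<^sup>2 * W l z \<zeta>" for l
      by (simp add: W_def algebra_simps power2_eq_square)
    have "M (c *s z) (c *s \<zeta> + e *s z) = cnj q * c\<^sup>2 * M z \<zeta>"
      unfolding M_def Wc homD[OF c] q_def[symmetric] by (simp add: algebra_simps)
    moreover have "of_real (S (c *s z)) = q * cnj q * of_real (S z)"
    proof -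
      have "S (c *s z) = (cmod q)\<^sup>2 * S z"
        unfolding S_def homD[OF c] q_def[symmetric] by (simp add: norm_mult power_mult_distrib distrib_left)
      then show ?thesis using complex_norm_square[of q] by (simp add: of_real_power)
    qed
    ultimately have \<Lambda>c: "\<Lambda> (c *s z) (c *s \<zeta> + e *s z) = c\<^sup>2 / q * \<Lambda> z \<zeta>"
      unfolding \<Lambda>_def using q0 by simp
    have qc: "q = c\<^sup>2 * (c ^ (d - 4) * c)"
    proof -
      have "d - 1 = 2 + ((d - 4) + 1)" using d by simp
      then show ?thesis unfolding q_def by (simp only: power_add power_one_right)
    qed
    have "\<Psi> j k (c *s z) (c *s \<zeta> + e *s z) = (c\<^sup>2 * (c ^ (d - 4) * c)) / q * \<Psi> j k z \<zeta>"
      unfolding \<Psi>_def \<Lambda>c by (simp add: power_mult_distrib mult_ac)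
    then show ?thesis unfolding qc[symmetric] using q0 by simp
  qed
  have lift0: "F x $ i = 0 \<and> a (F x) = 0 \<and> F x \<noteq> 0" if F: "lift g V F" and x: "x \<in> V" for V F x
  proof -
    obtain c where "c \<noteq> 0" "rep_proj3 (g x) = c *s F x" by (rule lift_rep[OF F x])
    then have "F x $ i = 0" using gi[of x] by simp
    then show ?thesis using ga[of x] hom_fun_lift[OF a(2) F x] F x unfolding lift_def by blast
  qed
  \<comment> \<open>F is orthogonal to the gradient by Euler's relation, and F' because
    \<open>a\<close> vanishes along the curve. So the cross product is a multiple of the
    gradient.\<close>
  have W_eq: "W l (F x) (vderiv F x) = \<Lambda> (F x) (vderiv F x) * D l (F x)"
    if F: "lift g V F" and x: "x \<in> V" and l: "l \<in> ?J" for V F x l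
  proof -
    have V: "open V" "\<And>k. (\<lambda>w. F w $ k) holomorphic_on V" using F unfolding lift_def by auto
    let ?z = "F x" and ?\<zeta> = "vderiv F x"
    have z0: "?z $ i = 0" "a ?z = 0" "?z \<noteq> 0" using lift0[OF F x] by auto
    have der0: "f' = 0" if "(f has_field_derivative f') (at x)" "\<And>y. y \<in> V \<Longrightarrow> f y = 0" for f f'
    proof -
      have "((\<lambda>y. 0) has_field_derivative f') (at x)"
        by (rule has_field_derivative_transform_within_open[OF that(1) V(1) x that(2)])
      then show ?thesis using DERIV_unique DERIV_const by blast
    qed
    have dF: "((\<lambda>y. F y $ k) has_field_derivative ?\<zeta> $ k) (at x)" for k
      using holomorphic_derivI[OF V(2,1) x] by (simp add: vderiv_def)
    have \<zeta>i: "?\<zeta> $ i = 0" by (rule der0[OF dF]) (use lift0[OF F] in blast)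
    have "\<forall>k. (\<lambda>y. F y $ k) field_differentiable (at x)" using dF unfolding field_differentiable_def by blast
    from D(2)[OF this] have "(\<Sum>j\<in>UNIV. D j ?z * deriv (\<lambda>y. F y $ j) x) = 0"
      by (rule der0) (use lift0[OF F] in blast)
    then have 2: "D j1 ?z * ?\<zeta> $ j1 + D j2 ?z * ?\<zeta> $ j2 + D j3 ?z * ?\<zeta> $ j3 = 0"
      using \<zeta>i by (simp add: sum4 vderiv_def)
    have 1: "D j1 ?z * ?z $ j1 + D j2 ?z * ?z $ j2 + D j3 ?z * ?z $ j3 = 0"
      using euler[of ?z] z0 by (simp add: sum4)
    note par = cross_product_parallel[OF 1 2, folded Wj]
    have Sc: "complex_of_real (S ?z) = D j1 ?z * cnj (D j1 ?z) + D j2 ?z * cnj (D j2 ?z) + D j3 ?z * cnj (D j3 ?z)"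
      unfolding S_def of_real_add complex_norm_square ..
    have S0: "complex_of_real (S ?z) \<noteq> 0" using S_pos[OF z0(3,1)] by simp
    have "W l ?z ?\<zeta> * of_real (S ?z) = M ?z ?\<zeta> * D l ?z"
    proof -
      from l consider "l = j1" | "l = j2" | "l = j3" by blast
      then show ?thesis
      proof cases
        case 1
        show ?thesis unfolding 1 Sc M_def using par by algebra
      next
        case 2
        show ?thesis unfolding 2 Sc M_def using par by algebra
      next
        case 3
        show ?thesis unfolding 3 Sc M_def using par by algebra
      qed
    qed
    then show ?thesis unfolding \<Lambda>_def using S0 by (simp add: field_simps)
  qed
  have const: "\<exists>c. \<forall>V F x. lift g V F \<longrightarrow> x \<in> V \<longrightarrow> \<Psi> j k (F x) (vderiv F x) = c" for j k
  proof -
    obtain E where E: "\<And>V F w. lift g V F \<Longrightarrow> w \<in> V \<Longrightarrow> E w = \<Psi> j k (F w) (vderiv F w)"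
      by (rule lift_invariant_function[of g "\<Psi> j k", OF g inv]) blast+
    have "E holomorphic_on UNIV"
    proof -
      have "E field_differentiable (at w)" for w
      proof -
        obtain V F where V: "w \<in> V" "lift g V F" using g unfolding proj_holomorphic_on_lift by blast
        have F: "open V" "\<And>i. (\<lambda>w. F w $ i) holomorphic_on V" using V(2) unfolding lift_def by auto
        have "S (F w) > 0" using S_pos lift0[OF V(2,1)] by blast
        then have "D j1 (F w) \<noteq> 0 \<or> D j2 (F w) \<noteq> 0 \<or> D j3 (F w) \<noteq> 0" unfolding S_def by auto
        then obtain l where l: "l \<in> ?J" "D l (F w) \<noteq> 0" by blast
        have hD: "(\<lambda>x. D l (F x)) holomorphic_on V" by (rule polyfun_holomorphic[OF D(1) F(2)])
        define O' where "O' = V \<inter> (\<lambda>x. D l (F x)) -` (- {0})"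
        have O': "open O'" "w \<in> O'" "O' \<subseteq> V"
          unfolding O'_def
          using continuous_open_preimage[OF holomorphic_on_imp_continuous_on[OF hD] F(1) open_Compl[OF closed_singleton[of 0]]] V(1) l(2)
          by auto
        have hF: "(\<lambda>x. F x $ k) holomorphic_on O'" for k by (rule holomorphic_on_subset[OF F(2) O'(3)])
        have hF': "(\<lambda>x. vderiv F x $ k) holomorphic_on O'" for k
          unfolding vderiv_def vec_lambda_beta by (rule holomorphic_on_subset[OF holomorphic_deriv[OF F(2,1)] O'(3)])
        have "(\<lambda>x. W l (F x) (vderiv F x) / D l (F x) * (F x $ j ^ (d - 4) * F x $ k)) holomorphic_on O'"
        proof (intro holomorphic_on_mult holomorphic_on_divide holomorphic_on_power hF)
          show "(\<lambda>x. W l (F x) (vderiv F x)) holomorphic_on O'"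
            unfolding W_def by (cases "l = j1"; cases "l = j2") (simp_all, (intro holomorphic_on_diff holomorphic_on_mult hF hF')+)
          show "(\<lambda>x. D l (F x)) holomorphic_on O'" by (rule holomorphic_on_subset[OF hD O'(3)])
          show "D l (F x) \<noteq> 0" if "x \<in> O'" for x using that unfolding O'_def by blast
        qed
        moreover have "W l (F x) (vderiv F x) / D l (F x) * (F x $ j ^ (d - 4) * F x $ k) = E x" if x: "x \<in> O'" for x
        proof -
          have xV: "x \<in> V" and nz: "D l (F x) \<noteq> 0" using x unfolding O'_def by auto
          show ?thesis unfolding E[OF V(2) xV] \<Psi>_def W_eq[OF V(2) xV l(1)] using nz by simp
        qed
        ultimately have "E holomorphic_on O'" by (rule holomorphic_transform)
        then show ?thesis using O'(1,2) by (rule holomorphic_on_imp_differentiable_at)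
      qed
      then show ?thesis by (simp add: holomorphic_on_def field_differentiable_at_within)
    qed
    moreover have "bounded (Set.range E)"
    proof -
      \<comment> \<open>By invariance the lift may be normalised to the unit sphere. On this compact
        set the gradient is bounded away from zero, and the minors are bounded by the Fubini--Study
        derivative.\<close>
      define K where "K = sphere (0 :: complex ^ 4) 1 \<inter> {z. z $ i = 0}"
      have cK: "compact K" unfolding K_def
        by (intro compact_Int_closed compact_sphere closed_Collect_eq continuous_intros)
      have "\<exists>b. \<forall>z\<in>K. cmod (D l z) \<le> b" for l
      proof -
        have "bounded (D l ` K)" by (intro compact_imp_bounded compact_continuous_image cK polyfun_continuous D(1))
        then show ?thesis unfolding bounded_iff by blast
      qed
      then obtain b where b: "\<And>l z. z \<in> K \<Longrightarrow> cmod (D l z) \<le> b l" by metis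
      have key: "\<exists>z\<in>K. \<exists>\<zeta>. E w = \<Psi> j k z \<zeta> \<and> wedge_norm z \<zeta> \<le> 2" for w
      proof -
        obtain V F where V: "w \<in> V" "lift g V F" using g unfolding proj_holomorphic_on_lift by blast
        have F0: "F w \<noteq> 0" "F w $ i = 0" using lift0[OF V(2,1)] by auto
        define c where "c = complex_of_real (1 / norm (F w))"
        have c0: "c \<noteq> 0" using F0(1) by (simp add: c_def)
        have nc: "norm (c *s F w) = 1"
        proof -
          have "c *s F w = (1 / norm (F w)) *\<^sub>R F w"
            unfolding c_def vec_eq_iff vector_smult_component vector_scaleR_component by (simp add: scaleR_conv_of_real)
          then show ?thesis using F0(1) by simp
        qed
        have "E w = \<Psi> j k (c *s F w) (c *s vderiv F w + 0 *s F w)" unfolding E[OF V(2,1)] by (rule inv[OF c0, symmetric])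
        moreover have "wedge_norm (c *s F w) (c *s vderiv F w + 0 *s F w) = fs_deriv g w"
        proof -
          have "fs_deriv g w = wedge_norm (c *s F w) (c *s vderiv F w + 0 *s F w) / sqn (c *s F w)"
            unfolding fs_deriv_lift[OF V(2,1)] wedge_norm_scale sqn_scale using c0 by simp
          then show ?thesis using nc by (simp add: sqn_eq_norm)
        qed
        moreover have "c *s F w \<in> K" unfolding K_def using nc F0(2) by simp
        ultimately show ?thesis using bd[of w] by (metis order_refl)
      qed
      have "K \<noteq> {}" using key by blast
      have "continuous_on K S" unfolding S_def[abs_def] by (intro continuous_intros polyfun_continuous D(1))
      then obtain z0 where z0: "z0 \<in> K" "\<And>z. z \<in> K \<Longrightarrow> S z0 \<le> S z"
        using continuous_attains_inf[OF cK \<open>K \<noteq> {}\<close>] by blast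
      have "z0 \<noteq> 0" "z0 $ i = 0" using z0(1) unfolding K_def by auto
      then have S0: "S z0 > 0" by (rule S_pos)
      have "cmod (E w) \<le> (b j1 * 2 + b j2 * 2 + b j3 * 2) / S z0" for w
      proof -
        obtain z \<zeta> where z: "z \<in> K" "E w = \<Psi> j k z \<zeta>" "wedge_norm z \<zeta> \<le> 2" using key by blast
        have nz: "norm z = 1" using z(1) unfolding K_def by simp
        have z1: "cmod (z $ l) \<le> 1" for l using Finite_Cartesian_Product.norm_nth_le[of z l] nz by simp
        have "cmod (z $ j) ^ (d - 4) * cmod (z $ k) \<le> 1 * 1"
          by (intro mult_mono power_le_one z1) auto
        then have m1: "cmod (z $ j ^ (d - 4) * z $ k) \<le> 1" by (simp add: norm_mult norm_power)
        have bW: "cmod (cnj (D l z) * W l z \<zeta>) \<le> b l * 2" for l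
        proof -
          have "cmod (D l z) * cmod (W l z \<zeta>) \<le> b l * 2"
            by (intro mult_mono b z(1) order_trans[OF W_le z(3)]) (auto intro: order_trans[OF norm_ge_zero b[OF z(1)]])
          then show ?thesis by (simp add: norm_mult)
        qed
        have "cmod (M z \<zeta>) \<le> b j1 * 2 + b j2 * 2 + b j3 * 2"
          unfolding M_def by (intro order_trans[OF norm_triangle_ineq] add_mono bW)
        then have "cmod (M z \<zeta>) / S z \<le> (b j1 * 2 + b j2 * 2 + b j3 * 2) / S z0"
          using z0(2)[OF z(1)] S0 by (intro frac_le) (auto intro: order_trans[OF norm_ge_zero])
        moreover have "S z > 0" using z0(2)[OF z(1)] S0 by linarith
        ultimately have \<Lambda>le: "cmod (\<Lambda> z \<zeta>) \<le> (b j1 * 2 + b j2 * 2 + b j3 * 2) / S z0" by (simp add: \<Lambda>_def norm_divide)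
        have "cmod (E w) = cmod (\<Lambda> z \<zeta>) * cmod (z $ j ^ (d - 4) * z $ k)" unfolding z(2) \<Psi>_def norm_mult ..
        also have "\<dots> \<le> cmod (\<Lambda> z \<zeta>) * 1" by (intro mult_left_mono m1) simp
        finally show ?thesis using \<Lambda>le by simp
      qed
      then show ?thesis unfolding bounded_iff by blast
    qed
    ultimately have "E constant_on UNIV" by (rule Liouville_theorem)
    then obtain c where "\<And>w. E w = c" unfolding constant_on_def by blast
    then show ?thesis using E by (intro exI[of _ c]) simp
  qed
  show ?thesis
  proof (rule ccontr)
    assume nz: "fs_deriv g w \<noteq> 0"
    obtain V F where V: "w \<in> V" "lift g V F" using g unfolding proj_holomorphic_on_lift by blast
    have Vo: "open V" "\<And>k. (\<lambda>w. F w $ k) holomorphic_on V" using V(2) unfolding lift_def by auto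
    let ?z = "F w" and ?\<zeta> = "vderiv F w"
    have wn: "wedge_norm ?z ?\<zeta> \<noteq> 0" using nz fs_deriv_lift[OF V(2,1)] by auto
    have Fi: "F x $ i = 0" if "x \<in> V" for x using lift0[OF V(2) that] by blast
    have dF: "((\<lambda>y. F y $ k) has_field_derivative ?\<zeta> $ k) (at w)" for k
      using holomorphic_derivI[OF Vo(2,1) V(1)] by (simp add: vderiv_def)
    have \<Lambda>nz: "\<Lambda> ?z ?\<zeta> \<noteq> 0"
    proof
      assume "\<Lambda> ?z ?\<zeta> = 0"
      then have W0: "W l ?z ?\<zeta> = 0" if "l \<in> ?J" for l using W_eq[OF V(2,1) that] by simp
      have "((\<lambda>y. 0) has_field_derivative ?\<zeta> $ i) (at w)"
        by (rule has_field_derivative_transform_within_open[OF dF Vo(1) V(1) Fi])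
      then have \<zeta>i: "?\<zeta> $ i = 0" using DERIV_unique DERIV_const by blast
      have "?z $ p * ?\<zeta> $ q - ?z $ q * ?\<zeta> $ p = 0" for p q
      proof -
        have "p \<in> {i, j1, j2, j3}" "q \<in> {i, j1, j2, j3}" using U by blast+
        then show ?thesis
          using W0[of j1] W0[of j2] W0[of j3] Fi[OF V(1)] \<zeta>i unfolding Wj by (auto simp: algebra_simps)
      qed
      then show False using wn unfolding wedge_norm_def by simp
    qed
    have "?z \<noteq> 0" using lift0[OF V(2,1)] by blast
    then obtain j where j: "?z $ j \<noteq> 0" by (auto simp: vec_eq_iff)
    have "\<forall>k. \<exists>c. \<forall>V F x. lift g V F \<longrightarrow> x \<in> V \<longrightarrow> \<Psi> j k (F x) (vderiv F x) = c" using const by blast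
    then obtain c where c: "\<And>k V F x. lift g V F \<Longrightarrow> x \<in> V \<Longrightarrow> \<Psi> j k (F x) (vderiv F x) = c k" by metis
    have cj: "c j \<noteq> 0" unfolding c[OF V(2,1), of j, symmetric] \<Psi>_def using \<Lambda>nz j by simp
    \<comment> \<open>The quotient of the constants for \<open>k\<close> and for \<open>j\<close> is
      the ratio of the two coordinates.\<close>
    have proportional_coord: "F x $ k = c k / c j * F x $ j" if x: "x \<in> V" for x k
    proof -
      have 1: "\<Lambda> (F x) (vderiv F x) * (F x $ j ^ (d - 4) * F x $ j) = c j"
        and 2: "\<Lambda> (F x) (vderiv F x) * (F x $ j ^ (d - 4) * F x $ k) = c k"
        using c[OF V(2) x, of j] c[OF V(2) x, of k] unfolding \<Psi>_def by auto
      have "c j * F x $ k = c k * F x $ j" unfolding 1[symmetric] 2[symmetric] by (simp add: mult_ac)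
      then show ?thesis using cj by (simp add: field_simps)
    qed
    have \<zeta>p: "?\<zeta> $ k = c k / c j * ?\<zeta> $ j" for k
    proof -
      have "((\<lambda>y. c k / c j * F y $ j) has_field_derivative ?\<zeta> $ k) (at w)"
        by (rule has_field_derivative_transform_within_open[OF dF Vo(1) V(1) proportional_coord])
      moreover have "((\<lambda>y. c k / c j * F y $ j) has_field_derivative c k / c j * ?\<zeta> $ j) (at w)"
        by (rule DERIV_cmult[OF dF])
      ultimately show ?thesis by (rule DERIV_unique)
    qed
    have "?z $ p * ?\<zeta> $ q - ?z $ q * ?\<zeta> $ p = 0" for p q
      unfolding proportional_coord[OF V(1), of p] proportional_coord[OF V(1), of q] \<zeta>p[of p] \<zeta>p[of q] by (simp add: mult_ac)
    then show False using wn unfolding wedge_norm_def by simp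
  qed
qed

subsection \<open>Projection from the vertex\<close>

lemma hom_fun_coord: "hom_fun 1 (\<lambda>z. z $ i)"
  by (simp add: hom_fun_def)

lemma fs_deriv_const:
  assumes "\<And>w. g w = p"
  shows "fs_deriv g w = 0"
proof -
  obtain z where z: "z \<noteq> 0" "p = pt z" using pt_surj by blast
  have "lift g UNIV (\<lambda>_. z)" unfolding lift_def using assms z by (simp add: holomorphic_on_const)
  then have "fs_deriv g w = wedge_norm z (vderiv (\<lambda>_. z) w) / sqn z" by (rule fs_deriv_lift) simp
  moreover have "vderiv (\<lambda>_. z) w = 0 *s z" by (simp add: vderiv_def vec_eq_iff)
  ultimately show ?thesis by (simp only: wedge_norm_smult_right) simp
qed

definition coproj :: "4 \<Rightarrow> complex ^ 4 \<Rightarrow> complex ^ 4" where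
  "coproj i z = (\<chi> j. if j = i then 0 else z $ j)"

lemma coproj_eq_0_iff: "coproj i z = 0 \<longleftrightarrow> (\<forall>j. j \<noteq> i \<longrightarrow> z $ j = 0)"
  by (auto simp: coproj_def vec_eq_iff)

lemma coproj_decomp: "z = coproj i z + z $ i *s axis i 1"
  by (simp add: coproj_def vec_eq_iff axis_def)

lemma coproj_scale: "coproj i (c *s z) = c *s coproj i z"
  by (simp add: coproj_def vec_eq_iff)

text \<open>Where the curve passes through the vertex, all projected coordinates vanish. Division by
  the lowest order of vanishing among the coordinates that are not identically zero, those in
  \<open>T\<close>, leaves a lift without zeros.\<close>

lemma remove_common_zeros:
  fixes P :: "complex \<Rightarrow> complex ^ 4"
  assumes hol: "\<And>j. (\<lambda>w. P w $ j) holomorphic_on ball w\<^sub>0 \<delta>" and \<delta>: "\<delta> > 0"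
    and nz: "\<exists>w\<in>ball w\<^sub>0 \<delta>. P w \<noteq> 0"
  obtains r k H where "r > 0" "\<And>j. (\<lambda>w. H w $ j) holomorphic_on ball w\<^sub>0 r"
    "\<And>w. w \<in> ball w\<^sub>0 r \<Longrightarrow> H w \<noteq> 0" "\<And>w. w \<in> ball w\<^sub>0 r \<Longrightarrow> P w = (w - w\<^sub>0) ^ k *s H w"
    "\<And>w j. w \<in> ball w\<^sub>0 r \<Longrightarrow> (\<And>w. w \<in> ball w\<^sub>0 \<delta> \<Longrightarrow> P w $ j = 0) \<Longrightarrow> H w $ j = 0"
proof -
  define T where "T = {j. \<exists>w\<in>ball w\<^sub>0 \<delta>. P w $ j \<noteq> 0}"
  have Tne: "T \<noteq> {}" using nz by (auto simp: T_def vec_eq_iff)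
  have "\<forall>j\<in>T. \<exists>n r h. r > 0 \<and> cball w\<^sub>0 r \<subseteq> ball w\<^sub>0 \<delta> \<and> h holomorphic_on cball w\<^sub>0 r \<and>
      (\<forall>w\<in>cball w\<^sub>0 r. P w $ j = h w * (w - w\<^sub>0) ^ n \<and> h w \<noteq> 0)"
  proof
    fix j assume "j \<in> T"
    then have "\<exists>w\<in>ball w\<^sub>0 \<delta>. P w $ j \<noteq> 0" unfolding T_def by blast
    from zorder_exist_zero[OF hol open_ball connected_ball _ this] \<delta>
    show "\<exists>n r h. r > 0 \<and> cball w\<^sub>0 r \<subseteq> ball w\<^sub>0 \<delta> \<and> h holomorphic_on cball w\<^sub>0 r \<and>
      (\<forall>w\<in>cball w\<^sub>0 r. P w $ j = h w * (w - w\<^sub>0) ^ n \<and> h w \<noteq> 0)" by (meson centre_in_ball)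
  qed
  then obtain n r h where nrh: "\<And>j. j \<in> T \<Longrightarrow> r j > 0" "\<And>j. j \<in> T \<Longrightarrow> h j holomorphic_on cball w\<^sub>0 (r j)"
    "\<And>j. j \<in> T \<Longrightarrow> cball w\<^sub>0 (r j) \<subseteq> ball w\<^sub>0 \<delta>"
    "\<And>j w. j \<in> T \<Longrightarrow> w \<in> cball w\<^sub>0 (r j) \<Longrightarrow> P w $ j = h j w * (w - w\<^sub>0) ^ n j \<and> h j w \<noteq> 0"
    by metis
  define R where "R = Min (r ` T)"
  define k where "k = Min (n ` T)"
  have R: "R > 0" unfolding R_def using Tne nrh(1) by simp
  have Rle: "ball w\<^sub>0 R \<subseteq> cball w\<^sub>0 (r j)" if "j \<in> T" for j
  proof -
    have "R \<le> r j" unfolding R_def using that by simp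
    then show ?thesis by (auto simp: subset_eq)
  qed
  have kle: "k \<le> n j" if "j \<in> T" for j unfolding k_def using that by simp
  define H where "H w = (\<chi> j. if j \<in> T then h j w * (w - w\<^sub>0) ^ (n j - k) else 0)" for w
  show thesis
  proof (rule that[of R H k])
    show "R > 0" by (rule R)
    show "(\<lambda>w. H w $ j) holomorphic_on ball w\<^sub>0 R" for j
    proof (cases "j \<in> T")
      case True
      have "h j holomorphic_on ball w\<^sub>0 R" by (rule holomorphic_on_subset[OF nrh(2)[OF True] Rle[OF True]])
      then have "(\<lambda>w. h j w * (w - w\<^sub>0) ^ (n j - k)) holomorphic_on ball w\<^sub>0 R"
        by (intro holomorphic_on_mult holomorphic_on_power holomorphic_on_diff holomorphic_on_ident holomorphic_on_const)
      then show ?thesis using True by (simp add: H_def)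
    next
      case False
      then show ?thesis by (simp add: H_def holomorphic_on_const)
    qed
    fix w assume w: "w \<in> ball w\<^sub>0 R"
    have "k \<in> n ` T" unfolding k_def using Tne by (intro Min_in) auto
    then obtain j where j: "j \<in> T" "n j = k" by auto
    have "H w $ j \<noteq> 0" using nrh(4)[OF j(1) subsetD[OF Rle[OF j(1)] w]] j by (simp add: H_def)
    then show "H w \<noteq> 0" by auto
    have "P w $ j = (w - w\<^sub>0) ^ k * H w $ j" for j
    proof (cases "j \<in> T")
      case True
      have "(w - w\<^sub>0) ^ n j = (w - w\<^sub>0) ^ k * (w - w\<^sub>0) ^ (n j - k)" using kle[OF True] by (simp flip: power_add)
      then show ?thesis using nrh(4)[OF True subsetD[OF Rle[OF True] w]] True by (simp add: H_def)
    next
      case False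
      obtain j0 where j0: "j0 \<in> T" using Tne by blast
      have "w \<in> ball w\<^sub>0 \<delta>" using Rle[OF j0] nrh(3)[OF j0] w by blast
      then show ?thesis using False unfolding T_def by (simp add: H_def T_def)
    qed
    then show "P w = (w - w\<^sub>0) ^ k *s H w" by (simp add: vec_eq_iff)
    show "H w $ j = 0" if "\<And>w. w \<in> ball w\<^sub>0 \<delta> \<Longrightarrow> P w $ j = 0" for j
      using that by (auto simp: H_def T_def)
  qed
qed

text \<open>The projection is undefined where the curve meets the vertex. By the identity principle
  this happens at isolated points only, and \<open>remove_common_zeros\<close> extends the projected
  curve across them.\<close>

lemma projection_curve:
  assumes g: "proj_holomorphic_on g UNIV" and nv: "\<exists>w. coproj i (rep_proj3 (g w)) \<noteq> 0"
  obtains q where "proj_holomorphic_on q UNIV" "\<And>w. rep_proj3 (q w) $ i = 0"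
    "\<And>w. \<exists>c. coproj i (rep_proj3 (g w)) = c *s rep_proj3 (q w)"
proof -
  have loc: "\<exists>r H. r > 0 \<and> (\<forall>j. (\<lambda>x. H x $ j) holomorphic_on ball w r) \<and> (\<forall>x\<in>ball w r. H x \<noteq> 0 \<and> H x $ i = 0) \<and>
      (\<forall>x\<in>ball w r. \<exists>c. coproj i (rep_proj3 (g x)) = c *s H x \<and> (x \<noteq> w \<longrightarrow> c \<noteq> 0))" for w
  proof -
    obtain V F where V: "w \<in> V" "lift g V F" using g unfolding proj_holomorphic_on_lift by blast
    have "open V" using V(2) unfolding lift_def by blast
    then obtain \<delta> where \<delta>: "\<delta> > 0" "ball w \<delta> \<subseteq> V" using V(1) openE by blast
    have F: "lift g (ball w \<delta>) F" by (rule lift_subset[OF V(2) open_ball \<delta>(2)])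
    have hF: "(\<lambda>x. F x $ j) holomorphic_on ball w \<delta>" for j using F unfolding lift_def by blast
    have hol: "(\<lambda>x. coproj i (F x) $ j) holomorphic_on ball w \<delta>" for j
      by (cases "j = i") (simp_all add: coproj_def holomorphic_on_const hF)
    have ex: "\<exists>x\<in>ball w \<delta>. coproj i (F x) \<noteq> 0"
    proof (rule ccontr)
      assume "\<not> ?thesis"
      then have z: "F x $ j = 0" if "x \<in> ball w \<delta>" "j \<noteq> i" for x j using that unfolding coproj_eq_0_iff by blast
      have "rep_proj3 (g x) $ j = 0" if "j \<noteq> i" for x j
      proof (rule identity_principle[OF g polyfun.coord hom_fun_coord open_ball])
        show "ball w \<delta> \<noteq> {}" using \<delta>(1) by simp
        show "rep_proj3 (g y) $ j = 0" if y: "y \<in> ball w \<delta>" for y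
          using hom_fun_lift[OF hom_fun_coord F y, of j] z[OF y \<open>j \<noteq> i\<close>] by simp
      qed
      then show False using nv unfolding coproj_eq_0_iff by blast
    qed
    obtain r k H where H: "r > 0" "\<And>j. (\<lambda>x. H x $ j) holomorphic_on ball w r"
      "\<And>x. x \<in> ball w r \<Longrightarrow> H x \<noteq> 0" "\<And>x. x \<in> ball w r \<Longrightarrow> coproj i (F x) = (x - w) ^ k *s H x"
      "\<And>x j. x \<in> ball w r \<Longrightarrow> (\<And>x. x \<in> ball w \<delta> \<Longrightarrow> coproj i (F x) $ j = 0) \<Longrightarrow> H x $ j = 0"
      by (rule remove_common_zeros[OF hol \<delta>(1) ex]) blast
    define s where "s = min r \<delta>"
    have s: "s > 0" "ball w s \<subseteq> ball w r" "ball w s \<subseteq> ball w \<delta>" using H(1) \<delta>(1) by (auto simp: s_def)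
    show ?thesis
    proof (intro exI[of _ s] exI[of _ H] conjI allI ballI)
      show "s > 0" by (rule s(1))
      show "(\<lambda>x. H x $ j) holomorphic_on ball w s" for j by (rule holomorphic_on_subset[OF H(2) s(2)])
      fix x assume x: "x \<in> ball w s"
      show "H x \<noteq> 0" using H(3) s(2) x by blast
      show "H x $ i = 0" by (rule H(5)) (use s(2) x in \<open>auto simp: coproj_def\<close>)
      obtain c where c: "c \<noteq> 0" "rep_proj3 (g x) = c *s F x" by (rule lift_rep[OF F subsetD[OF s(3) x]])
      have "coproj i (rep_proj3 (g x)) = (c * (x - w) ^ k) *s H x"
        unfolding c(2) coproj_scale H(4)[OF subsetD[OF s(2) x]] by (simp add: vector_smult_assoc)
      then show "\<exists>c. coproj i (rep_proj3 (g x)) = c *s H x \<and> (x \<noteq> w \<longrightarrow> c \<noteq> 0)"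
        using c(1) by (intro exI[of _ "c * (x - w) ^ k"]) simp
    qed
  qed
  then obtain r H where r: "\<And>w. r w > 0" and hol: "\<And>w j. (\<lambda>x. H w x $ j) holomorphic_on ball w (r w)"
    and H0: "\<And>w x. x \<in> ball w (r w) \<Longrightarrow> H w x \<noteq> 0 \<and> H w x $ i = 0"
    and Hc: "\<And>w x. x \<in> ball w (r w) \<Longrightarrow> \<exists>c. coproj i (rep_proj3 (g x)) = c *s H w x \<and> (x \<noteq> w \<longrightarrow> c \<noteq> 0)"
    by metis
  \<comment> \<open>The value at \<open>w\<close> comes from the lift centred at \<open>w\<close>.
    At any other point \<open>x\<close> of its ball the lifts centred at \<open>w\<close> and at
    \<open>x\<close> are proportional, since the projected vector is nonzero there and a multiple of
    both.\<close>
  define q where "q w = pt (H w w)" for w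
  have wB: "w \<in> ball w (r w)" for w using r by simp
  have lq: "lift q (ball w (r w)) (H w)" for w
    unfolding lift_def
  proof (intro conjI allI ballI open_ball hol)
    fix x assume x: "x \<in> ball w (r w)"
    show "H w x \<noteq> 0" using H0[OF x] by blast
    show "q x = pt (H w x)"
    proof (cases "x = w")
      case False
      obtain c where c: "coproj i (rep_proj3 (g x)) = c *s H w x" "c \<noteq> 0" using Hc[OF x] False by blast
      obtain c' where c': "coproj i (rep_proj3 (g x)) = c' *s H x x" using Hc[OF wB[of x]] by blast
      have "c *s H w x \<noteq> 0" using c(2) H0[OF x] by (auto simp: vec_eq_iff)
      then have c'0: "c' \<noteq> 0" using c(1) c' by auto
      have "H w x = (c' / c) *s H x x"
      proof -
        have "c * H w x $ j = c' * H x x $ j" for j using c(1) c' by (metis vector_smult_component)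
        then show ?thesis using c(2) by (simp add: vec_eq_iff field_simps)
      qed
      then show ?thesis
        unfolding q_def using pt_eq_iff[of "H x x" "H w x"] H0[OF x] H0[OF wB[of x]] c(2) c'0
        by (metis divide_eq_0_iff)
    qed (simp add: q_def)
  qed
  show thesis
  proof (rule that[of q])
    show "proj_holomorphic_on q UNIV" unfolding proj_holomorphic_on_lift using lq wB by blast
    fix w
    obtain e where e: "e \<noteq> 0" "rep_proj3 (q w) = e *s H w w" by (rule lift_rep[OF lq wB])
    show "rep_proj3 (q w) $ i = 0" using e H0[OF wB] by simp
    obtain c where "coproj i (rep_proj3 (g w)) = c *s H w w" using Hc[OF wB] by blast
    then have "coproj i (rep_proj3 (g w)) = (c / e) *s rep_proj3 (q w)"
      using e by (simp add: vector_smult_assoc)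
    then show "\<exists>c. coproj i (rep_proj3 (g w)) = c *s rep_proj3 (q w)" by blast
  qed
qed

text \<open>The derivative of a projected curve need not be bounded. If it is nonzero somewhere,
  dilation, rescaling and a limit produce a curve of bounded derivative in the same plane curve,
  against \<open>no_brody_plane_curve\<close>.\<close>

lemma no_entire_plane_curve:
  assumes q: "proj_holomorphic_on q UNIV" and a: "polyfun a" "hom_fun d a" and d: "d \<ge> 4"
    and qi: "\<And>w. rep_proj3 (q w) $ i = 0" and qa: "\<And>w. a (rep_proj3 (q w)) = 0"
    and smooth: "\<And>z. z \<noteq> 0 \<Longrightarrow> z $ i = 0 \<Longrightarrow>
      \<exists>j. j \<noteq> i \<and> \<not> ((\<lambda>t. a (z + t *s axis j 1)) has_field_derivative 0) (at 0)"
  shows "fs_deriv q w = 0"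
proof (rule ccontr)
  assume "fs_deriv q w \<noteq> 0"
  then have s: "fs_deriv q w > 0" using fs_deriv_nonneg[OF q, of w] by simp
  have ex: "\<exists>h. proj_holomorphic_on h (ball 0 (real k)) \<and> h ` ball 0 (real k) \<subseteq> Set.range q \<and>
      fs_deriv h 0 = 1 \<and> (\<forall>\<zeta>\<in>ball 0 (real k). fs_deriv h \<zeta> \<le> 2)" for k :: nat
  proof -
    \<comment> \<open>The dilation raises the derivative at the centre to 4 k + 1, so that the
      rescaled disc has radius greater than k.\<close>
    define c where "c = complex_of_real ((4 * real k + 1) / fs_deriv q w)"
    define \<phi> where "\<phi> \<zeta> = w + c * \<zeta>" for \<zeta>
    have hol: "\<phi> holomorphic_on ball 0 1"
      unfolding \<phi>_def[abs_def] by (intro holomorphic_on_add holomorphic_on_mult holomorphic_on_const holomorphic_on_ident)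
    have "(\<phi> has_field_derivative 0 + c * 1) (at 0)"
      unfolding \<phi>_def[abs_def] by (intro DERIV_add DERIV_const DERIV_cmult DERIV_ident)
    then have d: "deriv \<phi> 0 = c" using DERIV_imp_deriv by fastforce
    let ?f = "\<lambda>x. q (\<phi> x)"
    have f: "proj_holomorphic_on ?f (ball 0 1)" by (rule proj_holomorphic_on_compose[OF q open_ball hol]) simp
    have "fs_deriv ?f 0 = cmod (deriv \<phi> 0) * fs_deriv q (\<phi> 0)"
      by (rule fs_deriv_compose[OF q open_ball hol]) simp_all
    also have "\<phi> 0 = w" by (simp add: \<phi>_def)
    also have "cmod (deriv \<phi> 0) = (4 * real k + 1) / fs_deriv q w"
      unfolding d c_def norm_of_real using s by simp
    finally have fs: "fs_deriv ?f 0 = 4 * real k + 1" using s by simp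
    then have pos: "fs_deriv ?f 0 > 0" by simp
    obtain h where h: "proj_holomorphic_on h (ball 0 (fs_deriv ?f 0 / 4))"
      "h ` ball 0 (fs_deriv ?f 0 / 4) \<subseteq> ?f ` ball 0 1" "fs_deriv h 0 = 1"
      "\<And>\<zeta>. \<zeta> \<in> ball 0 (fs_deriv ?f 0 / 4) \<Longrightarrow> fs_deriv h \<zeta> \<le> 2"
      by (rule brody_rescaling[OF f pos]) blast
    have sub: "ball 0 (real k) \<subseteq> ball (0::complex) (fs_deriv ?f 0 / 4)" unfolding fs by auto
    show ?thesis
    proof (intro exI[of _ h] conjI ballI)
      show "proj_holomorphic_on h (ball 0 (real k))" by (rule proj_holomorphic_on_subset[OF h(1) open_ball sub])
      show "h ` ball 0 (real k) \<subseteq> Set.range q" using h(2) sub by blast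
      show "fs_deriv h 0 = 1" by (rule h(3))
      show "fs_deriv h \<zeta> \<le> 2" if "\<zeta> \<in> ball 0 (real k)" for \<zeta> using h(4) sub that by blast
    qed
  qed
  have "\<forall>k. \<exists>h. proj_holomorphic_on h (ball 0 (real k)) \<and> h ` ball 0 (real k) \<subseteq> Set.range q \<and>
      fs_deriv h 0 = 1 \<and> (\<forall>\<zeta>\<in>ball 0 (real k). fs_deriv h \<zeta> \<le> 2)" using ex by blast
  then obtain h where h: "\<And>k. proj_holomorphic_on (h k) (ball 0 (real k))" "\<And>k. h k ` ball 0 (real k) \<subseteq> Set.range q"
    "\<And>k. fs_deriv (h k) 0 = 1" "\<And>k \<zeta>. \<zeta> \<in> ball 0 (real k) \<Longrightarrow> fs_deriv (h k) \<zeta> \<le> 2" by metis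
  obtain r :: "nat \<Rightarrow> nat" and G where G: "strict_mono r" "conv_curves (\<lambda>k. h (r k)) G" "proj_holomorphic_on G UNIV"
    "\<And>w. fs_deriv G w \<le> 2" "fs_deriv G 0 = 1"
    by (rule brody_limit[of h]) (use h in blast)+
  have ev: "\<forall>\<^sub>F k in sequentially. P (rep_proj3 (h (r k) x)) = 0" if P: "\<And>w. P (rep_proj3 (q w)) = 0" for P :: "complex ^ 4 \<Rightarrow> complex" and x
  proof -
    obtain R :: nat where R: "cmod x < real R" using reals_Archimedean2 by blast
    show ?thesis
    proof (rule eventually_sequentiallyI[of R])
      fix k assume "k \<ge> R"
      then have "r k \<ge> R" using seq_suble[OF G(1), of k] by linarith
      then have "h (r k) x \<in> Set.range q" using h(2)[of "r k"] R by (auto simp: image_subset_iff)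
      then show "P (rep_proj3 (h (r k) x)) = 0" using P by auto
    qed
  qed
  have "fs_deriv G 0 = 0"
  proof (rule no_brody_plane_curve[OF G(3) a d])
    show "rep_proj3 (G w) $ i = 0" for w
      by (rule conv_curves_closed[OF G(2) polyfun.coord hom_fun_coord]) (rule ev, rule qi)
    show "a (rep_proj3 (G w)) = 0" for w
      by (rule conv_curves_closed[OF G(2) a]) (rule ev, rule qa)
  qed (fact smooth, fact G(4))
  then show False using G(5) by simp
qed

lemma polyfun_line_poly: "polyfun a \<Longrightarrow> \<exists>p :: complex poly. \<forall>t. poly p t = a (z + t *s v)"
proof (induction rule: polyfun.induct)
  case (const c)
  show ?case by (intro exI[of _ "[:c:]"]) simp
next
  case (coord i)
  show ?case by (intro exI[of _ "[:z $ i, v $ i:]"]) simp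
next
  case (add a b)
  then obtain p q where "\<forall>t. poly p t = a (z + t *s v)" "\<forall>t. poly q t = b (z + t *s v)" by blast
  then show ?case by (intro exI[of _ "p + q"]) simp
next
  case (mult a b)
  then obtain p q where "\<forall>t. poly p t = a (z + t *s v)" "\<forall>t. poly q t = b (z + t *s v)" by blast
  then show ?case by (intro exI[of _ "p * q"]) simp
qed

text \<open>If \<open>b\<close> vanished on the whole line, homogeneity would make it vanish at
  \<open>v + t *s u\<close> for all t \<noteq> 0 and then, being polynomial in t, at
  \<open>v\<close>.\<close>

lemma finite_line_zeros:
  assumes b: "polyfun b" "hom_fun n b" and v: "b v \<noteq> 0"
  shows "finite {t. b (u + t *s v) = 0}"
proof -
  obtain p where p: "\<And>t. poly p t = b (u + t *s v)" using polyfun_line_poly[OF b(1)] by blast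
  obtain q where q: "\<And>t. poly q t = b (v + t *s u)" using polyfun_line_poly[OF b(1)] by blast
  have "p \<noteq> 0"
  proof
    assume "p = 0"
    then have z: "b (u + t *s v) = 0" for t using p[of t] by simp
    have "poly q t = 0" if t: "t \<noteq> 0" for t
    proof -
      have "v + t *s u = t *s (u + (1 / t) *s v)" using t by (simp add: vec_eq_iff distrib_left)
      then have "poly q t = b (t *s (u + (1 / t) *s v))" unfolding q by (rule arg_cong)
      also have "\<dots> = t ^ n * b (u + (1 / t) *s v)" using b(2) unfolding hom_fun_def by blast
      also have "\<dots> = 0" unfolding z by simp
      finally show ?thesis .
    qed
    then have "UNIV - {0} \<subseteq> {t. poly q t = 0}" by blast
    moreover have "infinite (UNIV - {0 :: complex})" using infinite_UNIV_char_0 by simp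
    ultimately have "q = 0" using poly_roots_finite finite_subset by blast
    then show False using q[of 0] v by simp
  qed
  then show ?thesis unfolding p[symmetric] by (rule poly_roots_finite)
qed

lemma hom_fun_smult: "hom_fun d a \<Longrightarrow> x = c *s z \<Longrightarrow> a x = c ^ d * a z"
  unfolding hom_fun_def by blast

lemma smult_factor_nonzero: "x \<noteq> 0 \<Longrightarrow> x = c *s z \<Longrightarrow> c \<noteq> (0 :: complex)" for x :: "complex ^ 'n"
  by auto

lemma entire_finite_range_const:
  assumes "\<phi> holomorphic_on UNIV" "finite (Set.range \<phi>)"
  obtains c where "\<phi> = (\<lambda>_. c)"
proof -
  obtain x where x: "x \<notin> Set.range \<phi>" using ex_new_if_finite[OF infinite_UNIV_char_0 assms(2)] by blast
  have "finite (insert x (Set.range \<phi>))" using assms(2) by simp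
  then obtain y where y: "y \<notin> insert x (Set.range \<phi>)" using ex_new_if_finite[OF infinite_UNIV_char_0] by blast
  have "x \<noteq> y" "Set.range \<phi> \<inter> {x, y} = {}" using x y by auto
  then show thesis using little_Picard[OF assms(1)] that by blast
qed

text \<open>An entire curve in the cone \<open>a = 0\<close> with vertex \<open>e\<^sub>i\<close> lies on a generator; if moreover it can meet
  \<open>b = 0\<close> only on \<open>f = 0\<close>, it omits three points of that line.\<close>

theorem no_entire_curve_in_cone:
  assumes g: "proj_holomorphic_on g UNIV" and not_const: "\<And>p. \<exists>w. g w \<noteq> p"
    and a: "polyfun a" "hom_fun d a" "d \<ge> 4" and ai: "\<And>z c. a (z + c *s axis i 1) = a z"
    and smooth: "\<And>z. z \<noteq> 0 \<Longrightarrow> z $ i = 0 \<Longrightarrow>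
      \<exists>j. j \<noteq> i \<and> \<not> ((\<lambda>t. a (z + t *s axis j 1)) has_field_derivative 0) (at 0)"
    and b: "polyfun b" "hom_fun n b" "n > 0" "b (axis i 1) \<noteq> 0" and f: "hom_fun N f"
    and three: "\<And>u. u \<noteq> 0 \<Longrightarrow> u $ i = 0 \<Longrightarrow> a u = 0 \<Longrightarrow>
      card {\<mu>. b (u + \<mu> *s axis i 1) = 0 \<and> f (u + \<mu> *s axis i 1) \<noteq> 0} \<ge> 3"
    and ga: "\<And>w. a (rep_proj3 (g w)) = 0"
    and gb: "(\<forall>w. b (rep_proj3 (g w)) = 0) \<or> (\<forall>w. b (rep_proj3 (g w)) = 0 \<longrightarrow> f (rep_proj3 (g w)) = 0)"
  shows False
proof -
  have ptI: "g w = pt z" if "z \<noteq> 0" "rep_proj3 (g w) = c *s z" for w z c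
  proof -
    have "c \<noteq> 0" using that(2) rep_proj3_nonzero[of "g w"] by auto
    then have "pt z = pt (rep_proj3 (g w))" using pt_eq_iff[OF that(1) rep_proj3_nonzero] that(2) by blast
    then show ?thesis using pt_rep_proj3 by simp
  qed
  have axi: "axis i (1::complex) \<noteq> 0" by (simp add: axis_eq_0_iff)
  have nv: "\<exists>w. coproj i (rep_proj3 (g w)) \<noteq> 0"
  proof (rule ccontr)
    assume "\<not> ?thesis"
    then have "rep_proj3 (g w) = rep_proj3 (g w) $ i *s axis i 1" for w
      using coproj_decomp[of "rep_proj3 (g w)" i] by simp
    then have "g w = pt (axis i 1)" for w by (rule ptI[OF axi])
    then show False using not_const by blast
  qed
  obtain q where q: "proj_holomorphic_on q UNIV" "\<And>w. rep_proj3 (q w) $ i = 0"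
    "\<And>w. \<exists>c. coproj i (rep_proj3 (g w)) = c *s rep_proj3 (q w)"
    by (rule projection_curve[OF g nv]) blast
  have a_coproj: "a (coproj i z) = a z" for z using ai[of "coproj i z" "z $ i"] coproj_decomp[of z i] by simp
  \<comment> \<open>The projection does not change \<open>a\<close>. Where the curve avoids the
    vertex, the projected vector is a nonzero multiple of a representative of \<open>q\<close>; so
    \<open>a\<close> vanishes along \<open>q\<close> on an open set, and by the identity principle
    everywhere.\<close>
  have qa: "a (rep_proj3 (q w)) = 0" for w
  proof -
    obtain w1 where w1: "coproj i (rep_proj3 (g w1)) \<noteq> 0" using nv by blast
    obtain V F where V: "w1 \<in> V" "lift g V F" using g unfolding proj_holomorphic_on_lift by blast
    have Vo: "open V" "\<And>k. (\<lambda>w. F w $ k) holomorphic_on V" using V(2) unfolding lift_def by auto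
    obtain j where j: "j \<noteq> i" "rep_proj3 (g w1) $ j \<noteq> 0" using w1 unfolding coproj_eq_0_iff by blast
    have Fj: "F x $ j \<noteq> 0 \<longleftrightarrow> rep_proj3 (g x) $ j \<noteq> 0" if "x \<in> V" for x
      using hom_fun_lift[OF hom_fun_coord V(2) that, of j] by simp
    define O' where "O' = V \<inter> (\<lambda>x. F x $ j) -` (- {0})"
    have O'1: "open O'" unfolding O'_def
      by (rule continuous_open_preimage[OF holomorphic_on_imp_continuous_on[OF Vo(2)] Vo(1) open_Compl[OF closed_singleton]])
    have O'2: "w1 \<in> O'" using V(1) j(2) Fj[OF V(1)] unfolding O'_def by simp
    have O'3: "a (rep_proj3 (q x)) = 0" if x: "x \<in> O'" for x
    proof -
      obtain c where c: "coproj i (rep_proj3 (g x)) = c *s rep_proj3 (q x)" using q(3) by blast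
      have "rep_proj3 (g x) $ j \<noteq> 0" using x Fj unfolding O'_def by auto
      then have "coproj i (rep_proj3 (g x)) \<noteq> 0" using j(1) unfolding coproj_eq_0_iff by blast
      then have "c \<noteq> 0" using c by auto
      moreover have "c ^ d * a (rep_proj3 (q x)) = 0"
        using a(2) a_coproj[of "rep_proj3 (g x)"] ga[of x] unfolding c hom_fun_def by simp
      ultimately show ?thesis by simp
    qed
    show ?thesis
      by (rule identity_principle[OF q(1) a(1,2) O'1]) (use O'2 O'3 in blast)+
  qed
  have fsq: "fs_deriv q w = 0" for w
    by (rule no_entire_plane_curve[OF q(1) a q(2) qa]) (fact smooth)
  have qc: "q w = q 0" for w
    by (rule fs_deriv_zero_imp_const[OF q(1) convex_UNIV fsq]) simp_all
  define u where "u = rep_proj3 (q 0)"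
  have u: "u \<noteq> 0" "u $ i = 0" "a u = 0" unfolding u_def using rep_proj3_nonzero q(2) qa by auto
  obtain j where j: "u $ j \<noteq> 0" using u(1) by (auto simp: vec_eq_iff)
  have ji: "j \<noteq> i" using j u(2) by auto
  \<comment> \<open>Together with coordinate \<open>i\<close> this is a pair of homogeneous
    coordinates on the generator through \<open>u\<close>; it vanishes at the vertex.\<close>
  define \<Lambda> where "\<Lambda> z = z $ j * (1 / u $ j)" for z :: "complex ^ 4"
  have dec: "rep_proj3 (g w) = \<Lambda> (rep_proj3 (g w)) *s u + rep_proj3 (g w) $ i *s axis i 1" for w
  proof -
    obtain c where c: "coproj i (rep_proj3 (g w)) = c *s u" using q(3)[of w] unfolding qc[of w] u_def by blast
    from arg_cong[OF c, of "\<lambda>x. x $ j"] have "rep_proj3 (g w) $ j = c * u $ j" using ji by (simp add: coproj_def)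
    then have "c = \<Lambda> (rep_proj3 (g w))" using j by (simp add: \<Lambda>_def)
    then show ?thesis using coproj_decomp[of "rep_proj3 (g w)" i] c by simp
  qed
  have line_const: False if "\<And>w. rep_proj3 (g w) $ i = \<kappa> * \<Lambda> (rep_proj3 (g w))" for \<kappa>
  proof -
    have eq: "rep_proj3 (g w) = \<Lambda> (rep_proj3 (g w)) *s (u + \<kappa> *s axis i 1)" for w
      by (subst dec) (simp add: that vec_eq_iff distrib_left)
    have nz: "u + \<kappa> *s axis i 1 \<noteq> 0" using j ji by (auto simp: vec_eq_iff axis_def intro!: exI[of _ j])
    have "g w = pt (u + \<kappa> *s axis i 1)" for w by (rule ptI[OF nz eq])
    then show False using not_const by blast
  qed
  have \<Lambda>pf: "polyfun \<Lambda>" "hom_fun 1 \<Lambda>"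
    unfolding \<Lambda>_def by (intro polyfun.mult polyfun.coord polyfun.const) (simp add: hom_fun_def)
  have form: "polyfun (\<lambda>z. z $ i + (- \<mu>) * \<Lambda> z)" "hom_fun 1 (\<lambda>z. z $ i + (- \<mu>) * \<Lambda> z)" for \<mu>
  proof -
    show "polyfun (\<lambda>z. z $ i + (- \<mu>) * \<Lambda> z)"
      by (intro polyfun.add polyfun.mult polyfun.coord polyfun.const \<Lambda>pf(1))
    have "\<Lambda> (c *s z) = c * \<Lambda> z" for c z using \<Lambda>pf(2) unfolding hom_fun_def by simp
    then show "hom_fun 1 (\<lambda>z. z $ i + (- \<mu>) * \<Lambda> z)" by (simp add: hom_fun_def algebra_simps)
  qed
  from gb show False
  proof
    assume gb0: "\<forall>w. b (rep_proj3 (g w)) = 0"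
    \<comment> \<open>The curve avoids the vertex because \<open>b\<close> does not vanish
      there.\<close>
    have \<Lambda>0: "\<Lambda> (rep_proj3 (g w)) \<noteq> 0" for w
    proof
      assume 0: "\<Lambda> (rep_proj3 (g w)) = 0"
      have eq: "rep_proj3 (g w) = rep_proj3 (g w) $ i *s axis i 1" using dec[of w] unfolding 0 by simp
      have "rep_proj3 (g w) $ i \<noteq> 0" by (rule smult_factor_nonzero[OF rep_proj3_nonzero eq])
      moreover have "(rep_proj3 (g w) $ i) ^ n * b (axis i 1) = 0"
        using gb0 hom_fun_smult[OF b(2) eq] by simp
      ultimately show False using b(4) by simp
    qed
    define \<phi> where "\<phi> w = rep_proj3 (g w) $ i / \<Lambda> (rep_proj3 (g w))" for w
    have hol: "\<phi> holomorphic_on UNIV"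
      unfolding \<phi>_def[abs_def] by (rule ratio_holomorphic[OF g open_UNIV polyfun.coord \<Lambda>pf(1) hom_fun_coord \<Lambda>pf(2) \<Lambda>0])
    have "Set.range \<phi> \<subseteq> {t. b (u + t *s axis i 1) = 0}"
    proof (rule image_subsetI, rule CollectI)
      fix w
      have eq: "rep_proj3 (g w) = \<Lambda> (rep_proj3 (g w)) *s (u + \<phi> w *s axis i 1)"
        by (subst dec) (simp add: \<phi>_def vec_eq_iff distrib_left \<Lambda>0)
      have "\<Lambda> (rep_proj3 (g w)) ^ n * b (u + \<phi> w *s axis i 1) = 0"
        using gb0 hom_fun_smult[OF b(2) eq] by simp
      then show "b (u + \<phi> w *s axis i 1) = 0" using \<Lambda>0 by simp
    qed
    then have "finite (Set.range \<phi>)" using finite_line_zeros[OF b(1,2,4)] finite_subset by blast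
    then obtain c where "\<phi> = (\<lambda>_. c)" by (rule entire_finite_range_const[OF hol])
    then have c: "\<phi> w = c" for w by simp
    have "rep_proj3 (g w) $ i = c * \<Lambda> (rep_proj3 (g w))" for w
      using c[of w] \<Lambda>0[of w] unfolding \<phi>_def by (simp add: field_simps)
    then show False by (rule line_const)
  next
    assume gbf: "\<forall>w. b (rep_proj3 (g w)) = 0 \<longrightarrow> f (rep_proj3 (g w)) = 0"
    let ?T = "{\<mu>. b (u + \<mu> *s axis i 1) = 0 \<and> f (u + \<mu> *s axis i 1) \<noteq> 0}"
    obtain T where "T \<subseteq> ?T" "card T = 3" by (rule obtain_subset_with_card_n[OF three[OF u]])
    then obtain \<mu>1 \<mu>2 \<mu>3 where \<mu>: "\<mu>1 \<in> ?T" "\<mu>2 \<in> ?T" "\<mu>3 \<in> ?T" "\<mu>1 \<noteq> \<mu>2" "\<mu>1 \<noteq> \<mu>3" "\<mu>2 \<noteq> \<mu>3"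
      unfolding card_3_iff by auto
    have nz: "rep_proj3 (g w) $ i + (- \<mu>) * \<Lambda> (rep_proj3 (g w)) \<noteq> 0" if m: "\<mu> \<in> ?T" for \<mu> w
    proof
      assume "rep_proj3 (g w) $ i + (- \<mu>) * \<Lambda> (rep_proj3 (g w)) = 0"
      then have \<nu>: "rep_proj3 (g w) $ i = \<mu> * \<Lambda> (rep_proj3 (g w))" by (simp add: add_eq_0_iff)
      have eq: "rep_proj3 (g w) = \<Lambda> (rep_proj3 (g w)) *s (u + \<mu> *s axis i 1)"
        by (subst dec) (simp add: \<nu> vec_eq_iff distrib_left)
      have l0: "\<Lambda> (rep_proj3 (g w)) \<noteq> 0" by (rule smult_factor_nonzero[OF rep_proj3_nonzero eq])
      have "b (rep_proj3 (g w)) = \<Lambda> (rep_proj3 (g w)) ^ n * b (u + \<mu> *s axis i 1)"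
        by (rule hom_fun_smult[OF b(2) eq])
      then have "b (rep_proj3 (g w)) = 0" using m by simp
      then have "f (rep_proj3 (g w)) = 0" using gbf by blast
      moreover have "f (rep_proj3 (g w)) = \<Lambda> (rep_proj3 (g w)) ^ N * f (u + \<mu> *s axis i 1)"
        by (rule hom_fun_smult[OF f eq])
      ultimately show False using l0 m by simp
    qed
    \<comment> \<open>The coordinate on the generator that sends \<mu>1 to 0, \<mu>2 to infinity,
      \<mu>3 to \<kappa> and the vertex to 1. As the curve omits the first three, \<phi> is entire
      and omits 0 and \<kappa>.\<close>
    define \<phi> where "\<phi> w = (rep_proj3 (g w) $ i + (- \<mu>1) * \<Lambda> (rep_proj3 (g w))) / (rep_proj3 (g w) $ i + (- \<mu>2) * \<Lambda> (rep_proj3 (g w)))" for w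
    have hol: "\<phi> holomorphic_on UNIV"
      unfolding \<phi>_def[abs_def] by (rule ratio_holomorphic[OF g open_UNIV form(1) form(1) form(2) form(2) nz[OF \<mu>(2)]])
    define \<kappa> where "\<kappa> = (\<mu>3 - \<mu>1) / (\<mu>3 - \<mu>2)"
    have \<kappa>0: "\<kappa> \<noteq> 0" "\<mu>3 - \<mu>2 \<noteq> 0" unfolding \<kappa>_def using \<mu>(5,6) by auto
    have "\<phi> w \<noteq> 0" for w unfolding \<phi>_def using nz[OF \<mu>(1)] nz[OF \<mu>(2)] by simp
    moreover have "\<phi> w \<noteq> \<kappa>" for w
    proof
      assume "\<phi> w = \<kappa>"
      then have "(rep_proj3 (g w) $ i + (- \<mu>1) * \<Lambda> (rep_proj3 (g w))) * (\<mu>3 - \<mu>2)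
          = (\<mu>3 - \<mu>1) * (rep_proj3 (g w) $ i + (- \<mu>2) * \<Lambda> (rep_proj3 (g w)))"
        unfolding \<phi>_def \<kappa>_def by (rule iffD1[OF frac_eq_eq[OF nz[OF \<mu>(2)] \<kappa>0(2)]])
      then have "(\<mu>1 - \<mu>2) * (rep_proj3 (g w) $ i + (- \<mu>3) * \<Lambda> (rep_proj3 (g w))) = 0"
        by (simp add: algebra_simps)
      then show False using \<mu>(4) nz[OF \<mu>(3), of w] by simp
    qed
    ultimately have "Set.range \<phi> \<inter> {0, \<kappa>} = {}" by (auto simp: image_iff)
    then obtain c where "\<phi> = (\<lambda>_. c)" by (rule little_Picard[OF hol \<kappa>0(1)[symmetric]])
    then have c: "\<phi> w = c" for w by simp
    have rel: "rep_proj3 (g w) $ i + (- \<mu>1) * \<Lambda> (rep_proj3 (g w)) = c * (rep_proj3 (g w) $ i + (- \<mu>2) * \<Lambda> (rep_proj3 (g w)))" for w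
      using c[of w] unfolding \<phi>_def by (rule iffD1[OF nonzero_divide_eq_eq[OF nz[OF \<mu>(2)]]])
    show False
    \<comment> \<open>The value 1 belongs to the vertex, every other one to a point of the form
      \<open>u + \<mu> *s axis i 1\<close>.\<close>
    proof (cases "c = 1")
      case True
      have "(\<mu>1 - \<mu>2) * \<Lambda> (rep_proj3 (g w)) = 0" for w using rel[of w] unfolding True by (auto simp: algebra_simps)
      then have l0: "\<Lambda> (rep_proj3 (g w)) = 0" for w using \<mu>(4) by simp
      have "rep_proj3 (g w) = rep_proj3 (g w) $ i *s axis i 1" for w using dec[of w] unfolding l0 by simp
      then have "g w = pt (axis i 1)" for w by (rule ptI[OF axi])
      then show False using not_const by blast
    next
      case False
      have "rep_proj3 (g w) $ i = (\<mu>1 - c * \<mu>2) / (1 - c) * \<Lambda> (rep_proj3 (g w))" for w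
        using rel[of w] False by (simp add: field_simps)
      then show False by (rule line_const)
    qed
  qed
qed

subsection \<open>Limits of curves on the deformed surfaces\<close>

text \<open>A product of uniform limits is one if the factors are bounded, which compactness
  provides.\<close>

lemma polyfun_uniform_limit:
  assumes a: "polyfun a" and K: "compact K" and G: "\<And>i. continuous_on K (\<lambda>w. G w $ i)"
    and ul: "\<And>i. uniform_limit K (\<lambda>k w. H k w $ i) (\<lambda>w. G w $ i) sequentially"
  shows "continuous_on K (\<lambda>w. a (G w)) \<and> uniform_limit K (\<lambda>k w. a (H k w)) (\<lambda>w. a (G w)) sequentially"
  using a
proof induction
  case (const c)
  show ?case by (intro conjI continuous_on_const uniform_limit_const)
next
  case (coord i)
  show ?case by (intro conjI G ul)
next
  case (add a b)
  then show ?case by (intro conjI continuous_on_add uniform_limit_add) blast+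
next
  case (mult a b)
  then have c: "continuous_on K (\<lambda>w. a (G w))" "continuous_on K (\<lambda>w. b (G w))" by blast+
  have bd: "bounded ((\<lambda>w. a (G w)) ` K)" "bounded ((\<lambda>w. b (G w)) ` K)"
    by (rule compact_imp_bounded[OF compact_continuous_image[OF c(1) K]],
        rule compact_imp_bounded[OF compact_continuous_image[OF c(2) K]])
  show ?case
    by (intro conjI continuous_on_mult c uniform_lim_mult bd) (use mult in blast)+
qed

lemma conv_curves_polyfun:
  assumes "conv_curves h g"
  obtains r N H G where "r > 0" "\<forall>k\<ge>N. lift (h k) (ball w r) (H k)" "lift g (ball w r) G"
    "\<forall>a. polyfun a \<longrightarrow> uniform_limit (ball w r) (\<lambda>k x. a (H k x)) (\<lambda>x. a (G x)) sequentially"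
proof -
  from assms[unfolded conv_curves_def, rule_format, of w] obtain \<delta> N H G where \<delta>: "\<delta> > 0"
    and H: "\<And>k. k \<ge> N \<Longrightarrow> lift (h k) (ball w \<delta>) (H k)" and G: "lift g (ball w \<delta>) G"
    and ul: "\<And>i. uniform_limit (ball w \<delta>) (\<lambda>k x. H k x $ i) (\<lambda>x. G x $ i) sequentially" by blast
  have sub: "cball w (\<delta> / 2) \<subseteq> ball w \<delta>" "ball w (\<delta> / 2) \<subseteq> ball w \<delta>" using \<delta> by auto
  have c: "continuous_on (cball w (\<delta> / 2)) (\<lambda>x. G x $ i)" for i
    using G sub(1) unfolding lift_def by (meson continuous_on_subset holomorphic_on_imp_continuous_on)
  show thesis
  proof (rule that)
    show "\<delta> / 2 > 0" using \<delta> by simp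
    show "\<forall>k\<ge>N. lift (h k) (ball w (\<delta> / 2)) (H k)"
      by (intro allI impI lift_subset[OF H open_ball sub(2)])
    show "lift g (ball w (\<delta> / 2)) G" by (rule lift_subset[OF G open_ball sub(2)])
    show "\<forall>a. polyfun a \<longrightarrow> uniform_limit (ball w (\<delta> / 2)) (\<lambda>k x. a (H k x)) (\<lambda>x. a (G x)) sequentially"
    proof (intro allI impI)
      fix a assume a: "polyfun a"
      have "uniform_limit (cball w (\<delta> / 2)) (\<lambda>k x. a (H k x)) (\<lambda>x. a (G x)) sequentially"
      by (rule conjunct2[OF polyfun_uniform_limit[OF a compact_cball]]) (rule c, rule uniform_limit_on_subset[OF ul sub(1)])
    then show "uniform_limit (ball w (\<delta> / 2)) (\<lambda>k x. a (H k x)) (\<lambda>x. a (G x)) sequentially"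
      by (rule uniform_limit_on_subset) auto
    qed
  qed
qed

lemma polyfun_lift_holomorphic: "polyfun a \<Longrightarrow> lift g V F \<Longrightarrow> (\<lambda>x. a (F x)) holomorphic_on V"
  by (erule polyfun_holomorphic) (simp add: lift_def)

lemma hom_fun_deformation:
  "hom_fun m a \<Longrightarrow> hom_fun n b \<Longrightarrow> hom_fun (m + n) f \<Longrightarrow> hom_fun (m + n) (\<lambda>z. a z * b z + t * f z)"
  unfolding hom_fun_def by (simp add: power_add algebra_simps)

text \<open>Both cones enter symmetrically, so results for \<open>b\<close> transfer to
  \<open>a\<close> by \<open>deformed_curves_swap\<close>. The k-th curve lies on its surface only
  over the disc of radius k.\<close>

locale deformed_curves =
  fixes a b f :: "complex ^ 4 \<Rightarrow> complex" and m n :: nat and \<tau> :: "nat \<Rightarrow> complex" and h g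
  assumes a: "polyfun a" "hom_fun m a" and b: "polyfun b" "hom_fun n b"
    and f: "polyfun f" "hom_fun (m + n) f" and \<tau>: "\<tau> \<longlonglongrightarrow> 0" "\<And>k. \<tau> k \<noteq> 0"
    and conv: "conv_curves h g" and g: "proj_holomorphic_on g UNIV"
    and eq: "\<And>k w. cmod w < real k \<Longrightarrow>
       a (rep_proj3 (h k w)) * b (rep_proj3 (h k w)) + \<tau> k * f (rep_proj3 (h k w)) = 0"
begin

lemma lift_eq:
  assumes "lift (h k) V H" "w \<in> V" "cmod w < real k"
  shows "a (H w) * b (H w) + \<tau> k * f (H w) = 0"
  using hom_fun_lift[OF hom_fun_deformation[OF a(2) b(2) f(2), of "\<tau> k"] assms(1,2)] eq[OF assms(3)] by simp

lemma limit_product: "a (rep_proj3 (g w)) * b (rep_proj3 (g w)) = 0"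
proof -
  obtain r N H G where rr: "r > 0" "\<forall>k\<ge>N. lift (h k) (ball w r) (H k)" "lift g (ball w r) G"
    "\<forall>a. polyfun a \<longrightarrow> uniform_limit (ball w r) (\<lambda>k x. a (H k x)) (\<lambda>x. a (G x)) sequentially"
    by (rule conv_curves_polyfun[OF conv, where w = w])
  note r = rr(1) rr(2)[rule_format] rr(3) rr(4)[rule_format]
  have w: "w \<in> ball w r" using r(1) by simp
  have lim: "(\<lambda>k. p (H k w)) \<longlonglongrightarrow> p (G w)" if p: "polyfun p" for p
    by (rule tendsto_uniform_limitI[OF r(4)[OF p] w])
  have "(\<lambda>k. a (H k w) * b (H k w) + \<tau> k * f (H k w)) \<longlonglongrightarrow> a (G w) * b (G w) + 0 * f (G w)"
    by (intro tendsto_add tendsto_mult lim a b f \<tau>)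
  moreover obtain M :: nat where M: "cmod w < real M" using reals_Archimedean2 by blast
  have "\<forall>\<^sub>F k in sequentially. a (H k w) * b (H k w) + \<tau> k * f (H k w) = 0"
  proof (rule eventually_sequentiallyI[of "max M N"])
    fix k assume k: "max M N \<le> k"
    then have "cmod w < real k" using M by linarith
    then show "a (H k w) * b (H k w) + \<tau> k * f (H k w) = 0" using lift_eq[OF r(2) w] k by simp
  qed
  then have "(\<lambda>k. a (H k w) * b (H k w) + \<tau> k * f (H k w)) \<longlonglongrightarrow> 0" by (rule tendsto_eventually)
  ultimately have "a (G w) * b (G w) + 0 * f (G w) = 0" by (rule LIMSEQ_unique)
  then show ?thesis using hom_fun_lift[OF a(2) r(3) w] hom_fun_lift[OF b(2) r(3) w] by simp
qed

text \<open>Where \<open>b\<close> is nonzero, \<open>a\<close> vanishes, and the identity principle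
  spreads this from an open set to the whole curve.\<close>

lemma limit_on_one_cone: "(\<forall>w. a (rep_proj3 (g w)) = 0) \<or> (\<forall>w. b (rep_proj3 (g w)) = 0)"
proof (rule ccontr)
  assume "\<not> ?thesis"
  then obtain w1 w2 where w1: "b (rep_proj3 (g w1)) \<noteq> 0" and w2: "a (rep_proj3 (g w2)) \<noteq> 0" by blast
  obtain V F where V: "w1 \<in> V" "lift g V F" using g unfolding proj_holomorphic_on_lift by blast
  have Vo: "open V" using V(2) unfolding lift_def by blast
  define O' where "O' = V \<inter> (\<lambda>x. b (F x)) -` (- {0})"
  have "open O'" unfolding O'_def
    by (rule continuous_open_preimage[OF holomorphic_on_imp_continuous_on[OF polyfun_lift_holomorphic[OF b(1) V(2)]]
        Vo open_Compl[OF closed_singleton]])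
  moreover have "w1 \<in> O'" using V(1) w1 hom_fun_lift[OF b(2) V(2,1)] unfolding O'_def by simp
  then have "O' \<noteq> {}" by blast
  moreover have O3: "a (rep_proj3 (g x)) = 0" if x: "x \<in> O'" for x
    using limit_product[of x] hom_fun_lift[OF b(2) V(2), of x] x unfolding O'_def by simp
  ultimately have "a (rep_proj3 (g w2)) = 0" by (rule identity_principle[OF g a])
  then show False using w2 by simp
qed

text \<open>Where \<open>f \<noteq> 0\<close> the nearby curves avoid \<open>b = 0\<close>, so Hurwitz' theorem applies to \<open>b\<close>.\<close>

lemma limit_meets_cone_in_f:
  assumes nb: "b (rep_proj3 (g w1)) \<noteq> 0" and b0: "b (rep_proj3 (g w)) = 0"
  shows "f (rep_proj3 (g w)) = 0"
proof (rule ccontr)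
  assume f0: "f (rep_proj3 (g w)) \<noteq> 0"
  obtain r N H G where rr: "r > 0" "\<forall>k\<ge>N. lift (h k) (ball w r) (H k)" "lift g (ball w r) G"
    "\<forall>a. polyfun a \<longrightarrow> uniform_limit (ball w r) (\<lambda>k x. a (H k x)) (\<lambda>x. a (G x)) sequentially"
    by (rule conv_curves_polyfun[OF conv, where w = w])
  note r = rr(1) rr(2)[rule_format] rr(3) rr(4)[rule_format]
  have w: "w \<in> ball w r" using r(1) by simp
  define e where "e = cmod (f (G w)) / 2"
  have e: "e > 0" using f0 hom_fun_lift[OF f(2) r(3) w] by (simp add: e_def)
  have "continuous_on (ball w r) (\<lambda>x. f (G x))"
    by (rule holomorphic_on_imp_continuous_on[OF polyfun_lift_holomorphic[OF f(1) r(3)]])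
  then obtain s0 where s0: "s0 > 0" "\<And>x. x \<in> ball w r \<Longrightarrow> dist x w < s0 \<Longrightarrow> dist (f (G x)) (f (G w)) < e"
    using w e unfolding continuous_on_iff by blast
  define s where "s = min s0 r"
  have s: "s > 0" "ball w s \<subseteq> ball w r" using s0(1) r(1) by (auto simp: s_def)
  have ws: "w \<in> ball w s" using s(1) by simp
  have fG: "cmod (f (G x)) > e" if x: "x \<in> ball w s" for x
  proof -
    have "dist (f (G x)) (f (G w)) < e" using s0(2)[of x] s(2) x by (auto simp: s_def dist_commute)
    moreover have "cmod (f (G w)) = 2 * e" by (simp add: e_def)
    ultimately show ?thesis
      using norm_triangle_ineq2[of "f (G w)" "f (G x)"] by (simp add: dist_norm norm_minus_commute)
  qed
  have "\<forall>\<^sub>F k in sequentially. \<forall>x\<in>ball w r. dist (f (H k x)) (f (G x)) < e"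
    by (rule uniform_limitD[OF r(4)[OF f(1)] e])
  then obtain M1 where M1: "\<And>k x. k \<ge> M1 \<Longrightarrow> x \<in> ball w r \<Longrightarrow> dist (f (H k x)) (f (G x)) < e"
    unfolding eventually_sequentially by blast
  obtain M2 :: nat where M2: "cmod w + s < real M2" using reals_Archimedean2 by blast
  define M where "M = max M1 (max M2 N)"
  have M: "k + M \<ge> M1" "k + M \<ge> M2" "k + M \<ge> N" for k by (simp_all add: M_def)
  \<comment> \<open>On the deformed surface \<open>b = 0\<close> forces \<open>f = 0\<close>,
    because \<open>\<tau>\<close> is nowhere zero; but near \<open>w\<close> the values of
    \<open>f\<close> on late curves stay away from zero.\<close>
  have nz: "b (H (k + M) x) \<noteq> 0" if x: "x \<in> ball w s" for k x
  proof
    assume 0: "b (H (k + M) x) = 0"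
    have xr: "x \<in> ball w r" using x s(2) by blast
    have "cmod x < cmod w + s" using x norm_triangle_ineq2[of x w] by (simp add: dist_norm norm_minus_commute)
    then have "cmod x < real (k + M)" using M2 M(2)[of k] by linarith
    from lift_eq[OF r(2)[OF M(3)] xr this] have "\<tau> (k + M) * f (H (k + M) x) = 0" unfolding 0 by simp
    then have "f (H (k + M) x) = 0" using \<tau>(2) by simp
    then have "cmod (f (G x)) < e" using M1[OF M(1) xr, of k] by (simp add: dist_norm)
    then show False using fG[OF x] by simp
  qed
  have holG: "(\<lambda>x. b (G x)) holomorphic_on ball w s"
    by (rule holomorphic_on_subset[OF polyfun_lift_holomorphic[OF b(1) r(3)] s(2)])
  have "b (G w) \<noteq> 0"
  proof (rule Hurwitz_no_zeros[where S = "ball w s" and \<F> = "\<lambda>k x. b (H (k + M) x)" and g = "\<lambda>x. b (G x)"])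
    show "(\<lambda>x. b (H (k + M) x)) holomorphic_on ball w s" for k
      by (rule holomorphic_on_subset[OF polyfun_lift_holomorphic[OF b(1) r(2)[OF M(3)]] s(2)])
    show "uniform_limit K (\<lambda>k x. b (H (k + M) x)) (\<lambda>x. b (G x)) sequentially" if K: "compact K" "K \<subseteq> ball w s" for K
    proof -
      have "uniform_limit K (\<lambda>k x. b (H k x)) (\<lambda>x. b (G x)) sequentially"
        by (rule uniform_limit_on_subset[OF r(4)[OF b(1)]]) (use K(2) s(2) in blast)
      then show ?thesis by (rule filterlim_compose[OF _ filterlim_add_const_nat_at_top])
    qed
    show "\<not> (\<lambda>x. b (G x)) constant_on ball w s"
    proof
      assume "(\<lambda>x. b (G x)) constant_on ball w s"
      then obtain c where c: "\<And>x. x \<in> ball w s \<Longrightarrow> b (G x) = c" unfolding constant_on_def by blast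
      have "c = 0" using c[OF ws] hom_fun_lift[OF b(2) r(3) w] b0 by simp
      have "b (rep_proj3 (g w1)) = 0"
      proof (rule identity_principle[OF g b open_ball])
        show "ball w s \<noteq> {}" using s(1) by simp
        show "b (rep_proj3 (g x)) = 0" if x: "x \<in> ball w s" for x
          using c[OF x] hom_fun_lift[OF b(2) r(3) subsetD[OF s(2) x]] \<open>c = 0\<close> by simp
      qed
      then show False using nb by simp
    qed
  qed (use holG nz ws in auto)
  then show False using hom_fun_lift[OF b(2) r(3) w] b0 by simp
qed

lemma limit_alternative:
  "(\<forall>w. b (rep_proj3 (g w)) = 0) \<or> (\<forall>w. b (rep_proj3 (g w)) = 0 \<longrightarrow> f (rep_proj3 (g w)) = 0)"
  using limit_meets_cone_in_f by blast

lemma deformed_curves_swap: "deformed_curves b a f n m \<tau> h g"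
  using a b f \<tau> conv g eq by unfold_locales (simp_all add: add.commute mult.commute)

end

text \<open>Failure for each \<epsilon> = 1/(k+1) gives parameters that tend to 0 and, by
  \<open>kobayashi_hyperbolicI\<close>, discs with derivative above any bound. Their rescaled limit
  is a nonconstant entire curve, which \<open>noA\<close> and \<open>noB\<close> exclude.\<close>

theorem hyperbolic_deformation:
  fixes a b f :: "complex ^ 4 \<Rightarrow> complex"
  assumes a: "polyfun a" "hom_fun m a" and b: "polyfun b" "hom_fun n b"
    and f: "polyfun f" "hom_fun (m + n) f"
    and noA: "\<And>g. proj_holomorphic_on g UNIV \<Longrightarrow> (\<And>p. \<exists>w. g w \<noteq> p) \<Longrightarrow> (\<And>w. a (rep_proj3 (g w)) = 0) \<Longrightarrow>
      (\<forall>w. b (rep_proj3 (g w)) = 0) \<or> (\<forall>w. b (rep_proj3 (g w)) = 0 \<longrightarrow> f (rep_proj3 (g w)) = 0) \<Longrightarrow> False"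
    and noB: "\<And>g. proj_holomorphic_on g UNIV \<Longrightarrow> (\<And>p. \<exists>w. g w \<noteq> p) \<Longrightarrow> (\<And>w. b (rep_proj3 (g w)) = 0) \<Longrightarrow>
      (\<forall>w. a (rep_proj3 (g w)) = 0) \<or> (\<forall>w. a (rep_proj3 (g w)) = 0 \<longrightarrow> f (rep_proj3 (g w)) = 0) \<Longrightarrow> False"
  shows "\<exists>\<epsilon>>0. \<forall>t. 0 < cmod t \<and> cmod t < \<epsilon> \<longrightarrow>
    kobayashi_hyperbolic {pt z | z. z \<noteq> 0 \<and> a z * b z + t * f z = 0}"
proof (rule ccontr)
  assume neg: "\<not> ?thesis"
  define X where "X t = {pt z | z. z \<noteq> 0 \<and> a z * b z + t * f z = 0}" for t
  have X: "a (rep_proj3 p) * b (rep_proj3 p) + t * f (rep_proj3 p) = 0" if p: "p \<in> X t" for p t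
  proof -
    obtain z where "z \<noteq> 0" "p = pt z" "a z * b z + t * f z = 0" using p unfolding X_def by blast
    then show ?thesis using hom_fun_pt[OF hom_fun_deformation[OF a(2) b(2) f(2), of t], of z] by simp
  qed
  have ex: "\<exists>t h. t \<noteq> 0 \<and> cmod t < 1 / real (Suc k) \<and> proj_holomorphic_on h (ball 0 (real k)) \<and>
      h ` ball 0 (real k) \<subseteq> X t \<and> fs_deriv h 0 = 1 \<and> (\<forall>\<zeta>\<in>ball 0 (real k). fs_deriv h \<zeta> \<le> 2)" for k :: nat
  proof -
    have "1 / real (Suc k) > 0" by simp
    then obtain t where t: "0 < cmod t" "cmod t < 1 / real (Suc k)" "\<not> kobayashi_hyperbolic (X t)"
      using neg unfolding X_def by blast
    \<comment> \<open>A quarter of this bound is the radius after rescaling, and it exceeds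
      k.\<close>
    have "\<exists>f. holomorphic_disc (X t) f \<and> \<not> fs_deriv f 0 \<le> 4 * real k + 4"
    proof (rule ccontr)
      assume "\<not> ?thesis"
      then have "kobayashi_hyperbolic (X t)" by (intro kobayashi_hyperbolicI[of _ "4 * real k + 4"]) auto
      then show False using t(3) by blast
    qed
    then obtain \<phi> where \<phi>: "holomorphic_disc (X t) \<phi>" "\<not> fs_deriv \<phi> 0 \<le> 4 * real k + 4" by blast
    have hol: "proj_holomorphic_on \<phi> (ball 0 1)" and im: "\<phi> ` ball 0 1 \<subseteq> X t"
      using \<phi>(1) unfolding holomorphic_disc_def by auto
    have pos: "fs_deriv \<phi> 0 > 0" using \<phi>(2) by linarith
    obtain h where h: "proj_holomorphic_on h (ball 0 (fs_deriv \<phi> 0 / 4))"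
      "h ` ball 0 (fs_deriv \<phi> 0 / 4) \<subseteq> \<phi> ` ball 0 1" "fs_deriv h 0 = 1"
      "\<And>\<zeta>. \<zeta> \<in> ball 0 (fs_deriv \<phi> 0 / 4) \<Longrightarrow> fs_deriv h \<zeta> \<le> 2"
      by (rule brody_rescaling[OF hol pos]) blast
    have sub: "ball 0 (real k) \<subseteq> ball (0::complex) (fs_deriv \<phi> 0 / 4)" by (rule subset_ball) (use \<phi>(2) in linarith)
    show ?thesis
    proof (intro exI[of _ t] exI[of _ h] conjI ballI)
      show "t \<noteq> 0" using t(1) by auto
      show "proj_holomorphic_on h (ball 0 (real k))" by (rule proj_holomorphic_on_subset[OF h(1) open_ball sub])
      show "h ` ball 0 (real k) \<subseteq> X t" using h(2) sub im by blast
      show "fs_deriv h \<zeta> \<le> 2" if "\<zeta> \<in> ball 0 (real k)" for \<zeta> using h(4) sub that by blast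
    qed (fact t(2), fact h(3))
  qed
  have "\<forall>k. \<exists>t h. t \<noteq> 0 \<and> cmod t < 1 / real (Suc k) \<and> proj_holomorphic_on h (ball 0 (real k)) \<and>
      h ` ball 0 (real k) \<subseteq> X t \<and> fs_deriv h 0 = 1 \<and> (\<forall>\<zeta>\<in>ball 0 (real k). fs_deriv h \<zeta> \<le> 2)"
    by (rule allI) (rule ex)
  from choice[OF this] obtain \<tau> where "\<forall>k. \<exists>h. \<tau> k \<noteq> 0 \<and> cmod (\<tau> k) < 1 / real (Suc k) \<and> proj_holomorphic_on h (ball 0 (real k)) \<and>
      h ` ball 0 (real k) \<subseteq> X (\<tau> k) \<and> fs_deriv h 0 = 1 \<and> (\<forall>\<zeta>\<in>ball 0 (real k). fs_deriv h \<zeta> \<le> 2)" ..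
  from choice[OF this] obtain h where
    "\<forall>k. \<tau> k \<noteq> 0 \<and> cmod (\<tau> k) < 1 / real (Suc k) \<and> proj_holomorphic_on (h k) (ball 0 (real k)) \<and>
      h k ` ball 0 (real k) \<subseteq> X (\<tau> k) \<and> fs_deriv (h k) 0 = 1 \<and> (\<forall>\<zeta>\<in>ball 0 (real k). fs_deriv (h k) \<zeta> \<le> 2)" ..
  then have h: "\<And>k. \<tau> k \<noteq> 0" "\<And>k. cmod (\<tau> k) < 1 / real (Suc k)" "\<And>k. proj_holomorphic_on (h k) (ball 0 (real k))"
    "\<And>k. h k ` ball 0 (real k) \<subseteq> X (\<tau> k)" "\<And>k. fs_deriv (h k) 0 = 1"
    "\<And>k \<zeta>. \<zeta> \<in> ball 0 (real k) \<Longrightarrow> fs_deriv (h k) \<zeta> \<le> 2" by blast+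
  obtain r :: "nat \<Rightarrow> nat" and g where brody: "strict_mono r" "conv_curves (\<lambda>k. h (r k)) g" "proj_holomorphic_on g UNIV"
    "\<And>w. fs_deriv g w \<le> 2" "fs_deriv g 0 = 1"
    by (rule brody_limit[of h]) (use h(3,5,6) in blast)+
  have "\<tau> \<longlonglongrightarrow> 0"
  proof (rule Lim_null_comparison[OF _ LIMSEQ_inverse_real_of_nat])
    show "\<forall>\<^sub>F k in sequentially. cmod (\<tau> k) \<le> inverse (real (Suc k))"
      using h(2) by (intro always_eventually allI less_imp_le) (simp add: inverse_eq_divide)
  qed
  then have \<tau>: "(\<lambda>k. \<tau> (r k)) \<longlonglongrightarrow> 0" using LIMSEQ_subseq_LIMSEQ[OF _ brody(1), of \<tau> 0] by (simp add: comp_def)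
  interpret deformed_curves a b f m n "\<lambda>k. \<tau> (r k)" "\<lambda>k. h (r k)" g
  proof
    fix k w assume "cmod w < real k"
    then have "w \<in> ball 0 (real (r k))" using seq_suble[OF brody(1), of k] by simp
    then have "h (r k) w \<in> X (\<tau> (r k))" using h(4)[of "r k"] by blast
    then show "a (rep_proj3 (h (r k) w)) * b (rep_proj3 (h (r k) w)) + \<tau> (r k) * f (rep_proj3 (h (r k) w)) = 0"
      by (rule X)
  qed (fact a b f \<tau> h(1) brody(2,3))+
  interpret swap: deformed_curves b a f n m "\<lambda>k. \<tau> (r k)" "\<lambda>k. h (r k)" g
    by (rule deformed_curves_swap)
  have nc: "\<exists>w. g w \<noteq> p" for p using fs_deriv_const[of g p 0] brody(5) by fastforce
  from limit_on_one_cone show False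
  proof
    assume "\<forall>w. a (rep_proj3 (g w)) = 0"
    then show False by (intro noA[OF brody(3) nc _ limit_alternative]) blast
  next
    assume "\<forall>w. b (rep_proj3 (g w)) = 0"
    then show False by (intro noB[OF brody(3) nc _ swap.limit_alternative]) blast
  qed
qed

subsection \<open>Coordinates adapted to a pair of cones\<close>

text \<open>\<open>VN\<close> gets the value 0 that the smoothness condition of
  \<open>good_side\<close> prescribes.\<close>

fun xval :: "complex ^ 4 \<Rightarrow> cvar \<Rightarrow> complex" where
  "xval z VX = z $ 1"
| "xval z VY = z $ 2"
| "xval z VS = z $ 3"
| "xval z VM = z $ 4"
| "xval z VN = 0"

definition from_adapted :: "cone_pair \<times> 4 mpoly \<Rightarrow> complex ^ 4 \<Rightarrow> complex ^ 4" where
  "from_adapted \<theta> z = (\<chi> i. pnt \<theta> (xval z) i)"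

text \<open>Cramer's rule: the third and fourth coordinates of
  \<open>s v\<^sub>2 + \<mu> v\<^sub>1\<close> are solved for s here and for \<mu> in
  \<open>vm_coord\<close>.\<close>

definition vs_coord :: "cone_pair \<times> 4 mpoly \<Rightarrow> complex ^ 4 \<Rightarrow> complex" where
  "vs_coord \<theta> y = y $ 3 * (vert1 \<theta> $ 4 / vertex_det \<theta>) + y $ 4 * (- vert1 \<theta> $ 3 / vertex_det \<theta>)"

definition vm_coord :: "cone_pair \<times> 4 mpoly \<Rightarrow> complex ^ 4 \<Rightarrow> complex" where
  "vm_coord \<theta> y = y $ 4 * (vert2 \<theta> $ 3 / vertex_det \<theta>) + y $ 3 * (- vert2 \<theta> $ 4 / vertex_det \<theta>)"

definition to_adapted :: "cone_pair \<times> 4 mpoly \<Rightarrow> complex ^ 4 \<Rightarrow> complex ^ 4" where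
  "to_adapted \<theta> y = (\<chi> i. if i = 3 then vs_coord \<theta> y else if i = 4 then vm_coord \<theta> y
     else y $ i + (- vert2 \<theta> $ i) * vs_coord \<theta> y + (- vert1 \<theta> $ i) * vm_coord \<theta> y)"

lemma from_adapted_to_adapted:
  assumes "vertex_det \<theta> \<noteq> 0"
  shows "from_adapted \<theta> (to_adapted \<theta> y) = y"
proof -
  have d: "vert1 \<theta> $ 4 * vert2 \<theta> $ 3 - vert1 \<theta> $ 3 * vert2 \<theta> $ 4 \<noteq> 0" using assms by (simp add: vertex_det_def)
  have "vert2 \<theta> $ 3 * vs_coord \<theta> y + vert1 \<theta> $ 3 * vm_coord \<theta> y
      = y $ 3 * (vert1 \<theta> $ 4 * vert2 \<theta> $ 3 - vert1 \<theta> $ 3 * vert2 \<theta> $ 4) / vertex_det \<theta>"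
    unfolding vs_coord_def vm_coord_def using assms by (simp add: field_simps)
  then have 3: "vert2 \<theta> $ 3 * vs_coord \<theta> y + vert1 \<theta> $ 3 * vm_coord \<theta> y = y $ 3"
    using d by (simp add: vertex_det_def)
  have "vert2 \<theta> $ 4 * vs_coord \<theta> y + vert1 \<theta> $ 4 * vm_coord \<theta> y
      = y $ 4 * (vert1 \<theta> $ 4 * vert2 \<theta> $ 3 - vert1 \<theta> $ 3 * vert2 \<theta> $ 4) / vertex_det \<theta>"
    unfolding vs_coord_def vm_coord_def using assms by (simp add: field_simps)
  then have 4: "vert2 \<theta> $ 4 * vs_coord \<theta> y + vert1 \<theta> $ 4 * vm_coord \<theta> y = y $ 4"
    using d by (simp add: vertex_det_def)
  have "from_adapted \<theta> (to_adapted \<theta> y) $ i = y $ i" for i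
    using exhaust_4[of i] 3 4 by (auto simp: from_adapted_def to_adapted_def pnt_def)
  then show ?thesis by (simp add: vec_eq_iff)
qed

lemma pnt_xval_scale: "pnt \<theta> (xval (c *s z)) = (\<lambda>i. c * pnt \<theta> (xval z) i)"
  by (rule ext) (simp add: pnt_def algebra_simps)

lemma from_adapted_scale: "from_adapted \<theta> (c *s z) = c *s from_adapted \<theta> z"
  by (simp add: from_adapted_def pnt_xval_scale vec_eq_iff)

lemma to_adapted_scale: "to_adapted \<theta> (c *s y) = c *s to_adapted \<theta> y"
  by (simp add: to_adapted_def vs_coord_def vm_coord_def vec_eq_iff algebra_simps)

lemma polyfun_to_adapted: "polyfun (\<lambda>y. to_adapted \<theta> y $ i)"
proof -
  have c: "polyfun (vs_coord \<theta>)" "polyfun (vm_coord \<theta>)"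
    unfolding vs_coord_def[abs_def] vm_coord_def[abs_def]
    by (intro polyfun.add polyfun.mult polyfun.coord polyfun.const)+
  have o: "polyfun (\<lambda>y. y $ i + (- vert2 \<theta> $ i) * vs_coord \<theta> y + (- vert1 \<theta> $ i) * vm_coord \<theta> y)"
    by (intro polyfun.add polyfun.mult polyfun.coord polyfun.const c)
  show ?thesis
  proof (cases "i = 3 \<or> i = 4")
    case True
    then show ?thesis using c by (auto simp: to_adapted_def)
  next
    case False
    then show ?thesis using o by (simp add: to_adapted_def)
  qed
qed

lemma polyfun_pnt: "polyfun (\<lambda>z. pnt \<theta> (xval z) i)"
proof -
  have "polyfun (\<lambda>z. if P then z $ j else 0)" for P j
    by (cases P) (simp_all add: polyfun.const polyfun.coord)
  then show ?thesis
    unfolding pnt_def xval.simps by (intro polyfun.add polyfun.mult polyfun.const polyfun.coord)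
qed

lemma polyfun_adapted: "polyfun (\<lambda>z. meval p (pnt \<theta> (xval z)))"
  by (rule polyfun_meval[OF polyfun_pnt])

lemma hom_fun_adapted: "homogeneous d p \<Longrightarrow> hom_fun d (\<lambda>z. meval p (pnt \<theta> (xval z)))"
  unfolding hom_fun_def pnt_xval_scale using meval_homogeneous[of d p] by blast

lemma polyfun_standard: "polyfun (\<lambda>z. meval p (\<lambda>i. z $ i))"
  by (rule polyfun_meval[OF polyfun.coord])

lemma hom_fun_standard: "homogeneous d p \<Longrightarrow> hom_fun d (\<lambda>z. meval p (\<lambda>i. z $ i))"
  unfolding hom_fun_def vector_smult_component using meval_homogeneous[of d p] by blast

lemma pnt_to_adapted:
  assumes "vertex_det \<theta> \<noteq> 0"
  shows "pnt \<theta> (xval (to_adapted \<theta> y)) = (\<lambda>i. y $ i)"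
  using from_adapted_to_adapted[OF assms, of y] by (simp add: from_adapted_def vec_eq_iff fun_eq_iff)

lemma xval_add_axis:
  "xval (z + t *s axis 1 1) = (xval z)(VX := t + xval z VX)"
  "xval (z + t *s axis 2 1) = (xval z)(VY := t + xval z VY)"
  "xval (z + t *s axis 3 1) = (xval z)(VS := t + xval z VS)"
  "xval (z + t *s axis 4 1) = (xval z)(VM := t + xval z VM)"
proof -
  show "xval (z + t *s axis 1 1) = (xval z)(VX := t + xval z VX)"
  proof
    show "xval (z + t *s axis 1 1) v = ((xval z)(VX := t + xval z VX)) v" for v by (cases v) (simp_all add: axis_def)
  qed
  show "xval (z + t *s axis 2 1) = (xval z)(VY := t + xval z VY)"
  proof
    show "xval (z + t *s axis 2 1) v = ((xval z)(VY := t + xval z VY)) v" for v by (cases v) (simp_all add: axis_def)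
  qed
  show "xval (z + t *s axis 3 1) = (xval z)(VS := t + xval z VS)"
  proof
    show "xval (z + t *s axis 3 1) v = ((xval z)(VS := t + xval z VS)) v" for v by (cases v) (simp_all add: axis_def)
  qed
  show "xval (z + t *s axis 4 1) = (xval z)(VM := t + xval z VM)"
  proof
    show "xval (z + t *s axis 4 1) v = ((xval z)(VM := t + xval z VM)) v" for v by (cases v) (simp_all add: axis_def)
  qed
qed

lemma xval_zero: "xval 0 = (\<lambda>_. 0)"
proof
  show "xval 0 v = 0" for v by (cases v) simp_all
qed

lemma xval_inject: "xval z = (\<lambda>_. 0) \<Longrightarrow> z = 0"
proof -
  assume z: "xval z = (\<lambda>_. 0)"
  have "z $ i = 0" for i
    using exhaust_4[of i] fun_cong[OF z, of VX] fun_cong[OF z, of VY] fun_cong[OF z, of VS] fun_cong[OF z, of VM] by auto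
  then show "z = 0" by (simp add: vec_eq_iff)
qed

lemma linear_image_curve:
  assumes g: "proj_holomorphic_on g UNIV" and S: "\<And>i. polyfun (\<lambda>z. S z $ i)" "\<And>c z. S (c *s z) = c *s S z"
    and T: "\<And>z. T (S z) = z" "T 0 = (0 :: complex ^ 4)"
  shows "proj_holomorphic_on (\<lambda>w. pt (S (rep_proj3 (g w)))) UNIV"
  unfolding proj_holomorphic_on_lift
proof
  fix w
  have S0: "S z \<noteq> 0" if "z \<noteq> 0" for z using T(1)[of z] T(2) that by auto
  obtain V F where V: "w \<in> V" "lift g V F" using g unfolding proj_holomorphic_on_lift by blast
  have "lift (\<lambda>w. pt (S (rep_proj3 (g w)))) V (\<lambda>x. S (F x))"
    unfolding lift_def
  proof (intro conjI allI ballI)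
    show "open V" using V(2) unfolding lift_def by blast
    show "(\<lambda>x. S (F x) $ i) holomorphic_on V" for i by (rule polyfun_lift_holomorphic[OF S(1) V(2)])
    fix x assume x: "x \<in> V"
    have F: "F x \<noteq> 0" using V(2) x unfolding lift_def by blast
    show "S (F x) \<noteq> 0" by (rule S0[OF F])
    obtain c where c: "c \<noteq> 0" "rep_proj3 (g x) = c *s F x" by (rule lift_rep[OF V(2) x])
    have "S (rep_proj3 (g x)) = c *s S (F x)" unfolding c(2) S(2) ..
    then show "pt (S (rep_proj3 (g x))) = pt (S (F x))"
      using pt_eq_iff[OF S0[OF F] S0[OF rep_proj3_nonzero]] c(1) by metis
  qed
  then show "\<exists>V F. w \<in> V \<and> V \<subseteq> UNIV \<and> lift (\<lambda>w. pt (S (rep_proj3 (g w)))) V F" using V(1) by blast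
qed

lemma linear_image_nonconst:
  assumes S: "\<And>z. T (S z) = z" "T 0 = (0 :: complex ^ 4)" "\<And>c z. T (c *s z) = c *s T z"
    and nc: "\<And>p. \<exists>w :: complex. g w \<noteq> p"
  shows "\<exists>w. pt (S (rep_proj3 (g w))) \<noteq> p"
proof (rule ccontr)
  assume "\<not> ?thesis"
  then have p: "pt (S (rep_proj3 (g w))) = p" for w by blast
  have S0: "S z \<noteq> 0" if "z \<noteq> 0" for z using S(1)[of z] S(2) that by auto
  have "g w = g 0" for w
  proof -
    have "pt (S (rep_proj3 (g w))) = pt (S (rep_proj3 (g 0)))" using p by simp
    then obtain c where c: "c \<noteq> 0" "S (rep_proj3 (g 0)) = c *s S (rep_proj3 (g w))"
      using pt_eq_iff[OF S0[OF rep_proj3_nonzero] S0[OF rep_proj3_nonzero]] by blast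
    have "rep_proj3 (g 0) = c *s rep_proj3 (g w)" using arg_cong[OF c(2), of T] unfolding S(1,3) .
    then have "pt (rep_proj3 (g w)) = pt (rep_proj3 (g 0))"
      using pt_eq_iff[OF rep_proj3_nonzero rep_proj3_nonzero] c(1) by blast
    then show ?thesis unfolding pt_rep_proj3 .
  qed
  then show False using nc[of "g 0"] by blast
qed

text \<open>The adapted coordinates move the first vertex to the fourth coordinate point and make
  \<open>VM\<close> the parameter on its generators, which is the situation of
  \<open>no_entire_curve_in_cone\<close>.\<close>

lemma no_entire_curve_good_side:
  assumes hom: "homog_param m n \<theta>" and m: "m \<ge> 4" and n: "n \<ge> 4" and cone: "cone_param \<theta>"
    and det: "vertex_det \<theta> \<noteq> 0" and good: "good_side \<theta>"
    and g: "proj_holomorphic_on g UNIV" and nc: "\<And>p. \<exists>w. g w \<noteq> p"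
    and ga: "\<And>w. meval (eqn1 \<theta>) (\<lambda>i. rep_proj3 (g w) $ i) = 0"
    and gb: "(\<forall>w. meval (eqn2 \<theta>) (\<lambda>i. rep_proj3 (g w) $ i) = 0) \<or>
      (\<forall>w. meval (eqn2 \<theta>) (\<lambda>i. rep_proj3 (g w) $ i) = 0 \<longrightarrow> meval (defm \<theta>) (\<lambda>i. rep_proj3 (g w) $ i) = 0)"
  shows False
proof -
  define A where "A z = meval (eqn1 \<theta>) (pnt \<theta> (xval z))" for z
  define B where "B z = meval (eqn2 \<theta>) (pnt \<theta> (xval z))" for z
  define F where "F z = meval (defm \<theta>) (pnt \<theta> (xval z))" for z
  have pf: "polyfun A" "polyfun B" unfolding A_def[abs_def] B_def[abs_def] by (rule polyfun_adapted)+
  have hf: "hom_fun m A" "hom_fun n B" "hom_fun (m + n) F"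
    using hom unfolding homog_param_def A_def[abs_def] B_def[abs_def] F_def[abs_def] by (auto intro: hom_fun_adapted)
  define q where "q w = pt (to_adapted \<theta> (rep_proj3 (g w)))" for w
  note FT = from_adapted_to_adapted[OF det]
  have T0: "from_adapted \<theta> 0 = 0" using from_adapted_scale[of \<theta> 0 0] by simp
  have q: "proj_holomorphic_on q UNIV"
    unfolding q_def[abs_def] by (rule linear_image_curve[OF g polyfun_to_adapted to_adapted_scale FT T0])
  have qnc: "\<exists>w. q w \<noteq> p" for p
    unfolding q_def by (rule linear_image_nonconst[OF FT T0 from_adapted_scale nc])
  have S0: "to_adapted \<theta> (rep_proj3 p) \<noteq> 0" for p using FT[of "rep_proj3 p"] T0 rep_proj3_nonzero[of p] by auto
  have vA: "A (rep_proj3 (q w)) = 0 \<longleftrightarrow> meval (eqn1 \<theta>) (\<lambda>i. rep_proj3 (g w) $ i) = 0" for w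
    unfolding q_def hom_fun_pt[OF hf(1) S0] unfolding A_def pnt_to_adapted[OF det] ..
  have vB: "B (rep_proj3 (q w)) = 0 \<longleftrightarrow> meval (eqn2 \<theta>) (\<lambda>i. rep_proj3 (g w) $ i) = 0" for w
    unfolding q_def hom_fun_pt[OF hf(2) S0] unfolding B_def pnt_to_adapted[OF det] ..
  have vF: "F (rep_proj3 (q w)) = 0 \<longleftrightarrow> meval (defm \<theta>) (\<lambda>i. rep_proj3 (g w) $ i) = 0" for w
    unfolding q_def hom_fun_pt[OF hf(3) S0] unfolding F_def pnt_to_adapted[OF det] ..
  have good1: "X = (\<lambda>_. 0)" if "X VM = 0" "X VN = 0"
    "((\<lambda>t. meval (eqn1 \<theta>) (pnt \<theta> (X(VX := t)))) has_field_derivative 0) (at (X VX))"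
    "((\<lambda>t. meval (eqn1 \<theta>) (pnt \<theta> (X(VY := t)))) has_field_derivative 0) (at (X VY))"
    "((\<lambda>t. meval (eqn1 \<theta>) (pnt \<theta> (X(VS := t)))) has_field_derivative 0) (at (X VS))" for X
    using good that unfolding good_side_def Let_def by blast
  have good2: "meval (eqn2 \<theta>) (pnt \<theta> ((\<lambda>_. 0)(VM := 1))) \<noteq> 0" using good unfolding good_side_def Let_def by blast
  have good3: "card {\<mu>. meval (eqn2 \<theta>) (pnt \<theta> (X(VM := \<mu>))) = 0 \<and> meval (defm \<theta>) (pnt \<theta> (X(VM := \<mu>))) \<noteq> 0} \<ge> 3"
    if "X VX \<noteq> 0 \<or> X VY \<noteq> 0 \<or> X VS \<noteq> 0" "meval (eqn1 \<theta>) (pnt \<theta> X) = 0" for X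
    using good that unfolding good_side_def Let_def by blast
  show False
  proof (rule no_entire_curve_in_cone[OF q qnc pf(1) hf(1) m, where i = 4 and b = B and f = F])
    fix z c
    have "pnt \<theta> (xval (z + c *s axis 4 1)) = (\<lambda>i. pnt \<theta> (xval z) i + c * vert1 \<theta> $ i)"
      unfolding xval_add_axis by (rule ext) (simp add: pnt_def algebra_simps)
    then show "A (z + c *s axis 4 1) = A z" using cone unfolding A_def cone_param_def by simp
  next
    fix z :: "complex ^ 4" assume z: "z \<noteq> 0" "z $ 4 = 0"
    show "\<exists>j. j \<noteq> 4 \<and> \<not> ((\<lambda>t. A (z + t *s axis j 1)) has_field_derivative 0) (at 0)"
    proof (rule ccontr)
      assume neg: "\<not> ?thesis"
      have neq: "(1 :: 4) \<noteq> 4" "(2 :: 4) \<noteq> 4" "(3 :: 4) \<noteq> 4" by simp_all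
      have d: "((\<lambda>t. A (z + t *s axis 1 1)) has_field_derivative 0) (at 0)"
        "((\<lambda>t. A (z + t *s axis 2 1)) has_field_derivative 0) (at 0)"
        "((\<lambda>t. A (z + t *s axis 3 1)) has_field_derivative 0) (at 0)"
        using neg neq by blast+
      have "xval z = (\<lambda>_. 0)"
      proof (rule good1)
        show "((\<lambda>t. meval (eqn1 \<theta>) (pnt \<theta> ((xval z)(VX := t)))) has_field_derivative 0) (at (xval z VX))"
          using d(1) DERIV_shift[of "\<lambda>t. meval (eqn1 \<theta>) (pnt \<theta> ((xval z)(VX := t)))" 0 0 "xval z VX"]
          unfolding A_def xval_add_axis by simp
        show "((\<lambda>t. meval (eqn1 \<theta>) (pnt \<theta> ((xval z)(VY := t)))) has_field_derivative 0) (at (xval z VY))"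
          using d(2) DERIV_shift[of "\<lambda>t. meval (eqn1 \<theta>) (pnt \<theta> ((xval z)(VY := t)))" 0 0 "xval z VY"]
          unfolding A_def xval_add_axis by simp
        show "((\<lambda>t. meval (eqn1 \<theta>) (pnt \<theta> ((xval z)(VS := t)))) has_field_derivative 0) (at (xval z VS))"
          using d(3) DERIV_shift[of "\<lambda>t. meval (eqn1 \<theta>) (pnt \<theta> ((xval z)(VS := t)))" 0 0 "xval z VS"]
          unfolding A_def xval_add_axis by simp
      qed (use z(2) in simp_all)
      then show False using xval_inject z(1) by blast
    qed
  next
    have "xval (axis 4 1) = (\<lambda>_. 0)(VM := 1)"
      using xval_add_axis(4)[of 0 1] unfolding xval_zero by simp
    then show "B (axis 4 1) \<noteq> 0" using good2 unfolding B_def by simp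
  next
    fix u :: "complex ^ 4" assume u: "u \<noteq> 0" "u $ 4 = 0" "A u = 0"
    have "\<not> (u $ 1 = 0 \<and> u $ 2 = 0 \<and> u $ 3 = 0)" using u(1,2) by (auto simp: vec_eq_iff forall_4)
    then have nz: "xval u VX \<noteq> 0 \<or> xval u VY \<noteq> 0 \<or> xval u VS \<noteq> 0" by simp
    have x: "xval (u + \<mu> *s axis 4 1) = (xval u)(VM := \<mu>)" for \<mu> unfolding xval_add_axis by (simp add: u(2))
    show "card {\<mu>. B (u + \<mu> *s axis 4 1) = 0 \<and> F (u + \<mu> *s axis 4 1) \<noteq> 0} \<ge> 3"
      unfolding B_def F_def x by (rule good3[OF nz u(3)[unfolded A_def]])
  next
    show "A (rep_proj3 (q w)) = 0" for w unfolding vA by (rule ga)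
    show "(\<forall>w. B (rep_proj3 (q w)) = 0) \<or> (\<forall>w. B (rep_proj3 (q w)) = 0 \<longrightarrow> F (rep_proj3 (q w)) = 0)"
      unfolding vB vF by (rule gb)
  qed (use pf(2) hf(2,3) n in auto)
qed

section \<open>The equation of the deformed surface\<close>

lemma homogeneous_mult:
  fixes p q :: "'v mpoly"
  assumes "homogeneous d p" "homogeneous e q"
  shows "homogeneous (d + e) (p * q)"
  unfolding homogeneous_def
proof
  fix u assume "u \<in> Poly_Mapping.keys (p * q)"
  then obtain a b where "u = a + b" "a \<in> Poly_Mapping.keys p" "b \<in> Poly_Mapping.keys q"
    using keys_mult[of p q] by blast
  then show "mdegree u = d + e" using assms unfolding homogeneous_def by (simp add: mdegree_add)
qed

theorem good_pair_deformation_hyperbolic: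
  assumes hom: "homog_param m n \<theta>" and m: "m \<ge> 4" and n: "n \<ge> 4" and cone: "cone_param \<theta>"
    and det: "vertex_det \<theta> \<noteq> 0" and good: "good_side \<theta>" "good_side (swap_param \<theta>)"
  shows "\<exists>\<epsilon>>0. \<forall>t. 0 < cmod t \<and> cmod t < \<epsilon> \<longrightarrow>
    (let F = eqn1 \<theta> * eqn2 \<theta> + mconst t * defm \<theta> in
       F \<noteq> 0 \<and> homogeneous (m + n) F \<and> kobayashi_hyperbolic (hypersurface F))"
proof -
  let ?e = "\<lambda>p (z :: complex ^ 4). meval p (\<lambda>i. z $ i)"
  have homs: "homogeneous m (eqn1 \<theta>)" "homogeneous n (eqn2 \<theta>)" "homogeneous (m + n) (defm \<theta>)"
    using hom unfolding homog_param_def by auto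
  have swap: "homog_param n m (swap_param \<theta>)" "cone_param (swap_param \<theta>)" "vertex_det (swap_param \<theta>) \<noteq> 0"
    using hom cone det unfolding homog_param_def cone_param_def vertex_det_def by (auto simp: add.commute mult.commute)
  have "\<exists>\<epsilon>>0. \<forall>t. 0 < cmod t \<and> cmod t < \<epsilon> \<longrightarrow>
    kobayashi_hyperbolic {pt z | z. z \<noteq> 0 \<and> ?e (eqn1 \<theta>) z * ?e (eqn2 \<theta>) z + t * ?e (defm \<theta>) z = 0}"
  proof (rule hyperbolic_deformation[OF polyfun_standard hom_fun_standard[OF homs(1)] polyfun_standard hom_fun_standard[OF homs(2)]
        polyfun_standard hom_fun_standard[OF homs(3)]], goal_cases)
    case (1 g)
    then show ?case by (intro no_entire_curve_good_side[OF hom m n cone det good(1)]) blast+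
  next
    case (2 g)
    then show ?case
      by (intro no_entire_curve_good_side[OF swap(1) n m swap(2,3) good(2), unfolded swap_param_simps]) blast+
  qed
  then obtain \<epsilon>\<^sub>0 where e0: "\<epsilon>\<^sub>0 > 0" "\<And>t. 0 < cmod t \<Longrightarrow> cmod t < \<epsilon>\<^sub>0 \<Longrightarrow>
    kobayashi_hyperbolic {pt z | z. z \<noteq> 0 \<and> ?e (eqn1 \<theta>) z * ?e (eqn2 \<theta>) z + t * ?e (defm \<theta>) z = 0}" by blast
  \<comment> \<open>The sum of the vertices lies on neither cone: by invariance along its own
    vertex, each equation takes there its value at the other vertex. So the deformed equation is
    nonzero at this point for small t.\<close>
  define P where "P = (\<lambda>i. vert2 \<theta> $ i + 1 * vert1 \<theta> $ i)"
  have P': "P = (\<lambda>i. vert1 \<theta> $ i + 1 * vert2 \<theta> $ i)" by (simp add: P_def add.commute)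
  have "pnt \<theta> ((\<lambda>_. 0)(VS := 1)) = (\<lambda>i. vert2 \<theta> $ i)" "pnt \<theta> ((\<lambda>_. 0)(VM := 1)) = (\<lambda>i. vert1 \<theta> $ i)"
    by (simp_all add: pnt_def fun_eq_iff)
  then have "meval (eqn1 \<theta>) (\<lambda>i. vert2 \<theta> $ i) \<noteq> 0" "meval (eqn2 \<theta>) (\<lambda>i. vert1 \<theta> $ i) \<noteq> 0"
    using good(1) unfolding good_side_def Let_def by simp_all
  moreover have "meval (eqn1 \<theta>) P = meval (eqn1 \<theta>) (\<lambda>i. vert2 \<theta> $ i)"
    using cone unfolding cone_param_def P_def by blast
  moreover have "meval (eqn2 \<theta>) P = meval (eqn2 \<theta>) (\<lambda>i. vert1 \<theta> $ i)"
    using cone unfolding cone_param_def P' by blast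
  ultimately have ab: "meval (eqn1 \<theta>) P * meval (eqn2 \<theta>) P \<noteq> 0" by simp
  define c where "c = cmod (meval (eqn1 \<theta>) P * meval (eqn2 \<theta>) P)"
  \<comment> \<open>The added 1 keeps the divisor in \<open>c / M\<close> positive if
    \<open>defm \<theta>\<close> vanishes at \<open>P\<close>.\<close>
  define M where "M = cmod (meval (defm \<theta>) P) + 1"
  have c: "c > 0" and M: "M > 0" using ab by (simp_all add: c_def M_def add_nonneg_pos)
  show ?thesis
  proof (intro exI[of _ "min \<epsilon>\<^sub>0 (c / M)"] conjI allI impI)
    show "min \<epsilon>\<^sub>0 (c / M) > 0" using e0(1) c M by simp
    fix t assume t: "0 < cmod t \<and> cmod t < min \<epsilon>\<^sub>0 (c / M)"
    define F where "F = eqn1 \<theta> * eqn2 \<theta> + mconst t * defm \<theta>"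
    have mF: "meval F x = meval (eqn1 \<theta>) x * meval (eqn2 \<theta>) x + t * meval (defm \<theta>) x" for x
      by (simp add: F_def meval_add meval_mult)
    have "F \<noteq> 0"
    proof
      assume "F = 0"
      then have "meval F P = 0" by (simp add: meval_def)
      then have "meval (eqn1 \<theta>) P * meval (eqn2 \<theta>) P = - (t * meval (defm \<theta>) P)" unfolding mF by (simp add: eq_neg_iff_add_eq_0)
      then have "c = cmod t * cmod (meval (defm \<theta>) P)" unfolding c_def by (simp add: norm_mult)
      then have "c \<le> cmod t * M" by (simp add: M_def algebra_simps)
      then show False using t M by (simp add: pos_less_divide_eq)
    qed
    moreover have "homogeneous (m + n) F"
      unfolding F_def by (intro homogeneous_add homogeneous_mult homogeneous_mconst_mult homs)
    moreover have "kobayashi_hyperbolic (hypersurface F)"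
      unfolding hypersurface_def mF by (rule e0(2)) (use t in auto)
    ultimately show "let F = eqn1 \<theta> * eqn2 \<theta> + mconst t * defm \<theta> in
       F \<noteq> 0 \<and> homogeneous (m + n) F \<and> kobayashi_hyperbolic (hypersurface F)"
      unfolding Let_def F_def by blast
  qed
qed

theorem mainTheorem1:
  fixes m n :: nat
  assumes "m \<ge> 4" and "n \<ge> 4"
  shows "for_general cone_pair_coord (cone_space m \<times> cone_space n)
     (\<lambda>((v\<^sub>1, g\<^sub>1), (v\<^sub>2, g\<^sub>2)).
        for_general Poly_Mapping.lookup {f :: 4 mpoly. homogeneous (m + n) f}
          (\<lambda>f. \<exists>\<epsilon>>0. \<forall>t :: complex. 0 < cmod t \<and> cmod t < \<epsilon> \<longrightarrow>
             (let F = g\<^sub>1 * g\<^sub>2 + mconst t * f in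
                F \<noteq> 0 \<and> homogeneous (m + n) F \<and> kobayashi_hyperbolic (hypersurface F))))"
proof (rule for_general_cone_pairs[OF assms])
  fix v\<^sub>1 v\<^sub>2 :: "complex ^ 4" and g\<^sub>1 g\<^sub>2 f :: "4 mpoly"
  let ?th = "(((v\<^sub>1, g\<^sub>1), (v\<^sub>2, g\<^sub>2)), f)"
  assume th: "homog_param m n ?th" "cone_param ?th" "good_side ?th" "good_side (swap_param ?th)"
    "vertex_det ?th \<noteq> 0"
  from good_pair_deformation_hyperbolic[OF th(1) assms th(2,5,3,4)]
  show "\<exists>\<epsilon>>0. \<forall>t :: complex. 0 < cmod t \<and> cmod t < \<epsilon> \<longrightarrow>
             (let F = g\<^sub>1 * g\<^sub>2 + mconst t * f in
                F \<noteq> 0 \<and> homogeneous (m + n) F \<and> kobayashi_hyperbolic (hypersurface F))"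
    by (simp add: eqn1_def eqn2_def defm_def)
qed

end
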